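(* Let $\phi$ be a smooth spatially periodic time-independent solution of the Lugiato–Lefever equation $$\partial_t \psi=-i\beta\,\partial_x^2\psi-(1+i\alpha)\psi+i|\psi|^2\psi+F ,\qquad \psi(x,t)\in\mathbb C,\ x\in\mathbb R, \tag{LLE}$$ with $\alpha,\beta,F\in\mathbb R$, $\beta\ne0$, $F>0$, and let $k\ge1$ be an integer. Then there exist constants $\theta>0$, $C>0$, $\varepsilon>0$ such that the following holds. Let $\psi$ be a solution of (LLE) on a time interval $[0,t]$, let $\gamma(x,s)$ be a real-valued phase function, and let $$\bar v(x,s):=\psi(x,s)-\phi(x-\gamma(x,s))$$ be the forward-modulated perturbation variable. If $\|\bar v(\cdot,s)\|_{H^k(\mathbb R)}\le\varepsilon$ and $\|\partial_{x,t}\gamma(\cdot,s)\|_{H^{k+2}(\mathbb R)}^2\le\varepsilon$ for all $0\le s\le t$, then $$\|\bar v(\cdot,t)\|_{H^k}^2\le Ce^{-\theta t}\|\bar v(\cdot,0)\|_{H^k}^2+C\int_0^te^{-\theta(t-s)}\Big(\|\bar v(\cdot,s)\|_{L^2}^2+\|\partial_{x,t}\gamma(\cdot,s)\|_{H^{k+2}}^2\Big)ds .$$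
   Context: Here $\partial_{x,t}\gamma=(\partial_x\gamma,\partial_t\gamma)$, so $\|\partial_{x,t}\gamma\|_{H^r}^2=\|\partial_x\gamma\|_{H^r}^2+\|\partial_t\gamma\|_{H^r}^2$. All norms are over $x\in\mathbb R$. It is understood that $\bar v$ is continuous in time with values in $H^k(\mathbb R)$ and that $\partial_x\gamma,\partial_t\gamma$ are continuous in time with values in $H^{k+2}(\mathbb R)$ on $[0,t]$. *)

theory Defs
  imports "HOL-Analysis.Analysis"
begin

section \<open>Smooth functions and test functions on the line\<close>

text \<open>\<^const>\<open>deriv\<close> is only available for maps from a field to itself, so derivatives of
  vector-valued functions of a real variable are written with \<^const>\<open>vector_derivative\<close>.\<close>

definition vderiv :: "(real \<Rightarrow> 'a::real_normed_vector) \<Rightarrow> real \<Rightarrow> 'a" where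
  "vderiv f = (\<lambda>x. vector_derivative f (at x))"

definition smooth :: "(real \<Rightarrow> 'a::real_normed_vector) \<Rightarrow> bool" where
  "smooth f \<longleftrightarrow> (\<forall>n x. (vderiv ^^ n) f differentiable (at x))"

definition test_function :: "(real \<Rightarrow> real) \<Rightarrow> bool" where
  "test_function \<eta> \<longleftrightarrow> smooth \<eta> \<and> compact (closure {x. \<eta> x \<noteq> 0})"


section \<open>The Sobolev spaces of integer order on the line\<close>

definition locally_integrable :: "(real \<Rightarrow> 'a::euclidean_space) \<Rightarrow> bool" where
  "locally_integrable u \<longleftrightarrow> (\<forall>a b. set_integrable lborel {a..b} u)"

definition square_integrable :: "(real \<Rightarrow> 'a::euclidean_space) \<Rightarrow> bool" where
  "square_integrable u \<longleftrightarrow>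
     u \<in> borel_measurable lborel \<and> integrable lborel (\<lambda>x. (norm (u x))\<^sup>2)"

definition L2_norm :: "(real \<Rightarrow> 'a::euclidean_space) \<Rightarrow> real" where
  "L2_norm u = sqrt (LINT x|lborel. (norm (u x))\<^sup>2)"

text \<open>\<open>g\<close> is a \<open>j\<close>-th weak derivative of \<open>u\<close>.  By linearity, real-valued test functions suffice
  also when \<open>u\<close> is complex-valued.  Weak derivatives are unique only up to null sets, which does
  not affect the norms below.\<close>

definition has_weak_deriv ::
    "nat \<Rightarrow> (real \<Rightarrow> 'a::euclidean_space) \<Rightarrow> (real \<Rightarrow> 'a) \<Rightarrow> bool" where
  "has_weak_deriv j u g \<longleftrightarrow>
     locally_integrable u \<and> locally_integrable g \<and>
     (\<forall>\<eta>. test_function \<eta> \<longrightarrow>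
        (LINT x|lborel. (vderiv ^^ j) \<eta> x *\<^sub>R u x)
          = (-1) ^ j *\<^sub>R (LINT x|lborel. \<eta> x *\<^sub>R g x))"

definition weak_deriv :: "nat \<Rightarrow> (real \<Rightarrow> 'a::euclidean_space) \<Rightarrow> real \<Rightarrow> 'a" where
  "weak_deriv j u = (SOME g. has_weak_deriv j u g)"

definition sobolev :: "nat \<Rightarrow> (real \<Rightarrow> 'a::euclidean_space) \<Rightarrow> bool" where
  "sobolev k u \<longleftrightarrow> square_integrable u \<and>
     (\<forall>j\<le>k. \<exists>g. has_weak_deriv j u g \<and> square_integrable g)"

text \<open>Only meaningful for functions satisfying \<^term>\<open>sobolev k\<close>.\<close>

definition sobolev_norm :: "nat \<Rightarrow> (real \<Rightarrow> 'a::euclidean_space) \<Rightarrow> real" where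
  "sobolev_norm k u = sqrt (\<Sum>j\<le>k. (L2_norm (weak_deriv j u))\<^sup>2)"

text \<open>Functions of time and space take the time argument first, so that \<open>u s\<close> is the spatial
  profile at time \<open>s\<close>.  The next predicate says that \<open>u\<close> is continuous from the time set \<open>I\<close>
  into \<open>H\<^sup>k\<close>.\<close>

definition continuous_in_sobolev ::
    "nat \<Rightarrow> real set \<Rightarrow> (real \<Rightarrow> real \<Rightarrow> 'a::euclidean_space) \<Rightarrow> bool" where
  "continuous_in_sobolev k I u \<longleftrightarrow>
     (\<forall>s\<in>I. sobolev k (u s)) \<and>
     (\<forall>s\<in>I. ((\<lambda>r. sobolev_norm k (\<lambda>x. u r x - u s x)) \<longlongrightarrow> 0) (at s within I))"


section \<open>The Lugiato--Lefever equation\<close>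

definition lle_reaction :: "real \<Rightarrow> real \<Rightarrow> complex \<Rightarrow> complex" where
  "lle_reaction \<alpha> F z =
     - (1 + \<i> * of_real \<alpha>) * z + \<i> * of_real ((cmod z)\<^sup>2) * z + of_real F"

definition lle_stationary :: "real \<Rightarrow> real \<Rightarrow> real \<Rightarrow> (real \<Rightarrow> complex) \<Rightarrow> bool" where
  "lle_stationary \<alpha> \<beta> F \<phi> \<longleftrightarrow>
     (\<forall>x. 0 = - \<i> * of_real \<beta> * (vderiv ^^ 2) \<phi> x + lle_reaction \<alpha> F (\<phi> x))"

text \<open>Solutions on the time set \<open>I\<close>, in the sense of distributions in space: for every test
  function \<open>\<eta>\<close> the pairing of \<open>\<psi>\<close> with \<open>\<eta>\<close> is differentiable in time, and its derivative is the
  pairing of the right-hand side of the equation with \<open>\<eta>\<close>, where both space derivatives have been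
  moved onto \<open>\<eta>\<close>.  No decay of \<open>\<psi>\<close> in space is required.\<close>

definition lle_solution ::
    "real \<Rightarrow> real \<Rightarrow> real \<Rightarrow> real set \<Rightarrow> (real \<Rightarrow> real \<Rightarrow> complex) \<Rightarrow> bool" where
  "lle_solution \<alpha> \<beta> F I \<psi> \<longleftrightarrow>
     (\<forall>s\<in>I. locally_integrable (\<psi> s) \<and> locally_integrable (\<lambda>x. lle_reaction \<alpha> F (\<psi> s x))) \<and>
     (\<forall>\<eta>. test_function \<eta> \<longrightarrow> (\<forall>s\<in>I.
        ((\<lambda>r. LINT x|lborel. \<eta> x *\<^sub>R \<psi> r x) has_vector_derivative
          (LINT x|lborel. (vderiv ^^ 2) \<eta> x *\<^sub>R (- \<i> * of_real \<beta> * \<psi> s x)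
                          + \<eta> x *\<^sub>R lle_reaction \<alpha> F (\<psi> s x)))
        (at s within I)))"

definition forward_perturbation ::
    "(real \<Rightarrow> complex) \<Rightarrow> (real \<Rightarrow> real \<Rightarrow> complex) \<Rightarrow> (real \<Rightarrow> real \<Rightarrow> real)
      \<Rightarrow> real \<Rightarrow> real \<Rightarrow> complex" where
  "forward_perturbation \<phi> \<psi> \<gamma> = (\<lambda>s x. \<psi> s x - \<phi> (x - \<gamma> s x))"

text \<open>\<open>\<gamma>x\<close> and \<open>\<gamma>t\<close> are the partial derivatives of \<open>\<gamma>\<close> for times in \<open>I\<close> (one-sided in time at
  the endpoints of an interval).\<close>

definition has_partial_derivs ::
    "real set \<Rightarrow> (real \<Rightarrow> real \<Rightarrow> real) \<Rightarrow> (real \<Rightarrow> real \<Rightarrow> real) \<Rightarrow> (real \<Rightarrow> real \<Rightarrow> real) \<Rightarrow> bool" where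
  "has_partial_derivs I \<gamma> \<gamma>x \<gamma>t \<longleftrightarrow>
     (\<forall>s\<in>I. \<forall>x.
        ((\<lambda>y. \<gamma> s y) has_real_derivative \<gamma>x s x) (at x) \<and>
        ((\<lambda>r. \<gamma> r x) has_real_derivative \<gamma>t s x) (at s within I))"

definition grad_norm_sq :: "nat \<Rightarrow> (real \<Rightarrow> real) \<Rightarrow> (real \<Rightarrow> real) \<Rightarrow> real" where
  "grad_norm_sq r gx gt = (sobolev_norm r gx)\<^sup>2 + (sobolev_norm r gt)\<^sup>2"

end

(* At top order the L^2 balance for D^k v contains the damping -2 |D^k v|^2 and the term
   2 Re \<integral> i c^2 (cnj D^k v)^2, c = \<phi>(x - \<gamma>), which has no sign.  Adding
   (1/\<beta>) Re \<integral> c^2 (cnj D^(k-1) v)^2 to |D^k v|^2 cancels it: differentiating the added term in time,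
   dispersion reproduces it with the opposite sign, and everything else is of lower order or small.  A large multiple of
   |v|^2 makes the sum equivalent to the squared H^k norm by interpolation, and Gronwall's argument applies.
   As v is only in H^k, the computation is done for mollifications of v in space; by dominated convergence
   the commutator with the nonlinearity disappears in the limit. *)

theory Submission
  imports Defs
begin

section \<open>Square integrable functions\<close>

text \<open>Three obstacles shape the details. The profile \<phi>(x - \<gamma>) does not decay, so
  it can enter only as a bounded coefficient: \<open>cbd\<close> controls coefficients,
  \<open>hsob\<close> and \<open>hnorm\<close> control square integrable factors, and the two are
  never mixed. The phase is differentiable only pointwise, and at each time the sup bound for
  \<gamma>t is known only off a null set depending on that time; a Fubini argument turns this into a
  Lipschitz bound in time valid at every x. Finally, the error of mollification vanishes at each
  time separately, so the energy inequality is integrated first and the limit is taken afterwards.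
  The residual of the modulation has a factor \<gamma>_x, \<gamma>_t or \<gamma>_xx in every term,
  because the stationary equation cancels the rest; hence it is measured by the gradient norm. The
  damping of the top order square is 2. A quarter of it absorbs the lower order and nonlinear terms;
  the remaining 3/2 equals the top order coefficient in the upper bound of the energy, which gives
  the rate \<theta> = 1. All constants are fixed before the solution and the phase, so each bound
  has to be uniform over them.\<close>

lemma square_integrable_measurable [measurable_dest]:
  "square_integrable u \<Longrightarrow> u \<in> borel_measurable borel"
  by (simp add: square_integrable_def)

lemma L2_norm_nonneg [simp]: "0 \<le> L2_norm u"
  by (simp add: L2_norm_def)

lemma L2_norm_sq: "(L2_norm u)\<^sup>2 = (LINT x|lborel. (norm (u x))\<^sup>2)"
  by (simp add: L2_norm_def)

lemma L2_norm_cong_AE: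
  assumes "AE x in lborel. u x = w x" "u \<in> borel_measurable borel" "w \<in> borel_measurable borel"
  shows "L2_norm u = L2_norm w"
  unfolding L2_norm_def using assms by (intro arg_cong[where f=sqrt] integral_cong_AE) auto

lemma L2_norm_cong_norm:
  assumes "\<And>x. norm (u x) = norm (w x)"
  shows "L2_norm u = L2_norm w"
  by (simp add: L2_norm_def assms)

lemma square_integrable_zero [simp]: "square_integrable (\<lambda>x. 0)"
  by (simp add: square_integrable_def)

lemma L2_norm_zero [simp]: "L2_norm (\<lambda>x. 0) = 0"
  by (simp add: L2_norm_def)

lemma
  assumes w: "square_integrable w" and m: "u \<in> borel_measurable borel"
    and le: "AE x in lborel. norm (u x) \<le> B * norm (w x)" and B: "B \<ge> 0"
  shows square_integrable_dominated: "square_integrable u"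
    and L2_norm_dominated: "L2_norm u \<le> B * L2_norm w"
proof -
  have le2: "AE x in lborel. (norm (u x))\<^sup>2 \<le> B\<^sup>2 * (norm (w x))\<^sup>2"
    using le by eventually_elim (metis norm_ge_zero power_mono power_mult_distrib)
  have iw: "integrable lborel (\<lambda>x. B\<^sup>2 * (norm (w x))\<^sup>2)"
    using w by (auto simp: square_integrable_def)
  have iu: "integrable lborel (\<lambda>x. (norm (u x))\<^sup>2)"
    by (rule Bochner_Integration.integrable_bound[OF iw]) (use m le2 in auto)
  then show "square_integrable u"
    using m by (simp add: square_integrable_def)
  have "(L2_norm u)\<^sup>2 \<le> (B * L2_norm w)\<^sup>2"
    unfolding L2_norm_sq power_mult_distrib
    using integral_mono_AE[OF iu iw le2] by simp
  then show "L2_norm u \<le> B * L2_norm w"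
    using B by (simp add: power2_le_iff_abs_le)
qed

lemma square_integrable_cong_AE:
  assumes "square_integrable w" "u \<in> borel_measurable borel" "AE x in lborel. u x = w x"
  shows "square_integrable u"
  using assms by (intro square_integrable_dominated[of w u 1]) (auto elim: eventually_mono)

lemma
  assumes u: "square_integrable (u :: real \<Rightarrow> 'a::euclidean_space)"
    and w: "square_integrable (w :: real \<Rightarrow> 'b::euclidean_space)"
  shows integrable_norm_mult: "integrable lborel (\<lambda>x. norm (u x) * norm (w x))"
    and L2_Cauchy_Schwarz: "(LINT x|lborel. norm (u x) * norm (w x)) \<le> L2_norm u * L2_norm w"
proof -
  note [measurable] = square_integrable_measurable[OF u] square_integrable_measurable[OF w]
  have iu: "integrable lborel (\<lambda>x. (norm (u x))\<^sup>2)" and iw: "integrable lborel (\<lambda>x. (norm (w x))\<^sup>2)"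
    using u w by (auto simp: square_integrable_def)
  show i: "integrable lborel (\<lambda>x. norm (u x) * norm (w x))"
  proof (rule Bochner_Integration.integrable_bound)
    show "integrable lborel (\<lambda>x. (norm (u x))\<^sup>2 + (norm (w x))\<^sup>2)"
      using iu iw by auto
    have "a * b \<le> a\<^sup>2 + b\<^sup>2" if "a \<ge> 0" "b \<ge> 0" for a b :: real
      using sum_squares_bound[of a b] that mult_nonneg_nonneg[of a b] by linarith
    then show "AE x in lborel. norm (norm (u x) * norm (w x)) \<le> norm ((norm (u x))\<^sup>2 + (norm (w x))\<^sup>2)"
      by auto
  qed simp
  have "(\<integral>\<^sup>+x. ennreal (norm (u x)) * ennreal (norm (w x)) \<partial>lborel)\<^sup>2
      \<le> (\<integral>\<^sup>+x. (ennreal (norm (u x)))\<^sup>2 \<partial>lborel) * (\<integral>\<^sup>+x. (ennreal (norm (w x)))\<^sup>2 \<partial>lborel)"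
    by (rule Cauchy_Schwarz_nn_integral) auto
  also have "(\<integral>\<^sup>+x. ennreal (norm (u x)) * ennreal (norm (w x)) \<partial>lborel)
      = ennreal (LINT x|lborel. norm (u x) * norm (w x))"
    using nn_integral_eq_integral[OF i] by (simp add: ennreal_mult)
  also have "(\<integral>\<^sup>+x. (ennreal (norm (u x)))\<^sup>2 \<partial>lborel) = ennreal ((L2_norm u)\<^sup>2)"
    using nn_integral_eq_integral[OF iu] by (simp add: ennreal_power L2_norm_sq)
  also have "(\<integral>\<^sup>+x. (ennreal (norm (w x)))\<^sup>2 \<partial>lborel) = ennreal ((L2_norm w)\<^sup>2)"
    using nn_integral_eq_integral[OF iw] by (simp add: ennreal_power L2_norm_sq)
  finally have "(LINT x|lborel. norm (u x) * norm (w x))\<^sup>2 \<le> (L2_norm u * L2_norm w)\<^sup>2"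
    by (simp add: ennreal_power flip: ennreal_mult power_mult_distrib)
  then show "(LINT x|lborel. norm (u x) * norm (w x)) \<le> L2_norm u * L2_norm w"
    by (rule power2_le_imp_le) auto
qed

lemma
  fixes u w :: "real \<Rightarrow> 'a::euclidean_space"
  assumes u: "square_integrable u" and w: "square_integrable w"
  shows square_integrable_add: "square_integrable (\<lambda>x. u x + w x)"
    and L2_norm_triangle: "L2_norm (\<lambda>x. u x + w x) \<le> L2_norm u + L2_norm w"
proof -
  note [measurable] = square_integrable_measurable[OF u] square_integrable_measurable[OF w]
  have iu: "integrable lborel (\<lambda>x. (norm (u x))\<^sup>2)" and iw: "integrable lborel (\<lambda>x. (norm (w x))\<^sup>2)"
    using u w by (auto simp: square_integrable_def)
  note iuw = integrable_norm_mult[OF u w]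
  have ie: "integrable lborel (\<lambda>x. (norm (u x))\<^sup>2 + (norm (w x))\<^sup>2 + 2 * (norm (u x) * norm (w x)))"
    using iu iw iuw by auto
  have le: "(norm (u x + w x))\<^sup>2 \<le> (norm (u x))\<^sup>2 + (norm (w x))\<^sup>2 + 2 * (norm (u x) * norm (w x))" for x
    using power_mono[OF norm_triangle_ineq[of "u x" "w x"], of 2] by (simp add: power2_sum)
  have i: "integrable lborel (\<lambda>x. (norm (u x + w x))\<^sup>2)"
    by (rule Bochner_Integration.integrable_bound[OF ie]) (use le in auto)
  then show "square_integrable (\<lambda>x. u x + w x)"
    by (simp add: square_integrable_def)
  have "(L2_norm (\<lambda>x. u x + w x))\<^sup>2 \<le> (L2_norm u)\<^sup>2 + (L2_norm w)\<^sup>2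
      + 2 * (LINT x|lborel. norm (u x) * norm (w x))"
    unfolding L2_norm_sq using integral_mono[OF i ie le] iu iw iuw by simp
  also have "\<dots> \<le> (L2_norm u + L2_norm w)\<^sup>2"
    using L2_Cauchy_Schwarz[OF u w] by (simp add: power2_sum)
  finally show "L2_norm (\<lambda>x. u x + w x) \<le> L2_norm u + L2_norm w"
    by (rule power2_le_imp_le) auto
qed

text \<open>Serves all maps that scale the norm: negation, multiplication by a constant,
  conjugation, and the norm regarded as a complex number.\<close>

lemma
  fixes u :: "real \<Rightarrow> 'a::euclidean_space" and L :: "'a \<Rightarrow> 'b::euclidean_space"
  assumes u: "square_integrable u" and m: "L \<in> borel_measurable borel"
    and L: "\<And>z. norm (L z) = B * norm z"
  shows square_integrable_map: "square_integrable (\<lambda>x. L (u x))"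
    and L2_norm_map: "L2_norm (\<lambda>x. L (u x)) = \<bar>B\<bar> * L2_norm u"
proof -
  have i: "integrable lborel (\<lambda>x. (norm (u x))\<^sup>2)"
    using u by (auto simp: square_integrable_def)
  show "square_integrable (\<lambda>x. L (u x))"
    using i measurable_compose[OF square_integrable_measurable[OF u] m]
    by (simp add: square_integrable_def L power_mult_distrib)
  show "L2_norm (\<lambda>x. L (u x)) = \<bar>B\<bar> * L2_norm u"
    by (simp add: L2_norm_def L power_mult_distrib real_sqrt_mult)
qed

lemma
  fixes u :: "real \<Rightarrow> 'a::euclidean_space"
  shows square_integrable_minus: "square_integrable u \<Longrightarrow> square_integrable (\<lambda>x. - u x)"
    and L2_norm_minus [simp]: "L2_norm (\<lambda>x. - u x) = L2_norm u"
    and L2_norm_commute: "L2_norm (\<lambda>x. u x - w x) = L2_norm (\<lambda>x. w x - u x)"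
  using square_integrable_map[of u "\<lambda>z. - z" 1]
  by (auto simp: norm_minus_commute intro: L2_norm_cong_norm)

lemma
  fixes u :: "real \<Rightarrow> complex"
  assumes "square_integrable u"
  shows square_integrable_cmult: "square_integrable (\<lambda>x. c * u x)"
    and L2_norm_cmult: "L2_norm (\<lambda>x. c * u x) = norm c * L2_norm u"
  using square_integrable_map[OF assms, of "\<lambda>z. c * z" "norm c"] L2_norm_map[OF assms, of "\<lambda>z. c * z" "norm c"]
  by (auto simp: norm_mult)

lemma
  fixes u :: "real \<Rightarrow> complex"
  shows square_integrable_cnj: "square_integrable u \<Longrightarrow> square_integrable (\<lambda>x. cnj (u x))"
    and L2_norm_cnj [simp]: "L2_norm (\<lambda>x. cnj (u x)) = L2_norm u"
proof -
  have "cnj \<in> borel_measurable borel"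
    by (intro borel_measurable_continuous_onI continuous_intros)
  from square_integrable_map[of u cnj 1, OF _ this]
  show "square_integrable u \<Longrightarrow> square_integrable (\<lambda>x. cnj (u x))" by simp
qed (auto intro: L2_norm_cong_norm)

lemma
  fixes u w :: "real \<Rightarrow> 'a::euclidean_space"
  assumes u: "square_integrable u" and w: "square_integrable w"
  shows square_integrable_diff: "square_integrable (\<lambda>x. u x - w x)"
    and L2_norm_diff_le: "L2_norm (\<lambda>x. u x - w x) \<le> L2_norm u + L2_norm w"
    and L2_norm_le_diff: "L2_norm u \<le> L2_norm (\<lambda>x. u x - w x) + L2_norm w"
proof -
  show d: "square_integrable (\<lambda>x. u x - w x)"
    using square_integrable_add[OF u square_integrable_minus[OF w]] by simp
  show "L2_norm (\<lambda>x. u x - w x) \<le> L2_norm u + L2_norm w"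
    using L2_norm_triangle[OF u square_integrable_minus[OF w]] by simp
  show "L2_norm u \<le> L2_norm (\<lambda>x. u x - w x) + L2_norm w"
    using L2_norm_triangle[OF d w] by simp
qed

lemma L2_norm_triangle_mid:
  fixes u w y :: "real \<Rightarrow> 'a::euclidean_space"
  assumes "square_integrable u" "square_integrable w" "square_integrable y"
  shows "L2_norm (\<lambda>x. u x - y x) \<le> L2_norm (\<lambda>x. u x - w x) + L2_norm (\<lambda>x. w x - y x)"
  using L2_norm_triangle[OF square_integrable_diff[OF assms(1,2)] square_integrable_diff[OF assms(2,3)]]
  by simp

lemma
  fixes c u :: "real \<Rightarrow> complex"
  assumes u: "square_integrable u" and c: "c \<in> borel_measurable borel"
    and B: "AE x in lborel. norm (c x) \<le> B" "0 \<le> B"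
  shows square_integrable_bounded_mult: "square_integrable (\<lambda>x. c x * u x)"
    and L2_norm_bounded_mult: "L2_norm (\<lambda>x. c x * u x) \<le> B * L2_norm u"
proof -
  have m: "(\<lambda>x. c x * u x) \<in> borel_measurable borel"
    using square_integrable_measurable[OF u] c by simp
  have le: "AE x in lborel. norm (c x * u x) \<le> B * norm (u x)"
    using B(1) by eventually_elim (auto simp: norm_mult intro: mult_right_mono)
  show "square_integrable (\<lambda>x. c x * u x)" "L2_norm (\<lambda>x. c x * u x) \<le> B * L2_norm u"
    using square_integrable_dominated[OF u m le B(2)] L2_norm_dominated[OF u m le B(2)] by auto
qed

lemma
  fixes u w :: "real \<Rightarrow> complex"
  assumes u: "square_integrable u" and w: "square_integrable w"
  shows square_integrable_imp_integrable_mult: "integrable lborel (\<lambda>x. u x * w x)"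
    and L2_pairing_le: "norm (LINT x|lborel. u x * w x) \<le> L2_norm u * L2_norm w"
proof -
  show i: "integrable lborel (\<lambda>x. u x * w x)"
    by (rule Bochner_Integration.integrable_bound[OF integrable_norm_mult[OF u w]])
      (use square_integrable_measurable[OF u] square_integrable_measurable[OF w] in \<open>auto simp: norm_mult\<close>)
  have "norm (LINT x|lborel. u x * w x) \<le> (LINT x|lborel. norm (u x) * norm (w x))"
    using integral_norm_bound[of lborel "\<lambda>x. u x * w x"] by (simp add: norm_mult)
  then show "norm (LINT x|lborel. u x * w x) \<le> L2_norm u * L2_norm w"
    using L2_Cauchy_Schwarz[OF u w] by linarith
qed

text \<open>Fatou's lemma. It applies where the pointwise limit is not yet known to be square
  integrable.\<close>

lemma
  fixes u :: "nat \<Rightarrow> real \<Rightarrow> 'a::euclidean_space"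
  assumes u: "\<And>n. square_integrable (u n)" and B: "\<And>n. L2_norm (u n) \<le> B"
    and w: "w \<in> borel_measurable borel" and lim: "AE x in lborel. (\<lambda>n. u n x) \<longlonglongrightarrow> w x"
  shows square_integrable_Fatou: "square_integrable w" and L2_norm_Fatou: "L2_norm w \<le> B"
proof -
  have iu: "integrable lborel (\<lambda>x. (norm (u n x))\<^sup>2)" for n
    using u by (auto simp: square_integrable_def)
  note [measurable] = w square_integrable_measurable[OF u]
  have B0: "0 \<le> B" using B[of 0] L2_norm_nonneg[of "u 0"] by linarith
  have "(\<integral>\<^sup>+x. ennreal ((norm (w x))\<^sup>2) \<partial>lborel) \<le> (\<integral>\<^sup>+x. liminf (\<lambda>n. ennreal ((norm (u n x))\<^sup>2)) \<partial>lborel)"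
  proof (rule nn_integral_mono_AE)
    show "AE x in lborel. ennreal ((norm (w x))\<^sup>2) \<le> liminf (\<lambda>n. ennreal ((norm (u n x))\<^sup>2))"
      using lim
    proof eventually_elim
      case (elim x)
      have "(\<lambda>n. ennreal ((norm (u n x))\<^sup>2)) \<longlonglongrightarrow> ennreal ((norm (w x))\<^sup>2)"
        by (intro tendsto_ennrealI tendsto_intros elim)
      then show ?case
        by (metis lim_imp_Liminf order_refl trivial_limit_sequentially)
    qed
  qed
  also have "\<dots> \<le> liminf (\<lambda>n. \<integral>\<^sup>+x. ennreal ((norm (u n x))\<^sup>2) \<partial>lborel)"
    by (rule nn_integral_liminf) auto
  also have "\<dots> \<le> ennreal (B\<^sup>2)"
  proof (rule Liminf_le)
    show "\<forall>\<^sub>F n in sequentially. (\<integral>\<^sup>+x. ennreal ((norm (u n x))\<^sup>2) \<partial>lborel) \<le> ennreal (B\<^sup>2)"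
      using nn_integral_eq_integral[OF iu] B power_mono[OF B L2_norm_nonneg]
      by (intro always_eventually) (auto simp: L2_norm_sq[symmetric] intro!: ennreal_leI)
  qed auto
  finally have nn: "(\<integral>\<^sup>+x. ennreal ((norm (w x))\<^sup>2) \<partial>lborel) \<le> ennreal (B\<^sup>2)" .
  have i: "integrable lborel (\<lambda>x. (norm (w x))\<^sup>2)"
    by (rule integrableI_bounded) (use nn in \<open>auto simp: le_less_trans\<close>)
  then show "square_integrable w" by (simp add: square_integrable_def)
  have "ennreal ((L2_norm w)\<^sup>2) \<le> ennreal (B\<^sup>2)"
    using nn nn_integral_eq_integral[OF i] by (simp add: L2_norm_sq)
  then have "(L2_norm w)\<^sup>2 \<le> B\<^sup>2" by (simp add: ennreal_le_iff)
  then show "L2_norm w \<le> B" using B0 by (rule power2_le_imp_le)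
qed

lemma L2_norm_eq_0_imp_AE:
  assumes u: "square_integrable u" and "L2_norm u = 0"
  shows "AE x in lborel. u x = 0"
proof -
  have "(LINT x|lborel. (norm (u x))\<^sup>2) = 0"
    using assms(2) L2_norm_sq[of u] by simp
  then have "AE x in lborel. (norm (u x))\<^sup>2 = 0"
    using u by (subst (asm) integral_nonneg_eq_0_iff_AE) (auto simp: square_integrable_def)
  then show ?thesis by eventually_elim simp
qed

text \<open>Cauchy-Schwarz against the indicator of the interval.\<close>

lemma square_integrable_imp_locally_integrable:
  assumes "square_integrable u"
  shows "locally_integrable u"
  unfolding locally_integrable_def set_integrable_def
proof (intro allI)
  fix a b :: real
  have "square_integrable (indicator {a..b} :: real \<Rightarrow> real)"
    by (simp add: square_integrable_def power2_eq_square integrable_indicator_iff emeasure_lborel_Icc_eq flip: indicator_inter_arith)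
  from integrable_norm_mult[OF this assms]
  show "integrable lborel (\<lambda>x. indicator {a..b} x *\<^sub>R u x)"
    by (rule Bochner_Integration.integrable_bound)
       (use square_integrable_measurable[OF assms] in auto)
qed


section \<open>Finitely often differentiable functions\<close>

abbreviation nderiv :: "nat \<Rightarrow> (real \<Rightarrow> 'a::real_normed_vector) \<Rightarrow> real \<Rightarrow> 'a" where
  "nderiv n f \<equiv> (vderiv ^^ n) f"

text \<open>The class C^m. Continuity is demanded only of the last derivative; for the earlier ones
  it follows from differentiability (\<open>diffk_Suc_D\<close>).\<close>

primrec diffk :: "nat \<Rightarrow> (real \<Rightarrow> 'a::real_normed_vector) \<Rightarrow> bool" where
  "diffk 0 u \<longleftrightarrow> continuous_on UNIV u"
| "diffk (Suc m) u \<longleftrightarrow> (\<forall>x. u differentiable (at x)) \<and> diffk m (vderiv u)"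

lemma nderiv_Suc: "nderiv (Suc n) f = nderiv n (vderiv f)"
  by (simp add: funpow_swap1)

lemma vderiv_eqI: "(\<And>x. (f has_vector_derivative g x) (at x)) \<Longrightarrow> vderiv f = g"
  by (auto simp: vderiv_def vector_derivative_at)

lemma diffk_Suc_iff:
  "diffk (Suc m) u \<longleftrightarrow> (\<forall>x. (u has_vector_derivative vderiv u x) (at x)) \<and> diffk m (vderiv u)"
  by (auto simp: vderiv_def vector_derivative_works)

lemma diffk_SucI:
  "(\<And>x. (f has_vector_derivative g x) (at x)) \<Longrightarrow> diffk m g \<Longrightarrow> diffk (Suc m) f"
  using vderiv_eqI[of f g] differentiableI_vector by auto

lemma diffk_Suc_D: "diffk (Suc m) u \<Longrightarrow> diffk m u"
proof (induction m arbitrary: u)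
  case 0
  then show ?case
    by (auto intro!: continuous_at_imp_continuous_on differentiable_imp_continuous_within)
next
  case (Suc m)
  then show ?case by (metis diffk.simps(2))
qed

lemma diffk_mono: "diffk m u \<Longrightarrow> j \<le> m \<Longrightarrow> diffk j u"
  by (induction m) (auto simp: le_Suc_eq dest: diffk_Suc_D simp del: diffk.simps(2))

lemma diffk_nderiv: "diffk m u \<Longrightarrow> i + j \<le> m \<Longrightarrow> diffk i (nderiv j u)"
proof (induction j arbitrary: u m)
  case 0 then show ?case using diffk_mono by auto
next
  case (Suc j)
  then obtain m' where "m = Suc m'" by (cases m) auto
  then show ?case using Suc unfolding nderiv_Suc by auto
qed

lemma diffk_imp_continuous: "diffk m u \<Longrightarrow> continuous_on UNIV u"
  using diffk_mono[of m u 0] by simp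

lemma diffk_has_vector_derivative: "diffk m u \<Longrightarrow> j < m \<Longrightarrow> (nderiv j u has_vector_derivative nderiv (Suc j) u x) (at x)"
  using diffk_nderiv[of m u 1 j] by (auto simp: diffk_Suc_iff simp del: diffk.simps(2))

lemma diffk_continuous_nderiv: "diffk m u \<Longrightarrow> j \<le> m \<Longrightarrow> continuous_on UNIV (nderiv j u)"
  using diffk_nderiv[of m u 0 j] by auto

lemma diffk_measurable_nderiv: 
  fixes u :: "real \<Rightarrow> 'a::euclidean_space"
  shows "diffk m u \<Longrightarrow> j \<le> m \<Longrightarrow> nderiv j u \<in> borel_measurable borel"
  by (intro borel_measurable_continuous_onI diffk_continuous_nderiv)

text \<open>The working tool for computing iterated derivatives: a chain \<open>U 0\<close>, ...,
  \<open>U m\<close> of successive derivatives determines them all, since \<open>vderiv\<close>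
  picks the unique derivative. Sums, linear images, affine substitutions, convolutions and uniform
  limits are all treated by exhibiting such a chain.\<close>

lemma
  assumes "\<And>j x. j < m \<Longrightarrow> (U j has_vector_derivative U (Suc j) x) (at x)"
    and "continuous_on UNIV (U m)"
  shows diffkI: "diffk m (U 0)" and nderiv_eqI: "j \<le> m \<Longrightarrow> nderiv j (U 0) = U j"
proof -
  have "diffk m (U 0) \<and> (\<forall>j\<le>m. nderiv j (U 0) = U j)"
    using assms
  proof (induction m arbitrary: U)
    case 0 then show ?case by simp
  next
    case (Suc m)
    have d: "\<And>x. (U 0 has_vector_derivative U 1 x) (at x)"
      using Suc.prems(1)[of 0] by simp
    have IH: "diffk m (U 1) \<and> (\<forall>j\<le>m. nderiv j (U 1) = U (Suc j))"
      using Suc.IH[of "\<lambda>j. U (Suc j)"] Suc.prems by simp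
    have v: "vderiv (U 0) = U 1" by (rule vderiv_eqI[OF d])
    have "nderiv j (U 0) = U j" if "j \<le> Suc m" for j
      using IH that v by (cases j) (auto simp: nderiv_Suc simp del: funpow.simps(2))
    then show ?case using IH diffk_SucI[OF d, of m] by blast
  qed
  then show "diffk m (U 0)" "j \<le> m \<Longrightarrow> nderiv j (U 0) = U j" by auto
qed

text \<open>Differentiability of every iterated derivative already contains their continuity, one
  order later.\<close>

lemma smooth_iff_diffk: "smooth f \<longleftrightarrow> (\<forall>m. diffk m f)"
proof
  assume s: "smooth f"
  have "diffk m (nderiv j f)" for m j
  proof (induction m arbitrary: j)
    case 0
    then show ?case using s unfolding smooth_def
      by (auto intro!: continuous_at_imp_continuous_on differentiable_imp_continuous_within)
  next
    case (Suc m)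
    then show ?case using s Suc[of "Suc j"] unfolding smooth_def by auto
  qed
  from this[of _ 0] show "\<forall>m. diffk m f" by simp
next
  assume m: "\<forall>m. diffk m f"
  show "smooth f" unfolding smooth_def
  proof (intro allI)
    fix n x
    from m have "diffk (Suc n) f" by blast
    from diffk_has_vector_derivative[OF this, of n x]
    show "nderiv n f differentiable at x" by (simp add: differentiableI_vector)
  qed
qed

lemma smooth_nderiv: "smooth f \<Longrightarrow> smooth (nderiv j f)"
  unfolding smooth_iff_diffk using diffk_nderiv by blast

lemma
  assumes "diffk m u" "diffk m w"
  shows diffk_add: "diffk m (\<lambda>x. u x + w x)"
    and nderiv_add: "j \<le> m \<Longrightarrow> nderiv j (\<lambda>x. u x + w x) = (\<lambda>x. nderiv j u x + nderiv j w x)"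
  using diffkI[of m "\<lambda>j x. nderiv j u x + nderiv j w x"] nderiv_eqI[of m "\<lambda>j x. nderiv j u x + nderiv j w x"] assms
  by (auto intro!: has_vector_derivative_add diffk_has_vector_derivative[of m] continuous_on_add
      diffk_continuous_nderiv[of m] simp del: funpow.simps(2))

lemma
  assumes "bounded_linear L" "diffk m u"
  shows diffk_linear: "diffk m (\<lambda>x. L (u x))"
    and nderiv_linear: "j \<le> m \<Longrightarrow> nderiv j (\<lambda>x. L (u x)) = (\<lambda>x. L (nderiv j u x))"
  using diffkI[of m "\<lambda>j x. L (nderiv j u x)"] nderiv_eqI[of m "\<lambda>j x. L (nderiv j u x)"] assms
  by (auto intro!: bounded_linear.has_vector_derivative[OF assms(1)] diffk_has_vector_derivative[of m]
      bounded_linear.continuous_on[OF assms(1)] diffk_continuous_nderiv[of m] simp del: funpow.simps(2))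

lemma
  assumes "diffk m u" "diffk m w"
  shows diffk_diff: "diffk m (\<lambda>x. u x - w x)"
    and nderiv_diff: "j \<le> m \<Longrightarrow> nderiv j (\<lambda>x. u x - w x) = (\<lambda>x. nderiv j u x - nderiv j w x)"
  using diffkI[of m "\<lambda>j x. nderiv j u x - nderiv j w x"] nderiv_eqI[of m "\<lambda>j x. nderiv j u x - nderiv j w x"] assms
  by (auto intro!: has_vector_derivative_diff diffk_has_vector_derivative[of m] continuous_on_diff
      diffk_continuous_nderiv[of m] simp del: funpow.simps(2))

lemma
  fixes u :: "real \<Rightarrow> 'a::real_normed_vector"
  assumes "diffk m u"
  shows diffk_affine: "diffk m (\<lambda>x. u (b + a * x))"
    and nderiv_affine: "j \<le> m \<Longrightarrow> nderiv j (\<lambda>x. u (b + a * x)) = (\<lambda>x. a ^ j *\<^sub>R nderiv j u (b + a * x))"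
proof -
  have d: "((\<lambda>x. a ^ j *\<^sub>R nderiv j u (b + a * x)) has_vector_derivative a ^ Suc j *\<^sub>R nderiv (Suc j) u (b + a * x)) (at x)"
    if "j < m" for j x
  proof -
    have 1: "((\<lambda>x. b + a * x) has_vector_derivative a) (at x)"
      by (auto intro!: derivative_eq_intros)
    have "((nderiv j u \<circ> (\<lambda>x. b + a * x)) has_vector_derivative a *\<^sub>R nderiv (Suc j) u (b + a * x)) (at x)"
      by (rule vector_diff_chain_at[OF 1 diffk_has_vector_derivative[OF assms that]])
    from has_vector_derivative_scaleR[OF DERIV_const this, of "a ^ j"]
    show ?thesis by (simp add: o_def mult.commute)
  qed
  have c: "continuous_on UNIV (\<lambda>x. a ^ m *\<^sub>R nderiv m u (b + a * x))"
    by (intro continuous_intros continuous_on_compose2[OF diffk_continuous_nderiv[OF assms]]) auto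
  show "diffk m (\<lambda>x. u (b + a * x))"
    and "j \<le> m \<Longrightarrow> nderiv j (\<lambda>x. u (b + a * x)) = (\<lambda>x. a ^ j *\<^sub>R nderiv j u (b + a * x))"
    using diffkI[of m "\<lambda>j x. a ^ j *\<^sub>R nderiv j u (b + a * x)"] nderiv_eqI[of m "\<lambda>j x. a ^ j *\<^sub>R nderiv j u (b + a * x)"] d c by auto
qed

lemma vderiv_mult:
  fixes u w :: "real \<Rightarrow> 'a::real_normed_algebra"
  assumes "diffk (Suc m) u" "diffk (Suc m) w"
  shows "vderiv (\<lambda>x. u x * w x) = (\<lambda>x. vderiv u x * w x + u x * vderiv w x)"
    and "(\<lambda>x. u x * w x) differentiable (at x)"
proof -
  have *: "((\<lambda>x. u x * w x) has_vector_derivative (u x * vderiv w x + vderiv u x * w x)) (at x)" for x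
    using assms has_vector_derivative_mult[of u "vderiv u x" x UNIV w "vderiv w x"]
    by (auto simp: diffk_Suc_iff simp del: diffk.simps(2))
  then show "vderiv (\<lambda>x. u x * w x) = (\<lambda>x. vderiv u x * w x + u x * vderiv w x)"
    by (intro vderiv_eqI) (simp add: add.commute)
  show "(\<lambda>x. u x * w x) differentiable (at x)"
    using * differentiableI_vector by blast
qed

lemma diffk_mult:
  fixes u w :: "real \<Rightarrow> 'a::real_normed_algebra"
  shows "diffk m u \<Longrightarrow> diffk m w \<Longrightarrow> diffk m (\<lambda>x. u x * w x)"
proof (induction m arbitrary: u w)
  case 0 then show ?case by (simp add: continuous_on_mult)
next
  case (Suc m)
  have "diffk m u" "diffk m w" using Suc.prems diffk_Suc_D by blast+
  moreover have "diffk m (vderiv u)" "diffk m (vderiv w)" using Suc.prems by auto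
  ultimately have "diffk m (vderiv (\<lambda>x. u x * w x))"
    unfolding vderiv_mult(1)[OF Suc.prems] by (intro diffk_add Suc.IH)
  then show ?case using vderiv_mult(2)[OF Suc.prems] by simp
qed

lemma diffk_const: "diffk m (\<lambda>x. c)"
  and nderiv_const: "nderiv j (\<lambda>x. c) = (if j = 0 then (\<lambda>x. c) else (\<lambda>x. 0))"
proof -
  have "diffk m (\<lambda>x. c) \<and> (\<forall>j\<le>m. nderiv j (\<lambda>x. c) = (if j = 0 then (\<lambda>x. c) else (\<lambda>x. 0)))" for m
    using diffkI[of m "\<lambda>j. (if j = 0 then (\<lambda>x. c) else (\<lambda>x. 0))"] nderiv_eqI[of m "\<lambda>j. (if j = 0 then (\<lambda>x. c) else (\<lambda>x. 0))"] by auto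
  from this[of m] this[of j] show "diffk m (\<lambda>x. c)"
    "nderiv j (\<lambda>x. c) = (if j = 0 then (\<lambda>x. c) else (\<lambda>x. 0))" by auto
qed


section \<open>Test functions\<close>

definition exp_recip :: "real poly \<Rightarrow> real \<Rightarrow> real" where
  "exp_recip p x = (if x > 0 then poly p (1 / x) * exp (- (1 / x)) else 0)"

lemma poly_times_exp_minus_tendsto_0: "((\<lambda>t. poly p t * exp (- t)) \<longlongrightarrow> (0::real)) at_top"
proof -
  have "((\<lambda>t. \<Sum>i\<le>degree p. coeff p i * (t ^ i / exp t)) \<longlongrightarrow> (\<Sum>i\<le>degree p. coeff p i * 0)) at_top"
    by (intro tendsto_intros tendsto_power_div_exp_0)
  then show ?thesis
    by (simp add: poly_altdef sum_distrib_right exp_minus divide_inverse mult.assoc)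
qed

text \<open>With t = 1/x the derivative of p(t) exp(-t) in x is t^2 (p - p')(t) exp(-t), which
  explains the polynomial. At 0 the right difference quotient is t p(t) exp(-t) with t tending to
  infinity, and the left one vanishes.\<close>

lemma exp_recip_deriv:
  "(exp_recip p has_vector_derivative exp_recip ([:0, 0, 1:] * (p - pderiv p)) x) (at x)"
proof -
  let ?q = "[:0, 0, 1:] * (p - pderiv p)"
  consider "x > 0" | "x < 0" | "x = 0" by linarith
  then have "(exp_recip p has_real_derivative exp_recip ?q x) (at x)"
  proof cases
    case 1
    have *: "((\<lambda>x. poly p (1 / x) * exp (- (1 / x))) has_real_derivative exp_recip ?q x) (at x)"
      using 1 unfolding exp_recip_def
      by (auto intro!: derivative_eq_intros simp: field_simps power2_eq_square)
    show ?thesis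
      by (rule has_field_derivative_transform_within[OF *, of x]) (use 1 in \<open>auto simp: exp_recip_def dist_real_def\<close>)
  next
    case 2
    have *: "((\<lambda>x. 0) has_real_derivative exp_recip ?q x) (at x)"
      using 2 unfolding exp_recip_def by auto
    show ?thesis
      by (rule has_field_derivative_transform_within[OF *, of "-x"]) (use 2 in \<open>auto simp: exp_recip_def dist_real_def\<close>)
  next
    case 3
    have "((\<lambda>t. poly ([:0, 1:] * p) t * exp (- t)) \<longlongrightarrow> (0::real)) at_top"
      by (rule poly_times_exp_minus_tendsto_0)
    then have "((\<lambda>y. poly ([:0, 1:] * p) (inverse y) * exp (- inverse y)) \<longlongrightarrow> 0) (at_right 0)"
      by (rule filterlim_compose) (rule filterlim_inverse_at_top_right)
    then have r: "((\<lambda>y. exp_recip p y / y) \<longlongrightarrow> 0) (at_right 0)"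
      by (rule Lim_transform_eventually)
         (auto simp: eventually_at_filter exp_recip_def field_simps)
    have l: "((\<lambda>y. exp_recip p y / y) \<longlongrightarrow> 0) (at_left 0)"
      by (rule Lim_transform_eventually[OF tendsto_const])
         (auto simp: eventually_at_filter exp_recip_def)
    have "((\<lambda>y. exp_recip p y / y) \<longlongrightarrow> 0) (at 0)"
      using l r by (simp add: filterlim_at_split)
    then show ?thesis using 3 by (simp add: has_field_derivative_iff exp_recip_def)
  qed
  then show ?thesis by (simp add: has_real_derivative_iff_has_vector_derivative)
qed

lemma diffk_exp_recip: "diffk m (exp_recip p)"
proof (induction m arbitrary: p)
  case 0
  show ?case
    by (auto intro!: continuous_at_imp_continuous_on has_vector_derivative_continuous[OF exp_recip_deriv])
next
  case (Suc m)
  show ?case by (rule diffk_SucI[OF exp_recip_deriv Suc])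
qed

lemma test_functionI:
  assumes "smooth \<eta>" "\<And>x. \<bar>x\<bar> > R \<Longrightarrow> \<eta> x = 0"
  shows "test_function \<eta>"
proof -
  have "{x. \<eta> x \<noteq> 0} \<subseteq> {-R..R}" using assms(2) by force
  then have "bounded {x. \<eta> x \<noteq> 0}" using bounded_closed_interval bounded_subset by blast
  then show ?thesis using assms(1) by (simp add: test_function_def compact_closure)
qed

text \<open>One radius serves all derivatives, because a function that vanishes near a point has
  derivative 0 there.\<close>

lemma test_function_support:
  assumes "test_function \<eta>"
  obtains R where "R > 0" "\<And>j x. \<bar>x\<bar> > R \<Longrightarrow> nderiv j \<eta> x = 0"
proof -
  have "bounded {x. \<eta> x \<noteq> 0}"
    using assms unfolding test_function_def compact_closure by blast
  then obtain R where R: "R > 0" "\<And>x. \<eta> x \<noteq> 0 \<Longrightarrow> norm x \<le> R" unfolding bounded_pos by auto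
  have "nderiv j \<eta> x = 0" if "\<bar>x\<bar> > R" for j x
    using that
  proof (induction j arbitrary: x)
    case 0 then show ?case using R(2)[of x] by auto
  next
    case (Suc j)
    have "((\<lambda>y. 0) has_vector_derivative 0) (at x)" by simp
    then have "(nderiv j \<eta> has_vector_derivative 0) (at x)"
    proof (rule has_vector_derivative_transform_within)
      show "0 < \<bar>x\<bar> - R" using Suc.prems by simp
    qed (use Suc.IH in \<open>auto simp: dist_real_def\<close>)
    then have "vector_derivative (nderiv j \<eta>) (at x) = 0" by (rule vector_derivative_at)
    then show ?case by (simp add: vderiv_def[of "nderiv j \<eta>"])
  qed
  with R(1) that show ?thesis by blast
qed

lemma test_function_nderiv: 
  assumes "test_function \<eta>"
  shows "test_function (nderiv j \<eta>)"
proof -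
  obtain R where "\<And>j x. \<bar>x\<bar> > R \<Longrightarrow> nderiv j \<eta> x = 0"
    using test_function_support[OF assms] by metis
  then show ?thesis 
    using assms by (intro test_functionI[of _ R] smooth_nderiv) (auto simp: test_function_def)
qed

lemma test_function_diffk: "test_function \<eta> \<Longrightarrow> diffk m \<eta>"
  by (simp add: test_function_def smooth_iff_diffk)

lemma test_function_continuous: "test_function \<eta> \<Longrightarrow> continuous_on UNIV \<eta>"
  using test_function_diffk[of \<eta> 0] by simp

lemma test_function_measurable [measurable_dest]: "test_function \<eta> \<Longrightarrow> \<eta> \<in> borel_measurable borel"
  by (simp add: borel_measurable_continuous_onI test_function_continuous)

lemma test_function_bound:
  assumes "test_function \<eta>"
  obtains R B where "R > 0" "B > 0" "\<And>x. \<bar>\<eta> x\<bar> \<le> B" "\<And>x. \<bar>x\<bar> > R \<Longrightarrow> \<eta> x = 0"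
proof -
  obtain R where R: "R > 0" "\<And>j x. \<bar>x\<bar> > R \<Longrightarrow> nderiv j \<eta> x = 0" 
    using test_function_support[OF assms] by metis
  have "compact (\<eta> ` {-R..R})"
    by (intro compact_continuous_image continuous_on_subset[OF test_function_continuous[OF assms]]) auto
  then obtain B where B: "B > 0" "\<forall>y\<in>\<eta> ` {-R..R}. norm y \<le> B"
    using compact_imp_bounded bounded_pos by metis
  have "\<bar>\<eta> x\<bar> \<le> B" for x
  proof (cases "\<bar>x\<bar> > R")
    case False
    then have "x \<in> {-R..R}" by auto
    then show ?thesis using B(2) by auto
  qed (use B R(2)[of x 0] in auto)
  then show ?thesis using that R(1) B(1) R(2)[of _ 0] by auto
qed

lemma test_function_integrable:
  assumes "test_function \<eta>" "locally_integrable u"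
  shows "integrable lborel (\<lambda>x. \<eta> x *\<^sub>R u x)"
proof -
  obtain R B where RB: "R > 0" "B > 0" "\<And>x. \<bar>\<eta> x\<bar> \<le> B" "\<And>x. \<bar>x\<bar> > R \<Longrightarrow> \<eta> x = 0"
    using test_function_bound[OF assms(1)] by metis
  have "integrable lborel (\<lambda>x. indicator {-R..R} x *\<^sub>R u x)"
    using assms(2) by (auto simp: locally_integrable_def set_integrable_def)
  then have i: "integrable lborel (\<lambda>x. B *\<^sub>R (indicator {-R..R} x *\<^sub>R u x))"
    by (intro integrable_scaleR_right)
  \<comment> \<open>Local integrability directly gives measurability of cut-offs of
    \<open>u\<close>; writing the integrand with the cut-off \<open>w\<close> makes the product
    measurable.\<close>
  define w where "w = (\<lambda>x. indicator {-R..R} x *\<^sub>R u x)"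
  have wm: "w \<in> borel_measurable lborel"
    unfolding w_def using \<open>integrable lborel (\<lambda>x. indicator {-R..R} x *\<^sub>R u x)\<close>
    by (rule borel_measurable_integrable)
  have eq: "\<eta> x *\<^sub>R u x = \<eta> x *\<^sub>R w x" for x
    using RB(4)[of x] by (cases "\<bar>x\<bar> > R") (auto simp: indicator_def w_def)
  show ?thesis
  proof (rule Bochner_Integration.integrable_bound[OF i])
    show "(\<lambda>x. \<eta> x *\<^sub>R u x) \<in> borel_measurable lborel"
      unfolding eq using test_function_measurable[OF assms(1)] wm by simp
    show "AE x in lborel. norm (\<eta> x *\<^sub>R u x) \<le> norm (B *\<^sub>R indicator {-R..R} x *\<^sub>R u x)"
      unfolding eq w_def using RB(2,3)
      by (intro AE_I2) (auto simp: indicator_def intro!: mult_right_mono)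
  qed
qed

lemma test_function_affine:
  assumes "test_function \<eta>" "a \<noteq> 0"
  shows "test_function (\<lambda>y. \<eta> (b + a * y))"
proof -
  obtain R where R: "R > 0" "\<And>x. \<bar>x\<bar> > R \<Longrightarrow> \<eta> x = 0"
    using test_function_bound[OF assms(1)] by metis
  show ?thesis
  proof (rule test_functionI)
    show "smooth (\<lambda>y. \<eta> (b + a * y))"
      using assms(1) by (auto simp: test_function_def smooth_iff_diffk intro: diffk_affine)
    fix y assume "\<bar>y\<bar> > (R + \<bar>b\<bar>) / \<bar>a\<bar>"
    then have "\<bar>a * y\<bar> > R + \<bar>b\<bar>" using assms(2) by (simp add: abs_mult field_simps)
    then show "\<eta> (b + a * y) = 0" by (intro R(2)) linarith
  qed
qed

lemma test_function_cmult: 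
  assumes "test_function \<eta>"
  shows "test_function (\<lambda>y. c * \<eta> y)"
proof -
  obtain R where "\<And>x. \<bar>x\<bar> > R \<Longrightarrow> \<eta> x = 0" using test_function_bound[OF assms] by metis
  moreover have "smooth (\<lambda>y. c * \<eta> y)"
    unfolding smooth_iff_diffk
    by (intro allI diffk_linear[OF bounded_linear_mult_right] test_function_diffk assms)
  ultimately show ?thesis by (intro test_functionI[of _ R]) auto
qed

lemma locally_integrable_const: "locally_integrable (\<lambda>x. c)"
  unfolding locally_integrable_def set_integrable_def
  by (intro allI integrable_scaleR_left) (simp add: integrable_indicator_iff emeasure_lborel_Icc_eq)

lemma test_function_integrable_self: "test_function \<eta> \<Longrightarrow> integrable lborel \<eta>"
  using test_function_integrable[OF _ locally_integrable_const[of "1::real"]] by auto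

lemma bump_exists:
  obtains \<rho> where "test_function \<rho>" "\<And>x. \<rho> x \<ge> 0" "\<And>x. \<bar>x\<bar> > 1 \<Longrightarrow> \<rho> x = 0" "(LINT x|lborel. \<rho> x) = 1"
proof -
  \<comment> \<open>Each factor is positive on one side of -1 or 1 and zero on the other, so the
    product is positive exactly on (-1, 1).\<close>
  define b where "b = (\<lambda>x. exp_recip 1 (1 + 1 * x) * exp_recip 1 (1 + (-1) * x))"
  have t: "test_function b"
  proof (rule test_functionI[of _ 1])
    show "smooth b" unfolding b_def smooth_iff_diffk
      by (intro allI diffk_mult diffk_affine diffk_exp_recip)
  qed (auto simp: b_def exp_recip_def)
  have nn: "b x \<ge> 0" for x by (auto simp: b_def exp_recip_def)
  have i: "integrable lborel b" by (rule test_function_integrable_self[OF t])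
  have "(LINT x|lborel. b x) \<noteq> 0"
  proof
    assume "(LINT x|lborel. b x) = 0"
    then have z: "AE x in lborel. b x = 0"
      using integral_nonneg_eq_0_iff_AE[OF i] nn by auto
    have nz: "b x \<noteq> 0" if "x \<in> {-1<..<1}" for x
      using that by (auto simp: b_def exp_recip_def)
    have "AE x in lborel. x \<notin> {-1<..<1::real}"
      by (rule AE_mp[OF z], rule AE_I2) (use nz in auto)
    then have "{-1<..<1::real} \<in> null_sets lborel"
      using AE_iff_null_sets[of "{-1<..<1::real}" lborel] by simp
    then show False by (simp add: null_sets_def)
  qed
  then have p: "(LINT x|lborel. b x) > 0"
    using integral_nonneg_AE[of b lborel] nn by (simp add: less_le)
  show ?thesis
  proof (rule that[of "\<lambda>x. 1 / (LINT x|lborel. b x) * b x"])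
    show "test_function (\<lambda>x. 1 / (LINT x|lborel. b x) * b x)" by (rule test_function_cmult[OF t])
    show "(LINT x|lborel. 1 / (LINT x|lborel. b x) * b x) = 1" using p by simp
  qed (use p nn in \<open>auto simp: b_def exp_recip_def\<close>)
qed

section \<open>Convolution with test functions\<close>

definition conv :: "(real \<Rightarrow> real) \<Rightarrow> (real \<Rightarrow> 'a::euclidean_space) \<Rightarrow> real \<Rightarrow> 'a" where
  "conv \<eta> u = (\<lambda>x. LINT y|lborel. \<eta> (x - y) *\<^sub>R u y)"

lemma test_function_reflect: "test_function \<eta> \<Longrightarrow> test_function (\<lambda>y. \<eta> (x - y))"
  using test_function_affine[of \<eta> "-1" x] by simp

lemma nderiv_reflect:
  assumes "test_function \<eta>"
  shows "nderiv j (\<lambda>y. \<eta> (x - y)) = (\<lambda>y. (-1) ^ j * nderiv j \<eta> (x - y))"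
  using nderiv_affine[OF test_function_diffk[OF assms, of j], of j x "-1"] by simp

lemma conv_integrable: 
  "test_function \<eta> \<Longrightarrow> locally_integrable u \<Longrightarrow> integrable lborel (\<lambda>y. \<eta> (x - y) *\<^sub>R u y)"
  by (rule test_function_integrable[OF test_function_reflect])

lemma real_lipschitz_bound:
  fixes g :: "real \<Rightarrow> real"
  assumes "\<And>x. (g has_real_derivative g' x) (at x)" "\<And>x. \<bar>x - a\<bar> \<le> \<bar>b - a\<bar> \<Longrightarrow> \<bar>g' x\<bar> \<le> B"
  shows "\<bar>g b - g a\<bar> \<le> B * \<bar>b - a\<bar>"
proof -
  have "norm (g b - g a) \<le> B * norm (b - a)"
  proof (rule field_differentiable_bound[of "{a - \<bar>b - a\<bar>..a + \<bar>b - a\<bar>}" g g'])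
    fix z assume "z \<in> {a - \<bar>b - a\<bar>..a + \<bar>b - a\<bar>}"
    then have "\<bar>z - a\<bar> \<le> \<bar>b - a\<bar>" by auto
    then show "norm (g' z) \<le> B" using assms(2) by simp
    show "(g has_field_derivative g' z) (at z within {a - \<bar>b - a\<bar>..a + \<bar>b - a\<bar>})"
      using assms(1) DERIV_subset by blast
  qed auto
  then show ?thesis by simp
qed

lemma test_function_has_derivative:
  "test_function \<eta> \<Longrightarrow> (\<eta> has_real_derivative vderiv \<eta> x) (at x)"
  using diffk_has_vector_derivative[OF test_function_diffk[of \<eta> 1], of 0]
  by (simp add: has_real_derivative_iff_has_vector_derivative)

text \<open>The remainder bound is uniform in the base point, which is what differentiation under
  the convolution integral requires. It follows by applying the mean value bound first to the
  derivative and then to \<eta> minus its tangent.\<close>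

lemma test_function_taylor:
  assumes t: "test_function \<eta>"
  obtains B where "B > 0" "\<And>z h. \<bar>\<eta> (z + h) - \<eta> z - h * vderiv \<eta> z\<bar> \<le> B * h\<^sup>2"
proof -
  have t1: "test_function (vderiv \<eta>)" and t2: "test_function (vderiv (vderiv \<eta>))"
    using test_function_nderiv[OF t, of 1] test_function_nderiv[OF t, of 2] by (auto simp: numeral_2_eq_2)
  obtain B where B: "B > 0" "\<And>x. \<bar>vderiv (vderiv \<eta>) x\<bar> \<le> B"
    using test_function_bound[OF t2] by metis
  have "\<bar>\<eta> (z + h) - \<eta> z - h * vderiv \<eta> z\<bar> \<le> B * h\<^sup>2" for z h
  proof -
    have 1: "\<bar>vderiv \<eta> x - vderiv \<eta> z\<bar> \<le> B * \<bar>x - z\<bar>" for x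
      by (rule real_lipschitz_bound[OF test_function_has_derivative[OF t1]]) (rule B)
    have d: "((\<lambda>x. \<eta> x - x * vderiv \<eta> z) has_real_derivative vderiv \<eta> x - vderiv \<eta> z) (at x)" for x
      by (auto intro!: derivative_eq_intros test_function_has_derivative[OF t])
    have "\<bar>(\<eta> (z + h) - (z + h) * vderiv \<eta> z) - (\<eta> z - z * vderiv \<eta> z)\<bar> \<le> (B * \<bar>h\<bar>) * \<bar>(z + h) - z\<bar>"
    proof (rule real_lipschitz_bound[OF d])
      fix x assume "\<bar>x - z\<bar> \<le> \<bar>z + h - z\<bar>"
      then have "B * \<bar>x - z\<bar> \<le> B * \<bar>h\<bar>" using B(1) by simp
      then show "\<bar>vderiv \<eta> x - vderiv \<eta> z\<bar> \<le> B * \<bar>h\<bar>" using 1[of x] by linarith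
    qed
    then show ?thesis by (simp add: algebra_simps power2_eq_square)
  qed
  with B(1) that show ?thesis by blast
qed

lemma integral_norm_bound_on_interval:
  fixes u :: "real \<Rightarrow> 'a::euclidean_space"
  assumes "locally_integrable u" "\<And>y. \<bar>\<zeta> y\<bar> \<le> B" "\<And>y. \<zeta> y \<noteq> 0 \<Longrightarrow> y \<in> {a..b}"
    "integrable lborel (\<lambda>y. \<zeta> y *\<^sub>R u y)" "B \<ge> 0"
  shows "norm (LINT y|lborel. \<zeta> y *\<^sub>R u y) \<le> B * (LINT y|lborel. indicator {a..b} y * norm (u y))"
proof -
  have "integrable lborel (\<lambda>y. indicator {a..b} y *\<^sub>R u y)"
    using assms(1) by (simp add: locally_integrable_def set_integrable_def)
  from integrable_norm[OF this]
  have i: "integrable lborel (\<lambda>y. indicator {a..b} y * norm (u y))" by simp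
  have "norm (LINT y|lborel. \<zeta> y *\<^sub>R u y) \<le> (LINT y|lborel. norm (\<zeta> y *\<^sub>R u y))"
    by (rule integral_norm_bound)
  also have "\<dots> \<le> (LINT y|lborel. B * (indicator {a..b} y * norm (u y)))"
  proof (rule integral_mono)
    show "norm (\<zeta> y *\<^sub>R u y) \<le> B * (indicator {a..b} y * norm (u y))" for y
      using assms(2,3)[of y] assms(5) 
      by (cases "\<zeta> y = 0") (auto simp: indicator_def intro!: mult_right_mono)
    show "integrable lborel (\<lambda>y. norm (\<zeta> y *\<^sub>R u y))" by (rule integrable_norm[OF assms(4)])
  qed (use i in auto)
  finally show ?thesis by simp
qed

text \<open>By the uniform Taylor bound, the error of the difference quotient is at most a constant
  times |h| times the integral of |u| over a bounded interval, so local integrability of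
  \<open>u\<close> suffices.\<close>

lemma conv_has_vector_derivative:
  fixes u :: "real \<Rightarrow> 'a::euclidean_space"
  assumes t: "test_function \<eta>" and u: "locally_integrable u"
  shows "(conv \<eta> u has_vector_derivative conv (vderiv \<eta>) u x) (at x)"
proof -
  have t1: "test_function (vderiv \<eta>)" using test_function_nderiv[OF t, of 1] by simp
  obtain B where B: "B > 0" "\<And>z h. \<bar>\<eta> (z + h) - \<eta> z - h * vderiv \<eta> z\<bar> \<le> B * h\<^sup>2"
    using test_function_taylor[OF t] by metis
  obtain R where R: "R > 0" "\<And>j x. \<bar>x\<bar> > R \<Longrightarrow> nderiv j \<eta> x = 0"
    using test_function_support[OF t] by metis
  \<comment> \<open>The margin 1 makes the interval contain the supports of all translates with |h|
    at most 1.\<close>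
  define I where "I = (LINT y|lborel. indicator {x - R - 1..x + R + 1} y * norm (u y))"
  have bd: "norm (conv \<eta> u (x + h) - conv \<eta> u x - h *\<^sub>R conv (vderiv \<eta>) u x) \<le> B * h\<^sup>2 * I"
    if h: "\<bar>h\<bar> \<le> 1" for h
  proof -
    have e: "x + h - y = (x - y) + h" for y by simp
    note i1 = conv_integrable[OF t u, of "x+h", unfolded e]
    note i = i1 conv_integrable[OF t u, of x] conv_integrable[OF t1 u, of x]
    have s: "(\<eta> ((x - y) + h) - \<eta> (x - y) - h * vderiv \<eta> (x - y)) *\<^sub>R u y
        = \<eta> ((x - y) + h) *\<^sub>R u y - \<eta> (x - y) *\<^sub>R u y - h *\<^sub>R (vderiv \<eta> (x - y) *\<^sub>R u y)" for y
      by (simp add: scaleR_diff_left)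
    have eq: "conv \<eta> u (x + h) - conv \<eta> u x - h *\<^sub>R conv (vderiv \<eta>) u x
       = (LINT y|lborel. (\<eta> ((x - y) + h) - \<eta> (x - y) - h * vderiv \<eta> (x - y)) *\<^sub>R u y)"
      unfolding conv_def s e using i 
      by (simp only: Bochner_Integration.integral_diff Bochner_Integration.integrable_diff 
          integral_scaleR_right integrable_scaleR_right)
    show ?thesis unfolding eq I_def
    proof (rule integral_norm_bound_on_interval[OF u])
      show "\<bar>\<eta> ((x - y) + h) - \<eta> (x - y) - h * vderiv \<eta> (x - y)\<bar> \<le> B * h\<^sup>2" for y by (rule B)
      fix y assume "\<eta> ((x - y) + h) - \<eta> (x - y) - h * vderiv \<eta> (x - y) \<noteq> 0"
      then have "\<bar>x - y + h\<bar> \<le> R \<or> \<bar>x - y\<bar> \<le> R"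
        using R(2)[of "x - y + h" 0] R(2)[of "x - y" 0] R(2)[of "x - y" 1] by fastforce
      then show "y \<in> {x - R - 1..x + R + 1}" using h by auto
    next
      show "integrable lborel (\<lambda>y. (\<eta> ((x - y) + h) - \<eta> (x - y) - h * vderiv \<eta> (x - y)) *\<^sub>R u y)"
        unfolding s using i by (intro Bochner_Integration.integrable_diff integrable_scaleR_right)
    qed (use B in auto)
  qed
  have I: "I \<ge> 0" unfolding I_def by (rule integral_nonneg_AE) auto
  show ?thesis unfolding has_vector_derivative_def has_derivative_at
  proof (intro conjI bounded_linear_scaleR_left)
    show "(\<lambda>h. norm (conv \<eta> u (x + h) - conv \<eta> u x - h *\<^sub>R conv (vderiv \<eta>) u x) / norm h) \<midarrow>0\<rightarrow> 0"
    proof (rule Lim_null_comparison)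
      show "\<forall>\<^sub>F h in at 0. norm (norm (conv \<eta> u (x + h) - conv \<eta> u x - h *\<^sub>R conv (vderiv \<eta>) u x) / norm h) \<le> B * I * \<bar>h\<bar>"
        unfolding eventually_at
      proof (intro exI[of _ 1] conjI ballI impI)
        fix h :: real assume "h \<noteq> 0 \<and> dist h 0 < 1"
        then have "norm (conv \<eta> u (x + h) - conv \<eta> u x - h *\<^sub>R conv (vderiv \<eta>) u x) \<le> B * I * \<bar>h\<bar> * \<bar>h\<bar>"
          using bd[of h] by (auto simp: power2_eq_square algebra_simps)
        then show "norm (norm (conv \<eta> u (x + h) - conv \<eta> u x - h *\<^sub>R conv (vderiv \<eta>) u x) / norm h) \<le> B * I * \<bar>h\<bar>"
          using \<open>h \<noteq> 0 \<and> dist h 0 < 1\<close> by (simp add: divide_le_eq)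
      qed auto
      show "(\<lambda>h. B * I * \<bar>h\<bar>) \<midarrow>0\<rightarrow> 0" by (auto intro!: tendsto_eq_intros)
    qed
  qed
qed

lemma
  fixes u :: "real \<Rightarrow> 'a::euclidean_space"
  assumes t: "test_function \<eta>" and u: "locally_integrable u"
  shows diffk_conv: "diffk m (conv \<eta> u)" and nderiv_conv: "nderiv j (conv \<eta> u) = conv (nderiv j \<eta>) u"
proof -
  have d: "(conv (nderiv j \<eta>) u has_vector_derivative conv (nderiv (Suc j) \<eta>) u x) (at x)" for j x
    using conv_has_vector_derivative[OF test_function_nderiv[OF t] u] by simp
  have c: "continuous_on UNIV (conv (nderiv m \<eta>) u)" for m
    by (auto intro!: continuous_at_imp_continuous_on has_vector_derivative_continuous[OF d])
  show "diffk m (conv \<eta> u)"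
    using diffkI[of m "\<lambda>j. conv (nderiv j \<eta>) u"] d c by simp
  show "nderiv j (conv \<eta> u) = conv (nderiv j \<eta>) u"
    using nderiv_eqI[of j "\<lambda>j. conv (nderiv j \<eta>) u" j] d c by simp
qed

lemma conv_measurable [measurable]:
  "test_function \<eta> \<Longrightarrow> locally_integrable u \<Longrightarrow> conv \<eta> u \<in> borel_measurable borel"
  using diffk_conv[of \<eta> u 0] by (simp add: borel_measurable_continuous_onI)

lemma
  fixes u w :: "real \<Rightarrow> 'a::euclidean_space"
  assumes t: "test_function \<eta>" and u: "locally_integrable u" and w: "locally_integrable w"
  shows conv_add: "conv \<eta> (\<lambda>x. u x + w x) = (\<lambda>x. conv \<eta> u x + conv \<eta> w x)"
    and conv_diff: "conv \<eta> (\<lambda>x. u x - w x) = (\<lambda>x. conv \<eta> u x - conv \<eta> w x)"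
  unfolding conv_def using conv_integrable[OF t u] conv_integrable[OF t w]
  by (auto simp: scaleR_add_right scaleR_diff_right)

text \<open>This is the definition of the weak derivative, tested with the reflected kernel; the
  sign from the reflection cancels the sign in the definition. It moves derivatives from the
  mollifier to \<open>u\<close>.\<close>

lemma conv_nderiv_weak:
  fixes u g :: "real \<Rightarrow> 'a::euclidean_space"
  assumes t: "test_function \<eta>" and w: "has_weak_deriv j u g"
  shows "conv (nderiv j \<eta>) u = conv \<eta> g"
proof
  fix x
  have "(LINT y|lborel. nderiv j (\<lambda>y. \<eta> (x - y)) y *\<^sub>R u y) = (-1) ^ j *\<^sub>R (LINT y|lborel. \<eta> (x - y) *\<^sub>R g y)"
    using w test_function_reflect[OF t] unfolding has_weak_deriv_def by blast
  then have "(-1) ^ j *\<^sub>R conv (nderiv j \<eta>) u x = (-1::real) ^ j *\<^sub>R conv \<eta> g x"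
    by (simp add: conv_def nderiv_reflect[OF t] flip: scaleR_scaleR)
  then show "conv (nderiv j \<eta>) u x = conv \<eta> g x" by simp
qed

text \<open>Young's inequality. The kernel is split as a product of two square roots for
  Cauchy-Schwarz in y, and Tonelli then integrates the remaining kernel in x.\<close>

lemma
  fixes u :: "real \<Rightarrow> 'a::euclidean_space"
  assumes t: "test_function \<eta>" and u: "square_integrable u"
  shows square_integrable_conv: "square_integrable (conv \<eta> u)"
    and L2_norm_conv: "L2_norm (conv \<eta> u) \<le> (LINT y|lborel. \<bar>\<eta> y\<bar>) * L2_norm u"
proof -
  note lu = square_integrable_imp_locally_integrable[OF u]
  note [measurable] = square_integrable_measurable[OF u] test_function_measurable[OF t] conv_measurable[OF t lu]
  define M where "M = (LINT y|lborel. \<bar>\<eta> y\<bar>)"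
  have M0: "M \<ge> 0" unfolding M_def by (rule integral_nonneg_AE) auto
  have M: "(\<integral>\<^sup>+y. ennreal \<bar>\<eta> y\<bar> \<partial>lborel) = ennreal M"
    unfolding M_def by (intro nn_integral_eq_integral integrable_abs test_function_integrable_self t) auto
  have iu: "integrable lborel (\<lambda>x. (norm (u x))\<^sup>2)" using u by (auto simp: square_integrable_def)
  have Mr: "(\<integral>\<^sup>+y. ennreal \<bar>\<eta> (x - y)\<bar> \<partial>lborel) = ennreal M" for x
    using nn_integral_real_affine[of "\<lambda>y. ennreal \<bar>\<eta> y\<bar>" "-1" x] M by simp
  have Ml: "(\<integral>\<^sup>+x. ennreal \<bar>\<eta> (x - y)\<bar> \<partial>lborel) = ennreal M" for y
    using nn_integral_real_affine[of "\<lambda>y. ennreal \<bar>\<eta> y\<bar>" "1" "-y"] M by simp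
  have pt: "ennreal ((norm (conv \<eta> u x))\<^sup>2) 
      \<le> ennreal M * (\<integral>\<^sup>+y. ennreal \<bar>\<eta> (x - y)\<bar> * ennreal ((norm (u y))\<^sup>2) \<partial>lborel)" for x
  proof -
    have "ennreal (norm (conv \<eta> u x)) \<le> (\<integral>\<^sup>+y. ennreal (norm (\<eta> (x - y) *\<^sub>R u y)) \<partial>lborel)"
      unfolding conv_def by (rule integral_norm_bound_ennreal[OF conv_integrable[OF t lu]])
    also have "\<dots> = (\<integral>\<^sup>+y. ennreal (sqrt \<bar>\<eta> (x - y)\<bar>) * ennreal (sqrt \<bar>\<eta> (x - y)\<bar> * norm (u y)) \<partial>lborel)"
      by (intro nn_integral_cong) (simp flip: ennreal_mult mult.assoc)
    finally have "(ennreal (norm (conv \<eta> u x)))\<^sup>2 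
       \<le> (\<integral>\<^sup>+y. ennreal (sqrt \<bar>\<eta> (x - y)\<bar>) * ennreal (sqrt \<bar>\<eta> (x - y)\<bar> * norm (u y)) \<partial>lborel)\<^sup>2"
      by (rule power_mono) simp
    also have "\<dots> \<le> (\<integral>\<^sup>+y. (ennreal (sqrt \<bar>\<eta> (x - y)\<bar>))\<^sup>2 \<partial>lborel) 
        * (\<integral>\<^sup>+y. (ennreal (sqrt \<bar>\<eta> (x - y)\<bar> * norm (u y)))\<^sup>2 \<partial>lborel)"
      by (rule Cauchy_Schwarz_nn_integral) auto
    also have "(\<integral>\<^sup>+y. (ennreal (sqrt \<bar>\<eta> (x - y)\<bar>))\<^sup>2 \<partial>lborel) = ennreal M"
      using Mr[of x] by (simp add: ennreal_power)
    also have "(\<integral>\<^sup>+y. (ennreal (sqrt \<bar>\<eta> (x - y)\<bar> * norm (u y)))\<^sup>2 \<partial>lborel)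
       = (\<integral>\<^sup>+y. ennreal \<bar>\<eta> (x - y)\<bar> * ennreal ((norm (u y))\<^sup>2) \<partial>lborel)"
      by (intro nn_integral_cong) (simp add: ennreal_power power_mult_distrib flip: ennreal_mult)
    finally show ?thesis by (simp add: ennreal_power)
  qed
  have "(\<integral>\<^sup>+x. ennreal ((norm (conv \<eta> u x))\<^sup>2) \<partial>lborel)
      \<le> (\<integral>\<^sup>+x. ennreal M * (\<integral>\<^sup>+y. ennreal \<bar>\<eta> (x - y)\<bar> * ennreal ((norm (u y))\<^sup>2) \<partial>lborel) \<partial>lborel)"
    by (intro nn_integral_mono pt)
  also have "\<dots> = ennreal M * (\<integral>\<^sup>+x. (\<integral>\<^sup>+y. ennreal \<bar>\<eta> (x - y)\<bar> * ennreal ((norm (u y))\<^sup>2) \<partial>lborel) \<partial>lborel)"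
    by (rule nn_integral_cmult) measurable
  also have "(\<integral>\<^sup>+x. (\<integral>\<^sup>+y. ennreal \<bar>\<eta> (x - y)\<bar> * ennreal ((norm (u y))\<^sup>2) \<partial>lborel) \<partial>lborel)
     = (\<integral>\<^sup>+y. (\<integral>\<^sup>+x. ennreal \<bar>\<eta> (x - y)\<bar> * ennreal ((norm (u y))\<^sup>2) \<partial>lborel) \<partial>lborel)"
    by (rule lborel_pair.Fubini') measurable
  also have "\<dots> = (\<integral>\<^sup>+y. ennreal M * ennreal ((norm (u y))\<^sup>2) \<partial>lborel)"
    by (intro nn_integral_cong) (simp add: nn_integral_multc Ml)
  also have "\<dots> = ennreal M * ennreal ((L2_norm u)\<^sup>2)"
    using nn_integral_eq_integral[OF iu] by (simp add: nn_integral_cmult L2_norm_sq)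
  finally have nn: "(\<integral>\<^sup>+x. ennreal ((norm (conv \<eta> u x))\<^sup>2) \<partial>lborel) \<le> ennreal ((M * L2_norm u)\<^sup>2)"
    using M0 by (simp add: power2_eq_square mult_ac flip: ennreal_mult)
  have i: "integrable lborel (\<lambda>x. (norm (conv \<eta> u x))\<^sup>2)"
    by (rule integrableI_bounded) (use nn in \<open>auto simp: le_less_trans\<close>)
  then show "square_integrable (conv \<eta> u)"
    by (simp add: square_integrable_def)
  have "ennreal ((L2_norm (conv \<eta> u))\<^sup>2) \<le> ennreal ((M * L2_norm u)\<^sup>2)"
    using nn nn_integral_eq_integral[OF i] by (simp add: L2_norm_sq)
  then have "(L2_norm (conv \<eta> u))\<^sup>2 \<le> (M * L2_norm u)\<^sup>2" by (simp add: ennreal_le_iff)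
  then show "L2_norm (conv \<eta> u) \<le> (LINT y|lborel. \<bar>\<eta> y\<bar>) * L2_norm u"
    unfolding M_def[symmetric] by (rule power2_le_imp_le) (use M0 in auto)
qed

text \<open>Makes convolution with a fixed kernel continuous from L2 to the values at a point; this
  yields pointwise continuity in time after mollification.\<close>

lemma conv_sup_bound:
  fixes u :: "real \<Rightarrow> 'a::euclidean_space"
  assumes t: "test_function \<eta>" and u: "square_integrable u"
  shows "norm (conv \<eta> u x) \<le> L2_norm \<eta> * L2_norm u"
proof -
  note tx = test_function_reflect[OF t, of x]
  have sq: "square_integrable \<eta>" if "test_function \<eta>" for \<eta> :: "real \<Rightarrow> real"
  proof -
    have "integrable lborel (\<lambda>x. \<eta> x *\<^sub>R \<eta> x)"
    proof (rule test_function_integrable[OF that], unfold locally_integrable_def set_integrable_def, intro allI)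
      fix a b :: real
      show "integrable lborel (\<lambda>x. indicator {a..b} x *\<^sub>R \<eta> x)"
        by (rule integrable_mult_indicator) (use test_function_integrable_self[OF that] in auto)
    qed
    then show ?thesis using test_function_measurable[OF that]
      by (simp add: square_integrable_def power2_eq_square)
  qed
  have "norm (conv \<eta> u x) \<le> (LINT y|lborel. norm (\<eta> (x - y) *\<^sub>R u y))"
    unfolding conv_def by (rule integral_norm_bound)
  also have "\<dots> \<le> L2_norm (\<lambda>y. \<eta> (x - y)) * L2_norm u"
    using L2_Cauchy_Schwarz[OF sq[OF tx] u] by simp
  also have "L2_norm (\<lambda>y. \<eta> (x - y)) = L2_norm \<eta>"
    unfolding L2_norm_def using lborel_integral_real_affine[of "-1" "\<lambda>y. (norm (\<eta> y))\<^sup>2" x] by simp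
  finally show ?thesis .
qed


section \<open>Mollifiers\<close>

definition bump :: "real \<Rightarrow> real" where
  "bump = (SOME \<rho>. test_function \<rho> \<and> (\<forall>x. \<rho> x \<ge> 0) \<and> (\<forall>x. \<bar>x\<bar> > 1 \<longrightarrow> \<rho> x = 0) \<and> (LINT x|lborel. \<rho> x) = 1)"

definition mollifier :: "nat \<Rightarrow> real \<Rightarrow> real" where
  "mollifier n = (\<lambda>x. real (Suc n) * bump (real (Suc n) * x))"

abbreviation mollify :: "nat \<Rightarrow> (real \<Rightarrow> 'a::euclidean_space) \<Rightarrow> real \<Rightarrow> 'a" where
  "mollify n \<equiv> conv (mollifier n)"

lemma bump_props: "test_function bump" "bump x \<ge> 0" "\<bar>x\<bar> > 1 \<Longrightarrow> bump x = 0" "(LINT x|lborel. bump x) = 1"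
proof -
  let ?P = "\<lambda>\<rho>. test_function \<rho> \<and> (\<forall>x. \<rho> x \<ge> 0) \<and> (\<forall>x. \<bar>x\<bar> > 1 \<longrightarrow> \<rho> x = 0) \<and> (LINT x|lborel. \<rho> x) = 1"
  have "\<exists>\<rho>. ?P \<rho>"
    by (rule bump_exists) blast
  then have "?P bump"
    unfolding bump_def by (rule someI_ex[of ?P])
  then show "test_function bump" "bump x \<ge> 0" "\<bar>x\<bar> > 1 \<Longrightarrow> bump x = 0" "(LINT x|lborel. bump x) = 1" by auto
qed

lemma mollifier_test [simp]: "test_function (mollifier n)"
  unfolding mollifier_def using test_function_cmult[OF test_function_affine[OF bump_props(1), of "real (Suc n)" 0]] by simp

lemma mollifier_nonneg [simp]: "0 \<le> mollifier n x"
  by (simp add: mollifier_def bump_props)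

lemma mollifier_support: "\<bar>x\<bar> > 1 / real (Suc n) \<Longrightarrow> mollifier n x = 0"
proof -
  assume "\<bar>x\<bar> > 1 / real (Suc n)"
  then have "\<bar>real (Suc n) * x\<bar> > 1" unfolding abs_mult by (simp add: field_simps)
  then show ?thesis by (simp add: mollifier_def bump_props)
qed

lemma mollifier_support_1: "\<bar>x\<bar> > 1 \<Longrightarrow> mollifier n x = 0"
  by (rule mollifier_support, rule le_less_trans[of _ 1]) auto

lemma mollifier_integral [simp]: "(LINT x|lborel. mollifier n x) = 1"
  using lborel_integral_real_affine[of "real (Suc n)" bump 0] bump_props(4)
  unfolding mollifier_def by simp

lemma
  fixes u :: "real \<Rightarrow> 'a::euclidean_space"
  assumes "square_integrable u"
  shows square_integrable_mollify: "square_integrable (mollify n u)"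
    and L2_norm_mollify: "L2_norm (mollify n u) \<le> L2_norm u"
  using square_integrable_conv[OF mollifier_test assms] L2_norm_conv[OF mollifier_test assms, of n] by auto

lemma mollifier_reflect_integral: "(LINT y|lborel. mollifier n (x - y)) = 1"
  using lborel_integral_real_affine[of "-1" "mollifier n" x] by simp

text \<open>Since the mollifier has mass 1, the difference is an average of u(y) - c over a small
  neighbourhood. With c = u(x) this gives convergence, with c = 0 the preservation of sup
  bounds.\<close>

lemma mollify_diff_le:
  fixes u :: "real \<Rightarrow> 'a::euclidean_space"
  assumes u: "locally_integrable u" and e: "\<And>y. \<bar>x - y\<bar> \<le> 1 / real (Suc n) \<Longrightarrow> norm (u y - c) \<le> e"
  shows "norm (mollify n u x - c) \<le> e"
proof -
  have i: "integrable lborel (\<lambda>y. mollifier n (x - y))"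
    by (rule test_function_integrable_self[OF test_function_reflect]) simp
  have iu: "integrable lborel (\<lambda>y. mollifier n (x - y) *\<^sub>R (u y - c))"
    using conv_integrable[OF mollifier_test u, of n x] i by (simp add: scaleR_diff_right)
  have "mollify n u x - c = (LINT y|lborel. mollifier n (x - y) *\<^sub>R (u y - c))"
    unfolding conv_def scaleR_diff_right
    using conv_integrable[OF mollifier_test u, of n x] i by (simp add: mollifier_reflect_integral)
  also have "norm \<dots> \<le> (LINT y|lborel. norm (mollifier n (x - y) *\<^sub>R (u y - c)))"
    by (rule integral_norm_bound)
  also have "\<dots> \<le> (LINT y|lborel. mollifier n (x - y) * e)"
  proof (rule integral_mono)
    show "norm (mollifier n (x - y) *\<^sub>R (u y - c)) \<le> mollifier n (x - y) * e" for y
    proof (cases "\<bar>x - y\<bar> \<le> 1 / real (Suc n)")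
      case True
      then show ?thesis using e[of y] by (auto intro!: mult_left_mono)
    next
      case False
      then show ?thesis using mollifier_support[of n "x - y"] by auto
    qed
    show "integrable lborel (\<lambda>y. norm (mollifier n (x - y) *\<^sub>R (u y - c)))"
      by (rule integrable_norm[OF iu])
  qed (use i in auto)
  finally show ?thesis by (simp add: mollifier_reflect_integral)
qed

lemma continuous_imp_locally_integrable:
  "continuous_on UNIV u \<Longrightarrow> locally_integrable u"
  unfolding locally_integrable_def using continuous_on_subset
  by (metis borel_integrable_compact compact_Icc set_integrable_def subset_UNIV)

lemma mollify_tendsto_continuous:
  fixes u :: "real \<Rightarrow> 'a::euclidean_space"
  assumes u: "continuous_on UNIV u"
  shows "(\<lambda>n. mollify n u x) \<longlonglongrightarrow> u x"
proof (rule LIMSEQ_I)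
  fix e :: real assume "e > 0"
  then obtain d where d: "d > 0" "\<And>y. dist y x < d \<Longrightarrow> dist (u y) (u x) < e / 2"
    using u[unfolded continuous_on_iff, rule_format, of x "e / 2"] by auto
  obtain N where N: "1 / real (Suc N) < d" using d(1) nat_approx_posE by blast
  show "\<exists>no. \<forall>n\<ge>no. norm (mollify n u x - u x) < e"
  proof (intro exI[of _ N] allI impI)
    fix n assume "n \<ge> N"
    then have "1 / real (Suc n) < d" using N
      by (smt (verit) frac_le of_nat_0_less_iff of_nat_mono Suc_le_mono zero_less_Suc)
    then have "norm (mollify n u x - u x) \<le> e / 2"
      using d(2) by (intro mollify_diff_le continuous_imp_locally_integrable u)
        (smt (verit) dist_norm dist_real_def dist_commute)
    then show "norm (mollify n u x - u x) < e" using \<open>e > 0\<close> by linarith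
  qed
qed

lemma mollify_bound:
  fixes u :: "real \<Rightarrow> 'a::euclidean_space"
  assumes u: "locally_integrable u" and "\<And>y. norm (u y) \<le> B"
  shows "norm (mollify n u x) \<le> B"
  using mollify_diff_le[OF u, of x n 0 B] assms(2) by simp

text \<open>Lebesgue measurability provides continuous functions converging off a negligible set;
  composing them with a retraction onto the ball of radius \<open>B\<close> restores the bound and
  keeps the limit.\<close>

lemma bounded_continuous_approx:
  fixes u :: "real \<Rightarrow> 'a::euclidean_space"
  assumes u: "u \<in> borel_measurable borel" and B: "\<And>x. norm (u x) \<le> B"
  obtains g where "\<And>m. continuous_on UNIV (g m)" "\<And>m x. norm (g m x) \<le> B"
    "AE x in lborel. (\<lambda>m. g m x) \<longlonglongrightarrow> u x"
proof -
  have B0: "0 \<le> B" using B[of 0] norm_ge_zero order_trans by blast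
  have "u measurable_on UNIV"
    by (intro lebesgue_measurable_imp_measurable_on measurable_completion) (use u in simp_all)
  then obtain N g where N: "negligible N" and g: "\<And>n. continuous_on UNIV (g n)"
    and lim: "\<And>x. x \<notin> N \<Longrightarrow> (\<lambda>n. g n x) \<longlonglongrightarrow> u x"
    unfolding measurable_on_def by auto
  \<comment> \<open>The radial retraction onto the ball of radius \<open>B\<close>, which fixes
    every value of \<open>u\<close>.\<close>
  define c where "c = (\<lambda>z::'a. ((B + 0) / max B (norm z)) *\<^sub>R z)"
  show ?thesis
  proof (cases "B = 0")
    case True
    then have "u x = 0" for x using B[of x] by simp
    then show ?thesis using that[of "\<lambda>m x. 0"] True by auto
  next
    case False
    then have Bp: "B > 0" using B0 by simp
    have cc: "continuous_on UNIV c" unfolding c_def using Bp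
      by (intro continuous_intros) (auto simp: max_def)
    have cB: "norm (c z) \<le> B" for z
      using Bp by (auto simp: c_def max_def field_simps)
    have cu: "c (u x) = u x" for x using B[of x] Bp by (simp add: c_def max_def)
    show ?thesis
    proof (rule that[of "\<lambda>m x. c (g m x)"])
      show "continuous_on UNIV (\<lambda>x. c (g m x))" for m
        by (rule continuous_on_compose2[OF cc g]) auto
      show "norm (c (g m x)) \<le> B" for m x by (rule cB)
      have "(\<lambda>m. c (g m x)) \<longlonglongrightarrow> u x" if "x \<notin> N" for x
        using continuous_on_tendsto_compose[OF cc lim[OF that]] cu by simp
      moreover have "AE x in lebesgue. x \<notin> N"
        using N by (simp add: negligible_iff_null_sets AE_not_in)
      ultimately have "AE x in lebesgue. (\<lambda>m. c (g m x)) \<longlonglongrightarrow> u x"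
        by (auto elim: eventually_mono)
      then show "AE x in lborel. (\<lambda>m. c (g m x)) \<longlonglongrightarrow> u x"
        by (simp add: AE_completion_iff)
    qed
  qed
qed

lemma L2_norm_tendsto_0_dominated:
  fixes u :: "nat \<Rightarrow> real \<Rightarrow> 'a::euclidean_space" and w :: "real \<Rightarrow> 'b::euclidean_space"
  assumes u: "\<And>n. u n \<in> borel_measurable borel" and w: "square_integrable w"
    and le: "\<And>n. AE x in lborel. norm (u n x) \<le> norm (w x)"
    and lim: "AE x in lborel. (\<lambda>n. u n x) \<longlonglongrightarrow> 0"
  shows "(\<lambda>n. L2_norm (u n)) \<longlonglongrightarrow> 0"
proof -
  note [measurable] = u square_integrable_measurable[OF w]
  have "(\<lambda>n. LINT x|lborel. (norm (u n x))\<^sup>2) \<longlonglongrightarrow> (LINT x::real|lborel. (norm (0::'a))\<^sup>2)"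
  proof (rule integral_dominated_convergence[where s="\<lambda>n x. (norm (u n x))\<^sup>2" and f="\<lambda>x. (norm (0::'a))\<^sup>2" and M=lborel and w="\<lambda>x. (norm (w x))\<^sup>2"])
    show "integrable lborel (\<lambda>x. (norm (w x))\<^sup>2)" using w by (simp add: square_integrable_def)
    show "AE x in lborel. (\<lambda>n. (norm (u n x))\<^sup>2) \<longlonglongrightarrow> (norm (0::'a))\<^sup>2"
      using lim by eventually_elim (intro tendsto_intros)
    show "AE x in lborel. norm ((norm (u n x))\<^sup>2) \<le> (norm (w x))\<^sup>2" for n
      using le[of n] by eventually_elim (simp add: power_mono)
  qed auto
  then have "(\<lambda>n. sqrt (LINT x|lborel. (norm (u n x))\<^sup>2)) \<longlonglongrightarrow> sqrt 0"
    by (intro tendsto_real_sqrt) simp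
  then show ?thesis by (simp add: L2_norm_def)
qed

lemma
  fixes u :: "real \<Rightarrow> 'a::euclidean_space"
  assumes u: "u \<in> borel_measurable borel" and B: "\<And>x. norm (u x) \<le> B * indicator {a..b} x"
  shows square_integrable_bounded_support: "square_integrable u"
    and square_integrable_indicator: "square_integrable (\<lambda>x. B * indicator {a..b} x :: real)"
proof -
  show s: "square_integrable (\<lambda>x. B * indicator {a..b} x :: real)"
    by (simp add: square_integrable_def power2_eq_square mult.assoc integrable_indicator_iff 
        emeasure_lborel_Icc_eq indicator_inter_arith[symmetric] mult.left_commute[of "indicator _ _"])
  show "square_integrable u"
    by (rule square_integrable_dominated[OF s u, of 1]) (use order_trans[OF B abs_ge_self] in auto)
qed

text \<open>On a bounded window \<open>u\<close> is L2-close to a continuous bounded function, whose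
  mollifications converge pointwise and boundedly; contraction of mollification handles the
  difference. Each of the three contributions is at most e/3.\<close>

lemma mollify_tendsto_bounded_support:
  fixes u :: "real \<Rightarrow> 'a::euclidean_space"
  assumes u: "u \<in> borel_measurable borel" and Bu: "\<And>x. norm (u x) \<le> B"
    and supp: "\<And>x. \<bar>x\<bar> > R \<Longrightarrow> u x = 0" and e: "e > 0"
  shows "\<forall>\<^sub>F n in sequentially. L2_norm (\<lambda>x. mollify n u x - u x) \<le> e"
proof -
  have B0: "0 \<le> B" using Bu[of 0] norm_ge_zero order_trans by blast
  obtain g where g: "\<And>m. continuous_on UNIV (g m)" "\<And>m x. norm (g m x) \<le> B"
    "AE x in lborel. (\<lambda>m. g m x) \<longlonglongrightarrow> u x"
    using bounded_continuous_approx[OF u Bu] by metis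
  note [measurable] = u borel_measurable_continuous_onI[OF g(1)]
  \<comment> \<open>Mollification spreads the support by at most 1, and the kernel at such a point
    sees one unit further: together the margin is 2.\<close>
  define S where "S = {-R-2..R+2}"
  define i where "i = (\<lambda>x. indicator S x :: real)"
  have [measurable]: "i \<in> borel_measurable borel" unfolding i_def S_def by simp
  have sqi: "square_integrable w" if "w \<in> borel_measurable borel" "\<And>x. norm (w x) \<le> c * i x" 
    for w :: "real \<Rightarrow> 'a" and c
    using square_integrable_bounded_support[OF that(1), of c] that(2) unfolding i_def S_def by blast
  have ds: "square_integrable (\<lambda>x. (2*B) * i x)"
    unfolding i_def S_def by (rule square_integrable_indicator[of "\<lambda>x. 0::real"]) (use B0 in auto)
  have bb: "norm (i x *\<^sub>R (p - q)) \<le> 2 * B * i x" if "norm p \<le> B" "norm q \<le> B" for p q :: 'a and x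
    using norm_triangle_ineq4[of p q] that by (auto simp: i_def indicator_def)
  have "(\<lambda>m. L2_norm (\<lambda>x. i x *\<^sub>R (u x - g m x))) \<longlonglongrightarrow> 0"
  proof (rule L2_norm_tendsto_0_dominated[OF _ ds])
    show "AE x in lborel. norm (i x *\<^sub>R (u x - g m x)) \<le> norm (2 * B * i x)" for m
      using bb[OF Bu g(2)] B0 by (auto simp: i_def)
    show "AE x in lborel. (\<lambda>m. i x *\<^sub>R (u x - g m x)) \<longlonglongrightarrow> 0"
      using g(3) by eventually_elim (auto intro!: tendsto_eq_intros)
  qed measurable
  then have "\<forall>\<^sub>F m in sequentially. L2_norm (\<lambda>x. i x *\<^sub>R (u x - g m x)) < e / 3"
    using e by (intro order_tendstoD) auto
  then obtain m where m: "L2_norm (\<lambda>x. i x *\<^sub>R (u x - g m x)) < e / 3"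
    using eventually_happens trivial_limit_sequentially by blast
  let ?w = "\<lambda>x. i x *\<^sub>R (u x - g m x)"
  have w: "square_integrable ?w" by (rule sqi[of _ "2*B"]) (use bb[OF Bu g(2)] in auto)
  have lg: "locally_integrable (g m)" by (rule continuous_imp_locally_integrable[OF g(1)])
  have lu: "locally_integrable u"
  proof (rule square_integrable_imp_locally_integrable, rule sqi[of _ B])
    show "norm (u x) \<le> B * i x" for x
      using supp[of x] Bu[of x] B0 by (cases "\<bar>x\<bar> > R") (auto simp: i_def S_def indicator_def)
  qed measurable
  have [measurable]: "mollify n (g m) \<in> borel_measurable borel" for n using lg by simp
  let ?p = "\<lambda>n x. i x *\<^sub>R (mollify n (g m) x - g m x)"
  have "(\<lambda>n. L2_norm (?p n)) \<longlonglongrightarrow> 0"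
  proof (rule L2_norm_tendsto_0_dominated[OF _ ds])
    show "AE x in lborel. norm (?p n x) \<le> norm (2 * B * i x)" for n
      using bb[OF mollify_bound[OF lg g(2)] g(2)] B0 by (auto simp: i_def)
    show "AE x in lborel. (\<lambda>n. ?p n x) \<longlonglongrightarrow> 0"
      using mollify_tendsto_continuous[OF g(1)[of m]] by (auto intro!: tendsto_eq_intros AE_I2)
  qed measurable
  then have "\<forall>\<^sub>F n in sequentially. L2_norm (?p n) < e / 3"
    using e by (intro order_tendstoD) auto
  then show ?thesis
  proof eventually_elim
    case (elim n)
    have pn: "square_integrable (?p n)" 
      by (rule sqi[of _ "2*B"]) (use bb[OF mollify_bound[OF lg g(2)] g(2)] in auto)
    note mw = square_integrable_mollify[OF w, of n]
    have [measurable]: "mollify n u \<in> borel_measurable borel" using lu by simp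
    \<comment> \<open>For |x| at most R + 1 the kernel sees only the window, so the cut-off is
      invisible; farther out both \<open>u\<close> and its mollification vanish.\<close>
    have le: "norm (mollify n u x - u x) \<le> norm (mollify n ?w x + ?p n x - ?w x)" for x
    proof (cases "\<bar>x\<bar> \<le> R + 1")
      case True
      have "mollify n ?w x = mollify n (\<lambda>x. u x - g m x) x"
        unfolding conv_def
      proof (rule Bochner_Integration.integral_cong[OF refl])
        fix y
        have "\<bar>x - y\<bar> > 1" if "y \<notin> S" using True that by (auto simp: S_def)
        then show "mollifier n (x - y) *\<^sub>R ?w y = mollifier n (x - y) *\<^sub>R (u y - g m y)"
          using mollifier_support_1[of "x - y" n] by (cases "y \<in> S") (auto simp: i_def)
      qed
      also have "\<dots> = mollify n u x - mollify n (g m) x"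
        using conv_diff[OF mollifier_test lu lg] by simp
      finally show ?thesis using True by (simp add: i_def S_def indicator_def abs_le_iff)
    next
      case False
      have "mollify n u x = (LINT y::real|lborel. 0)" unfolding conv_def
      proof (rule Bochner_Integration.integral_cong[OF refl])
        fix y
        have "\<bar>x - y\<bar> > 1" if "\<bar>y\<bar> \<le> R" using False that by auto
        then show "mollifier n (x - y) *\<^sub>R u y = 0"
          using mollifier_support_1[of "x - y" n] supp[of y] by (cases "\<bar>y\<bar> > R") auto
      qed
      then show ?thesis using False supp[of x] by simp
    qed
    have "L2_norm (\<lambda>x. mollify n u x - u x) \<le> 1 * L2_norm (\<lambda>x. mollify n ?w x + ?p n x - ?w x)"
      using le square_integrable_diff[OF square_integrable_add[OF mw pn] w]
      by (intro L2_norm_dominated) auto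
    also have "\<dots> \<le> L2_norm (mollify n ?w) + L2_norm (?p n) + L2_norm ?w"
      using L2_norm_diff_le[OF square_integrable_add[OF mw pn] w] L2_norm_triangle[OF mw pn] by simp
    also have "\<dots> \<le> e" using L2_norm_mollify[OF w, of n] m elim by linarith
    finally show ?case .
  qed
qed

lemma square_integrable_truncate:
  fixes u :: "real \<Rightarrow> 'a::euclidean_space"
  assumes u: "square_integrable u" and e: "e > 0"
  obtains w B where "w \<in> borel_measurable borel" "\<And>x. norm (w x) \<le> B" "\<And>x. \<bar>x\<bar> > B \<Longrightarrow> w x = 0"
    "L2_norm (\<lambda>x. u x - w x) < e" "square_integrable w"
proof -
  note [measurable] = square_integrable_measurable[OF u]
  define w where "w = (\<lambda>n x. if \<bar>x\<bar> \<le> real n \<and> norm (u x) \<le> real n then u x else 0)"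
  have [measurable]: "w n \<in> borel_measurable borel" for n unfolding w_def by measurable
  have "(\<lambda>n. L2_norm (\<lambda>x. u x - w n x)) \<longlonglongrightarrow> 0"
  proof (rule L2_norm_tendsto_0_dominated[OF _ u])
    show "AE x in lborel. norm (u x - w n x) \<le> norm (u x)" for n by (auto simp: w_def)
    have "(\<lambda>n. u x - w n x) \<longlonglongrightarrow> 0" for x
    proof (rule tendsto_eventually)
      show "\<forall>\<^sub>F n in sequentially. u x - w n x = 0"
        using eventually_ge_at_top[of "nat \<lceil>max \<bar>x\<bar> (norm (u x))\<rceil>"]
        by eventually_elim (auto simp: w_def nat_le_iff ceiling_le_iff)
    qed
    then show "AE x in lborel. (\<lambda>n. u x - w n x) \<longlonglongrightarrow> 0" by simp
  qed measurable
  then have "\<forall>\<^sub>F n in sequentially. L2_norm (\<lambda>x. u x - w n x) < e"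
    using e by (intro order_tendstoD) auto
  then obtain n where n: "L2_norm (\<lambda>x. u x - w n x) < e"
    using eventually_happens trivial_limit_sequentially by blast
  show ?thesis
  proof (rule that[of "w n" "real n"])
    show "square_integrable (w n)" by (rule square_integrable_dominated[OF u, of _ 1]) (auto simp: w_def)
  qed (use n in \<open>auto simp: w_def\<close>)
qed

text \<open>Density: truncation makes the function bounded with bounded support, and mollification
  does not enlarge the L2 norm of what was cut away.\<close>

lemma mollify_tendsto_L2:
  fixes u :: "real \<Rightarrow> 'a::euclidean_space"
  assumes u: "square_integrable u"
  shows "(\<lambda>n. L2_norm (\<lambda>x. mollify n u x - u x)) \<longlonglongrightarrow> 0"
proof (rule LIMSEQ_I)
  fix e :: real assume e: "e > 0"
  obtain w B where w: "w \<in> borel_measurable borel" "\<And>x. norm (w x) \<le> B" "\<And>x. \<bar>x\<bar> > B \<Longrightarrow> w x = 0"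
    "L2_norm (\<lambda>x. u x - w x) < e / 4" "square_integrable w"
    using square_integrable_truncate[OF u, of "e/4"] e by auto
  have "\<forall>\<^sub>F n in sequentially. L2_norm (\<lambda>x. mollify n w x - w x) \<le> e / 4"
    using mollify_tendsto_bounded_support[OF w(1-3), where e="e/4"] e by simp
  then obtain N where N: "\<And>n. n \<ge> N \<Longrightarrow> L2_norm (\<lambda>x. mollify n w x - w x) \<le> e / 4"
    unfolding eventually_sequentially by blast
  show "\<exists>no. \<forall>n\<ge>no. norm (L2_norm (\<lambda>x. mollify n u x - u x) - 0) < e"
  proof (intro exI[of _ N] allI impI)
    fix n assume n: "n \<ge> N"
    note d = square_integrable_diff[OF u w(5)]
    note md = square_integrable_mollify[OF d, of n]
    note dw = square_integrable_diff[OF square_integrable_mollify[OF w(5), of n] w(5)]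
    have "mollify n u x - u x = (mollify n (\<lambda>x. u x - w x) x + (mollify n w x - w x)) - (u x - w x)" for x
      using conv_diff[OF mollifier_test, of u w n] u w(5) 
      by (simp add: square_integrable_imp_locally_integrable)
    then have "L2_norm (\<lambda>x. mollify n u x - u x) 
        \<le> L2_norm (\<lambda>x. mollify n (\<lambda>x. u x - w x) x + (mollify n w x - w x)) + L2_norm (\<lambda>x. u x - w x)"
      using L2_norm_diff_le[OF square_integrable_add[OF md dw] d] by simp
    also have "\<dots> \<le> L2_norm (\<lambda>x. u x - w x) + e / 4 + L2_norm (\<lambda>x. u x - w x)"
      using L2_norm_triangle[OF md dw] L2_norm_mollify[OF d, of n] N[OF n] by linarith
    also have "\<dots> < e" using w(4) e by linarith
    finally show "norm (L2_norm (\<lambda>x. mollify n u x - u x) - 0) < e" by simp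
  qed
qed

section \<open>Weak derivatives\<close>

lemma locally_integrable_measurable [measurable_dest]:
  assumes "locally_integrable u"
  shows "u \<in> borel_measurable borel"
proof (rule borel_measurable_LIMSEQ_metric)
  show "(\<lambda>x. indicator {-real n..real n} x *\<^sub>R u x) \<in> borel_measurable borel" for n
    using assms borel_measurable_integrable
    unfolding locally_integrable_def set_integrable_def by fastforce
  fix x
  show "(\<lambda>n. indicator {-real n..real n} x *\<^sub>R u x) \<longlonglongrightarrow> u x"
  proof (rule tendsto_eventually)
    show "\<forall>\<^sub>F n in sequentially. indicator {-real n..real n} x *\<^sub>R u x = u x"
      using eventually_ge_at_top[of "nat \<lceil>\<bar>x\<bar>\<rceil>"]
      by eventually_elim (auto simp: nat_le_iff ceiling_le_iff indicator_def abs_le_iff)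
  qed
qed

lemma locally_integrable_norm_indicator:
  "locally_integrable u \<Longrightarrow> integrable lborel (\<lambda>x. indicator {a..b} x * norm (u x))"
  using integrable_norm[of lborel "\<lambda>x. indicator {a..b} x *\<^sub>R u x"]
  by (simp add: locally_integrable_def set_integrable_def)

lemma
  assumes "locally_integrable u" "locally_integrable w"
  shows locally_integrable_add: "locally_integrable (\<lambda>x. u x + w x)"
    and locally_integrable_diff: "locally_integrable (\<lambda>x. u x - w x)"
  using assms by (auto simp: locally_integrable_def)

text \<open>The fundamental lemma of the calculus of variations. For each direction \<open>e\<close>
  the sign of the component along \<open>e\<close>, times a cut-off, is approximated by continuous
  functions and these by mollifications, which are test functions. The limit says that the integral
  of the cut-off times the absolute component is zero.\<close>

lemma AE_zero_if_test_integrals_zero: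
  fixes g :: "real \<Rightarrow> 'a::euclidean_space"
  assumes g: "locally_integrable g"
    and zero: "\<And>\<eta>. test_function \<eta> \<Longrightarrow> (LINT x|lborel. \<eta> x *\<^sub>R g x) = 0"
  shows "AE x in lborel. g x = 0"
proof -
  note [measurable] = locally_integrable_measurable[OF g]
  have comp: "AE x in lborel. g x \<bullet> e = 0" for e
  proof -
    \<comment> \<open>The ideal multiplier: pairing with it produces the absolute value of the
      component.\<close>
    define b where "b = (\<lambda>x. sgn (g x \<bullet> e))"
    have bm: "b \<in> borel_measurable borel" unfolding b_def by measurable
    have "norm (b x) \<le> 1" for x by (simp add: b_def sgn_real_def)
    then obtain h where h: "\<And>m. continuous_on UNIV (h m)" "\<And>m x. norm (h m x) \<le> 1"
      "AE x in lborel. (\<lambda>m. h m x) \<longlonglongrightarrow> b x"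
      using bounded_continuous_approx[OF bm] by metis
    have cut0: "AE x in lborel. \<bar>x\<bar> < real N \<longrightarrow> g x \<bullet> e = 0" for N
    proof -
      \<comment> \<open>A continuous cut-off that is positive exactly on |x| < N, so nothing inside
        the interval is lost.\<close>
      define c where "c = (\<lambda>x. max 0 (min 1 (real N - \<bar>x\<bar>)))"
      have cc: "continuous_on UNIV c" unfolding c_def by (intro continuous_intros)
      have c: "0 \<le> c x" "c x \<le> 1" "\<bar>x\<bar> > real N \<Longrightarrow> c x = 0" for x by (auto simp: c_def)
      note [measurable] = borel_measurable_continuous_onI[OF cc] borel_measurable_continuous_onI[OF h(1)]
      define H where "H = (\<lambda>m x. c x * h m x)"
      have Hc: "continuous_on UNIV (H m)" for m unfolding H_def by (intro continuous_intros cc h)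
      note [measurable] = borel_measurable_continuous_onI[OF Hc]
      have lH: "locally_integrable (H m)" for m by (rule continuous_imp_locally_integrable[OF Hc])
      have HB: "norm (H m x) \<le> 1" for m x
        using c[of x] h(2)[of m x] mult_mono[of "c x" 1 "\<bar>h m x\<bar>" 1] by (auto simp: H_def abs_mult)
      have H0: "\<bar>x\<bar> > real N \<Longrightarrow> H m x = 0" for m x by (simp add: H_def c)
      have M0: "mollify n (H m) x = 0" if "\<bar>x\<bar> > real N + 1" for n m x
      proof -
        have "mollify n (H m) x = (LINT y::real|lborel. 0)" unfolding conv_def
        proof (rule Bochner_Integration.integral_cong[OF refl])
          fix y
          have "\<bar>x - y\<bar> > 1" if "\<bar>y\<bar> \<le> real N" using \<open>\<bar>x\<bar> > real N + 1\<close> that by auto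
          then show "mollifier n (x - y) *\<^sub>R H m y = 0"
            using mollifier_support_1[of "x - y" n] H0[of y m] by (cases "\<bar>y\<bar> > real N") auto
        qed
        then show ?thesis by simp
      qed
      have t: "test_function (mollify n (H m))" for n m
        by (rule test_functionI[of _ "real N + 1"])
           (use M0 diffk_conv[OF mollifier_test lH] in \<open>auto simp: smooth_iff_diffk\<close>)
      let ?d = "\<lambda>x. indicator {-(real N + 1)..real N + 1} x * norm (g x)"
      have d: "integrable lborel ?d" by (rule locally_integrable_norm_indicator[OF g])
      have dom: "norm (p *\<^sub>R g x) \<le> ?d x" if "norm p \<le> 1" "\<bar>x\<bar> > real N + 1 \<Longrightarrow> p = 0" for p :: real and x
        using that mult_right_mono[of "norm p" 1 "norm (g x)"] 
        by (cases "\<bar>x\<bar> > real N + 1") (auto simp: indicator_def abs_le_iff)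
      have zH: "(LINT x|lborel. H m x *\<^sub>R g x) = 0" for m
      proof -
        have "(\<lambda>n. LINT x|lborel. mollify n (H m) x *\<^sub>R g x) \<longlonglongrightarrow> (LINT x|lborel. H m x *\<^sub>R g x)"
        proof (rule integral_dominated_convergence[where w="?d"])
          show "AE x in lborel. (\<lambda>n. mollify n (H m) x *\<^sub>R g x) \<longlonglongrightarrow> H m x *\<^sub>R g x"
            using mollify_tendsto_continuous[OF Hc] by (auto intro!: tendsto_intros)
          show "AE x in lborel. norm (mollify n (H m) x *\<^sub>R g x) \<le> ?d x" for n
            using mollify_bound[OF lH HB] M0 by (intro AE_I2 dom) auto
          show "(\<lambda>x. mollify n (H m) x *\<^sub>R g x) \<in> borel_measurable lborel" for n
            using conv_measurable[OF mollifier_test lH] by simp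
        qed (use d in auto)
        then show ?thesis using zero[OF t] by (simp add: LIMSEQ_const_iff)
      qed
      have "(\<lambda>m. LINT x|lborel. H m x *\<^sub>R g x) \<longlonglongrightarrow> (LINT x|lborel. (c x * b x) *\<^sub>R g x)"
      proof (rule integral_dominated_convergence[where w="?d"])
        show "AE x in lborel. (\<lambda>m. H m x *\<^sub>R g x) \<longlonglongrightarrow> (c x * b x) *\<^sub>R g x"
          using h(3) unfolding H_def by eventually_elim (intro tendsto_intros)
        show "AE x in lborel. norm (H m x *\<^sub>R g x) \<le> ?d x" for m
          using HB H0 by (intro AE_I2 dom) auto
        show "(\<lambda>x. (c x * b x) *\<^sub>R g x) \<in> borel_measurable lborel" using bm by simp
      qed (use d in auto)
      then have z: "(LINT x|lborel. (c x * b x) *\<^sub>R g x) = 0"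
        using zH by (simp add: LIMSEQ_const_iff)
      have i: "integrable lborel (\<lambda>x. (c x * b x) *\<^sub>R g x)"
      proof (rule Bochner_Integration.integrable_bound[OF d])
        have "norm (c x * b x) \<le> 1" for x
          using c[of x] \<open>\<And>x. norm (b x) \<le> 1\<close>[of x] mult_mono[of "c x" 1 "\<bar>b x\<bar>" 1] by (auto simp: abs_mult)
        then show "AE x in lborel. norm ((c x * b x) *\<^sub>R g x) \<le> norm (?d x)"
          using dom[of "c _ * b _"] c(3) by (intro AE_I2) (auto intro!: order_trans[OF dom abs_ge_self])
      qed (use bm in simp)
      have eq: "((c x * b x) *\<^sub>R g x) \<bullet> e = c x * \<bar>g x \<bullet> e\<bar>" for x
        by (simp add: b_def abs_sgn mult_ac)
      have "(LINT x|lborel. c x * \<bar>g x \<bullet> e\<bar>) = (LINT x|lborel. (c x * b x) *\<^sub>R g x) \<bullet> e"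
        using integral_inner_left[OF i, of e] by (simp only: eq)
      then have "(LINT x|lborel. c x * \<bar>g x \<bullet> e\<bar>) = 0" using z by simp
      moreover have "integrable lborel (\<lambda>x. c x * \<bar>g x \<bullet> e\<bar>)"
        using integrable_inner_left[OF i, of e] by (simp only: eq)
      ultimately have "AE x in lborel. c x * \<bar>g x \<bullet> e\<bar> = 0"
        using integral_nonneg_eq_0_iff_AE[of lborel "\<lambda>x. c x * \<bar>g x \<bullet> e\<bar>"] c by auto
      then show ?thesis by eventually_elim (auto simp: c_def max_def min_def split: if_splits)
    qed
    have "AE x in lborel. \<forall>N. \<bar>x\<bar> < real N \<longrightarrow> g x \<bullet> e = 0"
      unfolding AE_all_countable using cut0 by blast
    then show ?thesis
      by eventually_elim (meson reals_Archimedean2)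
  qed
  have "AE x in lborel. \<forall>e\<in>Basis. g x \<bullet> e = 0"
    using comp by (intro AE_finite_allI) auto
  then show ?thesis by eventually_elim (simp only: euclidean_all_zero_iff)
qed

lemma has_weak_deriv_unique:
  assumes "has_weak_deriv j u g" "has_weak_deriv j u h"
  shows "AE x in lborel. g x = h x"
proof -
  have l: "locally_integrable g" "locally_integrable h" using assms by (auto simp: has_weak_deriv_def)
  have "AE x in lborel. g x - h x = 0"
  proof (rule AE_zero_if_test_integrals_zero)
    show "locally_integrable (\<lambda>x. g x - h x)" using l by (rule locally_integrable_diff)
    fix \<eta> assume t: "test_function \<eta>"
    have "(-1) ^ j *\<^sub>R (LINT x|lborel. \<eta> x *\<^sub>R g x) = ((-1) ^ j :: real) *\<^sub>R (LINT x|lborel. \<eta> x *\<^sub>R h x)"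
      using assms t unfolding has_weak_deriv_def by metis
    then show "(LINT x|lborel. \<eta> x *\<^sub>R (g x - h x)) = 0"
      using l[THEN test_function_integrable[OF t]] by (simp add: scaleR_diff_right)
  qed
  then show ?thesis by eventually_elim simp
qed

lemma integral_test_mult_derivative:
  fixes u :: "real \<Rightarrow> 'a::euclidean_space"
  assumes t: "test_function \<eta>" and u: "diffk 1 u"
  shows "(LINT x|lborel. vderiv \<eta> x *\<^sub>R u x) = - (LINT x|lborel. \<eta> x *\<^sub>R vderiv u x)"
proof -
  have t1: "test_function (vderiv \<eta>)" using test_function_nderiv[OF t, of 1] by simp
  obtain R where R: "R > 0" "\<And>j x. \<bar>x\<bar> > R \<Longrightarrow> nderiv j \<eta> x = 0"
    using test_function_support[OF t] by metis
  have cu: "continuous_on UNIV u" "continuous_on UNIV (vderiv u)"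
    using u diffk_imp_continuous by fastforce+
  note i1 = test_function_integrable[OF t1 continuous_imp_locally_integrable[OF cu(1)]]
  note i2 = test_function_integrable[OF t continuous_imp_locally_integrable[OF cu(2)]]
  let ?g = "\<lambda>x. \<eta> x *\<^sub>R vderiv u x + vderiv \<eta> x *\<^sub>R u x"
  have d: "((\<lambda>x. \<eta> x *\<^sub>R u x) has_vector_derivative ?g x) (at x within {-R-1..R+1})" for x
    using has_vector_derivative_scaleR[OF test_function_has_derivative[OF t, of x], of u "vderiv u x"]
      diffk_has_vector_derivative[OF u, of 0 x] has_vector_derivative_at_within by auto
  have c: "continuous_on {-R-1..R+1} ?g"
    by (intro continuous_intros continuous_on_subset[OF test_function_continuous[OF t]]
       continuous_on_subset[OF test_function_continuous[OF t1]] cu[THEN continuous_on_subset]) auto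
  have "(LINT x|lborel. ?g x) = (LINT x|lborel. indicator {-R-1..R+1} x *\<^sub>R ?g x)"
    using R(2)[of _ 0] R(2)[of _ 1] 
    by (intro Bochner_Integration.integral_cong refl) (auto simp: indicator_def)
  also have "\<dots> = \<eta> (R+1) *\<^sub>R u (R+1) - \<eta> (-R-1) *\<^sub>R u (-R-1)"
    using integral_FTC_Icc[of "-R-1" "R+1" "\<lambda>x. \<eta> x *\<^sub>R u x" ?g] d c R(1) by auto
  also have "\<dots> = 0" using R(1) R(2)[of "R+1" 0] R(2)[of "-R-1" 0] by simp
  finally show ?thesis using i1 i2 by (simp add: add_eq_0_iff)
qed

lemma has_weak_deriv_nderiv:
  fixes u :: "real \<Rightarrow> 'a::euclidean_space"
  assumes u: "diffk j u"
  shows "has_weak_deriv j u (nderiv j u)"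
proof -
  have "(LINT x|lborel. nderiv i \<eta> x *\<^sub>R u x) = (-1) ^ i *\<^sub>R (LINT x|lborel. \<eta> x *\<^sub>R nderiv i u x)"
    if "i \<le> j" "test_function \<eta>" for i \<eta>
    using that
  proof (induction i arbitrary: \<eta>)
    case 0 then show ?case by simp
  next
    case (Suc i)
    have t1: "test_function (vderiv \<eta>)" using test_function_nderiv[OF Suc.prems(2), of 1] by simp
    have "(LINT x|lborel. nderiv (Suc i) \<eta> x *\<^sub>R u x) = (LINT x|lborel. nderiv i (vderiv \<eta>) x *\<^sub>R u x)"
      by (simp only: nderiv_Suc)
    also have "\<dots> = (-1) ^ i *\<^sub>R (LINT x|lborel. vderiv \<eta> x *\<^sub>R nderiv i u x)"
      using Suc.IH[OF _ t1] Suc.prems by simp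
    also have "(LINT x|lborel. vderiv \<eta> x *\<^sub>R nderiv i u x) = - (LINT x|lborel. \<eta> x *\<^sub>R nderiv (Suc i) u x)"
      using integral_test_mult_derivative[OF Suc.prems(2), of "nderiv i u"] diffk_nderiv[OF u, of 1 i] Suc.prems by simp
    finally show ?case by simp
  qed
  then show ?thesis unfolding has_weak_deriv_def
    using diffk_continuous_nderiv[OF u] diffk_imp_continuous[OF u] continuous_imp_locally_integrable by blast
qed

lemma conv_nderiv:
  fixes u :: "real \<Rightarrow> 'a::euclidean_space"
  assumes "test_function \<eta>" "diffk j u"
  shows "conv (nderiv j \<eta>) u = conv \<eta> (nderiv j u)"
  by (rule conv_nderiv_weak[OF assms(1) has_weak_deriv_nderiv[OF assms(2)]])


section \<open>Sobolev norms\<close>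

text \<open>\<open>weak_deriv\<close> chooses an arbitrary weak derivative, whereas membership in
  the Sobolev space speaks of some square integrable one; uniqueness up to null sets transfers
  square integrability.\<close>

lemma
  assumes "sobolev k u" "j \<le> k"
  shows sobolev_has_weak_deriv: "has_weak_deriv j u (weak_deriv j u)"
    and sobolev_square_integrable: "square_integrable (weak_deriv j u)"
proof -
  obtain g where g: "has_weak_deriv j u g" "square_integrable g"
    using assms by (auto simp: sobolev_def)
  from g(1) show w: "has_weak_deriv j u (weak_deriv j u)"
    unfolding weak_deriv_def by (rule someI[of "has_weak_deriv j u"])
  have "weak_deriv j u \<in> borel_measurable borel"
    using w locally_integrable_measurable by (auto simp: has_weak_deriv_def)
  then show "square_integrable (weak_deriv j u)"
    using has_weak_deriv_unique[OF w g(1)] by (rule square_integrable_cong_AE[OF g(2)])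
qed

lemma L2_weak_deriv_eq:
  assumes "sobolev k u" "j \<le> k" "has_weak_deriv j u g"
  shows "L2_norm (weak_deriv j u) = L2_norm g" "AE x in lborel. weak_deriv j u x = g x"
proof -
  note w = sobolev_has_weak_deriv[OF assms(1,2)]
  show "AE x in lborel. weak_deriv j u x = g x" by (rule has_weak_deriv_unique[OF w assms(3)])
  then show "L2_norm (weak_deriv j u) = L2_norm g"
    using w assms(3) by (intro L2_norm_cong_AE locally_integrable_measurable) (auto simp: has_weak_deriv_def)
qed

lemma has_weak_deriv_0: "locally_integrable u \<Longrightarrow> has_weak_deriv 0 u u"
  by (simp add: has_weak_deriv_def)

lemma L2_weak_deriv_0:
  assumes "sobolev k u"
  shows "L2_norm (weak_deriv 0 u) = L2_norm u" "AE x in lborel. weak_deriv 0 u x = u x"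
  using L2_weak_deriv_eq[OF assms le0 has_weak_deriv_0] assms
  by (auto simp: sobolev_def square_integrable_imp_locally_integrable)

lemma has_weak_deriv_diff:
  assumes "has_weak_deriv j u g" "has_weak_deriv j w h"
  shows "has_weak_deriv j (\<lambda>x. u x - w x) (\<lambda>x. g x - h x)"
  unfolding has_weak_deriv_def
proof (intro conjI allI impI)
  have l: "locally_integrable u" "locally_integrable w" "locally_integrable g" "locally_integrable h"
    using assms by (auto simp: has_weak_deriv_def)
  show "locally_integrable (\<lambda>x. u x - w x)" "locally_integrable (\<lambda>x. g x - h x)"
    using l by (auto intro: locally_integrable_diff)
  fix \<eta> assume t: "test_function \<eta>"
  have "(LINT x|lborel. nderiv j \<eta> x *\<^sub>R u x) = (-1) ^ j *\<^sub>R (LINT x|lborel. \<eta> x *\<^sub>R g x)"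
     "(LINT x|lborel. nderiv j \<eta> x *\<^sub>R w x) = (-1) ^ j *\<^sub>R (LINT x|lborel. \<eta> x *\<^sub>R h x)"
    using assms t by (auto simp: has_weak_deriv_def)
  then show "(LINT x|lborel. nderiv j \<eta> x *\<^sub>R (u x - w x)) = (-1) ^ j *\<^sub>R (LINT x|lborel. \<eta> x *\<^sub>R (g x - h x))"
    using l[THEN test_function_integrable[OF t]] l[THEN test_function_integrable[OF test_function_nderiv[OF t, of j]]]
    by (simp add: scaleR_diff_right)
qed

lemma
  assumes "sobolev k u" "sobolev k w"
  shows sobolev_diff: "sobolev k (\<lambda>x. u x - w x)"
    and weak_deriv_diff: "j \<le> k \<Longrightarrow> AE x in lborel. weak_deriv j (\<lambda>x. u x - w x) x = weak_deriv j u x - weak_deriv j w x"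
proof -
  have h: "has_weak_deriv j (\<lambda>x. u x - w x) (\<lambda>x. weak_deriv j u x - weak_deriv j w x)" if "j \<le> k" for j
    using assms that by (intro has_weak_deriv_diff sobolev_has_weak_deriv)
  show s: "sobolev k (\<lambda>x. u x - w x)"
    using h assms square_integrable_diff sobolev_square_integrable unfolding sobolev_def by metis
  show "j \<le> k \<Longrightarrow> AE x in lborel. weak_deriv j (\<lambda>x. u x - w x) x = weak_deriv j u x - weak_deriv j w x"
    using L2_weak_deriv_eq(2)[OF s _ h] .
qed

lemma sobolev_norm_nonneg: "0 \<le> sobolev_norm k u"
  by (simp add: sobolev_norm_def sum_nonneg)

lemma sobolev_norm_sq: "(sobolev_norm k u)\<^sup>2 = (\<Sum>j\<le>k. (L2_norm (weak_deriv j u))\<^sup>2)"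
  by (simp add: sobolev_norm_def sum_nonneg)

lemma L2_le_sobolev_norm: "j \<le> k \<Longrightarrow> L2_norm (weak_deriv j u) \<le> sobolev_norm k u"
proof -
  assume "j \<le> k"
  then have "(L2_norm (weak_deriv j u))\<^sup>2 \<le> (sobolev_norm k u)\<^sup>2"
    unfolding sobolev_norm_sq by (intro member_le_sum) auto
  then show ?thesis using sobolev_norm_nonneg by (rule power2_le_imp_le)
qed

lemma L2_weak_deriv_diff:
  assumes "sobolev k u" "sobolev k w" "j \<le> k"
  shows "L2_norm (\<lambda>x. weak_deriv j u x - weak_deriv j w x) = L2_norm (weak_deriv j (\<lambda>x. u x - w x))"
  using weak_deriv_diff[OF assms] sobolev_square_integrable[OF assms(1,3)] sobolev_square_integrable[OF assms(2,3)]
    sobolev_square_integrable[OF sobolev_diff[OF assms(1,2)] assms(3)]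
  by (intro L2_norm_cong_AE) (auto intro: square_integrable_measurable elim: eventually_mono)

lemma continuous_in_sobolev_weak_deriv:
  assumes "continuous_in_sobolev k I u" "s \<in> I" "j \<le> k"
  shows "((\<lambda>r. L2_norm (\<lambda>x. weak_deriv j (u r) x - weak_deriv j (u s) x)) \<longlongrightarrow> 0) (at s within I)"
proof (rule Lim_null_comparison)
  have "L2_norm (\<lambda>x. weak_deriv j (u r) x - weak_deriv j (u s) x) \<le> sobolev_norm k (\<lambda>x. u r x - u s x)" if "r \<in> I" for r
    using L2_weak_deriv_diff[of k "u r" "u s" j] L2_le_sobolev_norm[of j k "\<lambda>x. u r x - u s x"] assms that
    by (auto simp: continuous_in_sobolev_def)
  then show "\<forall>\<^sub>F r in at s within I. norm (L2_norm (\<lambda>x. weak_deriv j (u r) x - weak_deriv j (u s) x)) \<le> sobolev_norm k (\<lambda>x. u r x - u s x)"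
    by (auto simp: eventually_at_filter)
  show "((\<lambda>r. sobolev_norm k (\<lambda>x. u r x - u s x)) \<longlongrightarrow> 0) (at s within I)"
    using assms by (simp add: continuous_in_sobolev_def)
qed

lemma L2_norm_abs_diff_le:
  assumes "square_integrable u" "square_integrable w"
  shows "\<bar>L2_norm u - L2_norm w\<bar> \<le> L2_norm (\<lambda>x. u x - w x)"
  using L2_norm_le_diff[OF assms] L2_norm_le_diff[OF assms(2,1)] L2_norm_commute[of u w] by linarith

definition L2_continuous_on :: "real set \<Rightarrow> (real \<Rightarrow> real \<Rightarrow> 'a::euclidean_space) \<Rightarrow> bool" where
  "L2_continuous_on I u \<longleftrightarrow> (\<forall>s\<in>I. square_integrable (u s) \<and>
     ((\<lambda>r. L2_norm (\<lambda>x. u r x - u s x)) \<longlongrightarrow> 0) (at s within I))"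

lemma L2_continuous_on_imp_continuous_norm:
  assumes "L2_continuous_on I u"
  shows "continuous_on I (\<lambda>s. L2_norm (u s))"
  unfolding continuous_on_def
proof
  fix s assume s: "s \<in> I"
  show "((\<lambda>s. L2_norm (u s)) \<longlongrightarrow> L2_norm (u s)) (at s within I)"
  proof (rule tendstoI, unfold dist_real_def, rule eventually_mono)
    fix e :: real assume "e > 0"
    moreover have "((\<lambda>r. L2_norm (\<lambda>x. u r x - u s x)) \<longlongrightarrow> 0) (at s within I)"
      using assms s by (simp add: L2_continuous_on_def)
    ultimately have "\<forall>\<^sub>F r in at s within I. L2_norm (\<lambda>x. u r x - u s x) < e"
      by (intro order_tendstoD(2))
    moreover have "\<forall>\<^sub>F r in at s within I. r \<in> I" by (simp add: eventually_at_filter)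
    ultimately show "\<forall>\<^sub>F r in at s within I. r \<in> I \<and> L2_norm (\<lambda>x. u r x - u s x) < e"
      by (simp add: eventually_conj_iff)
  next
    fix e r assume "r \<in> I \<and> L2_norm (\<lambda>x. u r x - u s x) < e"
    then show "\<bar>L2_norm (u r) - L2_norm (u s)\<bar> < e"
      using L2_norm_abs_diff_le[of "u r" "u s"] assms s unfolding L2_continuous_on_def by fastforce
  qed
qed

lemma L2_continuous_on_weak_deriv:
  assumes "continuous_in_sobolev k I u" "j \<le> k"
  shows "L2_continuous_on I (\<lambda>s. weak_deriv j (u s))"
  unfolding L2_continuous_on_def
proof (intro ballI conjI)
  fix s assume s: "s \<in> I"
  then show "square_integrable (weak_deriv j (u s))"
    using assms by (intro sobolev_square_integrable[of k]) (auto simp: continuous_in_sobolev_def)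
  show "((\<lambda>r. L2_norm (\<lambda>x. weak_deriv j (u r) x - weak_deriv j (u s) x)) \<longlongrightarrow> 0) (at s within I)"
    by (rule continuous_in_sobolev_weak_deriv[OF assms(1) s assms(2)])
qed

lemma L2_continuous_on_cong_AE:
  assumes "L2_continuous_on I u" "\<And>s. s \<in> I \<Longrightarrow> AE x in lborel. w s x = u s x"
    "\<And>s. s \<in> I \<Longrightarrow> w s \<in> borel_measurable borel"
  shows "L2_continuous_on I w"
  unfolding L2_continuous_on_def
proof (intro ballI conjI)
  have u: "square_integrable (u s)" if "s \<in> I" for s using assms(1) that by (simp add: L2_continuous_on_def)
  fix s assume s: "s \<in> I"
  show "square_integrable (w s)" using square_integrable_cong_AE[OF u assms(3,2)] s by blast
  have "L2_norm (\<lambda>x. w r x - w s x) = L2_norm (\<lambda>x. u r x - u s x)" if "r \<in> I" for r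
  proof (rule L2_norm_cong_AE)
    show "AE x in lborel. w r x - w s x = u r x - u s x"
      using assms(2)[OF s] assms(2)[OF that] by eventually_elim simp
  qed (use assms(3) u s that square_integrable_measurable in \<open>auto intro!: borel_measurable_diff\<close>)
  then show "((\<lambda>r. L2_norm (\<lambda>x. w r x - w s x)) \<longlongrightarrow> 0) (at s within I)"
    using assms(1) s tendsto_cong[of "\<lambda>r. L2_norm (\<lambda>x. w r x - w s x)" "\<lambda>r. L2_norm (\<lambda>x. u r x - u s x)" "at s within I" 0]
    by (auto simp: L2_continuous_on_def eventually_at_filter)
qed

lemma continuous_in_sobolev_L2:
  assumes "continuous_in_sobolev k I u"
  shows "L2_continuous_on I u"
proof (rule L2_continuous_on_cong_AE[OF L2_continuous_on_weak_deriv[OF assms le0]])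
  fix s assume "s \<in> I"
  then have s: "sobolev k (u s)" using assms by (simp add: continuous_in_sobolev_def)
  show "AE x in lborel. u s x = weak_deriv 0 (u s) x"
    using L2_weak_deriv_0(2)[OF s] by eventually_elim simp
  show "u s \<in> borel_measurable borel" using s by (auto simp: sobolev_def intro: square_integrable_measurable)
qed

lemma continuous_on_sobolev_norm_sq:
  assumes "continuous_in_sobolev k I u"
  shows "continuous_on I (\<lambda>s. (sobolev_norm k (u s))\<^sup>2)"
  unfolding sobolev_norm_sq using assms
  by (intro continuous_intros L2_continuous_on_imp_continuous_norm L2_continuous_on_weak_deriv) auto

text \<open>The phase derivatives are real, while the calculus with classical derivatives below is
  set up for complex functions.\<close>

lemma has_weak_deriv_of_real:
  assumes "has_weak_deriv j u g"
  shows "has_weak_deriv j (\<lambda>x. complex_of_real (u x)) (\<lambda>x. complex_of_real (g x))"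
proof -
  have l: "locally_integrable (\<lambda>x. complex_of_real (u x))" if "locally_integrable u" for u :: "real \<Rightarrow> real"
    using that unfolding locally_integrable_def set_integrable_def
    by (auto simp: scaleR_conv_of_real simp flip: of_real_mult)
  have e: "(LINT x|lborel. p x *\<^sub>R complex_of_real (w x)) = complex_of_real (LINT x|lborel. p x *\<^sub>R w x)"
    for p w :: "real \<Rightarrow> real"
    by (simp add: scaleR_conv_of_real flip: of_real_mult)
  show ?thesis
    unfolding has_weak_deriv_def e
  proof (intro conjI allI impI)
    show "locally_integrable (\<lambda>x. complex_of_real (u x))" "locally_integrable (\<lambda>x. complex_of_real (g x))"
      using assms l by (auto simp: has_weak_deriv_def)
    fix \<eta> assume "test_function \<eta>"
    then have "(LINT x|lborel. nderiv j \<eta> x *\<^sub>R u x) = (-1) ^ j *\<^sub>R (LINT x|lborel. \<eta> x *\<^sub>R g x)"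
      using assms by (simp add: has_weak_deriv_def)
    then show "complex_of_real (LINT x|lborel. nderiv j \<eta> x *\<^sub>R u x)
        = (-1) ^ j *\<^sub>R complex_of_real (LINT x|lborel. \<eta> x *\<^sub>R g x)"
      by (simp only: scaleR_conv_of_real[where 'a=complex] real_scaleR_def of_real_mult)
  qed
qed

lemma square_integrable_of_real:
  assumes "square_integrable (u :: real \<Rightarrow> real)"
  shows "square_integrable (\<lambda>x. complex_of_real (u x))" "L2_norm (\<lambda>x. complex_of_real (u x)) = L2_norm u"
  using assms by (auto simp: square_integrable_def L2_norm_def)

lemma
  assumes u: "sobolev k (u :: real \<Rightarrow> real)"
  shows sobolev_of_real: "sobolev k (\<lambda>x. complex_of_real (u x))"
    and L2_weak_deriv_of_real: "j \<le> k \<Longrightarrow> L2_norm (weak_deriv j (\<lambda>x. complex_of_real (u x))) = L2_norm (weak_deriv j u)"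
    and weak_deriv_of_real: "j \<le> k \<Longrightarrow> AE x in lborel. weak_deriv j (\<lambda>x. complex_of_real (u x)) x = complex_of_real (weak_deriv j u x)"
proof -
  show s: "sobolev k (\<lambda>x. complex_of_real (u x))"
    unfolding sobolev_def
  proof (intro conjI allI impI)
    show "square_integrable (\<lambda>x. complex_of_real (u x))"
      using u by (intro square_integrable_of_real) (simp add: sobolev_def)
    fix j assume "j \<le> k"
    then show "\<exists>g. has_weak_deriv j (\<lambda>x. complex_of_real (u x)) g \<and> square_integrable g"
      using has_weak_deriv_of_real[OF sobolev_has_weak_deriv[OF u]]
        square_integrable_of_real(1)[OF sobolev_square_integrable[OF u]] by blast
  qed
  assume j: "j \<le> k"
  note w = L2_weak_deriv_eq[OF s j has_weak_deriv_of_real[OF sobolev_has_weak_deriv[OF u j]]]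
  show "L2_norm (weak_deriv j (\<lambda>x. complex_of_real (u x))) = L2_norm (weak_deriv j u)"
    using w(1) square_integrable_of_real(2)[OF sobolev_square_integrable[OF u j]] by simp
  show "AE x in lborel. weak_deriv j (\<lambda>x. complex_of_real (u x)) x = complex_of_real (weak_deriv j u x)"
    by (rule w(2))
qed

section \<open>Differentiable functions with square integrable derivatives\<close>

text \<open>The classical counterpart of \<open>sobolev\<close>: derivatives are honest functions,
  so the Leibniz rule and integration by parts are identities at every point. Mollifications belong
  to it at every order.\<close>

definition hsob :: "nat \<Rightarrow> (real \<Rightarrow> complex) \<Rightarrow> bool" where
  "hsob m u \<longleftrightarrow> diffk m u \<and> (\<forall>j\<le>m. square_integrable (nderiv j u))"

text \<open>The sum of the norms, equivalent to the Sobolev norm, makes splitting off the top order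
  an exact identity (\<open>hnorm_Suc\<close>), which the energy estimate uses.\<close>

definition hnorm :: "nat \<Rightarrow> (real \<Rightarrow> complex) \<Rightarrow> real" where
  "hnorm m u = (\<Sum>j\<le>m. L2_norm (nderiv j u))"

lemma hsob_imp_diffk: "hsob m u \<Longrightarrow> diffk m u"
  and hsob_square_integrable: "hsob m u \<Longrightarrow> j \<le> m \<Longrightarrow> square_integrable (nderiv j u)"
  by (auto simp: hsob_def)

lemma hsob_square_integrable_0: "hsob m u \<Longrightarrow> square_integrable u"
  using hsob_square_integrable[of m u 0] by simp

lemma hsob_mono: "hsob m u \<Longrightarrow> j \<le> m \<Longrightarrow> hsob j u"
  using diffk_mono by (auto simp: hsob_def)

lemma hsob_nderiv:
  assumes "hsob m u" "i + j \<le> m" shows "hsob i (nderiv j u)"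
  unfolding hsob_def
proof (intro conjI allI impI)
  show "diffk i (nderiv j u)" using assms diffk_nderiv by (auto simp: hsob_def)
  fix l assume "l \<le> i"
  then show "square_integrable (nderiv l (nderiv j u))"
    using assms hsob_square_integrable[of m u "l + j"] by (simp add: funpow_add)
qed

lemma hnorm_nonneg [simp]: "0 \<le> hnorm m u"
  by (simp add: hnorm_def sum_nonneg)

lemma L2_nderiv_le_hnorm: "j \<le> m \<Longrightarrow> L2_norm (nderiv j u) \<le> hnorm m u"
  unfolding hnorm_def by (rule member_le_sum) auto

lemma hnorm_mono: "j \<le> m \<Longrightarrow> hnorm j u \<le> hnorm m u"
  unfolding hnorm_def by (rule sum_mono2) auto

lemma hnorm_Suc: "hnorm (Suc m) u = hnorm m u + L2_norm (nderiv (Suc m) u)"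
  by (simp add: hnorm_def)

lemma
  assumes "hsob m u" "hsob m w"
  shows hsob_add: "hsob m (\<lambda>x. u x + w x)"
    and hnorm_add: "hnorm m (\<lambda>x. u x + w x) \<le> hnorm m u + hnorm m w"
    and hsob_diff: "hsob m (\<lambda>x. u x - w x)"
    and hnorm_diff: "hnorm m (\<lambda>x. u x - w x) \<le> hnorm m u + hnorm m w"
proof -
  have d: "diffk m u" "diffk m w" using assms by (auto simp: hsob_def)
  show "hsob m (\<lambda>x. u x + w x)" "hsob m (\<lambda>x. u x - w x)"
    using assms diffk_add[OF d] nderiv_add[OF d] diffk_diff[OF d] nderiv_diff[OF d]
    by (auto simp: hsob_def square_integrable_add square_integrable_diff)
  show "hnorm m (\<lambda>x. u x + w x) \<le> hnorm m u + hnorm m w"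
    unfolding hnorm_def sum.distrib[symmetric] using assms
    by (intro sum_mono) (auto simp: nderiv_add[OF d] hsob_def intro!: L2_norm_triangle)
  show "hnorm m (\<lambda>x. u x - w x) \<le> hnorm m u + hnorm m w"
    unfolding hnorm_def sum.distrib[symmetric] using assms
    by (intro sum_mono) (auto simp: nderiv_diff[OF d] hsob_def intro!: L2_norm_diff_le)
qed

lemma
  assumes "hsob m u"
  shows hsob_cmult: "hsob m (\<lambda>x. c * u x)" and hnorm_cmult: "hnorm m (\<lambda>x. c * u x) = norm c * hnorm m u"
proof -
  have d: "diffk m u" using assms by (simp add: hsob_def)
  note l = bounded_linear_mult_right[of c]
  show "hsob m (\<lambda>x. c * u x)"
    using assms diffk_linear[OF l d] nderiv_linear[OF l d] by (auto simp: hsob_def square_integrable_cmult)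
  show "hnorm m (\<lambda>x. c * u x) = norm c * hnorm m u"
    unfolding hnorm_def sum_distrib_left using assms
    by (intro sum.cong) (auto simp: nderiv_linear[OF l d] hsob_def L2_norm_cmult)
qed

lemma
  assumes "hsob m u"
  shows hsob_cnj: "hsob m (\<lambda>x. cnj (u x))" and hnorm_cnj: "hnorm m (\<lambda>x. cnj (u x)) = hnorm m u"
proof -
  have d: "diffk m u" using assms by (simp add: hsob_def)
  note l = bounded_linear_cnj
  show "hsob m (\<lambda>x. cnj (u x))"
    using assms diffk_linear[OF l d] nderiv_linear[OF l d] by (auto simp: hsob_def square_integrable_cnj)
  show "hnorm m (\<lambda>x. cnj (u x)) = hnorm m u"
    unfolding hnorm_def by (intro sum.cong) (auto simp: nderiv_linear[OF l d])
qed

lemma nderiv_cnj: "diffk m u \<Longrightarrow> j \<le> m \<Longrightarrow> nderiv j (\<lambda>x. cnj (u x)) = (\<lambda>x. cnj (nderiv j u x))"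
  by (rule nderiv_linear[OF bounded_linear_cnj])

lemma nderiv_cmult:
  fixes u :: "real \<Rightarrow> complex"
  shows "diffk m u \<Longrightarrow> j \<le> m \<Longrightarrow> nderiv j (\<lambda>x. c * u x) = (\<lambda>x. c * nderiv j u x)"
  by (rule nderiv_linear[OF bounded_linear_mult_right])

text \<open>The fundamental theorem of calculus averaged over [x, x+1]. Keeping the bound local
  gives not only the Sobolev inequality but also decay at infinity.\<close>

lemma norm_le_local_integral:
  fixes u :: "real \<Rightarrow> 'a::euclidean_space"
  assumes u: "diffk 1 u"
  shows "norm (u x) \<le> (LINT y|lborel. indicator {x..x+1} y * norm (u y))
     + (LINT y|lborel. indicator {x..x+1} y * norm (vderiv u y))"
proof -
  have cu: "continuous_on UNIV u" "continuous_on UNIV (vderiv u)"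
    using u diffk_imp_continuous by fastforce+
  note i = continuous_imp_locally_integrable[OF cu(1), THEN locally_integrable_norm_indicator]
    continuous_imp_locally_integrable[OF cu(2), THEN locally_integrable_norm_indicator]
  define J where "J = (LINT y|lborel. indicator {x..x+1} y * norm (vderiv u y))"
  have J: "norm (u y - u x) \<le> J" if "y \<in> {x..x+1}" for y
  proof -
    have "u y - u x = (LINT z|lborel. indicator {x..y} z *\<^sub>R vderiv u z)"
      using that diffk_has_vector_derivative[OF u, of 0] continuous_on_subset[OF cu(2)]
      by (subst integral_FTC_Icc[of x y u "vderiv u"]) (auto intro: has_vector_derivative_at_within)
    also have "norm \<dots> \<le> (LINT z|lborel. norm (indicator {x..y} z *\<^sub>R vderiv u z))"
      by (rule integral_norm_bound)
    also have "\<dots> \<le> J" unfolding J_def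
    proof (rule integral_mono)
      show "norm (indicator {x..y} z *\<^sub>R vderiv u z) \<le> indicator {x..x+1} z * norm (vderiv u z)" for z
        using that by (auto simp: indicator_def)
      show "integrable lborel (\<lambda>z. norm (indicator {x..y} z *\<^sub>R vderiv u z))" using i(2)[of x y] by simp
    qed (use i in auto)
    finally show ?thesis .
  qed
  have i1: "integrable lborel (indicator {x..x+1} :: real \<Rightarrow> real)" and
    v1: "(LINT y|lborel. indicator {x..x+1} y :: real) = 1"
    by (auto simp: integrable_indicator_iff emeasure_lborel_Icc_eq measure_def)
  have "(LINT y|lborel. indicator {x..x+1} y * norm (u x)) 
      \<le> (LINT y|lborel. indicator {x..x+1} y * norm (u y) + indicator {x..x+1} y * J)"
  proof (rule integral_mono)
    show "indicator {x..x+1} y * norm (u x) \<le> indicator {x..x+1} y * norm (u y) + indicator {x..x+1} y * J" for y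
      using J[of y] norm_triangle_sub[of "u x" "u y"] by (auto simp: indicator_def norm_minus_commute)
  qed (use i i1 in auto)
  then show ?thesis using i i1 v1 by (simp add: J_def)
qed

lemma hsob_sup_bound_1:
  assumes u: "hsob 1 u"
  shows "norm (u x) \<le> L2_norm u + L2_norm (vderiv u)"
proof -
  have b: "(LINT y|lborel. indicator {x..x+1} y * norm (w y)) \<le> L2_norm w" if w: "square_integrable w" for w :: "real \<Rightarrow> complex"
  proof -
    have s: "square_integrable (indicator {x..x+1} :: real \<Rightarrow> real)"
      using square_integrable_indicator[of "\<lambda>x. 0::real" 1 x "x+1"] by simp
    have "(LINT y|lborel. indicator {x..x+1} y * norm (w y)) \<le> L2_norm (indicator {x..x+1} :: real \<Rightarrow> real) * L2_norm w"
      using L2_Cauchy_Schwarz[OF s w] by simp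
    also have "L2_norm (indicator {x..x+1} :: real \<Rightarrow> real) = 1"
      by (simp add: L2_norm_def power2_eq_square measure_def flip: indicator_inter_arith)
    finally show ?thesis by simp
  qed
  have s: "square_integrable u" "square_integrable (vderiv u)"
    using hsob_square_integrable[OF u, of 0] hsob_square_integrable[OF u, of 1] by auto
  show ?thesis
    using norm_le_local_integral[of u x] b[OF s(1)] b[OF s(2)] u by (simp add: hsob_def)
qed

lemma hsob_sup_bound:
  assumes u: "hsob m u" and j: "j < m"
  shows "norm (nderiv j u x) \<le> hnorm m u"
proof -
  have "norm (nderiv j u x) \<le> L2_norm (nderiv j u) + L2_norm (nderiv (Suc j) u)"
    using hsob_sup_bound_1[OF hsob_nderiv[OF u, of 1 j]] j by simp
  also have "\<dots> = (\<Sum>i\<in>{j, Suc j}. L2_norm (nderiv i u))" by simp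
  also have "\<dots> \<le> hnorm m u" unfolding hnorm_def by (rule sum_mono2) (use j in auto)
  finally show ?thesis .
qed

text \<open>The integral over [-n, n] is a difference of boundary values, and these tend to 0: they
  are bounded by integrals of integrable functions over unit intervals that escape to
  infinity.\<close>

lemma integral_derivative_eq_0:
  fixes g :: "real \<Rightarrow> 'a::euclidean_space"
  assumes g: "diffk 1 g" and i: "integrable lborel g" "integrable lborel (vderiv g)"
  shows "(LINT x|lborel. vderiv g x) = 0"
proof -
  note d = diffk_has_vector_derivative[OF g, of 0]
  have cg: "continuous_on UNIV (vderiv g)" using g diffk_imp_continuous by fastforce
  have F: "(LINT x|lborel. indicator {-real n..real n} x *\<^sub>R vderiv g x) = g (real n) - g (- real n)" for n
    using d continuous_on_subset[OF cg]
    by (intro integral_FTC_Icc) (auto intro: has_vector_derivative_at_within)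
  have 1: "(\<lambda>n. LINT x|lborel. indicator {-real n..real n} x *\<^sub>R vderiv g x) \<longlonglongrightarrow> (LINT x|lborel. vderiv g x)"
  proof (rule integral_dominated_convergence[where w="\<lambda>x. norm (vderiv g x)"])
    show "AE x in lborel. (\<lambda>n. indicator {-real n..real n} x *\<^sub>R vderiv g x) \<longlonglongrightarrow> vderiv g x"
    proof (rule AE_I2, rule tendsto_eventually)
      fix x
      show "\<forall>\<^sub>F n in sequentially. indicator {-real n..real n} x *\<^sub>R vderiv g x = vderiv g x"
        using eventually_ge_at_top[of "nat \<lceil>\<bar>x\<bar>\<rceil>"]
        by eventually_elim (auto simp: nat_le_iff ceiling_le_iff indicator_def abs_le_iff)
    qed
  qed (use i in \<open>auto simp: indicator_def\<close>)
  \<comment> \<open>The sign \<open>s\<close> is 1 or -1 and treats both ends of the line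
    together.\<close>
  have tail: "(\<lambda>n. LINT y|lborel. indicator {s * real n..s * real n + 1} y * norm (h y)) \<longlonglongrightarrow> 0"
    if h: "integrable lborel h" and s: "\<bar>s\<bar> = 1" for h :: "real \<Rightarrow> 'a" and s :: real
  proof -
    have "(\<lambda>n. LINT y|lborel. indicator {s * real n..s * real n + 1} y * norm (h y)) \<longlonglongrightarrow> (LINT y::real|lborel. 0)"
    proof (rule integral_dominated_convergence[where w="\<lambda>x. norm (h x)"])
      show "AE y in lborel. (\<lambda>n. indicator {s * real n..s * real n + 1} y * norm (h y)) \<longlonglongrightarrow> 0"
      proof (rule AE_I2, rule tendsto_eventually)
        fix y
        show "\<forall>\<^sub>F n in sequentially. indicator {s * real n..s * real n + 1} y * norm (h y) = 0"
          using eventually_gt_at_top[of "nat \<lceil>\<bar>y\<bar> + 1\<rceil>"]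
        proof eventually_elim
          case (elim n)
          then have "real n > \<bar>y\<bar> + 1" by linarith
          then have "y \<notin> {s * real n..s * real n + 1}" using s by (cases "s = 1") (auto simp: abs_if split: if_splits)
          then show ?case by simp
        qed
      qed
    qed (use h in \<open>auto simp: indicator_def\<close>)
    then show ?thesis by simp
  qed
  have g0: "(\<lambda>n. g (s * real n)) \<longlonglongrightarrow> 0" if s: "\<bar>s\<bar> = 1" for s
    by (rule Lim_null_comparison[OF always_eventually[OF allI[OF norm_le_local_integral[OF g]]]])
       (use tendsto_add[OF tail[OF i(1) s] tail[OF i(2) s]] in simp)
  have "(\<lambda>n. g (real n) - g (- real n)) \<longlonglongrightarrow> 0"
    using tendsto_diff[OF g0[of 1] g0[of "-1"]] by simp
  then show ?thesis using 1 unfolding F using LIMSEQ_unique by blast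
qed

lemma integral_by_parts_line:
  fixes u w :: "real \<Rightarrow> complex"
  assumes u: "hsob 1 u" and w: "hsob 1 w"
  shows "(LINT x|lborel. vderiv u x * w x) = - (LINT x|lborel. u x * vderiv w x)"
proof -
  have d: "diffk 1 u" "diffk 1 w" using u w by (auto simp: hsob_def simp del: diffk.simps)
  have s: "square_integrable u" "square_integrable (vderiv u)" "square_integrable w" "square_integrable (vderiv w)"
    using hsob_square_integrable[OF u, of 0] hsob_square_integrable[OF u, of 1]
      hsob_square_integrable[OF w, of 0] hsob_square_integrable[OF w, of 1] by auto
  note i = square_integrable_imp_integrable_mult[OF s(2,3)] square_integrable_imp_integrable_mult[OF s(1,4)]
  have v: "vderiv (\<lambda>x. u x * w x) = (\<lambda>x. vderiv u x * w x + u x * vderiv w x)"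
    using vderiv_mult(1)[of 0 u w] d by simp
  have "(LINT x|lborel. vderiv (\<lambda>x. u x * w x) x) = 0"
    by (rule integral_derivative_eq_0[OF diffk_mult[OF d]])
       (use i v square_integrable_imp_integrable_mult[OF s(1,3)] in auto)
  then show ?thesis using i by (simp add: v add_eq_0_iff)
qed

text \<open>A Leibniz bound without binomial coefficients: each derivative turns one product into
  two of the same kind, hence the factor 2^n.\<close>

lemma
  fixes u w :: "real \<Rightarrow> complex"
  assumes u: "diffk k u" and w: "diffk k w"
    and M: "\<And>i j. i + j \<le> k \<Longrightarrow> square_integrable (\<lambda>x. nderiv i u x * nderiv j w x)
        \<and> L2_norm (\<lambda>x. nderiv i u x * nderiv j w x) \<le> M"
  shows nderiv_mult_bound_aux: "n + i + j \<le> k \<Longrightarrow> square_integrable (nderiv n (\<lambda>x. nderiv i u x * nderiv j w x))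
     \<and> L2_norm (nderiv n (\<lambda>x. nderiv i u x * nderiv j w x)) \<le> 2 ^ n * M"
proof (induction n arbitrary: i j)
  case 0
  then show ?case using M[of i j] by simp
next
  case (Suc n)
  have d: "diffk (Suc n) (nderiv i u)" "diffk (Suc n) (nderiv j w)"
    using diffk_nderiv[OF u, of "Suc n" i] diffk_nderiv[OF w, of "Suc n" j] Suc.prems by auto
  have dm: "diffk n (\<lambda>x. nderiv (Suc i) u x * nderiv j w x)" "diffk n (\<lambda>x. nderiv i u x * nderiv (Suc j) w x)"
    using diffk_nderiv[OF u, of n] diffk_nderiv[OF w, of n] Suc.prems by (auto intro!: diffk_mult simp del: funpow.simps)
  have "nderiv (Suc n) (\<lambda>x. nderiv i u x * nderiv j w x)
     = nderiv n (\<lambda>x. nderiv (Suc i) u x * nderiv j w x + nderiv i u x * nderiv (Suc j) w x)"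
    unfolding nderiv_Suc[of n] vderiv_mult(1)[OF d] by simp
  also have "\<dots> = (\<lambda>x. nderiv n (\<lambda>x. nderiv (Suc i) u x * nderiv j w x) x + nderiv n (\<lambda>x. nderiv i u x * nderiv (Suc j) w x) x)"
    by (rule nderiv_add[OF dm order_refl])
  finally have eq: "nderiv (Suc n) (\<lambda>x. nderiv i u x * nderiv j w x) = \<dots>" .
  have IH: "square_integrable (nderiv n (\<lambda>x. nderiv (Suc i) u x * nderiv j w x))"
      "L2_norm (nderiv n (\<lambda>x. nderiv (Suc i) u x * nderiv j w x)) \<le> 2 ^ n * M"
      "square_integrable (nderiv n (\<lambda>x. nderiv i u x * nderiv (Suc j) w x))"
      "L2_norm (nderiv n (\<lambda>x. nderiv i u x * nderiv (Suc j) w x)) \<le> 2 ^ n * M"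
    using Suc.IH[of "Suc i" j] Suc.IH[of i "Suc j"] Suc.prems by auto
  show ?case unfolding eq
    using square_integrable_add[OF IH(1,3)] L2_norm_triangle[OF IH(1,3)] IH by auto
qed

lemma
  fixes u w :: "real \<Rightarrow> complex"
  assumes u: "diffk k u" and w: "diffk k w"
    and M: "\<And>i j. i + j \<le> k \<Longrightarrow> square_integrable (\<lambda>x. nderiv i u x * nderiv j w x)
        \<and> L2_norm (\<lambda>x. nderiv i u x * nderiv j w x) \<le> M"
  shows hsob_mult_aux: "hsob k (\<lambda>x. u x * w x)"
    and hnorm_mult_aux: "hnorm k (\<lambda>x. u x * w x) \<le> 2 ^ Suc k * M"
proof -
  have b: "square_integrable (nderiv n (\<lambda>x. u x * w x)) \<and> L2_norm (nderiv n (\<lambda>x. u x * w x)) \<le> 2 ^ n * M" if "n \<le> k" for n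
    using nderiv_mult_bound_aux[OF u w M, of n 0 0] that by simp
  show "hsob k (\<lambda>x. u x * w x)"
    using b diffk_mult[OF u w] by (simp add: hsob_def)
  have M0: "0 \<le> M" using M[of 0 0] order_trans[OF L2_norm_nonneg] by auto
  have "hnorm k (\<lambda>x. u x * w x) \<le> (\<Sum>n\<le>k. 2 ^ n * M)"
    unfolding hnorm_def using b by (intro sum_mono) auto
  also have "\<dots> = (2 ^ Suc k - 1) * M"
    by (induction k) (auto simp: algebra_simps)
  also have "\<dots> \<le> 2 ^ Suc k * M" using M0 by (intro mult_right_mono) auto
  finally show "hnorm k (\<lambda>x. u x * w x) \<le> 2 ^ Suc k * M" .
qed

text \<open>The algebra property of H^k. If i + j is at most k and k is at least 1, one of the two
  factors has order below k and is bounded by the Sobolev inequality, while the other stays in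
  L2.\<close>

lemma
  assumes u: "hsob k u" and w: "hsob k w" and k: "k \<ge> 1"
  shows hsob_mult: "hsob k (\<lambda>x. u x * w x)"
    and hnorm_mult: "hnorm k (\<lambda>x. u x * w x) \<le> 2 ^ Suc k * (hnorm k u * hnorm k w)"
proof -
  have M: "square_integrable (\<lambda>x. nderiv i u x * nderiv j w x)
        \<and> L2_norm (\<lambda>x. nderiv i u x * nderiv j w x) \<le> hnorm k u * hnorm k w" if ij: "i + j \<le> k" for i j
  proof -
    note m = diffk_measurable_nderiv[OF hsob_imp_diffk[OF u], of i] diffk_measurable_nderiv[OF hsob_imp_diffk[OF w], of j]
    note su = hsob_square_integrable[OF u, of i] and sw = hsob_square_integrable[OF w, of j]
    have l: "L2_norm (nderiv i u) \<le> hnorm k u" "L2_norm (nderiv j w) \<le> hnorm k w"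
      using ij by (auto intro: L2_nderiv_le_hnorm)
    show ?thesis
    proof (cases "i < k")
      case True
      have b: "AE x in lborel. norm (nderiv i u x) \<le> hnorm k u" using hsob_sup_bound[OF u True] by simp
      have "L2_norm (\<lambda>x. nderiv i u x * nderiv j w x) \<le> hnorm k u * L2_norm (nderiv j w)"
        using L2_norm_bounded_mult[OF sw m(1) b] ij by simp
      also have "\<dots> \<le> hnorm k u * hnorm k w" using l by (intro mult_left_mono) auto
      finally show ?thesis using square_integrable_bounded_mult[OF sw m(1) b] ij by simp
    next
      case False
      then have "j < k" using ij k by simp
      have b: "AE x in lborel. norm (nderiv j w x) \<le> hnorm k w" using hsob_sup_bound[OF w \<open>j < k\<close>] by simp
      have "L2_norm (\<lambda>x. nderiv j w x * nderiv i u x) \<le> hnorm k w * L2_norm (nderiv i u)"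
        using L2_norm_bounded_mult[OF su m(2) b] ij by simp
      also have "\<dots> \<le> hnorm k w * hnorm k u" using l by (intro mult_left_mono) auto
      finally show ?thesis using square_integrable_bounded_mult[OF su m(2) b] ij by (simp add: mult.commute)
    qed
  qed
  note d = hsob_imp_diffk[OF u] hsob_imp_diffk[OF w]
  show "hsob k (\<lambda>x. u x * w x)" "hnorm k (\<lambda>x. u x * w x) \<le> 2 ^ Suc k * (hnorm k u * hnorm k w)"
    using hsob_mult_aux[OF d M] hnorm_mult_aux[OF d M] by auto
qed


section \<open>Bounded coefficients\<close>

text \<open>The class for coefficients such as the modulated profile, which are bounded with their
  derivatives but lie in no L2-based space.\<close>

definition cbd :: "nat \<Rightarrow> (real \<Rightarrow> complex) \<Rightarrow> real \<Rightarrow> bool" where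
  "cbd m c B \<longleftrightarrow> diffk m c \<and> (\<forall>j\<le>m. \<forall>x. norm (nderiv j c x) \<le> B)"

lemma cbd_nonneg: "cbd m c B \<Longrightarrow> 0 \<le> B"
  unfolding cbd_def using norm_ge_zero order_trans by blast

lemma cbd_mono: "cbd m c B \<Longrightarrow> j \<le> m \<Longrightarrow> B \<le> B' \<Longrightarrow> cbd j c B'"
  unfolding cbd_def using diffk_mono by (meson order_trans)

lemma cbd_bound: "cbd m c B \<Longrightarrow> norm (c x) \<le> B"
  unfolding cbd_def by (metis funpow_0 le0)

lemma cbd_vderiv: "cbd (Suc m) c B \<Longrightarrow> cbd m (vderiv c) B"
  unfolding cbd_def using nderiv_Suc[of _ c] by (metis diffk.simps(2) Suc_le_mono)

lemma cbd_SucI: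
  assumes "\<And>x. (c has_vector_derivative c' x) (at x)" "cbd m c' B" "\<And>x. norm (c x) \<le> B"
  shows "cbd (Suc m) c B"
proof -
  have v: "vderiv c = c'" by (rule vderiv_eqI[OF assms(1)])
  have "norm (nderiv j c x) \<le> B" if "j \<le> Suc m" for j x
    using that assms(2,3) v nderiv_Suc[of _ c] by (cases j) (auto simp: cbd_def simp del: funpow.simps(2))
  then show ?thesis using diffk_SucI[OF assms(1)] assms(2) unfolding cbd_def by blast
qed

lemma cbd_add:
  assumes "cbd m c B" "cbd m d B'"
  shows "cbd m (\<lambda>x. c x + d x) (B + B')"
proof -
  have d: "diffk m c" "diffk m d" using assms by (auto simp: cbd_def)
  show ?thesis using assms diffk_add[OF d] nderiv_add[OF d]
    by (auto simp: cbd_def intro!: norm_triangle_le add_mono)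
qed

lemma cbd_cnj: "cbd m c B \<Longrightarrow> cbd m (\<lambda>x. cnj (c x)) B"
  unfolding cbd_def using diffk_linear[OF bounded_linear_cnj, of m c] nderiv_cnj[of m c] by auto

lemma cbd_cmult:
  assumes "cbd m c B"
  shows "cbd m (\<lambda>x. z * c x) (norm z * B)"
  using assms unfolding cbd_def
  using diffk_linear[OF bounded_linear_mult_right, of m c z] nderiv_cmult[of m c _ z] 
  by (auto simp: norm_mult intro!: mult_left_mono)

lemma cbd_mult: "cbd m c B \<Longrightarrow> cbd m d B' \<Longrightarrow> cbd m (\<lambda>x. c x * d x) (2 ^ m * (B * B'))"
proof (induction m arbitrary: c d)
  case 0
  then show ?case using cbd_nonneg[OF 0(1)]
    by (auto simp: cbd_def norm_mult continuous_on_mult intro!: mult_mono)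
next
  case (Suc m)
  have d: "diffk (Suc m) c" "diffk (Suc m) d" using Suc.prems by (auto simp: cbd_def simp del: diffk.simps)
  have 1: "cbd m (\<lambda>x. vderiv c x * d x) (2 ^ m * (B * B'))" "cbd m (\<lambda>x. c x * vderiv d x) (2 ^ m * (B * B'))"
    using Suc.prems by (auto intro!: Suc.IH cbd_vderiv elim: cbd_mono)
  show ?case
  proof (rule cbd_SucI)
    show "((\<lambda>x. c x * d x) has_vector_derivative vderiv c x * d x + c x * vderiv d x) (at x)" for x
      using has_vector_derivative_mult[of c "vderiv c x" x UNIV d "vderiv d x"] d
      by (simp add: diffk_Suc_iff add.commute del: diffk.simps)
    show "cbd m (\<lambda>x. vderiv c x * d x + c x * vderiv d x) (2 ^ Suc m * (B * B'))"
      using cbd_add[OF 1] by (simp add: mult_ac)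
    have BB: "0 \<le> B * B'" using cbd_nonneg Suc.prems by (meson mult_nonneg_nonneg)
    have "norm (c x * d x) \<le> B * B'" for x
      using cbd_bound[OF Suc.prems(1), of x] cbd_bound[OF Suc.prems(2), of x] cbd_nonneg[OF Suc.prems(1)]
      by (auto simp: norm_mult intro!: mult_mono)
    also have "B * B' \<le> 2 ^ Suc m * (B * B')" using BB mult_right_mono[of 1 "2 ^ Suc m" "B * B'"] 
      by (simp add: one_le_power del: power_Suc)
    finally show "norm (c x * d x) \<le> 2 ^ Suc m * (B * B')" for x .
  qed
qed

lemma
  assumes c: "cbd m c B" and u: "hsob m u"
  shows hsob_coeff_mult: "hsob m (\<lambda>x. c x * u x)"
    and hnorm_coeff_mult: "hnorm m (\<lambda>x. c x * u x) \<le> 2 ^ Suc m * (B * hnorm m u)"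
proof -
  have d: "diffk m c" "diffk m u" using c u by (auto simp: cbd_def hsob_def)
  have M: "square_integrable (\<lambda>x. nderiv i c x * nderiv j u x)
        \<and> L2_norm (\<lambda>x. nderiv i c x * nderiv j u x) \<le> B * hnorm m u" if ij: "i + j \<le> m" for i j
  proof -
    note mc = diffk_measurable_nderiv[OF d(1), of i] and su = hsob_square_integrable[OF u, of j]
    have b: "AE x in lborel. norm (nderiv i c x) \<le> B" using c ij by (auto simp: cbd_def)
    have "L2_norm (\<lambda>x. nderiv i c x * nderiv j u x) \<le> B * L2_norm (nderiv j u)"
      using L2_norm_bounded_mult[OF su mc b cbd_nonneg[OF c]] ij by simp
    also have "\<dots> \<le> B * hnorm m u" using ij cbd_nonneg[OF c] by (intro mult_left_mono L2_nderiv_le_hnorm) auto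
    finally show ?thesis using square_integrable_bounded_mult[OF su mc b cbd_nonneg[OF c]] ij by simp
  qed
  show "hsob m (\<lambda>x. c x * u x)" "hnorm m (\<lambda>x. c x * u x) \<le> 2 ^ Suc m * (B * hnorm m u)"
    using hsob_mult_aux[OF d M] hnorm_mult_aux[OF d M] by auto
qed

text \<open>The leading term of the Leibniz rule is \<open>c u\<^sup>(\<^sup>n\<^sup>)\<close>; the rest costs one derivative less.\<close>

lemma L2_commutator_bound:
  assumes c: "cbd (Suc m) c B" and u: "hsob (Suc m) u"
  shows "L2_norm (\<lambda>x. nderiv (Suc m) (\<lambda>x. c x * u x) x - c x * nderiv (Suc m) u x) \<le> 2 ^ (2 * m + 2) * (B * hnorm m u)"
proof -
  let ?M = "2 ^ Suc m * (B * hnorm m u)"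
  have c': "cbd m (vderiv c) B" by (rule cbd_vderiv[OF c])
  have B0: "0 \<le> B" by (rule cbd_nonneg[OF c])
  have d: "diffk (Suc m) c" "diffk (Suc m) u" using c u by (auto simp: cbd_def hsob_def simp del: diffk.simps)
  \<comment> \<open>Generalised to \<open>n\<close> derivatives of c D^j u so that the induction
    moves one derivative at a time. The term split off carries a derivative on \<open>c\<close> and
    therefore at most \<open>m\<close> derivatives on \<open>u\<close>.\<close>
  have "square_integrable (\<lambda>x. nderiv n (\<lambda>x. c x * nderiv j u x) x - c x * nderiv (n + j) u x) \<and>
     L2_norm (\<lambda>x. nderiv n (\<lambda>x. c x * nderiv j u x) x - c x * nderiv (n + j) u x) \<le> 2 ^ n * ?M"
    if "n + j \<le> Suc m" for n j
    using that
  proof (induction n arbitrary: j)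
    case 0
    then show ?case using B0 by simp
  next
    case (Suc n)
    have dd: "diffk (Suc n) c" "diffk (Suc n) (nderiv j u)"
      using diffk_mono[OF d(1)] diffk_nderiv[OF d(2), of "Suc n" j] Suc.prems by (auto simp del: diffk.simps)
    have cn: "cbd n (vderiv c) B" and hu: "hsob n (nderiv j u)"
      using Suc.prems c' u by (auto intro!: hsob_nderiv[OF u] elim: cbd_mono)
    have dm: "diffk n (\<lambda>x. vderiv c x * nderiv j u x)" "diffk n (\<lambda>x. c x * nderiv (Suc j) u x)"
      using dd diffk_nderiv[OF d(2), of n "Suc j"] diffk_nderiv[OF d(2), of n j] diffk_mono[OF d(1), of n] Suc.prems
      by (auto intro!: diffk_mult simp del: funpow.simps)
    have eq: "nderiv (Suc n) (\<lambda>x. c x * nderiv j u x) = (\<lambda>x. nderiv n (\<lambda>x. vderiv c x * nderiv j u x) x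
       + nderiv n (\<lambda>x. c x * nderiv (Suc j) u x) x)"
      unfolding nderiv_Suc[of n] vderiv_mult(1)[OF dd] using nderiv_add[OF dm order_refl] by simp
    note A = hsob_coeff_mult[OF cn hu] hnorm_coeff_mult[OF cn hu]
    have A1: "square_integrable (nderiv n (\<lambda>x. vderiv c x * nderiv j u x))"
      using A(1) by (simp add: hsob_def)
    have "hnorm n (nderiv j u) \<le> hnorm m u"
    proof -
      have "hnorm n (nderiv j u) = (\<Sum>i\<in>(\<lambda>i. i + j) ` {..n}. L2_norm (nderiv i u))"
        unfolding hnorm_def by (subst sum.reindex) (auto simp: funpow_add)
      also have "\<dots> \<le> hnorm m u" unfolding hnorm_def
        by (rule sum_mono2) (use Suc.prems in auto)
      finally show ?thesis .
    qed
    then have "2 ^ Suc n * (B * hnorm n (nderiv j u)) \<le> 2 ^ Suc n * (B * hnorm m u)"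
      using B0 by (intro mult_left_mono) auto
    then have "L2_norm (nderiv n (\<lambda>x. vderiv c x * nderiv j u x)) \<le> 2 ^ Suc n * (B * hnorm m u)"
      using order_trans[OF L2_nderiv_le_hnorm[OF order_refl] A(2)] by linarith
    also have "\<dots> \<le> 2 ^ Suc n * (2 ^ m * (B * hnorm m u))"
      using B0 mult_right_mono[of 1 "2 ^ m" "B * hnorm m u"] by (intro mult_left_mono) auto
    also have "\<dots> = 2 ^ n * ?M" by simp
    finally have A2: "L2_norm (nderiv n (\<lambda>x. vderiv c x * nderiv j u x)) \<le> 2 ^ n * ?M" .
    have IH: "square_integrable (\<lambda>x. nderiv n (\<lambda>x. c x * nderiv (Suc j) u x) x - c x * nderiv (n + Suc j) u x)"
      "L2_norm (\<lambda>x. nderiv n (\<lambda>x. c x * nderiv (Suc j) u x) x - c x * nderiv (n + Suc j) u x) \<le> 2 ^ n * ?M"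
      using Suc.IH[of "Suc j"] Suc.prems by auto
    show ?case unfolding eq
      using square_integrable_add[OF A1 IH(1)] L2_norm_triangle[OF A1 IH(1)] A2 IH(2)
      by (simp add: algebra_simps del: funpow.simps)
  qed
  note this[of "Suc m" 0]
  moreover have "(2::real) ^ (2 * m + 2) = 2 ^ Suc m * 2 ^ Suc m"
    unfolding power_add[symmetric] by (rule arg_cong[of _ _ "(^) 2"]) simp
  ultimately show ?thesis by (simp only: funpow_0 add_0_right mult.assoc le_refl simp_thms)
qed


section \<open>Interpolation\<close>

text \<open>Interpolation reduced to sequences: only log-convexity of the norms of successive
  derivatives is used. The constant is quantified before the sequence, so that it later serves all
  functions.\<close>

lemma log_convex_interpolation:
  fixes \<eta> :: real
  assumes "\<eta> > 0"
  shows "\<exists>C\<ge>0. \<forall>a::nat\<Rightarrow>real. (\<forall>j. 0 \<le> a j) \<longrightarrow> (\<forall>j. j + 2 \<le> k \<longrightarrow> (a (Suc j))\<^sup>2 \<le> a j * a (j + 2)) \<longrightarrow>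
     (\<forall>j<k. (a j)\<^sup>2 \<le> \<eta> * (a k)\<^sup>2 + C * (a 0)\<^sup>2)"
proof -
  define P where "P = (\<lambda>a::nat\<Rightarrow>real. (\<forall>j. 0 \<le> a j) \<and> (\<forall>j. j + 2 \<le> k \<longrightarrow> (a (Suc j))\<^sup>2 \<le> a j * a (j + 2)))"
  \<comment> \<open>By the arithmetic-geometric mean inequality 2 \<eta> a_{j+1}^2 is at most a_j^2
    + \<eta>^2 a_{j+2}^2. The induction hypothesis replaces a_j^2 by \<eta> a_{j+1}^2 plus a
    multiple of a_0^2; the first part is absorbed on the left and division by \<eta> gives the new
    constant C / \<eta>.\<close>
  have step: "\<exists>C\<ge>0. \<forall>a. P a \<longrightarrow> (a j)\<^sup>2 \<le> \<eta> * (a (Suc j))\<^sup>2 + C * (a 0)\<^sup>2" if "\<eta> > 0" "j < k" for j and \<eta> :: real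
    using that
  proof (induction j arbitrary: \<eta>)
    case 0
    show ?case by (rule exI[of _ 1]) (use 0 in auto)
  next
    case (Suc j)
    obtain C where C: "C \<ge> 0" "\<And>a. P a \<Longrightarrow> (a j)\<^sup>2 \<le> \<eta> * (a (Suc j))\<^sup>2 + C * (a 0)\<^sup>2"
      using Suc.IH[of \<eta>] Suc.prems by auto
    show ?case
    proof (intro exI[of _ "C / \<eta>"] conjI allI impI)
      fix a assume a: "P a"
      have 1: "(a (Suc j))\<^sup>2 \<le> a j * a (j + 2)" using a Suc.prems by (auto simp: P_def)
      have "0 \<le> (a j - \<eta> * a (j + 2))\<^sup>2" by simp
      then have "2 * \<eta> * (a j * a (j + 2)) \<le> (a j)\<^sup>2 + \<eta>\<^sup>2 * (a (j + 2))\<^sup>2"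
        by (simp add: power2_eq_square algebra_simps)
      moreover have "2 * \<eta> * (a (Suc j))\<^sup>2 \<le> 2 * \<eta> * (a j * a (j + 2))"
        using 1 Suc.prems by (intro mult_left_mono) auto
      ultimately have "\<eta> * (a (Suc j))\<^sup>2 \<le> \<eta>\<^sup>2 * (a (j + 2))\<^sup>2 + C * (a 0)\<^sup>2"
        using C(2)[OF a] by (simp only: mult.assoc)
      also have "\<dots> = \<eta> * (\<eta> * (a (j + 2))\<^sup>2 + C / \<eta> * (a 0)\<^sup>2)"
        using Suc.prems(1) by (simp add: power2_eq_square field_simps)
      finally show "(a (Suc j))\<^sup>2 \<le> \<eta> * (a (Suc (Suc j)))\<^sup>2 + C / \<eta> * (a 0)\<^sup>2"
        using Suc.prems(1) by simp
    qed (use C Suc.prems in auto)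
  qed
  \<comment> \<open>Only the last step, from k - 1 to k, needs the small factor; the earlier ones
    are used with factor 1.\<close>
  have chain: "\<exists>C\<ge>0. \<forall>a. P a \<longrightarrow> (a j)\<^sup>2 \<le> \<eta> * (a k)\<^sup>2 + C * (a 0)\<^sup>2" if "Suc j + d = k" for j d
    using that
  proof (induction d arbitrary: j)
    case 0
    then show ?case using step[OF assms, of j] by auto
  next
    case (Suc d)
    obtain C where C: "C \<ge> 0" "\<And>a. P a \<Longrightarrow> (a (Suc j))\<^sup>2 \<le> \<eta> * (a k)\<^sup>2 + C * (a 0)\<^sup>2"
      using Suc.IH[of "Suc j"] Suc.prems by auto
    obtain C' where C': "C' \<ge> 0" "\<And>a. P a \<Longrightarrow> (a j)\<^sup>2 \<le> 1 * (a (Suc j))\<^sup>2 + C' * (a 0)\<^sup>2"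
      using step[of 1 j] Suc.prems by auto
    show ?case
      by (rule exI[of _ "C + C'"]) (use C C' in \<open>fastforce simp: algebra_simps\<close>)
  qed
  have "\<forall>j. \<exists>C. j < k \<longrightarrow> C \<ge> 0 \<and> (\<forall>a. P a \<longrightarrow> (a j)\<^sup>2 \<le> \<eta> * (a k)\<^sup>2 + C * (a 0)\<^sup>2)"
    using chain by (metis less_iff_Suc_add add_Suc)
  then obtain C where C: "\<And>j. j < k \<Longrightarrow> C j \<ge> 0" "\<And>j a. j < k \<Longrightarrow> P a \<Longrightarrow> (a j)\<^sup>2 \<le> \<eta> * (a k)\<^sup>2 + C j * (a 0)\<^sup>2"
    by metis
  show ?thesis
  proof (intro exI[of _ "\<Sum>j<k. C j"] conjI allI impI)
    show "0 \<le> (\<Sum>j<k. C j)" using C(1) by (intro sum_nonneg) auto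
    fix a :: "nat \<Rightarrow> real" and j assume a: "\<forall>j. 0 \<le> a j" "\<forall>j. j + 2 \<le> k \<longrightarrow> (a (Suc j))\<^sup>2 \<le> a j * a (j + 2)" and j: "j < k"
    have "C j \<le> (\<Sum>j<k. C j)" using C(1) j by (intro member_le_sum) auto
    then have "C j * (a 0)\<^sup>2 \<le> (\<Sum>j<k. C j) * (a 0)\<^sup>2" by (intro mult_right_mono) auto
    then show "(a j)\<^sup>2 \<le> \<eta> * (a k)\<^sup>2 + (\<Sum>j<k. C j) * (a 0)\<^sup>2"
      using C(2)[OF j, of a] a by (simp add: P_def)
  qed
qed

lemma L2_norm_sq_complex: "complex_of_real ((L2_norm u)\<^sup>2) = (LINT x|lborel. u x * cnj (u x))"
  unfolding L2_norm_sq complex_norm_square[symmetric] by (simp flip: of_real_power)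

text \<open>One integration by parts followed by Cauchy-Schwarz.\<close>

lemma L2_norm_nderiv_log_convex:
  assumes u: "hsob m u" and j: "j + 2 \<le> m"
  shows "(L2_norm (nderiv (Suc j) u))\<^sup>2 \<le> L2_norm (nderiv j u) * L2_norm (nderiv (j + 2) u)"
proof -
  have d: "hsob 1 (nderiv j u)" "hsob 1 (nderiv (Suc j) u)" 
    using hsob_nderiv[OF u, of 1 j] hsob_nderiv[OF u, of 1 "Suc j"] j by auto
  note dc = hsob_cnj[OF d(2)]
  have v: "vderiv (\<lambda>x. cnj (nderiv (Suc j) u x)) = (\<lambda>x. cnj (nderiv (j + 2) u x))"
    using nderiv_cnj[OF hsob_imp_diffk[OF d(2)], of 1] by simp
  have s: "square_integrable (nderiv j u)" "square_integrable (\<lambda>x. cnj (nderiv (j + 2) u x))"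
    using hsob_square_integrable[OF u] j by (auto intro: square_integrable_cnj simp del: funpow.simps)
  have "complex_of_real ((L2_norm (nderiv (Suc j) u))\<^sup>2) = - (LINT x|lborel. nderiv j u x * cnj (nderiv (j + 2) u x))"
    unfolding L2_norm_sq_complex using integral_by_parts_line[OF d(1) dc] unfolding v by simp
  then have "(L2_norm (nderiv (Suc j) u))\<^sup>2 = norm (LINT x|lborel. nderiv j u x * cnj (nderiv (j + 2) u x))"
    by (metis norm_minus_cancel norm_of_real abs_of_nonneg zero_le_power2)
  also have "\<dots> \<le> L2_norm (nderiv j u) * L2_norm (nderiv (j + 2) u)"
    using L2_pairing_le[OF s] by simp
  finally show ?thesis .
qed

lemma hnorm_interpolation:
  fixes \<eta> :: real
  assumes "\<eta> > 0"
  obtains C where "C \<ge> 0" "\<And>u. hsob (Suc m) u \<Longrightarrow> (hnorm m u)\<^sup>2 \<le> \<eta> * (L2_norm (nderiv (Suc m) u))\<^sup>2 + C * (L2_norm u)\<^sup>2"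
proof -
  \<comment> \<open>\<open>hnorm m\<close> has m + 1 summands, so its square costs a factor (m +
    1)^2, which is divided out in advance.\<close>
  have e: "\<eta> / real (Suc m)^2 > 0" using assms by simp
  obtain C where C: "C \<ge> 0" "\<And>a::nat\<Rightarrow>real. (\<forall>j. 0 \<le> a j) \<Longrightarrow> (\<forall>j. j + 2 \<le> Suc m \<longrightarrow> (a (Suc j))\<^sup>2 \<le> a j * a (j + 2)) \<Longrightarrow>
     (\<forall>j<Suc m. (a j)\<^sup>2 \<le> \<eta> / real (Suc m)^2 * (a (Suc m))\<^sup>2 + C * (a 0)\<^sup>2)"
    using log_convex_interpolation[OF e, of "Suc m"] by blast
  show ?thesis
  proof (rule that[of "real (Suc m)^2 * C"])
    fix u assume u: "hsob (Suc m) u"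
    let ?a = "\<lambda>j. L2_norm (nderiv j u)"
    let ?r = "sqrt (\<eta> / real (Suc m)^2 * (?a (Suc m))\<^sup>2 + C * (?a 0)\<^sup>2)"
    have "\<forall>j<Suc m. (?a j)\<^sup>2 \<le> \<eta> / real (Suc m)^2 * (?a (Suc m))\<^sup>2 + C * (?a 0)\<^sup>2"
      by (rule C(2)[of ?a]) (use L2_norm_nderiv_log_convex[OF u] in auto)
    then have "?a j \<le> ?r" if "j \<le> m" for j using that by (intro real_le_rsqrt) auto
    then have "hnorm m u \<le> (\<Sum>j\<le>m. ?r)" unfolding hnorm_def by (intro sum_mono) auto
    then have "hnorm m u \<le> real (Suc m) * ?r" by simp
    then have "(hnorm m u)\<^sup>2 \<le> (real (Suc m) * ?r)\<^sup>2" by (rule power_mono) simp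
    also have "\<dots> = real (Suc m)^2 * (\<eta> / real (Suc m)^2 * (?a (Suc m))\<^sup>2 + C * (?a 0)\<^sup>2)"
      using assms C(1) by (simp only: power_mult_distrib) (subst real_sqrt_pow2, auto)
    also have "\<dots> = \<eta> * (?a (Suc m))\<^sup>2 + real (Suc m)^2 * C * (L2_norm u)\<^sup>2"
      by (simp add: field_simps del: of_nat_Suc)
    finally show "(hnorm m u)\<^sup>2 \<le> \<eta> * (L2_norm (nderiv (Suc m) u))\<^sup>2 + real (Suc m)^2 * C * (L2_norm u)\<^sup>2" .
  qed (use C in auto)
qed

section \<open>Continuous representatives of Sobolev functions\<close>

text \<open>Fatou applied to the tails of the sequence bounds the L2 norm of the difference of the
  two limits by every positive number.\<close>

lemma L2_limit_AE_eq:
  fixes U :: "nat \<Rightarrow> real \<Rightarrow> 'a::euclidean_space"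
  assumes U: "\<And>n. square_integrable (U n)" and a: "square_integrable a"
    and lim: "(\<lambda>n. L2_norm (\<lambda>x. U n x - a x)) \<longlonglongrightarrow> 0"
    and b: "b \<in> borel_measurable borel" and pt: "AE x in lborel. (\<lambda>n. U n x) \<longlonglongrightarrow> b x"
  shows "AE x in lborel. b x = a x"
proof -
  have m: "(\<lambda>x. b x - a x) \<in> borel_measurable borel"
    using b square_integrable_measurable[OF a] by simp
  have B: "square_integrable (\<lambda>x. b x - a x) \<and> L2_norm (\<lambda>x. b x - a x) \<le> e" if "e > 0" for e
  proof -
    have "\<forall>\<^sub>F n in sequentially. L2_norm (\<lambda>x. U n x - a x) < e"
      using order_tendstoD(2)[OF lim that] .
    then obtain N where N: "\<And>n. n \<ge> N \<Longrightarrow> L2_norm (\<lambda>x. U n x - a x) < e"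
      unfolding eventually_sequentially by blast
    have 1: "AE x in lborel. (\<lambda>n. U (n + N) x - a x) \<longlonglongrightarrow> b x - a x"
      using pt by eventually_elim (intro tendsto_intros LIMSEQ_ignore_initial_segment)
    have 2: "L2_norm (\<lambda>x. U (n + N) x - a x) \<le> e" for n using N[of "n + N"] by simp
    show ?thesis
      using square_integrable_Fatou[OF square_integrable_diff[OF U a] 2 m 1]
        L2_norm_Fatou[OF square_integrable_diff[OF U a] 2 m 1] by simp
  qed
  have "L2_norm (\<lambda>x. b x - a x) = 0"
    by (rule antisym[OF field_le_epsilon]) (use B in auto)
  then have "AE x in lborel. b x - a x = 0"
    using B[of 1] by (intro L2_norm_eq_0_imp_AE) auto
  then show ?thesis by eventually_elim simp
qed

lemma
  assumes u: "sobolev k u"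
  shows hsob_mollify_sobolev: "hsob m (mollify n u)"
    and nderiv_mollify_sobolev: "j \<le> k \<Longrightarrow> nderiv j (mollify n u) = mollify n (weak_deriv j u)"
proof -
  have su: "square_integrable u" using u by (simp add: sobolev_def)
  note lu = square_integrable_imp_locally_integrable[OF su]
  show "hsob m (mollify n u)"
    unfolding hsob_def nderiv_conv[OF mollifier_test lu]
    using diffk_conv[OF mollifier_test lu] square_integrable_conv[OF test_function_nderiv[OF mollifier_test] su] by blast
  show "j \<le> k \<Longrightarrow> nderiv j (mollify n u) = mollify n (weak_deriv j u)"
    unfolding nderiv_conv[OF mollifier_test lu]
    using conv_nderiv_weak[OF mollifier_test sobolev_has_weak_deriv[OF u]] by blast
qed

lemma hnorm_mollify_le:
  assumes u: "sobolev k u"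
  shows "hnorm k (mollify n u) \<le> (\<Sum>i\<le>k. L2_norm (weak_deriv i u))"
  unfolding hnorm_def
  using nderiv_mollify_sobolev[OF u] L2_norm_mollify[OF sobolev_square_integrable[OF u]]
  by (intro sum_mono) auto

lemma mollify_hnorm_Cauchy:
  assumes u: "sobolev k u" and e: "e > 0"
  shows "\<exists>N. \<forall>n\<ge>N. \<forall>p\<ge>N. hnorm k (\<lambda>x. mollify n u x - mollify p u x) < e"
proof -
  let ?d = "\<lambda>n. \<Sum>i\<le>k. L2_norm (\<lambda>x. mollify n (weak_deriv i u) x - weak_deriv i u x)"
  have "?d \<longlonglongrightarrow> (\<Sum>i\<le>k. 0)"
    using mollify_tendsto_L2[OF sobolev_square_integrable[OF u]] by (intro tendsto_sum) auto
  then have "\<forall>\<^sub>F n in sequentially. ?d n < e / 2" using e by (intro order_tendstoD(2)) auto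
  then obtain N where N: "\<And>n. n \<ge> N \<Longrightarrow> ?d n < e / 2" unfolding eventually_sequentially by blast
  have "hnorm k (\<lambda>x. mollify n u x - mollify p u x) < e" if "n \<ge> N" "p \<ge> N" for n p
  proof -
    have "hnorm k (\<lambda>x. mollify n u x - mollify p u x) \<le> ?d n + ?d p"
      unfolding hnorm_def sum.distrib[symmetric]
    proof (rule sum_mono)
      fix i assume "i \<in> {..k}"
      then have i: "i \<le> k" by simp
      note s = sobolev_square_integrable[OF u i]
      have "nderiv i (\<lambda>x. mollify n u x - mollify p u x) = (\<lambda>x. mollify n (weak_deriv i u) x - mollify p (weak_deriv i u) x)"
        using nderiv_diff[OF hsob_imp_diffk[OF hsob_mollify_sobolev[OF u, of k n]] hsob_imp_diffk[OF hsob_mollify_sobolev[OF u, of k p]] i]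
          nderiv_mollify_sobolev[OF u i] by simp
      then show "L2_norm (nderiv i (\<lambda>x. mollify n u x - mollify p u x))
         \<le> L2_norm (\<lambda>x. mollify n (weak_deriv i u) x - weak_deriv i u x) + L2_norm (\<lambda>x. mollify p (weak_deriv i u) x - weak_deriv i u x)"
        using L2_norm_triangle_mid[OF square_integrable_mollify[OF s, of n] s square_integrable_mollify[OF s, of p]]
          L2_norm_commute[of "weak_deriv i u" "mollify p (weak_deriv i u)"] by simp
    qed
    then show ?thesis using N[OF that(1)] N[OF that(2)] by linarith
  qed
  then show ?thesis by blast
qed

text \<open>One spare derivative turns H^(m+1) convergence of the mollifications into uniform
  convergence of their derivatives up to order \<open>m\<close>. The uniform limits differentiate
  into each other and agree with the weak derivatives almost everywhere, because the same
  mollifications converge to those in L2.\<close>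

lemma sobolev_representative:
  fixes u :: "real \<Rightarrow> complex"
  assumes u: "sobolev (Suc m) u"
  obtains w where "hsob m w" "\<And>j. j \<le> m \<Longrightarrow> AE x in lborel. nderiv j w x = weak_deriv j u x"
    "AE x in lborel. w x = u x"
    "\<And>j. j \<le> m \<Longrightarrow> L2_norm (nderiv j w) = L2_norm (weak_deriv j u)"
    "cbd m w (\<Sum>i\<le>Suc m. L2_norm (weak_deriv i u))"
proof -
  let ?S = "\<Sum>i\<le>Suc m. L2_norm (weak_deriv i u)"
  define U where "U = (\<lambda>n j. nderiv j (mollify n u))"
  note h = hsob_mollify_sobolev[OF u]
  have unif: "\<exists>N. \<forall>n\<ge>N. \<forall>p\<ge>N. \<forall>x. norm (U n j x - U p j x) < e" if j: "j \<le> m" and e: "e > 0" for j e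
  proof -
    obtain N where N: "\<And>n p. n \<ge> N \<Longrightarrow> p \<ge> N \<Longrightarrow> hnorm (Suc m) (\<lambda>x. mollify n u x - mollify p u x) < e"
      using mollify_hnorm_Cauchy[OF u e] by blast
    have "norm (U n j x - U p j x) < e" if np: "n \<ge> N" "p \<ge> N" for n p x
    proof -
      have "norm (nderiv j (\<lambda>x. mollify n u x - mollify p u x) x) \<le> hnorm (Suc m) (\<lambda>x. mollify n u x - mollify p u x)"
        using \<open>j \<le> m\<close> by (intro hsob_sup_bound hsob_diff h) auto
      then show ?thesis
        using nderiv_diff[OF hsob_imp_diffk[OF h[of "Suc m" n]] hsob_imp_diffk[OF h[of "Suc m" p]], of j]
          N[OF np] \<open>j \<le> m\<close> by (simp add: U_def)
    qed
    then show ?thesis by blast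
  qed
  have "uniformly_Cauchy_on UNIV (\<lambda>n. U n j)" if "j \<le> m" for j
    unfolding uniformly_Cauchy_on_def using unif[OF that] by (auto simp: dist_norm) metis
  then have "\<exists>W. uniform_limit UNIV (\<lambda>n. U n j) W sequentially" if "j \<le> m" for j
    using that Cauchy_uniformly_convergent uniformly_convergent_on_def by metis
  then obtain W where W: "\<And>j. j \<le> m \<Longrightarrow> uniform_limit UNIV (\<lambda>n. U n j) (W j) sequentially"
    by metis
  have lim: "(\<lambda>n. U n j x) \<longlonglongrightarrow> W j x" if "j \<le> m" for j x
    using tendsto_uniform_limitI[OF W[OF that]] by simp
  have Uc: "continuous_on UNIV (U n j)" for n j
    unfolding U_def using diffk_continuous_nderiv[OF hsob_imp_diffk[OF h[of j n]]] by blast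
  have Wc: "continuous_on UNIV (W j)" if "j \<le> m" for j
    by (rule uniform_limit_theorem[OF _ W[OF that]]) (simp_all add: Uc)
  \<comment> \<open>Uniform convergence of the derivatives lets differentiation pass to the limit;
    uniqueness of limits identifies the resulting primitive with \<open>W j\<close>.\<close>
  have Wd: "(W j has_vector_derivative W (Suc j) x) (at x)" if "j < m" for j x
  proof -
    have "\<exists>g. \<forall>x\<in>UNIV. (\<lambda>n. U n j x) \<longlonglongrightarrow> g x \<and> (g has_derivative (\<lambda>h. h *\<^sub>R W (Suc j) x)) (at x within UNIV)"
    proof (rule has_derivative_sequence[where f' = "\<lambda>n x h. h *\<^sub>R U n (Suc j) x"])
      show "(U n j has_derivative (\<lambda>h. h *\<^sub>R U n (Suc j) x)) (at x within UNIV)" for n x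
        using diffk_has_vector_derivative[OF hsob_imp_diffk[OF h[of "Suc j" n]], of j x] 
        by (simp add: U_def has_vector_derivative_def)
      show "(\<lambda>n. U n j 0) \<longlonglongrightarrow> W j 0" using lim that by simp
      fix e :: real assume "e > 0"
      with W[of "Suc j"] that have "\<forall>\<^sub>F n in sequentially. \<forall>x\<in>UNIV. dist (U n (Suc j) x) (W (Suc j) x) < e"
        by (auto simp: uniform_limit_iff)
      then show "\<forall>\<^sub>F n in sequentially. \<forall>x\<in>UNIV. \<forall>h. norm (h *\<^sub>R U n (Suc j) x - h *\<^sub>R W (Suc j) x) \<le> e * norm h"
      proof eventually_elim
        case (elim n)
        then have "norm (U n (Suc j) x - W (Suc j) x) \<le> e" for x by (simp add: dist_norm less_imp_le)
        then have "norm h * norm (U n (Suc j) x - W (Suc j) x) \<le> norm h * e" for x and h :: real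
          by (rule mult_left_mono) auto
        then show ?case by (simp add: mult.commute flip: scaleR_diff_right)
      qed
    qed auto
    then obtain g where g: "\<And>x. (\<lambda>n. U n j x) \<longlonglongrightarrow> g x" "\<And>x. (g has_derivative (\<lambda>h. h *\<^sub>R W (Suc j) x)) (at x)"
      by auto
    have "g = W j" using LIMSEQ_unique[OF g(1) lim] that by auto
    then show ?thesis using g(2) by (simp add: has_vector_derivative_def)
  qed
  have D: "diffk m (W 0)" by (rule diffkI[of m W]) (use Wd Wc in auto)
  have N: "nderiv j (W 0) = W j" if "j \<le> m" for j by (rule nderiv_eqI[of m W]) (use Wd Wc that in auto)
  have Umol: "U n j = mollify n (weak_deriv j u)" if "j \<le> m" for n j
    unfolding U_def using nderiv_mollify_sobolev[OF u] that by simp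
  have AEj: "AE x in lborel. W j x = weak_deriv j u x" if "j \<le> m" for j
  proof (rule L2_limit_AE_eq[where U="\<lambda>n. U n j"])
    show s: "square_integrable (weak_deriv j u)" using sobolev_square_integrable[OF u] that by simp
    show "square_integrable (U n j)" for n
      unfolding Umol[OF that] by (rule square_integrable_mollify[OF s])
    show "(\<lambda>n. L2_norm (\<lambda>x. U n j x - weak_deriv j u x)) \<longlonglongrightarrow> 0"
      unfolding Umol[OF that] by (rule mollify_tendsto_L2[OF s])
    show "W j \<in> borel_measurable borel" by (rule borel_measurable_continuous_onI[OF Wc[OF that]])
    show "AE x in lborel. (\<lambda>n. U n j x) \<longlonglongrightarrow> W j x" using lim[OF that] by simp
  qed
  have bd: "norm (W j x) \<le> ?S" if "j \<le> m" for j x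
  proof (rule LIMSEQ_le_const2[OF tendsto_norm[OF lim[OF that, of x]]], intro exI allI impI)
    fix n
    have "norm (U n j x) \<le> hnorm (Suc m) (mollify n u)"
      unfolding U_def using hsob_sup_bound[OF h[of "Suc m" n]] that by simp
    then show "norm (U n j x) \<le> ?S" using hnorm_mollify_le[OF u, of n] by linarith
  qed
  have Wm: "W j \<in> borel_measurable borel" if "j \<le> m" for j
    by (rule borel_measurable_continuous_onI[OF Wc[OF that]])
  have sW: "square_integrable (W j)" if "j \<le> m" for j
    by (rule square_integrable_cong_AE[OF sobolev_square_integrable[OF u] Wm AEj]) (use that in auto)
  show ?thesis
  proof (rule that[of "W 0"])
    show "hsob m (W 0)" using D N sW by (simp add: hsob_def)
    show "\<And>j. j \<le> m \<Longrightarrow> AE x in lborel. nderiv j (W 0) x = weak_deriv j u x" using N AEj by simp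
    show "AE x in lborel. W 0 x = u x"
      using AEj[OF le0] L2_weak_deriv_0(2)[OF u] by eventually_elim simp
    show "cbd m (W 0) ?S" using D N bd by (simp add: cbd_def)
    show "L2_norm (nderiv j (W 0)) = L2_norm (weak_deriv j u)" if "j \<le> m" for j
      unfolding N[OF that] using that
      by (intro L2_norm_cong_AE AEj Wm square_integrable_measurable[OF sobolev_square_integrable[OF u]]) auto
  qed
qed

text \<open>Upgrades almost-everywhere relations between continuous functions to everywhere, since a
  nonempty open set is not null.\<close>

lemma AE_lborel_closed_imp_UNIV:
  fixes S :: "real set"
  assumes "closed S" "AE x in lborel. x \<in> S"
  shows "S = UNIV"
proof (rule ccontr)
  assume "S \<noteq> UNIV"
  then have "\<not> negligible (- S)" using assms(1) by (intro open_not_negligible) auto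
  moreover have "AE x in lebesgue. x \<notin> - S" using AE_completion[OF assms(2)] by simp
  moreover have "- S \<in> sets lebesgue" using assms(1) by (auto intro: borel_open)
  ultimately show False using AE_iff_null_sets[of "- S" lebesgue] negligible_iff_null_sets by blast
qed

lemma AE_lborel_imp_negligible:
  assumes "AE x in lborel. P (x::real)"
  shows "negligible {x. \<not> P x}"
proof -
  have "AE x in lebesgue. P x" by (rule AE_completion[OF assms])
  then show ?thesis by (simp add: eventually_ae_filter negligible_iff_null_sets)
     (metis negligible_iff_null_sets negligible_subset)
qed

text \<open>The gauge integral recovers \<open>f\<close> from its derivative without any
  integrability assumption and ignores null sets, so \<open>f\<close> is a primitive of the
  continuous function \<open>g\<close>, and \<open>f'\<close> is \<open>g\<close> at every point.
  Thus an everywhere-defined derivative cannot differ from its continuous representative.\<close>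

lemma derivative_eq_continuous_AE:
  fixes f :: "real \<Rightarrow> real"
  assumes f: "\<And>x. (f has_real_derivative f' x) (at x)" and g: "continuous_on UNIV g"
    and ae: "AE x in lborel. f' x = g x"
  shows "f' = g"
proof
  fix x
  have neg: "negligible {x. \<not> f' x = g x}" by (rule AE_lborel_imp_negligible[OF ae])
  have I: "integral {x - 1..y} g = f y - f (x - 1)" if "x - 1 \<le> y" for y
  proof (rule integral_unique, rule has_integral_spike[OF neg])
    show "(f' has_integral f y - f (x - 1)) {x - 1..y}"
      using that f
      by (intro fundamental_theorem_of_calculus) 
         (auto simp: has_real_derivative_iff_has_vector_derivative[symmetric] intro: has_field_derivative_at_within)
  qed auto
  have "((\<lambda>y. integral {x - 1..y} g) has_real_derivative g x) (at x within {x - 1..x + 1})"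
    by (rule integral_has_real_derivative) (use continuous_on_subset[OF g] in auto)
  then have "((\<lambda>y. f y - f (x - 1)) has_real_derivative g x) (at x within {x - 1..x + 1})"
    by (rule has_field_derivative_transform_within[where d = 1]) (use I in auto)
  then have "((\<lambda>y. f y - f (x - 1)) has_real_derivative g x) (at x)"
    by (simp add: at_within_Icc_at)
  moreover have "((\<lambda>y. f y - f (x - 1)) has_real_derivative f' x) (at x)"
    by (auto intro!: derivative_eq_intros f)
  ultimately show "f' x = g x" by (rule DERIV_unique[rotated])
qed


section \<open>Composition with a modulated variable\<close>

lemma periodic_continuous_bounded:
  fixes f :: "real \<Rightarrow> complex"
  assumes "continuous_on UNIV f" "T > 0" "\<And>x. f (x + T) = f x"
  shows "\<exists>B. \<forall>x. norm (f x) \<le> B"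
proof -
  have "compact (f ` {0..T})"
    by (intro compact_continuous_image continuous_on_subset[OF assms(1)]) auto
  then obtain B where B: "\<forall>y\<in>f ` {0..T}. norm y \<le> B"
    using compact_imp_bounded bounded_pos by metis
  have n: "f (x + real n * T) = f x" for x n
  proof (induction n)
    case (Suc n)
    have "f (x + real (Suc n) * T) = f ((x + real n * T) + T)" by (simp add: algebra_simps)
    then show ?case using assms(3) Suc by simp
  qed simp
  have i: "f (x + of_int m * T) = f x" for x m
  proof (cases m)
    case (neg j)
    have "f (x + of_int m * T + real (Suc j) * T) = f (x + of_int m * T)" by (rule n)
    moreover have "of_int m = - real (Suc j)" using neg by simp
    then have "x + of_int m * T + real (Suc j) * T = x" by (simp only: minus_mult_left)
    ultimately show ?thesis by metis
  qed (use n in simp)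
  have "norm (f x) \<le> B" for x
  proof -
    define m where "m = - \<lfloor>x / T\<rfloor>"
    have "x + of_int m * T = T * frac (x / T)" 
      using assms(2) by (simp add: m_def frac_def field_simps)
    then have "x + of_int m * T \<in> {0..T}"
      using assms(2) frac_lt_1[of "x / T"] frac_ge_0[of "x/T"] by auto
    then have "norm (f (x + of_int m * T)) \<le> B" using B by blast
    then show ?thesis by (simp only: i)
  qed
  then show ?thesis by blast
qed

definition bounded_smooth :: "(real \<Rightarrow> complex) \<Rightarrow> bool" where
  "bounded_smooth f \<longleftrightarrow> (\<forall>m. \<exists>B. cbd m f B)"

lemma bounded_smooth_vderiv: "bounded_smooth f \<Longrightarrow> bounded_smooth (vderiv f)"
  unfolding bounded_smooth_def using cbd_vderiv by blast

lemma bounded_smooth_has_vector_derivative: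
  "bounded_smooth f \<Longrightarrow> (f has_vector_derivative vderiv f x) (at x)"
  unfolding bounded_smooth_def cbd_def using diffk_Suc_iff by metis

lemma bounded_smooth_bound:
  assumes "bounded_smooth f" obtains B where "B > 0" "\<And>x. norm (f x) \<le> B"
proof -
  obtain B where B: "cbd 0 f B" using assms by (auto simp: bounded_smooth_def)
  then have "norm (f x) \<le> B + 1" for x using cbd_bound[OF B, of x] by simp
  then show ?thesis using that[of "B + 1"] cbd_nonneg[OF B] by auto
qed

lemma periodic_smooth_imp_bounded_smooth:
  assumes "smooth f" "T > 0" "\<And>x. f (x + T) = f x"
  shows "bounded_smooth f"
  unfolding bounded_smooth_def
proof
  fix m
  have d: "diffk j f" for j using assms(1) by (simp add: smooth_iff_diffk)
  have p: "nderiv j f (x + T) = nderiv j f x" for j x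
  proof -
    have "(\<lambda>x. f (T + 1 * x)) = f" using assms(3) by (simp add: add.commute)
    then have "nderiv j f = (\<lambda>x. nderiv j f (T + 1 * x))"
      using nderiv_affine[OF d[of j], of j T 1] by simp
    then show ?thesis by (metis add.commute mult_1)
  qed
  have "\<exists>B. \<forall>x. norm (nderiv j f x) \<le> B" for j
    by (rule periodic_continuous_bounded[of "nderiv j f" T]) (use diffk_continuous_nderiv[OF d, of j j] assms(2) p in auto)
  then obtain B where B: "\<And>j x. norm (nderiv j f x) \<le> B j" by metis
  have "norm (nderiv j f x) \<le> (\<Sum>i\<le>m. B i)" if "j \<le> m" for j x
  proof -
    have "0 \<le> B i" for i using B[of i 0] norm_ge_zero order_trans by blast
    then have "B j \<le> (\<Sum>i\<le>m. B i)" using that by (intro member_le_sum) auto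
    then show ?thesis using B[of j x] by linarith
  qed
  then show "\<exists>B. cbd m f B" using d by (auto simp: cbd_def)
qed

lemma modulated_has_vector_derivative:
  assumes f: "bounded_smooth f" and g: "(\<gamma> has_real_derivative g) (at x)"
  shows "((\<lambda>x. f (x - \<gamma> x)) has_vector_derivative vderiv f (x - \<gamma> x) * (1 - complex_of_real g)) (at x)"
proof -
  have 1: "((\<lambda>x. x - \<gamma> x) has_vector_derivative (1 - g)) (at x)"
    unfolding has_real_derivative_iff_has_vector_derivative[symmetric]
    by (auto intro!: derivative_eq_intros g)
  have "((f \<circ> (\<lambda>x. x - \<gamma> x)) has_vector_derivative (1 - g) *\<^sub>R vderiv f (x - \<gamma> x)) (at x)"
    by (rule vector_diff_chain_at[OF 1 bounded_smooth_has_vector_derivative[OF f]])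
  then show ?thesis by (simp add: o_def scaleR_conv_of_real mult.commute)
qed

text \<open>The bound is quantified before the phase: the derivative of f(x - \<gamma>) is f'(x -
  \<gamma>)(1 - \<gamma>_x), so only the bound 2 for 1 - \<gamma>_x enters the induction, never the
  size of \<gamma> itself.\<close>

lemma cbd_modulated:
  assumes "bounded_smooth f"
  shows "\<exists>B. \<forall>\<gamma> g. (\<forall>x. (\<gamma> has_real_derivative g x) (at x)) \<longrightarrow> cbd m (\<lambda>x. 1 - complex_of_real (g x)) 2
     \<longrightarrow> cbd m (\<lambda>x. f (x - \<gamma> x)) B"
  using assms
proof (induction m arbitrary: f)
  case 0
  obtain B where B: "\<And>x. norm (f x) \<le> B" using bounded_smooth_bound[OF 0] by metis
  have "cbd 0 (\<lambda>x. f (x - \<gamma> x)) B" if "\<forall>x. (\<gamma> has_real_derivative g x) (at x)" for \<gamma> g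
  proof -
    have "isCont (\<lambda>x. f (x - \<gamma> x)) x" for x
      using has_vector_derivative_continuous[OF modulated_has_vector_derivative[OF 0 that[rule_format]]] .
    then show ?thesis using B by (auto simp: cbd_def intro!: continuous_at_imp_continuous_on)
  qed
  then show ?case by blast
next
  case (Suc m)
  obtain B0 where B0: "B0 > 0" "\<And>x. norm (f x) \<le> B0" using bounded_smooth_bound[OF Suc.prems] by metis
  obtain B where B: "\<And>\<gamma> g. \<forall>x. (\<gamma> has_real_derivative g x) (at x) \<Longrightarrow> cbd m (\<lambda>x. 1 - complex_of_real (g x)) 2
     \<Longrightarrow> cbd m (\<lambda>x. vderiv f (x - \<gamma> x)) B"
    using Suc.IH[OF bounded_smooth_vderiv[OF Suc.prems]] by blast
  show ?case
  proof (intro exI[of _ "max B0 (2 ^ m * (B * 2))"] allI impI)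
    fix \<gamma> g assume a: "\<forall>x. (\<gamma> has_real_derivative g x) (at x)" "cbd (Suc m) (\<lambda>x. 1 - complex_of_real (g x)) 2"
    have c: "cbd m (\<lambda>x. 1 - complex_of_real (g x)) 2" by (rule cbd_mono[OF a(2)]) auto
    show "cbd (Suc m) (\<lambda>x. f (x - \<gamma> x)) (max B0 (2 ^ m * (B * 2)))"
    proof (rule cbd_SucI)
      show "((\<lambda>x. f (x - \<gamma> x)) has_vector_derivative vderiv f (x - \<gamma> x) * (1 - complex_of_real (g x))) (at x)" for x
        using modulated_has_vector_derivative[OF Suc.prems] a(1) by blast
      show "cbd m (\<lambda>x. vderiv f (x - \<gamma> x) * (1 - complex_of_real (g x))) (max B0 (2 ^ m * (B * 2)))"
        by (rule cbd_mono[OF cbd_mult[OF B[OF a(1) c] c]]) auto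
    qed (use B0(2) in \<open>auto simp: le_max_iff_disj\<close>)
  qed
qed


section \<open>Bounds for time derivatives\<close>

text \<open>The exceptional null set in the hypothesis may depend on time. Fubini exchanges the
  quantifiers: for almost every x the bound holds at almost every time, and integrating in time
  gives the Lipschitz bound for such x. Continuity of \<gamma> in x extends it to all x, and
  difference quotients then bound \<gamma>t everywhere. Fubini needs joint measurability, which
  occupies the first half of the proof.\<close>

lemma time_derivative_bound:
  fixes \<gamma> \<gamma>t :: "real \<Rightarrow> real \<Rightarrow> real"
  assumes t: "t > 0"
    and d: "\<And>s x. s \<in> {0..t} \<Longrightarrow> ((\<lambda>r. \<gamma> r x) has_real_derivative \<gamma>t s x) (at s within {0..t})"
    and c: "\<And>s. s \<in> {0..t} \<Longrightarrow> continuous_on UNIV (\<gamma> s)"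
    and M: "\<And>s. s \<in> {0..t} \<Longrightarrow> AE x in lborel. \<bar>\<gamma>t s x\<bar> \<le> M"
  shows time_lipschitz_bound: "a \<in> {0..t} \<Longrightarrow> b \<in> {0..t} \<Longrightarrow> \<bar>\<gamma> b x - \<gamma> a x\<bar> \<le> M * \<bar>b - a\<bar>"
    and time_derivative_bound_everywhere: "s \<in> {0..t} \<Longrightarrow> \<bar>\<gamma>t s x\<bar> \<le> M"
proof -
  \<comment> \<open>Clamping time to [0, t] extends \<gamma> to the whole plane.\<close>
  define cl where "cl = (\<lambda>r. max 0 (min t r))"
  have cl: "cl r \<in> {0..t}" for r using t by (auto simp: cl_def)
  have cl_id: "cl r = r" if "r \<in> {0..t}" for r using that by (auto simp: cl_def)
  have ccl: "continuous_on UNIV cl" unfolding cl_def by (intro continuous_intros)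
  define \<Gamma> where "\<Gamma> = (\<lambda>p::real\<times>real. \<gamma> (cl (fst p)) (snd p))"
  have cont_t: "continuous_on {0..t} (\<lambda>r. \<gamma> r x)" for x
    by (auto simp: continuous_on_eq_continuous_within intro: DERIV_continuous d)
  have [measurable]: "\<Gamma> \<in> borel_measurable (lborel \<Otimes>\<^sub>M lborel)"
  proof (rule borel_measurable_LIMSEQ_real)
    \<comment> \<open>Continuity in each variable separately implies joint measurability: with time
      rounded down to a grid, only countably many continuous functions of x occur.\<close>
    define G where "G = (\<lambda>n (p::real\<times>real). \<gamma> (cl (of_int \<lfloor>real (Suc n) * fst p\<rfloor> / real (Suc n))) (snd p))"
    show "G n \<in> borel_measurable (lborel \<Otimes>\<^sub>M lborel)" for n
      unfolding G_def
    proof (rule measurable_compose_countable[where f = "\<lambda>i p. \<gamma> (cl (of_int i / real (Suc n))) (snd p)" and g="\<lambda>p. \<lfloor>real (Suc n) * fst p\<rfloor>"])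
      show "(\<lambda>p. \<gamma> (cl (of_int i / real (Suc n))) (snd p)) \<in> borel_measurable (lborel \<Otimes>\<^sub>M lborel)" for i
        by (rule measurable_compose[OF measurable_snd]) (simp add: borel_measurable_continuous_onI[OF c[OF cl]])
    qed measurable
    fix p :: "real \<times> real"
    have "(\<lambda>n. of_int \<lfloor>real (Suc n) * fst p\<rfloor> / real (Suc n)) \<longlonglongrightarrow> fst p"
    proof (rule tendsto_sandwich)
      show "\<forall>\<^sub>F n in sequentially. fst p - 1 / real (Suc n) \<le> of_int \<lfloor>real (Suc n) * fst p\<rfloor> / real (Suc n)"
      proof (rule always_eventually, rule allI)
        fix n
        have "real (Suc n) * fst p - 1 \<le> of_int \<lfloor>real (Suc n) * fst p\<rfloor>" by linarith
        then have "(real (Suc n) * fst p - 1) / real (Suc n) \<le> of_int \<lfloor>real (Suc n) * fst p\<rfloor> / real (Suc n)"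
          by (intro divide_right_mono) auto
        then show "fst p - 1 / real (Suc n) \<le> of_int \<lfloor>real (Suc n) * fst p\<rfloor> / real (Suc n)"
          by (simp add: diff_divide_distrib del: of_nat_Suc)
      qed
      show "\<forall>\<^sub>F n in sequentially. of_int \<lfloor>real (Suc n) * fst p\<rfloor> / real (Suc n) \<le> fst p"
      proof (rule always_eventually, rule allI)
        fix n
        have "of_int \<lfloor>real (Suc n) * fst p\<rfloor> / real (Suc n) \<le> (real (Suc n) * fst p) / real (Suc n)"
          by (intro divide_right_mono) auto
        then show "of_int \<lfloor>real (Suc n) * fst p\<rfloor> / real (Suc n) \<le> fst p" by (simp del: of_nat_Suc)
      qed
      show "(\<lambda>n. fst p - 1 / real (Suc n)) \<longlonglongrightarrow> fst p"
        using tendsto_diff[OF tendsto_const[of "fst p"] LIMSEQ_inverse_real_of_nat] by (simp add: inverse_eq_divide)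
    qed auto
    then have "(\<lambda>n. cl (of_int \<lfloor>real (Suc n) * fst p\<rfloor> / real (Suc n))) \<longlonglongrightarrow> cl (fst p)"
      by (rule continuous_on_tendsto_compose[OF ccl]) auto
    then show "(\<lambda>n. G n p) \<longlonglongrightarrow> \<Gamma> p"
      unfolding G_def \<Gamma>_def by (rule continuous_on_tendsto_compose[OF cont_t]) (use cl in auto)
  qed
  \<comment> \<open>Forward difference quotients in time. Their limit is a jointly measurable
    function that equals \<gamma>t for times before \<open>t\<close>, where the quotients stay
    inside the interval.\<close>
  define D where "D = (\<lambda>n (p::real\<times>real). (\<Gamma> (fst p + 1 / real (Suc n), snd p) - \<Gamma> p) * real (Suc n))"
  have [measurable]: "D n \<in> borel_measurable (lborel \<Otimes>\<^sub>M lborel)" for n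
  proof -
    have "(\<lambda>p. \<Gamma> (fst p + 1 / real (Suc n), snd p)) \<in> borel_measurable (lborel \<Otimes>\<^sub>M lborel)"
      by (rule measurable_compose[where g = \<Gamma> and N = "lborel \<Otimes>\<^sub>M lborel"]) measurable
    then show ?thesis unfolding D_def by measurable
  qed
  define h where "h = (\<lambda>p. lim (\<lambda>n. D n p))"
  have [measurable]: "h \<in> borel_measurable (lborel \<Otimes>\<^sub>M lborel)"
    unfolding h_def by (rule borel_measurable_lim_metric) measurable
  have h: "h (r, x) = \<gamma>t r x" if r: "0 \<le> r" "r < t" for r x
  proof -
    have "((\<lambda>y. (\<gamma> y x - \<gamma> r x) / (y - r)) \<longlongrightarrow> \<gamma>t r x) (at r within {0..t})"
      using d[of r x] r by (simp add: has_field_derivative_iff)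
    moreover have "filterlim (\<lambda>n. r + 1 / real (Suc n)) (at r within {0..t}) sequentially"
      unfolding filterlim_at
    proof
      obtain N where N: "1 / real (Suc N) < t - r" using r nat_approx_posE[of "t - r"] by auto
      show "\<forall>\<^sub>F n in sequentially. r + 1 / real (Suc n) \<in> {0..t} \<and> r + 1 / real (Suc n) \<noteq> r"
        using eventually_ge_at_top[of N]
      proof eventually_elim
        case (elim n)
        then have "1 / real (Suc n) \<le> 1 / real (Suc N)" by (intro divide_left_mono) auto
        then show ?case using N r by (auto simp del: of_nat_Suc)
      qed
      show "(\<lambda>n. r + 1 / real (Suc n)) \<longlonglongrightarrow> r"
        using tendsto_add[OF tendsto_const[of r] LIMSEQ_inverse_real_of_nat] by (simp add: inverse_eq_divide)
    qed
    ultimately have "(\<lambda>n. (\<gamma> (r + 1 / real (Suc n)) x - \<gamma> r x) / (r + 1 / real (Suc n) - r)) \<longlonglongrightarrow> \<gamma>t r x"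
      by (rule filterlim_compose)
    moreover obtain N where N: "1 / real (Suc N) < t - r" using r nat_approx_posE[of "t - r"] by auto
    then have "\<forall>\<^sub>F n in sequentially. (\<gamma> (r + 1 / real (Suc n)) x - \<gamma> r x) / (r + 1 / real (Suc n) - r) = D n (r, x)"
      using eventually_ge_at_top[of N]
    proof (elim eventually_rev_mp, intro always_eventually allI impI)
      fix n assume n: "N \<le> n"
      then have "1 / real (Suc n) \<le> 1 / real (Suc N)" by (intro divide_left_mono) auto
      then have "r + 1 / real (Suc n) \<in> {0..t}" using N r by (auto simp del: of_nat_Suc)
      then show "(\<gamma> (r + 1 / real (Suc n)) x - \<gamma> r x) / (r + 1 / real (Suc n) - r) = D n (r, x)"
        using r cl_id[of r] cl_id[of "r + 1 / real (Suc n)"] by (simp add: D_def \<Gamma>_def del: of_nat_Suc)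
    qed
    ultimately have "(\<lambda>n. D n (r, x)) \<longlonglongrightarrow> \<gamma>t r x" by (rule Lim_transform_eventually)
    then show ?thesis unfolding h_def by (rule limI)
  qed
  \<comment> \<open>The product-measurable \<open>h\<close> permits the exchange of the two
    almost-everywhere quantifiers.\<close>
  have "AE r in lborel. AE x in lborel. 0 \<le> r \<and> r < t \<longrightarrow> \<bar>h (r, x)\<bar> \<le> M"
  proof (rule AE_I2)
    fix r :: real
    show "AE x in lborel. 0 \<le> r \<and> r < t \<longrightarrow> \<bar>h (r, x)\<bar> \<le> M"
      using M[of r] h[of r] by (cases "0 \<le> r \<and> r < t") auto
  qed
  then have "AE x in lborel. AE r in lborel. 0 \<le> r \<and> r < t \<longrightarrow> \<bar>h (r, x)\<bar> \<le> M"
    by (subst (asm) lborel_pair.AE_commute) measurable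
  then have "AE x in lborel. \<forall>a\<in>{0..t}. \<forall>b\<in>{a..t}. \<bar>\<gamma> b x - \<gamma> a x\<bar> \<le> M * (b - a)"
  proof eventually_elim
    case (elim x)
    \<comment> \<open>The endpoint \<open>t\<close> joins the exceptional set because
      \<open>h\<close> represents \<gamma>t only before \<open>t\<close>.\<close>
    have neg: "negligible ({r. \<not> (0 \<le> r \<and> r < t \<longrightarrow> \<bar>h (r, x)\<bar> \<le> M)} \<union> {t})"
      by (intro negligible_Un AE_lborel_imp_negligible[OF elim]) auto
    have M0: "0 \<le> M"
    proof (rule ccontr)
      assume "\<not> 0 \<le> M"
      then have "AE x::real in lborel. x \<in> {}" using M[of 0] t by auto
      then show False using AE_lborel_closed_imp_UNIV[of "{}"] by auto
    qed
    show ?case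
    proof (intro ballI)
      fix a b assume ab: "a \<in> {0..t}" "b \<in> {a..t}"
      let ?q = "\<lambda>r. if \<bar>\<gamma>t r x\<bar> \<le> M then \<gamma>t r x else 0"
      have "((\<lambda>r. \<gamma>t r x) has_integral \<gamma> b x - \<gamma> a x) {a..b}"
      proof (rule fundamental_theorem_of_calculus)
        fix r assume "r \<in> {a..b}"
        then show "((\<lambda>r. \<gamma> r x) has_vector_derivative \<gamma>t r x) (at r within {a..b})"
          using d[of r x] ab 
          by (auto simp: has_real_derivative_iff_has_vector_derivative[symmetric] intro: DERIV_subset)
      qed (use ab in auto)
      then have "(?q has_integral \<gamma> b x - \<gamma> a x) {a..b}"
        by (rule has_integral_spike[OF neg, rotated]) (use h ab in auto)
      then have "norm (\<gamma> b x - \<gamma> a x) \<le> M * measure lborel (cbox a b)"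
        by (intro has_integral_bound[OF M0, of ?q]) (use M0 in auto)
      then show "\<bar>\<gamma> b x - \<gamma> a x\<bar> \<le> M * (b - a)" using ab by simp
    qed
  qed
  \<comment> \<open>For fixed a and b the set of admissible x is closed and of full measure, hence
    everything.\<close>
  then have "AE x in lborel. x \<in> {x. \<bar>\<gamma> b x - \<gamma> a x\<bar> \<le> M * (b - a)}" if "0 \<le> a" "a \<le> b" "b \<le> t" for a b
    by eventually_elim (use that in auto)
  moreover have "closed {x. \<bar>\<gamma> b x - \<gamma> a x\<bar> \<le> M * (b - a)}" if "0 \<le> a" "a \<le> b" "b \<le> t" for a b
    using that by (intro closed_Collect_le continuous_intros c) auto
  ultimately have le: "\<bar>\<gamma> b x - \<gamma> a x\<bar> \<le> M * (b - a)" if "0 \<le> a" "a \<le> b" "b \<le> t" for a b x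
    using AE_lborel_closed_imp_UNIV that by blast
  show lip: "\<bar>\<gamma> b x - \<gamma> a x\<bar> \<le> M * \<bar>b - a\<bar>" if "a \<in> {0..t}" "b \<in> {0..t}" for a b x
    using le[of a b x] le[of b a x] that by (cases "a \<le> b") (auto simp: abs_minus_commute)
  show "\<bar>\<gamma>t s x\<bar> \<le> M" if s: "s \<in> {0..t}" for s x
  proof (rule tendsto_upperbound)
    show "((\<lambda>y. \<bar>(\<gamma> y x - \<gamma> s x) / (y - s)\<bar>) \<longlongrightarrow> \<bar>\<gamma>t s x\<bar>) (at s within {0..t})"
      using d[OF s, of x] by (intro tendsto_rabs) (simp add: has_field_derivative_iff)
    show "\<forall>\<^sub>F y in at s within {0..t}. \<bar>(\<gamma> y x - \<gamma> s x) / (y - s)\<bar> \<le> M"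
      unfolding eventually_at_filter
      using lip[OF s] by (intro always_eventually) (auto simp: abs_divide divide_le_eq)
    show "at s within {0..t} \<noteq> bot"
      using s t by (simp add: trivial_limit_within islimpt_Icc)
  qed
qed

section \<open>Differentiation in time with respect to the \<open>L\<^sup>2\<close> norm\<close>

lemma has_vector_derivative_withinI:
  fixes f :: "real \<Rightarrow> 'a::real_normed_vector"
  assumes "((\<lambda>r. norm (f r - f s - (r - s) *\<^sub>R d) / \<bar>r - s\<bar>) \<longlongrightarrow> 0) (at s within S)"
  shows "(f has_vector_derivative d) (at s within S)"
  unfolding has_vector_derivative_def has_derivative_within
proof (intro conjI bounded_linear_scaleR_left)
  have "((\<lambda>r. norm ((1 / norm (r - s)) *\<^sub>R (f r - (f s + (r - s) *\<^sub>R d)))) \<longlongrightarrow> 0) (at s within S)"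
    using assms by (simp add: diff_diff_eq)
  then show "((\<lambda>r. (1 / norm (r - s)) *\<^sub>R (f r - (f s + (r - s) *\<^sub>R d))) \<longlongrightarrow> 0) (at s within S)"
    by (simp only: tendsto_norm_zero_iff)
qed

lemma has_vector_derivative_withinD:
  fixes f :: "real \<Rightarrow> 'a::real_normed_vector"
  assumes "(f has_vector_derivative d) (at s within S)"
  shows "((\<lambda>r. norm (f r - f s - (r - s) *\<^sub>R d) / \<bar>r - s\<bar>) \<longlongrightarrow> 0) (at s within S)"
proof -
  have "((\<lambda>r. (1 / norm (r - s)) *\<^sub>R (f r - (f s + (r - s) *\<^sub>R d))) \<longlongrightarrow> 0) (at s within S)"
    using assms by (simp add: has_vector_derivative_def has_derivative_within)
  then have "((\<lambda>r. norm ((1 / norm (r - s)) *\<^sub>R (f r - (f s + (r - s) *\<^sub>R d)))) \<longlongrightarrow> 0) (at s within S)"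
    by (simp only: tendsto_norm_zero_iff)
  then show ?thesis by (simp add: diff_diff_eq)
qed

text \<open>Finite sums obey the triangle inequality in L2; together with Fatou's lemma they take
  the place of an L2-valued time integral.\<close>

lemma Riemann_sums_tendsto:
  fixes F :: "real \<Rightarrow> 'a::euclidean_space"
  assumes F: "\<And>x. x \<in> {0..1} \<Longrightarrow> (F has_vector_derivative f x) (at x within {0..1})"
    and f: "continuous_on {0..1} f"
  shows "(\<lambda>n. \<Sum>i<Suc n. (1 / real (Suc n)) *\<^sub>R f (real i / real (Suc n))) \<longlonglongrightarrow> F 1 - F 0"
proof (rule LIMSEQ_I)
  fix e :: real assume e: "e > 0"
  have "uniformly_continuous_on {0..1} f" by (rule compact_uniformly_continuous[OF f]) auto
  then obtain d where d: "d > 0" "\<And>x y. x \<in> {0..1} \<Longrightarrow> y \<in> {0..1} \<Longrightarrow> dist y x < d \<Longrightarrow> dist (f y) (f x) < e / 2"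
    using e half_gt_zero unfolding uniformly_continuous_on_def by metis
  obtain N where N: "1 / real (Suc N) < d" using d(1) nat_approx_posE by blast
  show "\<exists>no. \<forall>n\<ge>no. norm ((\<Sum>i<Suc n. (1 / real (Suc n)) *\<^sub>R f (real i / real (Suc n))) - (F 1 - F 0)) < e"
  proof (intro exI[of _ N] allI impI)
    fix n assume n: "n \<ge> N"
    define h where "h = 1 / real (Suc n)"
    have h0: "h > 0" "real (Suc n) * h = 1" by (auto simp: h_def)
    have hd: "h < d"
    proof -
      have "h \<le> 1 / real (Suc N)" unfolding h_def using n by (intro divide_left_mono) auto
      then show ?thesis using N by simp
    qed
    have piece: "norm (F (real (Suc i) * h) - F (real i * h) - h *\<^sub>R f (real i * h)) \<le> h * (e / 2)" if i: "i < Suc n" for i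
    proof -
      let ?a = "real i * h" and ?b = "real (Suc i) * h"
      have ab: "0 \<le> ?a" "?b = ?a + h" using h0 by (auto simp: algebra_simps)
      have "real (Suc i) * h \<le> real (Suc n) * h" using i h0(1) by (intro mult_right_mono) auto
      then have b1: "?b \<le> 1" using h0(2) by simp
      have sub: "{?a..?b} \<subseteq> {0..1}" using ab b1 by auto
      have "norm (F ?b - F ?a - (?b - ?a) *\<^sub>R f ?a) \<le> norm (?b - ?a) * (e / 2)"
      proof (rule vector_differentiable_bound_linearization[of "{?a..?b}" F f])
        show "(F has_vector_derivative f x) (at x within {?a..?b})" if "x \<in> {?a..?b}" for x
          using has_vector_derivative_within_subset[OF F sub] that sub by blast
        show "closed_segment ?a ?b \<subseteq> {?a..?b}" using ab h0 by (simp add: closed_segment_eq_real_ivl)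
        show "norm (f x - f ?a) \<le> e / 2" if "x \<in> {?a..?b}" for x
        proof -
          have "?a \<in> {?a..?b}" using ab h0 by auto
          then have "x \<in> {0..1}" "?a \<in> {0..1}" using that sub by blast+
          moreover have "dist x ?a < d" using that hd ab h0 by (auto simp: dist_real_def simp del: of_nat_Suc)
          ultimately have "dist (f x) (f ?a) < e / 2" using d(2) by blast
          then show ?thesis by (simp add: dist_norm)
        qed
        show "?a \<in> {?a..?b}" using ab h0 by auto
      qed
      then show ?thesis using ab h0 by simp
    qed
    have tel: "F 1 - F 0 = (\<Sum>i<Suc n. F (real (Suc i) * h) - F (real i * h))"
      using sum_lessThan_telescope[of "\<lambda>i. F (real i * h)" "Suc n"] h0(2) by simp
    have "(\<Sum>i<Suc n. (1 / real (Suc n)) *\<^sub>R f (real i / real (Suc n))) - (F 1 - F 0)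
       = - (\<Sum>i<Suc n. F (real (Suc i) * h) - F (real i * h) - h *\<^sub>R f (real i * h))"
      unfolding tel by (simp add: sum_subtractf h_def del: sum.lessThan_Suc)
    then have "norm ((\<Sum>i<Suc n. (1 / real (Suc n)) *\<^sub>R f (real i / real (Suc n))) - (F 1 - F 0))
       \<le> (\<Sum>i<Suc n. norm (F (real (Suc i) * h) - F (real i * h) - h *\<^sub>R f (real i * h)))"
      using norm_sum by (simp only: norm_minus_cancel)
    also have "\<dots> \<le> (\<Sum>i<Suc n. h * (e / 2))" using piece by (intro sum_mono) auto
    also have "\<dots> = (real (Suc n) * h) * (e / 2)" by simp
    also have "\<dots> < e" unfolding h0(2) using e by simp
    finally show "norm ((\<Sum>i<Suc n. (1 / real (Suc n)) *\<^sub>R f (real i / real (Suc n))) - (F 1 - F 0)) < e" .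
  qed
qed

lemma
  fixes u :: "'i \<Rightarrow> real \<Rightarrow> complex"
  assumes "finite A" "\<And>i. i \<in> A \<Longrightarrow> square_integrable (u i)"
  shows square_integrable_sum: "square_integrable (\<lambda>x. \<Sum>i\<in>A. u i x)"
    and L2_norm_sum: "L2_norm (\<lambda>x. \<Sum>i\<in>A. u i x) \<le> (\<Sum>i\<in>A. L2_norm (u i))"
proof -
  have "square_integrable (\<lambda>x. \<Sum>i\<in>A. u i x) \<and> L2_norm (\<lambda>x. \<Sum>i\<in>A. u i x) \<le> (\<Sum>i\<in>A. L2_norm (u i))"
    using assms
  proof (induction A rule: finite_induct)
    case (insert a A)
    then have IH: "square_integrable (\<lambda>x. \<Sum>i\<in>A. u i x)" "L2_norm (\<lambda>x. \<Sum>i\<in>A. u i x) \<le> (\<Sum>i\<in>A. L2_norm (u i))"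
      and a: "square_integrable (u a)" by auto
    show ?case using square_integrable_add[OF a IH(1)] L2_norm_triangle[OF a IH(1)] IH(2) insert.hyps by auto
  qed auto
  then show "square_integrable (\<lambda>x. \<Sum>i\<in>A. u i x)" "L2_norm (\<lambda>x. \<Sum>i\<in>A. u i x) \<le> (\<Sum>i\<in>A. L2_norm (u i))" by auto
qed

text \<open>Differentiability of the curve r \<mapsto> u r as a map into L2, expressed with
  functions instead of classes and relative to the time set.\<close>

definition has_L2_derivative ::
    "(real \<Rightarrow> real \<Rightarrow> complex) \<Rightarrow> (real \<Rightarrow> complex) \<Rightarrow> real \<Rightarrow> real set \<Rightarrow> bool" where
  "has_L2_derivative u u' s I \<longleftrightarrow> s \<in> I \<and> (\<forall>r\<in>I. square_integrable (u r)) \<and> square_integrable u' \<and>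
     ((\<lambda>r. L2_norm (\<lambda>x. u r x - u s x - of_real (r - s) * u' x) / \<bar>r - s\<bar>) \<longlongrightarrow> 0) (at s within I)"

lemma has_L2_derivativeD:
  assumes "has_L2_derivative u u' s I"
  shows "s \<in> I" "r \<in> I \<Longrightarrow> square_integrable (u r)" "square_integrable u'"
    "((\<lambda>r. L2_norm (\<lambda>x. u r x - u s x - of_real (r - s) * u' x) / \<bar>r - s\<bar>) \<longlongrightarrow> 0) (at s within I)"
    "r \<in> I \<Longrightarrow> square_integrable (\<lambda>x. u r x - u s x - of_real (r - s) * u' x)"
  using assms unfolding has_L2_derivative_def
  by (auto intro!: square_integrable_diff square_integrable_cmult)

lemma has_L2_derivative_continuous:
  assumes "has_L2_derivative u u' s I"
  shows "((\<lambda>r. L2_norm (\<lambda>x. u r x - u s x)) \<longlongrightarrow> 0) (at s within I)"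
proof (rule Lim_null_comparison)
  note D = has_L2_derivativeD[OF assms]
  let ?q = "\<lambda>r. L2_norm (\<lambda>x. u r x - u s x - of_real (r - s) * u' x) / \<bar>r - s\<bar>"
  have "L2_norm (\<lambda>x. u r x - u s x) \<le> ?q r * \<bar>r - s\<bar> + \<bar>r - s\<bar> * L2_norm u'" if "r \<in> I" "r \<noteq> s" for r
  proof -
    have "L2_norm (\<lambda>x. u r x - u s x) \<le> L2_norm (\<lambda>x. u r x - u s x - of_real (r - s) * u' x) + L2_norm (\<lambda>x. of_real (r - s) * u' x)"
      by (rule L2_norm_le_diff[OF square_integrable_diff[OF D(2)[OF that(1)] D(2)[OF D(1)]] square_integrable_cmult[OF D(3)]])
    then show ?thesis using that by (simp add: L2_norm_cmult[OF D(3)] norm_of_real flip: of_real_diff)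
  qed
  then show "\<forall>\<^sub>F r in at s within I. norm (L2_norm (\<lambda>x. u r x - u s x)) \<le> ?q r * \<bar>r - s\<bar> + \<bar>r - s\<bar> * L2_norm u'"
    by (auto simp: eventually_at_filter)
  have "((\<lambda>r. \<bar>r - s\<bar>) \<longlongrightarrow> \<bar>s - s\<bar>) (at s within I)" by (intro tendsto_intros)
  then show "((\<lambda>r. ?q r * \<bar>r - s\<bar> + \<bar>r - s\<bar> * L2_norm u') \<longlongrightarrow> 0) (at s within I)"
    using tendsto_add[OF tendsto_mult[OF D(4)] tendsto_mult[OF _ tendsto_const]] by fastforce
qed

text \<open>The first-order remainder of \<open>u\<close> between two times is a time average of
  differences of \<open>g\<close>, multiplied by the time step. These differences are small in L2 by
  continuity of \<open>g\<close>, and Fatou carries the bound from the Riemann sums to the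
  remainder.\<close>

lemma has_L2_derivative_pointwise:
  fixes u g :: "real \<Rightarrow> real \<Rightarrow> complex"
  assumes d: "\<And>s x. s \<in> {0..t} \<Longrightarrow> ((\<lambda>r. u r x) has_vector_derivative g s x) (at s within {0..t})"
    and gc: "\<And>x. continuous_on {0..t} (\<lambda>s. g s x)"
    and u: "\<And>s. s \<in> {0..t} \<Longrightarrow> square_integrable (u s)"
    and g: "L2_continuous_on {0..t} g" and a: "a \<in> {0..t}"
  shows "has_L2_derivative u (g a) a {0..t}"
proof -
  have sg: "square_integrable (g s)" if "s \<in> {0..t}" for s using g that by (simp add: L2_continuous_on_def)
  have main: "L2_norm (\<lambda>x. u b x - u a x - of_real (b - a) * g a x) \<le> e * \<bar>b - a\<bar>"
    if b: "b \<in> {0..t}" and e: "\<And>r. r \<in> {0..t} \<Longrightarrow> \<bar>r - a\<bar> \<le> \<bar>b - a\<bar> \<Longrightarrow> L2_norm (\<lambda>x. g r x - g a x) \<le> e" for b e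
  proof -
    \<comment> \<open>Parametrising the segment from \<open>a\<close> to \<open>b\<close> by [0, 1]
      covers both orders of the two times.\<close>
    define \<rho> where "\<rho> = (\<lambda>\<theta>::real. a + \<theta> * (b - a))"
    have \<rho>: "\<rho> \<theta> \<in> {0..t}" "\<bar>\<rho> \<theta> - a\<bar> \<le> \<bar>b - a\<bar>" if "\<theta> \<in> {0..1}" for \<theta>
    proof -
      have "\<rho> \<theta> = (1 - \<theta>) * a + \<theta> * b" by (simp add: \<rho>_def algebra_simps)
      moreover have "(1 - \<theta>) * a + \<theta> * b \<le> (1 - \<theta>) * t + \<theta> * t"
        using a b that by (intro add_mono mult_left_mono) auto
      moreover have "(1 - \<theta>) * t + \<theta> * t = t" by (simp add: algebra_simps)
      moreover have "0 \<le> (1 - \<theta>) * a + \<theta> * b" using a b that by auto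
      ultimately show "\<rho> \<theta> \<in> {0..t}" by simp
      show "\<bar>\<rho> \<theta> - a\<bar> \<le> \<bar>b - a\<bar>" using that by (auto simp: \<rho>_def abs_mult mult_left_le_one_le)
    qed
    define q where "q = (\<lambda>\<theta> x. of_real (b - a) * (g (\<rho> \<theta>) x - g a x))"
    \<comment> \<open>Riemann sums for the first-order remainder, each with L2 norm at most e |b -
      a|.\<close>
    define S where "S = (\<lambda>n x. \<Sum>i<Suc n. of_real (1 / real (Suc n)) * q (real i / real (Suc n)) x)"
    have th: "real i / real (Suc n) \<in> {0..1}" if "i < Suc n" for i n using that by auto
    have sq: "square_integrable (q \<theta>)" if "\<theta> \<in> {0..1}" for \<theta>
      unfolding q_def using \<rho>(1)[OF that] a by (intro square_integrable_cmult square_integrable_diff sg)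
    have Lq: "L2_norm (q \<theta>) \<le> \<bar>b - a\<bar> * e" if "\<theta> \<in> {0..1}" for \<theta>
      unfolding q_def using L2_norm_cmult[OF square_integrable_diff[OF sg[OF \<rho>(1)[OF that]] sg[OF a]], of "of_real (b - a)"] 
        e[OF \<rho>[OF that]] by (simp add: mult_left_mono norm_of_real del: of_real_diff)
    have sS: "square_integrable (S n)" for n
      unfolding S_def using th by (intro square_integrable_sum square_integrable_cmult sq) auto
    have LS: "L2_norm (S n) \<le> e * \<bar>b - a\<bar>" for n
    proof -
      have "L2_norm (S n) \<le> (\<Sum>i<Suc n. L2_norm (\<lambda>x. of_real (1 / real (Suc n)) * q (real i / real (Suc n)) x))"
        unfolding S_def using th by (intro L2_norm_sum square_integrable_cmult sq) auto
      also have "\<dots> \<le> (\<Sum>i<Suc n. 1 / real (Suc n) * (\<bar>b - a\<bar> * e))"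
      proof (rule sum_mono)
        fix i assume "i \<in> {..<Suc n}"
        then have i: "real i / real (Suc n) \<in> {0..1}" using th by auto
        show "L2_norm (\<lambda>x. of_real (1 / real (Suc n)) * q (real i / real (Suc n)) x) \<le> 1 / real (Suc n) * (\<bar>b - a\<bar> * e)"
          unfolding L2_norm_cmult[OF sq[OF i]] norm_of_real using Lq[OF i] by (intro mult_mono) auto
      qed
      also have "\<dots> = e * \<bar>b - a\<bar>" by simp
      finally show ?thesis .
    qed
    have lim: "(\<lambda>n. S n x) \<longlonglongrightarrow> u b x - u a x - of_real (b - a) * g a x" for x
    proof -
      let ?F = "\<lambda>\<theta>. u (\<rho> \<theta>) x - of_real \<theta> * (of_real (b - a) * g a x)"
      have "(\<lambda>n. \<Sum>i<Suc n. (1 / real (Suc n)) *\<^sub>R q (real i / real (Suc n)) x) \<longlonglongrightarrow> ?F 1 - ?F 0"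
      proof (rule Riemann_sums_tendsto[where f="\<lambda>\<theta>. q \<theta> x"])
        fix \<theta> :: real assume \<theta>: "\<theta> \<in> {0..1}"
        have 1: "(\<rho> has_vector_derivative (b - a)) (at \<theta> within {0..1})"
          unfolding \<rho>_def has_real_derivative_iff_has_vector_derivative[symmetric] by (auto intro!: derivative_eq_intros)
        have "((\<lambda>r. u r x) has_vector_derivative g (\<rho> \<theta>) x) (at (\<rho> \<theta>) within \<rho> ` {0..1})"
          using \<rho>(1) by (intro has_vector_derivative_within_subset[OF d[OF \<rho>(1)[OF \<theta>]]]) auto
        from vector_diff_chain_within[OF 1 this]
        have 2: "((\<lambda>\<theta>. u (\<rho> \<theta>) x) has_vector_derivative (b - a) *\<^sub>R g (\<rho> \<theta>) x) (at \<theta> within {0..1})"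
          by (simp add: o_def)
        have 3: "((\<lambda>\<theta>. of_real \<theta> * (of_real (b - a) * g a x)) has_vector_derivative of_real (b - a) * g a x) (at \<theta> within {0..1})"
          by (rule has_vector_derivative_eq_rhs[OF has_vector_derivative_mult_left[OF has_vector_derivative_of_real[OF DERIV_ident]]]) simp
        show "(?F has_vector_derivative q \<theta> x) (at \<theta> within {0..1})"
          using has_vector_derivative_diff[OF 2 3] by (simp add: q_def scaleR_conv_of_real right_diff_distrib)
      next
        have "continuous_on {0..1} (\<lambda>\<theta>. g (\<rho> \<theta>) x)"
        proof (rule continuous_on_compose2[OF gc[of x]])
          show "continuous_on {0..1} \<rho>" unfolding \<rho>_def by (intro continuous_intros)
          show "\<rho> ` {0..1} \<subseteq> {0..t}" using \<rho>(1) by blast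
        qed
        then show "continuous_on {0..1} (\<lambda>\<theta>. q \<theta> x)" unfolding q_def by (intro continuous_intros)
      qed
      moreover have "?F 1 - ?F 0 = u b x - u a x - of_real (b - a) * g a x" by (simp add: \<rho>_def)
      ultimately show ?thesis by (simp only: S_def scaleR_conv_of_real)
    qed
    show ?thesis
      by (rule L2_norm_Fatou[where u=S, OF sS LS])
         (use lim u[OF b] u[OF a] sg[OF a] in \<open>auto intro!: borel_measurable_diff borel_measurable_times square_integrable_measurable\<close>)
  qed
  have "((\<lambda>r. L2_norm (\<lambda>x. u r x - u a x - of_real (r - a) * g a x) / \<bar>r - a\<bar>) \<longlongrightarrow> 0) (at a within {0..t})"
  proof (rule tendstoI)
    fix e :: real assume e: "e > 0"
    have "((\<lambda>r. L2_norm (\<lambda>x. g r x - g a x)) \<longlongrightarrow> 0) (at a within {0..t})"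
      using g a by (simp add: L2_continuous_on_def)
    then have "\<forall>\<^sub>F r in at a within {0..t}. L2_norm (\<lambda>x. g r x - g a x) < e / 2"
      using e by (intro order_tendstoD(2)) auto
    then obtain \<delta> where \<delta>: "\<delta> > 0" "\<And>r. r \<in> {0..t} \<Longrightarrow> r \<noteq> a \<Longrightarrow> \<bar>r - a\<bar> < \<delta> \<Longrightarrow> L2_norm (\<lambda>x. g r x - g a x) < e / 2"
      unfolding eventually_at dist_real_def by blast
    have "L2_norm (\<lambda>x. u r x - u a x - of_real (r - a) * g a x) / \<bar>r - a\<bar> < e"
      if r: "r \<in> {0..t}" "r \<noteq> a" "\<bar>r - a\<bar> < \<delta>" for r
    proof -
      have "L2_norm (\<lambda>x. u r x - u a x - of_real (r - a) * g a x) \<le> e / 2 * \<bar>r - a\<bar>"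
      proof (rule main[OF r(1)])
        fix p assume p: "p \<in> {0..t}" "\<bar>p - a\<bar> \<le> \<bar>r - a\<bar>"
        show "L2_norm (\<lambda>x. g p x - g a x) \<le> e / 2"
          using \<delta>(2)[of p] p r e by (cases "p = a") auto
      qed
      also have "\<dots> < e * \<bar>r - a\<bar>" using e r by simp
      finally show ?thesis using r by (simp add: divide_less_eq)
    qed
    then show "\<forall>\<^sub>F r in at a within {0..t}. dist (L2_norm (\<lambda>x. u r x - u a x - of_real (r - a) * g a x) / \<bar>r - a\<bar>) 0 < e"
      unfolding eventually_at using \<delta>(1) by (intro exI[of _ \<delta>]) (auto simp: dist_real_def)
  qed
  then show ?thesis using a u sg by (auto simp: has_L2_derivative_def)
qed

lemma has_L2_derivative_cnj:
  assumes "has_L2_derivative u u' s I"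
  shows "has_L2_derivative (\<lambda>r x. cnj (u r x)) (\<lambda>x. cnj (u' x)) s I"
proof -
  have "cnj (u r x) - cnj (u s x) - of_real (r - s) * cnj (u' x) = cnj (u r x - u s x - of_real (r - s) * u' x)" for r x
    by simp
  then show ?thesis using assms unfolding has_L2_derivative_def
    by (auto simp only: L2_norm_cnj intro: square_integrable_cnj)
qed

text \<open>The pairing carries no conjugation, so it covers both the squared norm and the
  indefinite correction built from the square of a conjugate; conjugates are supplied by
  \<open>has_L2_derivative_cnj\<close>.\<close>

lemma has_vector_derivative_pairing:
  assumes W: "has_L2_derivative W W' s I" and Z: "has_L2_derivative Z Z' s I"
  shows "((\<lambda>r. LINT x|lborel. W r x * Z r x) has_vector_derivative
     ((LINT x|lborel. W' x * Z s x) + (LINT x|lborel. W s x * Z' x))) (at s within I)"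
proof (rule has_vector_derivative_withinI, rule Lim_null_comparison)
  note DW = has_L2_derivativeD[OF W] and DZ = has_L2_derivativeD[OF Z]
  let ?d = "(LINT x|lborel. W' x * Z s x) + (LINT x|lborel. W s x * Z' x)"
  let ?hW = "\<lambda>r x. W r x - W s x - of_real (r - s) * W' x" and ?hZ = "\<lambda>r x. Z r x - Z s x - of_real (r - s) * Z' x"
  let ?B = "\<lambda>r. (L2_norm (?hW r) / \<bar>r - s\<bar>) * (L2_norm (\<lambda>x. Z r x - Z s x) + L2_norm (Z s))
     + L2_norm W' * L2_norm (\<lambda>x. Z r x - Z s x) + L2_norm (W s) * (L2_norm (?hZ r) / \<bar>r - s\<bar>)"
  have "norm ((LINT x|lborel. W r x * Z r x) - (LINT x|lborel. W s x * Z s x) - (r - s) *\<^sub>R ?d) / \<bar>r - s\<bar> \<le> ?B r"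
    if r: "r \<in> I" "r \<noteq> s" for r
  proof -
    note Zr = DZ(2)[OF r(1)] and Wr = DW(2)[OF r(1)] and Ws = DW(2)[OF DW(1)] and Zs = DZ(2)[OF DZ(1)]
    note hW = DW(5)[OF r(1)] and hZ = DZ(5)[OF r(1)]
    note dZ = square_integrable_diff[OF Zr Zs]
    note I1 = square_integrable_imp_integrable_mult[OF hW Zr]
      and I2 = square_integrable_imp_integrable_mult[OF DW(3) dZ]
      and I3 = square_integrable_imp_integrable_mult[OF Ws hZ]
      and I4 = square_integrable_imp_integrable_mult[OF Wr Zr]
      and I5 = square_integrable_imp_integrable_mult[OF Ws Zs]
      and I6 = square_integrable_imp_integrable_mult[OF DW(3) Zs]
      and I7 = square_integrable_imp_integrable_mult[OF Ws DZ(3)]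
    \<comment> \<open>The remainder of the product splits into one remainder for each factor and a
      mixed term, which is small because \<open>Z\<close> is continuous into L2.\<close>
    have pt: "W r x * Z r x - W s x * Z s x - of_real (r - s) * (W' x * Z s x + W s x * Z' x)
      = ?hW r x * Z r x + of_real (r - s) * (W' x * (Z r x - Z s x)) + W s x * ?hZ r x" for x
      by (simp add: algebra_simps)
    have "(LINT x|lborel. W r x * Z r x) - (LINT x|lborel. W s x * Z s x) - (r - s) *\<^sub>R ?d
       = (LINT x|lborel. W r x * Z r x - W s x * Z s x - of_real (r - s) * (W' x * Z s x + W s x * Z' x))"
      using I4 I5 I6 I7 by (simp add: scaleR_conv_of_real)
    also have "\<dots> = (LINT x|lborel. ?hW r x * Z r x) + of_real (r - s) * (LINT x|lborel. W' x * (Z r x - Z s x)) + (LINT x|lborel. W s x * ?hZ r x)"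
      unfolding pt using I1 I2 I3 by (simp del: of_real_diff)
    finally have split: "(LINT x|lborel. W r x * Z r x) - (LINT x|lborel. W s x * Z s x) - (r - s) *\<^sub>R ?d
       = (LINT x|lborel. ?hW r x * Z r x) + of_real (r - s) * (LINT x|lborel. W' x * (Z r x - Z s x)) + (LINT x|lborel. W s x * ?hZ r x)" .
    have "norm ((LINT x|lborel. W r x * Z r x) - (LINT x|lborel. W s x * Z s x) - (r - s) *\<^sub>R ?d) \<le> L2_norm (?hW r) * L2_norm (Z r) + \<bar>r - s\<bar> * (L2_norm W' * L2_norm (\<lambda>x. Z r x - Z s x)) + L2_norm (W s) * L2_norm (?hZ r)"
    proof -
      have tri: "norm (A + of_real (r - s) * B + C) \<le> norm A + \<bar>r - s\<bar> * norm B + norm C" for A B C :: complex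
        using norm_triangle_ineq[of "A + of_real (r - s) * B" C] norm_triangle_ineq[of A "of_real (r - s) * B"]
        by (simp only: norm_mult norm_of_real)
      show ?thesis unfolding split
        by (rule order_trans[OF tri add_mono[OF add_mono[OF L2_pairing_le[OF hW Zr]
              mult_left_mono[OF L2_pairing_le[OF DW(3) dZ] abs_ge_zero]] L2_pairing_le[OF Ws hZ]]])
    qed
    also have "\<dots> \<le> L2_norm (?hW r) * (L2_norm (\<lambda>x. Z r x - Z s x) + L2_norm (Z s)) + \<bar>r - s\<bar> * (L2_norm W' * L2_norm (\<lambda>x. Z r x - Z s x)) + L2_norm (W s) * L2_norm (?hZ r)"
      by (rule add_mono[OF add_mono[OF mult_left_mono[OF L2_norm_le_diff[OF Zr Zs] L2_norm_nonneg] order_refl] order_refl])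
    finally have "norm ((LINT x|lborel. W r x * Z r x) - (LINT x|lborel. W s x * Z s x) - (r - s) *\<^sub>R ?d) / \<bar>r - s\<bar>
      \<le> (L2_norm (?hW r) * (L2_norm (\<lambda>x. Z r x - Z s x) + L2_norm (Z s)) + \<bar>r - s\<bar> * (L2_norm W' * L2_norm (\<lambda>x. Z r x - Z s x)) + L2_norm (W s) * L2_norm (?hZ r)) / \<bar>r - s\<bar>"
      by (intro divide_right_mono) auto
    also have "\<dots> = ?B r" using r by (simp add: add_divide_distrib)
    finally show ?thesis .
  qed
  then show "\<forall>\<^sub>F r in at s within I. norm (norm ((LINT x|lborel. W r x * Z r x) - (LINT x|lborel. W s x * Z s x) - (r - s) *\<^sub>R ?d) / \<bar>r - s\<bar>) \<le> ?B r"
    by (auto simp: eventually_at_filter)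
  have "(?B \<longlongrightarrow> 0 * (0 + L2_norm (Z s)) + L2_norm W' * 0 + L2_norm (W s) * 0) (at s within I)"
    by (intro tendsto_intros DW(4) DZ(4) has_L2_derivative_continuous[OF Z])
  then show "(?B \<longlongrightarrow> 0) (at s within I)" by simp
qed

text \<open>The coefficient is differentiable in time only pointwise in x and does not lie in L2.
  Its uniform Lipschitz bound lets a multiple of W at time \<open>s\<close> dominate the error of
  the difference quotients.\<close>

lemma has_L2_derivative_mult_coeff:
  assumes W: "has_L2_derivative W W' s I"
    and pm: "\<And>r. r \<in> I \<Longrightarrow> p r \<in> borel_measurable borel" and P: "\<And>r x. r \<in> I \<Longrightarrow> norm (p r x) \<le> P"
    and L: "\<And>r x. r \<in> I \<Longrightarrow> norm (p r x - p s x) \<le> L * \<bar>r - s\<bar>"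
    and p'm: "p' \<in> borel_measurable borel" and p': "\<And>x. norm (p' x) \<le> L"
    and d: "\<And>x. ((\<lambda>r. p r x) has_vector_derivative p' x) (at s within I)"
  shows "has_L2_derivative (\<lambda>r x. p r x * W r x) (\<lambda>x. p' x * W s x + p s x * W' x) s I"
proof -
  note D = has_L2_derivativeD[OF W]
  note Ws = D(2)[OF D(1)]
  have P0: "0 \<le> P" using P[OF D(1), of 0] norm_ge_zero order_trans by blast
  have L0: "0 \<le> L" using p'[of 0] norm_ge_zero order_trans by blast
  have sp: "square_integrable (\<lambda>x. p r x * w x)" "L2_norm (\<lambda>x. p r x * w x) \<le> P * L2_norm w"
    if "r \<in> I" "square_integrable w" for r w
    using square_integrable_bounded_mult[OF that(2) pm[OF that(1)] _ P0] L2_norm_bounded_mult[OF that(2) pm[OF that(1)] _ P0] P[OF that(1)] by auto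
  have sd: "square_integrable (\<lambda>x. p' x * W s x)" 
    by (rule square_integrable_bounded_mult[OF Ws p'm _ L0]) (use p' in auto)
  let ?hW = "\<lambda>r x. W r x - W s x - of_real (r - s) * W' x"
  let ?hp = "\<lambda>r x. (p r x - p s x - of_real (r - s) * p' x) / of_real (r - s)"
  have hp: "norm (?hp r x) \<le> 2 * L" if "r \<in> I" "r \<noteq> s" for r x
  proof -
    have "norm (p r x - p s x - of_real (r - s) * p' x) \<le> norm (p r x - p s x) + norm (of_real (r - s) * p' x)"
      by (rule norm_triangle_ineq4)
    also have "\<dots> \<le> L * \<bar>r - s\<bar> + \<bar>r - s\<bar> * L"
      unfolding norm_mult norm_of_real using L[OF that(1)] p' by (intro add_mono mult_left_mono) auto
    finally show ?thesis using that by (simp add: norm_divide norm_of_real divide_le_eq del: of_real_diff)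
  qed
  have hpm: "?hp r \<in> borel_measurable borel" if "r \<in> I" for r
    using pm[OF that] pm[OF D(1)] p'm by measurable
  \<comment> \<open>The limit is tested along sequences of times because dominated convergence is
    used for sequences.\<close>
  have hpW: "((\<lambda>r. L2_norm (\<lambda>x. ?hp r x * W s x)) \<longlongrightarrow> 0) (at s within I)"
    unfolding tendsto_at_iff_sequentially
  proof (intro allI impI)
    fix X :: "nat \<Rightarrow> real" assume X: "\<forall>i. X i \<in> I - {s}" "X \<longlonglongrightarrow> s"
    have Xf: "filterlim X (at s within I) sequentially"
      unfolding filterlim_at using X by (auto intro!: always_eventually)
    have "(\<lambda>n. L2_norm (\<lambda>x. ?hp (X n) x * W s x)) \<longlonglongrightarrow> 0"
    proof (rule L2_norm_tendsto_0_dominated)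
      show "(\<lambda>x. ?hp (X n) x * W s x) \<in> borel_measurable borel" for n
        using hpm X(1) square_integrable_measurable[OF Ws] by (intro borel_measurable_times) auto
      show "square_integrable (\<lambda>x. of_real (2 * L) * W s x)" by (rule square_integrable_cmult[OF Ws])
      show "AE x in lborel. norm (?hp (X n) x * W s x) \<le> norm (of_real (2 * L) * W s x)" for n
      proof (rule AE_I2)
        fix x
        have "norm (?hp (X n) x) * norm (W s x) \<le> 2 * L * norm (W s x)"
          using hp[of "X n" x] X(1) by (intro mult_right_mono) auto
        then show "norm (?hp (X n) x * W s x) \<le> norm (of_real (2 * L) * W s x)"
          using L0 by (simp only: norm_mult[of _ "W s x"] norm_of_real)
      qed
      show "AE x in lborel. (\<lambda>n. ?hp (X n) x * W s x) \<longlonglongrightarrow> 0"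
      proof (rule AE_I2)
        fix x
        have "((\<lambda>r. norm (p r x - p s x - (r - s) *\<^sub>R p' x) / \<bar>r - s\<bar>) \<longlongrightarrow> 0) (at s within I)"
          by (rule has_vector_derivative_withinD[OF d])
        then have "((\<lambda>r. norm (?hp r x)) \<longlongrightarrow> 0) (at s within I)"
          by (simp add: norm_divide norm_of_real scaleR_conv_of_real del: of_real_diff)
        then have "((\<lambda>r. ?hp r x) \<longlongrightarrow> 0) (at s within I)" by (simp only: tendsto_norm_zero_iff)
        from filterlim_compose[OF this Xf] have "(\<lambda>n. ?hp (X n) x) \<longlonglongrightarrow> 0" .
        from tendsto_mult[OF this tendsto_const] show "(\<lambda>n. ?hp (X n) x * W s x) \<longlonglongrightarrow> 0" by simp
      qed
    qed
    then show "((\<lambda>r. L2_norm (\<lambda>x. ?hp r x * W s x)) \<circ> X) \<longlonglongrightarrow> 0" by (simp add: o_def)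
  qed
  let ?h = "\<lambda>r x. p r x * W r x - p s x * W s x - of_real (r - s) * (p' x * W s x + p s x * W' x)"
  let ?B = "\<lambda>r. P * (L2_norm (?hW r) / \<bar>r - s\<bar>) + L * \<bar>r - s\<bar> * L2_norm W' + L2_norm (\<lambda>x. ?hp r x * W s x)"
  have bound: "L2_norm (?h r) / \<bar>r - s\<bar> \<le> ?B r" if r: "r \<in> I" "r \<noteq> s" for r
  proof -
    have m2: "(\<lambda>x. p r x - p s x) \<in> borel_measurable borel" using pm[OF r(1)] pm[OF D(1)] by simp
    have LL: "AE x in lborel. norm (p r x - p s x) \<le> L * \<bar>r - s\<bar>" using L[OF r(1)] by simp
    have LL0: "0 \<le> L * \<bar>r - s\<bar>" using L0 by simp
    have HP: "AE x in lborel. norm (?hp r x) \<le> 2 * L" using hp[OF r] by simp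
    note s1 = sp[OF r(1) D(5)[OF r(1)]]
    note s2 = square_integrable_bounded_mult[OF D(3) m2 LL LL0] L2_norm_bounded_mult[OF D(3) m2 LL LL0]
    note s3 = square_integrable_bounded_mult[OF Ws hpm[OF r(1)] HP]
    have s3': "square_integrable (\<lambda>x. ?hp r x * W s x)" using s3 L0 by simp
    note c2 = square_integrable_cmult[OF s2(1), of "of_real (r - s)"] and c3 = square_integrable_cmult[OF s3', of "of_real (r - s)"]
    have nz: "complex_of_real (r - s) \<noteq> 0" using r by simp
    have pt: "?h r x = (p r x * ?hW r x + of_real (r - s) * ((p r x - p s x) * W' x)) + of_real (r - s) * (?hp r x * W s x)" for x
    proof -
      have "of_real (r - s) * (?hp r x * W s x) = (p r x - p s x - of_real (r - s) * p' x) * W s x"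
        using nz by (simp del: of_real_diff)
      then show ?thesis by (simp add: algebra_simps del: of_real_diff)
    qed
    have "L2_norm (?h r) \<le> L2_norm (\<lambda>x. p r x * ?hW r x) + L2_norm (\<lambda>x. of_real (r - s) * ((p r x - p s x) * W' x))
       + L2_norm (\<lambda>x. of_real (r - s) * (?hp r x * W s x))"
      unfolding pt using L2_norm_triangle[OF square_integrable_add[OF s1(1) c2] c3] L2_norm_triangle[OF s1(1) c2] by linarith
    also have "\<dots> \<le> P * L2_norm (?hW r) + \<bar>r - s\<bar> * (L * \<bar>r - s\<bar> * L2_norm W') + \<bar>r - s\<bar> * L2_norm (\<lambda>x. ?hp r x * W s x)"
      unfolding L2_norm_cmult[OF s2(1)] L2_norm_cmult[OF s3'] norm_of_real
      using s1(2) s2(2) by (intro add_mono mult_left_mono) auto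
    finally have "L2_norm (?h r) / \<bar>r - s\<bar> \<le> (P * L2_norm (?hW r) + \<bar>r - s\<bar> * (L * \<bar>r - s\<bar> * L2_norm W') + \<bar>r - s\<bar> * L2_norm (\<lambda>x. ?hp r x * W s x)) / \<bar>r - s\<bar>"
      by (intro divide_right_mono) auto
    also have "\<dots> = ?B r" using r by (simp add: add_divide_distrib)
    finally show ?thesis .
  qed
  have "((\<lambda>r. L2_norm (?h r) / \<bar>r - s\<bar>) \<longlongrightarrow> 0) (at s within I)"
  proof (rule Lim_null_comparison)
    show "\<forall>\<^sub>F r in at s within I. norm (L2_norm (?h r) / \<bar>r - s\<bar>) \<le> ?B r"
      using bound by (auto simp: eventually_at_filter)
    have "(?B \<longlongrightarrow> P * 0 + L * \<bar>s - s\<bar> * L2_norm W' + 0) (at s within I)"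
      by (intro tendsto_intros D(4) hpW)
    then show "(?B \<longlongrightarrow> 0) (at s within I)" by simp
  qed
  then show ?thesis unfolding has_L2_derivative_def
    using D sp square_integrable_add[OF sd sp(1)[OF D(1) D(3)]] by auto
qed

section \<open>Curves that are continuous in time with values in L2\<close>

lemma L2_continuous_on_add:
  fixes u w :: "real \<Rightarrow> real \<Rightarrow> complex"
  assumes "L2_continuous_on I u" "L2_continuous_on I w"
  shows "L2_continuous_on I (\<lambda>s x. u s x + w s x)"
  unfolding L2_continuous_on_def
proof (intro ballI conjI)
  have s: "square_integrable (u r)" "square_integrable (w r)" if "r \<in> I" for r
    using assms that by (auto simp: L2_continuous_on_def)
  fix a assume a: "a \<in> I"
  show "square_integrable (\<lambda>x. u a x + w a x)" using s[OF a] by (rule square_integrable_add)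
  show "((\<lambda>r. L2_norm (\<lambda>x. u r x + w r x - (u a x + w a x))) \<longlongrightarrow> 0) (at a within I)"
  proof (rule Lim_null_comparison)
    have "L2_norm (\<lambda>x. u r x + w r x - (u a x + w a x)) \<le> L2_norm (\<lambda>x. u r x - u a x) + L2_norm (\<lambda>x. w r x - w a x)" if "r \<in> I" for r
      using L2_norm_triangle[OF square_integrable_diff[OF s(1)[OF that] s(1)[OF a]] square_integrable_diff[OF s(2)[OF that] s(2)[OF a]]]
      by (simp add: algebra_simps)
    then show "\<forall>\<^sub>F r in at a within I. norm (L2_norm (\<lambda>x. u r x + w r x - (u a x + w a x))) \<le> L2_norm (\<lambda>x. u r x - u a x) + L2_norm (\<lambda>x. w r x - w a x)"
      by (auto simp: eventually_at_filter)
    show "((\<lambda>r. L2_norm (\<lambda>x. u r x - u a x) + L2_norm (\<lambda>x. w r x - w a x)) \<longlongrightarrow> 0) (at a within I)"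
      using assms a tendsto_add[of "\<lambda>r. L2_norm (\<lambda>x. u r x - u a x)" 0 "at a within I" "\<lambda>r. L2_norm (\<lambda>x. w r x - w a x)" 0]
      by (auto simp: L2_continuous_on_def)
  qed
qed

text \<open>A general modulus \<omega> covers coefficients that are Lipschitz in time, constant
  ones, and those whose variation is measured by a Sobolev norm.\<close>

lemma L2_continuous_on_coeff_mult:
  fixes c u :: "real \<Rightarrow> real \<Rightarrow> complex"
  assumes u: "L2_continuous_on I u" and cm: "\<And>r. r \<in> I \<Longrightarrow> c r \<in> borel_measurable borel"
    and P: "\<And>r. r \<in> I \<Longrightarrow> AE x in lborel. norm (c r x) \<le> P" and P0: "0 \<le> P"
    and L: "\<And>r a. r \<in> I \<Longrightarrow> a \<in> I \<Longrightarrow> AE x in lborel. norm (c r x - c a x) \<le> \<omega> r a" "\<And>r a. 0 \<le> \<omega> r a"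
    and \<omega>: "\<And>a. a \<in> I \<Longrightarrow> ((\<lambda>r. \<omega> r a) \<longlongrightarrow> 0) (at a within I)"
  shows "L2_continuous_on I (\<lambda>s x. c s x * u s x)"
  unfolding L2_continuous_on_def
proof (intro ballI conjI)
  have s: "square_integrable (u r)" if "r \<in> I" for r using u that by (auto simp: L2_continuous_on_def)
  fix a assume a: "a \<in> I"
  show "square_integrable (\<lambda>x. c a x * u a x)" by (rule square_integrable_bounded_mult[OF s[OF a] cm[OF a] P[OF a] P0])
  show "((\<lambda>r. L2_norm (\<lambda>x. c r x * u r x - c a x * u a x)) \<longlongrightarrow> 0) (at a within I)"
  proof (rule Lim_null_comparison)
    have "L2_norm (\<lambda>x. c r x * u r x - c a x * u a x) \<le> P * L2_norm (\<lambda>x. u r x - u a x) + \<omega> r a * L2_norm (u a)" if r: "r \<in> I" for r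
    proof -
      have m: "(\<lambda>x. c r x - c a x) \<in> borel_measurable borel" using cm[OF r] cm[OF a] by simp
      note d = square_integrable_diff[OF s[OF r] s[OF a]]
      note 1 = square_integrable_bounded_mult[OF d cm[OF r] P[OF r] P0] and 2 = L2_norm_bounded_mult[OF d cm[OF r] P[OF r] P0]
      note 3 = square_integrable_bounded_mult[OF s[OF a] m L(1)[OF r a] L(2)] and 4 = L2_norm_bounded_mult[OF s[OF a] m L(1)[OF r a] L(2)]
      have "(\<lambda>x. c r x * u r x - c a x * u a x) = (\<lambda>x. c r x * (u r x - u a x) + (c r x - c a x) * u a x)"
        by (simp add: algebra_simps)
      then show ?thesis using L2_norm_triangle[OF 1 3] 2 4 by simp
    qed
    then show "\<forall>\<^sub>F r in at a within I. norm (L2_norm (\<lambda>x. c r x * u r x - c a x * u a x)) \<le> P * L2_norm (\<lambda>x. u r x - u a x) + \<omega> r a * L2_norm (u a)"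
      by (auto simp: eventually_at_filter)
    have "((\<lambda>r. P * L2_norm (\<lambda>x. u r x - u a x) + \<omega> r a * L2_norm (u a)) \<longlongrightarrow> P * 0 + 0 * L2_norm (u a)) (at a within I)"
      using u a by (intro tendsto_intros \<omega>) (auto simp: L2_continuous_on_def)
    then show "((\<lambda>r. P * L2_norm (\<lambda>x. u r x - u a x) + \<omega> r a * L2_norm (u a)) \<longlongrightarrow> 0) (at a within I)" by simp
  qed
qed

lemma L2_continuous_on_cmult:
  fixes u :: "real \<Rightarrow> real \<Rightarrow> complex"
  assumes "L2_continuous_on I u"
  shows "L2_continuous_on I (\<lambda>s x. c * u s x)"
  by (rule L2_continuous_on_coeff_mult[OF assms, of "\<lambda>_ _. c" "norm c" "\<lambda>_ _. 0"]) auto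

lemma L2_continuous_on_conv:
  fixes u :: "real \<Rightarrow> real \<Rightarrow> complex"
  assumes u: "L2_continuous_on I u" and t: "test_function \<eta>"
  shows "L2_continuous_on I (\<lambda>s. conv \<eta> (u s))" "continuous_on I (\<lambda>s. conv \<eta> (u s) x)"
proof -
  have s: "square_integrable (u r)" if "r \<in> I" for r using u that by (auto simp: L2_continuous_on_def)
  have e: "(\<lambda>x. conv \<eta> (u r) x - conv \<eta> (u a) x) = conv \<eta> (\<lambda>x. u r x - u a x)" if "r \<in> I" "a \<in> I" for r a
    using conv_diff[OF t s[OF that(1), THEN square_integrable_imp_locally_integrable] s[OF that(2), THEN square_integrable_imp_locally_integrable]] by simp
  have lim: "((\<lambda>r. L2_norm (\<lambda>x. u r x - u a x)) \<longlongrightarrow> 0) (at a within I)" if "a \<in> I" for a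
    using u that by (auto simp: L2_continuous_on_def)
  show "L2_continuous_on I (\<lambda>s. conv \<eta> (u s))"
    unfolding L2_continuous_on_def
  proof (intro ballI conjI)
    fix a assume a: "a \<in> I"
    show "square_integrable (conv \<eta> (u a))" by (rule square_integrable_conv[OF t s[OF a]])
    show "((\<lambda>r. L2_norm (\<lambda>x. conv \<eta> (u r) x - conv \<eta> (u a) x)) \<longlongrightarrow> 0) (at a within I)"
    proof (rule Lim_null_comparison)
      show "\<forall>\<^sub>F r in at a within I. norm (L2_norm (\<lambda>x. conv \<eta> (u r) x - conv \<eta> (u a) x)) \<le> (LINT y|lborel. \<bar>\<eta> y\<bar>) * L2_norm (\<lambda>x. u r x - u a x)"
        using L2_norm_conv[OF t square_integrable_diff[OF s s[OF a]]] e a by (auto simp: eventually_at_filter)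
      show "((\<lambda>r. (LINT y|lborel. \<bar>\<eta> y\<bar>) * L2_norm (\<lambda>x. u r x - u a x)) \<longlongrightarrow> 0) (at a within I)"
        using tendsto_mult[OF tendsto_const lim[OF a]] by simp
    qed
  qed
  show "continuous_on I (\<lambda>s. conv \<eta> (u s) x)"
    unfolding continuous_on_def
  proof
    fix a assume a: "a \<in> I"
    have "((\<lambda>r. conv \<eta> (u r) x - conv \<eta> (u a) x) \<longlongrightarrow> 0) (at a within I)"
    proof (rule Lim_null_comparison)
      have "norm (conv \<eta> (u r) x - conv \<eta> (u a) x) \<le> L2_norm \<eta> * L2_norm (\<lambda>x. u r x - u a x)" if "r \<in> I" for r
        using conv_sup_bound[OF t square_integrable_diff[OF s[OF that] s[OF a]], of x] fun_cong[OF e[OF that a], of x] by simp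
      then show "\<forall>\<^sub>F r in at a within I. norm (conv \<eta> (u r) x - conv \<eta> (u a) x) \<le> L2_norm \<eta> * L2_norm (\<lambda>x. u r x - u a x)"
        by (auto simp: eventually_at_filter)
      show "((\<lambda>r. L2_norm \<eta> * L2_norm (\<lambda>x. u r x - u a x)) \<longlongrightarrow> 0) (at a within I)"
        using tendsto_mult[OF tendsto_const lim[OF a]] by simp
    qed
    then show "((\<lambda>s. conv \<eta> (u s) x) \<longlongrightarrow> conv \<eta> (u a) x) (at a within I)"
      by (simp only: LIM_zero_iff)
  qed
qed

section \<open>The equation of the forward-modulated perturbation\<close>

definition cubic_diff :: "complex \<Rightarrow> complex \<Rightarrow> complex" where
  "cubic_diff c z = \<i> * (of_real ((cmod (c + z))\<^sup>2) * (c + z) - of_real ((cmod c)\<^sup>2) * c)"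

text \<open>The first two terms are linear in the perturbation: the first rotates the phase and
  drops out of L2 balances, the second couples to the conjugate and has no sign. The bracket is at
  least quadratic.\<close>

lemma cubic_diff_expand:
  "cubic_diff c z = (2 * \<i> * (c * cnj c)) * z + (\<i> * (c * c)) * cnj z
     + ((2 * \<i> * c) * (z * cnj z) + (\<i> * cnj c) * (z * z) + \<i> * (z * z * cnj z))"
  unfolding cubic_diff_def complex_norm_square by (simp add: algebra_simps)

text \<open>A change of the coefficient is weighted by the norm of the perturbation, because the
  increment vanishes at 0. Without this weight the bound would not be square integrable, as the
  difference of two modulated profiles need not decay.\<close>

lemma cubic_diff_lipschitz:
  assumes B: "norm c \<le> B" "norm c' \<le> B" and ab: "norm a \<le> 1" "norm b \<le> 1"
  shows "norm (cubic_diff c a - cubic_diff c' b) \<le> (3 * (B + 1)\<^sup>2 + 6 * B + 3) * (norm (a - b) + norm (c - c') * norm b)"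
proof -
  have B0: "0 \<le> B" using B(1) norm_ge_zero order_trans by blast
  have g: "norm (x * x * cnj x - y * y * cnj y) \<le> 3 * (B + 1)\<^sup>2 * norm (x - y)"
    if "norm x \<le> B + 1" "norm y \<le> B + 1" for x y
  proof -
    have "x * x * cnj x - y * y * cnj y = (x - y) * (x * cnj x) + (x - y) * (y * cnj x) + cnj (x - y) * (y * y)"
      by (simp add: algebra_simps)
    also have "norm \<dots> \<le> norm (x - y) * (norm x * norm x) + norm (x - y) * (norm y * norm x) + norm (x - y) * (norm y * norm y)"
      by (intro norm_triangle_le add_mono) (simp_all only: norm_mult complex_mod_cnj order_refl)
    also have "\<dots> \<le> norm (x - y) * ((B + 1) * (B + 1)) + norm (x - y) * ((B + 1) * (B + 1)) + norm (x - y) * ((B + 1) * (B + 1))"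
      using that B0 by (intro add_mono mult_left_mono mult_mono) auto
    finally show ?thesis by (simp add: power2_eq_square algebra_simps)
  qed
  have "norm (cubic_diff c a - cubic_diff c b) = norm ((c + a) * (c + a) * cnj (c + a) - (c + b) * (c + b) * cnj (c + b))"
  proof -
    have "cubic_diff c a - cubic_diff c b = \<i> * ((c + a) * (c + a) * cnj (c + a) - (c + b) * (c + b) * cnj (c + b))"
      unfolding cubic_diff_def complex_norm_square by (simp add: algebra_simps)
    then show ?thesis by (simp only: norm_mult norm_ii mult_1)
  qed
  also have "\<dots> \<le> 3 * (B + 1)\<^sup>2 * norm ((c + a) - (c + b))"
    using B(1) ab norm_triangle_ineq[of c a] norm_triangle_ineq[of c b] by (intro g) linarith+
  finally have 1: "norm (cubic_diff c a - cubic_diff c b) \<le> 3 * (B + 1)\<^sup>2 * norm (a - b)" by simp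
  have eq: "cubic_diff c b - cubic_diff c' b = \<i> * (2 * (((c - c') * cnj c + c' * cnj (c - c')) * b) + ((c - c') * (c + c')) * cnj b
     + 2 * ((c - c') * (b * cnj b)) + cnj (c - c') * (b * b))"
    unfolding cubic_diff_expand by (simp add: algebra_simps)
  have "norm (cubic_diff c b - cubic_diff c' b) \<le> 2 * ((norm (c - c') * norm c + norm c' * norm (c - c')) * norm b)
     + (norm (c - c') * (norm c + norm c')) * norm b + 2 * (norm (c - c') * (norm b * norm b)) + norm (c - c') * (norm b * norm b)"
    unfolding eq norm_mult[of \<i>] norm_ii mult_1
    by (intro norm_triangle_le add_mono)
       (simp_all only: norm_mult complex_mod_cnj norm_numeral order_refl, 
        auto intro!: mult_left_mono mult_right_mono norm_triangle_le simp: norm_mult simp flip: complex_cnj_diff)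
  also have "\<dots> \<le> 2 * ((norm (c - c') * B + B * norm (c - c')) * norm b)
     + (norm (c - c') * (B + B)) * norm b + 2 * (norm (c - c') * (norm b * 1)) + norm (c - c') * (norm b * 1)"
    using B ab by (intro add_mono mult_left_mono mult_right_mono) auto
  also have "\<dots> = (6 * B + 3) * (norm (c - c') * norm b)" by (simp add: algebra_simps)
  finally have 2: "norm (cubic_diff c b - cubic_diff c' b) \<le> (6 * B + 3) * (norm (c - c') * norm b)" .
  have "norm (cubic_diff c a - cubic_diff c' b) \<le> norm (cubic_diff c a - cubic_diff c b) + norm (cubic_diff c b - cubic_diff c' b)"
    using norm_triangle_ineq[of "cubic_diff c a - cubic_diff c b" "cubic_diff c b - cubic_diff c' b"] by simp
  also have "\<dots> \<le> 3 * (B + 1)\<^sup>2 * norm (a - b) + (6 * B + 3) * (norm (c - c') * norm b)"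
    using 1 2 by linarith
  also have "\<dots> \<le> (3 * (B + 1)\<^sup>2 + 6 * B + 3) * norm (a - b) + (3 * (B + 1)\<^sup>2 + 6 * B + 3) * (norm (c - c') * norm b)"
    using B0 by (intro add_mono mult_right_mono) auto
  finally show ?thesis by (simp add: algebra_simps)
qed

lemma cubic_diff_0 [simp]: "cubic_diff c 0 = 0"
  by (simp add: cubic_diff_def)

lemma L2_continuous_on_of_real:
  fixes u :: "real \<Rightarrow> real \<Rightarrow> real"
  assumes "L2_continuous_on I u"
  shows "L2_continuous_on I (\<lambda>s x. complex_of_real (u s x))"
proof -
  have e: "L2_norm (\<lambda>x. complex_of_real (u r x) - complex_of_real (u s x)) = L2_norm (\<lambda>x. u r x - u s x)" for r s
    by (rule L2_norm_cong_norm) (simp flip: of_real_diff)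
  show ?thesis using assms square_integrable_of_real(1) by (auto simp: L2_continuous_on_def e)
qed

lemma bounded_smooth_lipschitz:
  assumes f: "bounded_smooth f"
  obtains L where "L > 0" "\<And>p q. norm (f p - f q) \<le> L * \<bar>p - q\<bar>" "\<And>x. norm (vderiv f x) \<le> L"
proof -
  obtain L where L: "L > 0" "\<And>x. norm (vderiv f x) \<le> L"
    using bounded_smooth_bound[OF bounded_smooth_vderiv[OF f]] by metis
  have "norm (f p - f q) \<le> L * norm (p - q)" for p q
  proof (rule differentiable_bound[of UNIV f "\<lambda>x h. h *\<^sub>R vderiv f x"])
    show "(f has_derivative (\<lambda>h. h *\<^sub>R vderiv f x)) (at x within UNIV)" for x
      using bounded_smooth_has_vector_derivative[OF f, of x] by (simp add: has_vector_derivative_def)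
    show "onorm (\<lambda>h. h *\<^sub>R vderiv f x) \<le> L" for x
      by (rule onorm_le) (use L(2)[of x] in \<open>auto intro!: mult_left_mono simp: mult.commute[of L]\<close>)
  qed auto
  then show ?thesis using that L by auto
qed

lemma continuous_AE_eq:
  fixes f g :: "real \<Rightarrow> 'a::t2_space"
  assumes "continuous_on UNIV f" "continuous_on UNIV g" "AE x in lborel. f x = g x"
  shows "f = g"
proof -
  have "{x. f x = g x} = UNIV"
    by (rule AE_lborel_closed_imp_UNIV) (use assms closed_Collect_eq in auto)
  then show ?thesis by auto
qed

lemma sum_L2_le_sobolev_norm: "(\<Sum>i\<le>m. L2_norm (weak_deriv i u)) \<le> real (m + 1) * sobolev_norm m u"
  using sum_mono[of "{..m}" "\<lambda>i. L2_norm (weak_deriv i u)" "\<lambda>_. sobolev_norm m u"] L2_le_sobolev_norm[of _ m u] by simp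

text \<open>The bound \<open>B\<close> is a parameter, fixed before \<psi> and \<gamma>, so that
  later constants do not depend on the solution. The factors k + 3 and k + 1 count the derivatives
  up to order k + 2 and k; they convert smallness of a Sobolev norm into smallness of the sum of its
  L2 norms, hence into sup bounds.\<close>

locale modulated_lle =
  fixes \<alpha> \<beta> F t B :: real and k :: nat and \<phi> :: "real \<Rightarrow> complex"
    and \<psi> :: "real \<Rightarrow> real \<Rightarrow> complex" and \<gamma> \<gamma>x \<gamma>t :: "real \<Rightarrow> real \<Rightarrow> real" and v :: "real \<Rightarrow> real \<Rightarrow> complex"
  assumes t_pos: "t > 0" and k_pos: "k \<ge> 1" and phi: "bounded_smooth \<phi>"
    and stationary: "lle_stationary \<alpha> \<beta> F \<phi>"
    and solution: "lle_solution \<alpha> \<beta> F {0..t} \<psi>"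
    and partials: "has_partial_derivs {0..t} \<gamma> \<gamma>x \<gamma>t"
    and v_eq: "v = forward_perturbation \<phi> \<psi> \<gamma>"
    and cont_v: "continuous_in_sobolev k {0..t} v"
    and cont_x: "continuous_in_sobolev (k + 2) {0..t} \<gamma>x"
    and cont_t: "continuous_in_sobolev (k + 2) {0..t} \<gamma>t"
    and small_grad: "\<And>s. s \<in> {0..t} \<Longrightarrow> real (k + 3) * sqrt (grad_norm_sq (k + 2) (\<gamma>x s) (\<gamma>t s)) \<le> 1"
    and small_v: "\<And>s. s \<in> {0..t} \<Longrightarrow> real (k + 1) * sobolev_norm k (v s) \<le> 1"
    and modulated_bound: "\<And>f \<gamma> g. f \<in> {\<phi>, vderiv \<phi>, vderiv (vderiv \<phi>)} \<Longrightarrow>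
       \<forall>x. (\<gamma> has_real_derivative g x) (at x) \<Longrightarrow> cbd k (\<lambda>x. 1 - complex_of_real (g x)) 2 \<Longrightarrow>
       cbd k (\<lambda>x. f (x - \<gamma> x)) B"
begin

definition gx :: "real \<Rightarrow> real \<Rightarrow> complex" where "gx s x = of_real (\<gamma>x s x)"
definition gt :: "real \<Rightarrow> real \<Rightarrow> complex" where "gt s x = of_real (\<gamma>t s x)"
text \<open>A classical derivative, which is legitimate because \<gamma>x will turn out to coincide
  with its continuously differentiable representative.\<close>

definition gxx :: "real \<Rightarrow> real \<Rightarrow> complex" where "gxx s = vderiv (gx s)"
definition modul :: "(real \<Rightarrow> complex) \<Rightarrow> real \<Rightarrow> real \<Rightarrow> complex" where
  "modul f s x = f (x - \<gamma> s x)"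
text \<open>What the modulated wave fails to satisfy in the equation. The stationary equation
  removes the term without phase derivatives, and (1 - \<gamma>_x)^2 - 1 = (\<gamma>_x - 2)
  \<gamma>_x leaves a phase derivative in each term.\<close>

definition resid :: "real \<Rightarrow> real \<Rightarrow> complex" where
  "resid s x = modul (vderiv \<phi>) s x * gt s x
     - \<i> * of_real \<beta> * (modul (vderiv (vderiv \<phi>)) s x * ((gx s x - 2) * gx s x) - modul (vderiv \<phi>) s x * gxx s x)"
definition forcing :: "real \<Rightarrow> real \<Rightarrow> complex" where
  "forcing s x = cubic_diff (modul \<phi> s x) (v s x) + resid s x"

section \<open>Regularity and sup bounds of the phase and of the perturbation\<close>

lemma sobolev_v: "s \<in> {0..t} \<Longrightarrow> sobolev k (v s)"
  and sobolev_x: "s \<in> {0..t} \<Longrightarrow> sobolev (k + 2) (\<gamma>x s)"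
  and sobolev_t: "s \<in> {0..t} \<Longrightarrow> sobolev (k + 2) (\<gamma>t s)"
  using cont_v cont_x cont_t by (auto simp: continuous_in_sobolev_def)

lemma gamma_x: "s \<in> {0..t} \<Longrightarrow> (\<gamma> s has_real_derivative \<gamma>x s x) (at x)"
  and gamma_t: "s \<in> {0..t} \<Longrightarrow> ((\<lambda>r. \<gamma> r x) has_real_derivative \<gamma>t s x) (at s within {0..t})"
  using partials by (auto simp: has_partial_derivs_def)

lemma gamma_continuous: "s \<in> {0..t} \<Longrightarrow> continuous_on UNIV (\<gamma> s)"
  using gamma_x by (auto intro!: continuous_at_imp_continuous_on DERIV_isCont)

lemma sobolev_norm_x_le: "sobolev_norm (k + 2) (\<gamma>x s) \<le> sqrt (grad_norm_sq (k + 2) (\<gamma>x s) (\<gamma>t s))"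
  and sobolev_norm_t_le: "sobolev_norm (k + 2) (\<gamma>t s) \<le> sqrt (grad_norm_sq (k + 2) (\<gamma>x s) (\<gamma>t s))"
  unfolding grad_norm_sq_def by (auto intro!: real_le_rsqrt)

text \<open>Being an everywhere-defined derivative in x, \<gamma>x equals its continuous
  representative at every point and inherits its k + 1 classical derivatives. One order of the k + 2
  is spent on the Sobolev inequality.\<close>

lemma
  assumes s: "s \<in> {0..t}"
  shows hsob_gx: "hsob (k + 1) (gx s)"
    and cbd_gx: "cbd (k + 1) (gx s) 1"
    and L2_nderiv_gx: "j \<le> k + 1 \<Longrightarrow> L2_norm (nderiv j (gx s)) = L2_norm (weak_deriv j (\<gamma>x s))"
    and gxx_AE: "AE x in lborel. gxx s x = of_real (weak_deriv 1 (\<gamma>x s) x)"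
proof -
  have S: "sobolev (Suc (k + 1)) (\<lambda>x. complex_of_real (\<gamma>x s x))"
    using sobolev_of_real[OF sobolev_x[OF s]] by simp
  obtain w where w: "hsob (k + 1) w"
    "\<And>j. j \<le> k + 1 \<Longrightarrow> AE x in lborel. nderiv j w x = weak_deriv j (\<lambda>x. complex_of_real (\<gamma>x s x)) x"
    "AE x in lborel. w x = complex_of_real (\<gamma>x s x)"
    "\<And>j. j \<le> k + 1 \<Longrightarrow> L2_norm (nderiv j w) = L2_norm (weak_deriv j (\<lambda>x. complex_of_real (\<gamma>x s x)))"
    "cbd (k + 1) w (\<Sum>i\<le>Suc (k + 1). L2_norm (weak_deriv i (\<lambda>x. complex_of_real (\<gamma>x s x))))"
    using sobolev_representative[OF S] by blast
  have cw: "continuous_on UNIV w" using hsob_imp_diffk[OF w(1)] by (rule diffk_imp_continuous)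
  have "\<gamma>x s = (\<lambda>x. Re (w x))"
  proof (rule derivative_eq_continuous_AE[OF gamma_x[OF s]])
    show "continuous_on UNIV (\<lambda>x. Re (w x))" by (intro continuous_intros cw)
    show "AE x in lborel. \<gamma>x s x = Re (w x)" using w(3) by eventually_elim simp
  qed
  then have "continuous_on UNIV (gx s)" unfolding gx_def by (auto intro!: continuous_intros cw)
  then have wg: "w = gx s"
    by (rule continuous_AE_eq[OF cw]) (use w(3) in \<open>simp add: gx_def\<close>)
  have L: "L2_norm (weak_deriv j (\<lambda>x. complex_of_real (\<gamma>x s x))) = L2_norm (weak_deriv j (\<gamma>x s))" if "j \<le> k + 2" for j
    by (rule L2_weak_deriv_of_real[OF sobolev_x[OF s] that])
  show "hsob (k + 1) (gx s)" using w(1) wg by simp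
  show "j \<le> k + 1 \<Longrightarrow> L2_norm (nderiv j (gx s)) = L2_norm (weak_deriv j (\<gamma>x s))"
    using w(4)[of j] L[of j] wg by simp
  have "AE x in lborel. weak_deriv 1 (\<lambda>x. complex_of_real (\<gamma>x s x)) x = complex_of_real (weak_deriv 1 (\<gamma>x s) x)"
    by (rule weak_deriv_of_real[OF sobolev_x[OF s]]) simp
  moreover have "AE x in lborel. gxx s x = weak_deriv 1 (\<lambda>x. complex_of_real (\<gamma>x s x)) x"
    using w(2)[of 1] wg by (simp add: gxx_def)
  ultimately show "AE x in lborel. gxx s x = of_real (weak_deriv 1 (\<gamma>x s) x)"
    by eventually_elim simp
  have "(\<Sum>i\<le>Suc (k + 1). L2_norm (weak_deriv i (\<lambda>x. complex_of_real (\<gamma>x s x)))) = (\<Sum>i\<le>k + 2. L2_norm (weak_deriv i (\<gamma>x s)))"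
    using L by (intro sum.cong) auto
  also have "\<dots> \<le> real (k + 3) * sobolev_norm (k + 2) (\<gamma>x s)"
    using sum_L2_le_sobolev_norm[where m="k + 2" and u="\<gamma>x s"] by (simp add: algebra_simps)
  also have "\<dots> \<le> real (k + 3) * sqrt (grad_norm_sq (k + 2) (\<gamma>x s) (\<gamma>t s))"
    by (intro mult_left_mono sobolev_norm_x_le) auto
  also have "\<dots> \<le> 1" by (rule small_grad[OF s])
  finally show "cbd (k + 1) (gx s) 1" using w(5) unfolding wg by (rule cbd_mono[OF _ order_refl, rotated])
qed

lemma cbd_one_minus_gx: "s \<in> {0..t} \<Longrightarrow> cbd (k + 1) (\<lambda>x. 1 - complex_of_real (\<gamma>x s x)) 2"
proof -
  assume s: "s \<in> {0..t}"
  have 1: "cbd (k + 1) (\<lambda>x. 1) 1" 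
    unfolding cbd_def using diffk_const[of "k+1" "1::complex"] by (auto simp only: nderiv_const split: if_splits) auto
  show ?thesis using cbd_add[OF 1 cbd_cmult[OF cbd_gx[OF s], of "-1"]] by (simp add: gx_def)
qed

text \<open>The Sobolev inequality bounds the representative of \<gamma>t, hence \<gamma>t itself
  only almost everywhere at each time; \<open>time_derivative_bound\<close> removes the exceptional
  sets.\<close>

lemma gamma_t_bound: "s \<in> {0..t} \<Longrightarrow> \<bar>\<gamma>t s x\<bar> \<le> 1"
  and gamma_lipschitz: "a \<in> {0..t} \<Longrightarrow> b \<in> {0..t} \<Longrightarrow> \<bar>\<gamma> b x - \<gamma> a x\<bar> \<le> \<bar>b - a\<bar>"
proof -
  have M: "AE x in lborel. \<bar>\<gamma>t s x\<bar> \<le> 1" if s: "s \<in> {0..t}" for s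
  proof -
    have S: "sobolev (Suc (k + 1)) (\<lambda>x. complex_of_real (\<gamma>t s x))"
      using sobolev_of_real[OF sobolev_t[OF s]] by simp
    obtain w where w: "AE x in lborel. w x = complex_of_real (\<gamma>t s x)"
      "cbd (k + 1) w (\<Sum>i\<le>Suc (k + 1). L2_norm (weak_deriv i (\<lambda>x. complex_of_real (\<gamma>t s x))))"
      using sobolev_representative[OF S] by blast
    have "(\<Sum>i\<le>Suc (k + 1). L2_norm (weak_deriv i (\<lambda>x. complex_of_real (\<gamma>t s x)))) = (\<Sum>i\<le>k + 2. L2_norm (weak_deriv i (\<gamma>t s)))"
      using L2_weak_deriv_of_real[OF sobolev_t[OF s]] by (intro sum.cong) auto
    also have "\<dots> \<le> real (k + 3) * sobolev_norm (k + 2) (\<gamma>t s)"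
      using sum_L2_le_sobolev_norm[where m="k + 2" and u="\<gamma>t s"] by (simp add: algebra_simps)
    also have "\<dots> \<le> real (k + 3) * sqrt (grad_norm_sq (k + 2) (\<gamma>x s) (\<gamma>t s))"
      by (intro mult_left_mono sobolev_norm_t_le) auto
    also have "\<dots> \<le> 1" by (rule small_grad[OF s])
    finally have "norm (w x) \<le> 1" for x using cbd_bound[OF w(2), of x] by linarith
    then have "AE x in lborel. norm (w x) \<le> 1" by simp
    with w(1) show ?thesis by eventually_elim simp
  qed
  show "s \<in> {0..t} \<Longrightarrow> \<bar>\<gamma>t s x\<bar> \<le> 1"
    by (rule time_derivative_bound_everywhere[OF t_pos gamma_t gamma_continuous M])
  show "a \<in> {0..t} \<Longrightarrow> b \<in> {0..t} \<Longrightarrow> \<bar>\<gamma> b x - \<gamma> a x\<bar> \<le> \<bar>b - a\<bar>"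
    using time_lipschitz_bound[OF t_pos gamma_t gamma_continuous M, of a b x] by simp
qed

lemma v_AE_bound: 
  assumes s: "s \<in> {0..t}"
  shows "AE x in lborel. norm (v s x) \<le> 1"
proof -
  \<comment> \<open>The representative costs one derivative, so the index drops to k - 1, which is
    legitimate because k is at least 1.\<close>
  have S: "sobolev (Suc (k - 1)) (v s)" using sobolev_v[OF s] k_pos by simp
  obtain w where w: "AE x in lborel. w x = v s x" "cbd (k - 1) w (\<Sum>i\<le>Suc (k - 1). L2_norm (weak_deriv i (v s)))"
    by (rule sobolev_representative[OF S])
  have "(\<Sum>i\<le>Suc (k - 1). L2_norm (weak_deriv i (v s))) \<le> 1"
    using sum_L2_le_sobolev_norm[where m=k and u="v s"] small_v[OF s] k_pos by simp
  then have "norm (w x) \<le> 1" for x using cbd_bound[OF w(2), of x] by linarith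
  then have "AE x in lborel. norm (w x) \<le> 1" by simp
  with w(1) show ?thesis by eventually_elim simp
qed

section \<open>The modulated profile as a coefficient in space and time\<close>

lemma cbd_modul: "s \<in> {0..t} \<Longrightarrow> f \<in> {\<phi>, vderiv \<phi>, vderiv (vderiv \<phi>)} \<Longrightarrow> cbd k (modul f s) B"
  unfolding modul_def using gamma_x cbd_mono[OF cbd_one_minus_gx] by (intro modulated_bound) auto

lemma B_nonneg: "0 \<le> B"
  using cbd_nonneg[OF cbd_modul[of 0 \<phi>]] t_pos by simp

lemma modul_bound: "s \<in> {0..t} \<Longrightarrow> f \<in> {\<phi>, vderiv \<phi>, vderiv (vderiv \<phi>)} \<Longrightarrow> norm (modul f s x) \<le> B"
  by (rule cbd_bound[OF cbd_modul])

lemma modul_measurable: "s \<in> {0..t} \<Longrightarrow> f \<in> {\<phi>, vderiv \<phi>, vderiv (vderiv \<phi>)} \<Longrightarrow> modul f s \<in> borel_measurable borel"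
  using cbd_modul[of s f] diffk_imp_continuous by (auto simp: cbd_def intro: borel_measurable_continuous_onI)

lemma bounded_smooth_cases: "f \<in> {\<phi>, vderiv \<phi>, vderiv (vderiv \<phi>)} \<Longrightarrow> bounded_smooth f"
  using phi bounded_smooth_vderiv by auto

lemma modul_has_vector_derivative_x:
  "s \<in> {0..t} \<Longrightarrow> bounded_smooth f \<Longrightarrow> (modul f s has_vector_derivative modul (vderiv f) s x * (1 - gx s x)) (at x)"
  unfolding modul_def gx_def by (rule modulated_has_vector_derivative[OF _ gamma_x])

lemma modul_has_vector_derivative_t:
  assumes s: "s \<in> {0..t}" and f: "bounded_smooth f"
  shows "((\<lambda>r. modul f r x) has_vector_derivative - (modul (vderiv f) s x * gt s x)) (at s within {0..t})"
proof -
  have 1: "((\<lambda>r. x - \<gamma> r x) has_vector_derivative - \<gamma>t s x) (at s within {0..t})"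
    unfolding has_real_derivative_iff_has_vector_derivative[symmetric]
    by (auto intro!: derivative_eq_intros gamma_t s)
  have "(f has_vector_derivative vderiv f (x - \<gamma> s x)) (at (x - \<gamma> s x) within (\<lambda>r. x - \<gamma> r x) ` {0..t})"
    by (rule has_vector_derivative_at_within[OF bounded_smooth_has_vector_derivative[OF f]])
  from vector_diff_chain_within[OF 1 this] show ?thesis
    by (simp add: o_def modul_def gt_def scaleR_conv_of_real mult.commute)
qed

lemma modul_lipschitz:
  assumes f: "bounded_smooth f"
  obtains L where "L > 0" "\<And>a b x. a \<in> {0..t} \<Longrightarrow> b \<in> {0..t} \<Longrightarrow> norm (modul f b x - modul f a x) \<le> L * \<bar>b - a\<bar>"
    "\<And>s x. norm (modul (vderiv f) s x) \<le> L"
proof -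
  obtain L where L: "L > 0" "\<And>p q. norm (f p - f q) \<le> L * \<bar>p - q\<bar>" "\<And>x. norm (vderiv f x) \<le> L"
    using bounded_smooth_lipschitz[OF f] by metis
  have "norm (modul f b x - modul f a x) \<le> L * \<bar>b - a\<bar>" if "a \<in> {0..t}" "b \<in> {0..t}" for a b x
  proof -
    have "norm (modul f b x - modul f a x) \<le> L * \<bar>(x - \<gamma> b x) - (x - \<gamma> a x)\<bar>"
      unfolding modul_def by (rule L(2))
    also have "\<dots> \<le> L * \<bar>b - a\<bar>"
      using gamma_lipschitz[OF that, of x] L(1) by (intro mult_left_mono) auto
    finally show ?thesis .
  qed
  then show ?thesis using that L by (auto simp: modul_def)
qed

lemma tendsto_lipschitz_modulus: "((\<lambda>r. L * \<bar>r - a\<bar>) \<longlongrightarrow> 0) (at a within {0..t})" for L a :: real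
proof -
  have "((\<lambda>r. L * \<bar>r - a\<bar>) \<longlongrightarrow> L * \<bar>a - a\<bar>) (at a within {0..t})" by (intro tendsto_intros)
  then show ?thesis by simp
qed

lemma L2_continuous_modul_mult:
  assumes f: "f \<in> {\<phi>, vderiv \<phi>, vderiv (vderiv \<phi>)}" and u: "L2_continuous_on {0..t} u"
  shows "L2_continuous_on {0..t} (\<lambda>s x. modul f s x * u s x)"
proof -
  obtain L where L: "L > 0" "\<And>a b x. a \<in> {0..t} \<Longrightarrow> b \<in> {0..t} \<Longrightarrow> norm (modul f b x - modul f a x) \<le> L * \<bar>b - a\<bar>"
    using modul_lipschitz[OF bounded_smooth_cases[OF f]] by metis
  show ?thesis
    by (rule L2_continuous_on_coeff_mult[OF u, of _ B "\<lambda>r a. L * \<bar>r - a\<bar>"])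
       (use f L modul_bound[of _ f] modul_measurable[of _ f] B_nonneg tendsto_lipschitz_modulus in auto)
qed

section \<open>Continuity in time of the residual and of the forcing\<close>

lemma L2_continuous_gx: "L2_continuous_on {0..t} gx"
  and L2_continuous_gt: "L2_continuous_on {0..t} gt"
  and L2_continuous_gxx: "L2_continuous_on {0..t} gxx"
proof -
  show "L2_continuous_on {0..t} gx" unfolding gx_def
    by (rule L2_continuous_on_of_real[OF continuous_in_sobolev_L2[OF cont_x]])
  show "L2_continuous_on {0..t} gt" unfolding gt_def
    by (rule L2_continuous_on_of_real[OF continuous_in_sobolev_L2[OF cont_t]])
  show "L2_continuous_on {0..t} gxx"
  proof (rule L2_continuous_on_cong_AE)
    show "L2_continuous_on {0..t} (\<lambda>s x. complex_of_real (weak_deriv 1 (\<gamma>x s) x))"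
      by (rule L2_continuous_on_of_real[OF L2_continuous_on_weak_deriv[OF cont_x]]) simp
    show "gxx s \<in> borel_measurable borel" if "s \<in> {0..t}" for s
      using diffk_measurable_nderiv[OF hsob_imp_diffk[OF hsob_gx[OF that]], of 1] by (simp add: gxx_def)
  qed (rule gxx_AE)
qed

lemma L2_continuous_resid: "L2_continuous_on {0..t} resid"
proof -
  \<comment> \<open>By the Sobolev inequality the H^1 distance bounds the sup distance of
    \<open>gx\<close> at two times, so it serves as the modulus of the coefficient.\<close>
  let ?\<omega> = "\<lambda>r a. L2_norm (\<lambda>x. gx r x - gx a x) + L2_norm (\<lambda>x. gxx r x - gxx a x)"
  have gx_cont: "L2_continuous_on {0..t} (\<lambda>s x. (gx s x - 2) * gx s x)"
  proof (rule L2_continuous_on_coeff_mult[OF L2_continuous_gx, of _ 3 ?\<omega>])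
    show "(\<lambda>x. gx r x - 2) \<in> borel_measurable borel" if "r \<in> {0..t}" for r
      using diffk_measurable_nderiv[OF hsob_imp_diffk[OF hsob_gx[OF that]], of 0] by simp
    show "AE x in lborel. norm (gx r x - 2) \<le> 3" if "r \<in> {0..t}" for r
    proof (rule AE_I2)
      fix x show "norm (gx r x - 2) \<le> 3"
        using cbd_bound[OF cbd_gx[OF that], of x] norm_triangle_ineq4[of "gx r x" 2] by simp
    qed
    show "AE x in lborel. norm (gx r x - 2 - (gx a x - 2)) \<le> ?\<omega> r a" if ra: "r \<in> {0..t}" "a \<in> {0..t}" for r a
    proof (rule AE_I2)
      fix x
      have h: "hsob 1 (gx r)" "hsob 1 (gx a)" using hsob_mono[OF hsob_gx, of _ 1] ra by auto
      have "vderiv (\<lambda>x. gx r x - gx a x) = (\<lambda>x. gxx r x - gxx a x)"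
        using nderiv_diff[OF hsob_imp_diffk[OF h(1)] hsob_imp_diffk[OF h(2)], of 1] by (simp add: gxx_def)
      then show "norm (gx r x - 2 - (gx a x - 2)) \<le> ?\<omega> r a"
        using hsob_sup_bound_1[OF hsob_diff[OF h], of x] by simp
    qed
    show "((\<lambda>r. ?\<omega> r a) \<longlongrightarrow> 0) (at a within {0..t})" if "a \<in> {0..t}" for a
      using L2_continuous_gx L2_continuous_gxx that 
        tendsto_add[of "\<lambda>r. L2_norm (\<lambda>x. gx r x - gx a x)" 0 "at a within {0..t}" "\<lambda>r. L2_norm (\<lambda>x. gxx r x - gxx a x)" 0]
      by (auto simp: L2_continuous_on_def)
  qed auto
  have "L2_continuous_on {0..t} (\<lambda>s x. modul (vderiv \<phi>) s x * gt s x 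
     + (- (\<i> * of_real \<beta>) * (modul (vderiv (vderiv \<phi>)) s x * ((gx s x - 2) * gx s x))
       + (\<i> * of_real \<beta>) * (modul (vderiv \<phi>) s x * gxx s x)))"
    by (intro L2_continuous_on_add L2_continuous_on_cmult L2_continuous_modul_mult L2_continuous_gt gx_cont L2_continuous_gxx) auto
  moreover have "modul (vderiv \<phi>) s x * gt s x 
     + (- (\<i> * of_real \<beta>) * (modul (vderiv (vderiv \<phi>)) s x * ((gx s x - 2) * gx s x))
       + (\<i> * of_real \<beta>) * (modul (vderiv \<phi>) s x * gxx s x)) = resid s x" for s x
    unfolding resid_def by (simp add: algebra_simps)
  ultimately show ?thesis by simp
qed

lemma v_square_integrable: "s \<in> {0..t} \<Longrightarrow> square_integrable (v s)"
  using sobolev_v by (auto simp: sobolev_def)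

lemma cubic_measurable:
  assumes "s \<in> {0..t}" "w \<in> borel_measurable borel"
  shows "(\<lambda>x. cubic_diff (modul \<phi> s x) (w x)) \<in> borel_measurable borel"
proof -
  note [measurable] = modul_measurable[OF assms(1), of \<phi>, simplified] assms(2)
  show ?thesis unfolding cubic_diff_def by measurable
qed

lemma L2_continuous_cubic: "L2_continuous_on {0..t} (\<lambda>s x. cubic_diff (modul \<phi> s x) (v s x))"
  unfolding L2_continuous_on_def
proof (intro ballI conjI)
  let ?K = "3 * (B + 1)\<^sup>2 + 6 * B + 3"
  have K: "0 \<le> ?K" using B_nonneg by simp
  note m = cubic_measurable[OF _ square_integrable_measurable[OF v_square_integrable]]
  fix a assume a: "a \<in> {0..t}"
  show "square_integrable (\<lambda>x. cubic_diff (modul \<phi> a x) (v a x))"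
  proof (rule square_integrable_dominated[OF v_square_integrable[OF a] m[OF a a] _ K])
    show "AE x in lborel. norm (cubic_diff (modul \<phi> a x) (v a x)) \<le> ?K * norm (v a x)"
      using v_AE_bound[OF a]
    proof eventually_elim
      case (elim x)
      show ?case using cubic_diff_lipschitz[OF modul_bound[OF a] modul_bound[OF a], of \<phi> \<phi> "v a x" 0 x x] elim by simp
    qed
  qed
  obtain L where L: "L > 0" "\<And>a b x. a \<in> {0..t} \<Longrightarrow> b \<in> {0..t} \<Longrightarrow> norm (modul \<phi> b x - modul \<phi> a x) \<le> L * \<bar>b - a\<bar>"
    using modul_lipschitz[OF phi] by metis
  let ?D = "\<lambda>r x. cubic_diff (modul \<phi> r x) (v r x) - cubic_diff (modul \<phi> a x) (v a x)"
  show "((\<lambda>r. L2_norm (?D r)) \<longlongrightarrow> 0) (at a within {0..t})"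
  proof (rule Lim_null_comparison)
    have "L2_norm (?D r) \<le> ?K * (L2_norm (\<lambda>x. v r x - v a x) + (L * \<bar>r - a\<bar>) * L2_norm (v a))" if r: "r \<in> {0..t}" for r
    proof -
      note d = square_integrable_diff[OF v_square_integrable[OF r] v_square_integrable[OF a]]
      have m1: "(\<lambda>z::complex. of_real (norm z) :: complex) \<in> borel_measurable borel" by measurable
      \<comment> \<open>The pointwise bound is a sum of two norms. Written with these complex-valued
        stand-ins it is the norm of a single L2 function, as domination requires.\<close>
      let ?p = "\<lambda>x. of_real (norm (v r x - v a x)) :: complex" and ?q = "\<lambda>x. of_real (norm (v a x)) :: complex"
      have p: "square_integrable ?p" "L2_norm ?p = L2_norm (\<lambda>x. v r x - v a x)"
        using square_integrable_map[OF d m1, of 1] L2_norm_map[OF d m1, of 1] by auto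
      have q: "square_integrable ?q" "L2_norm ?q = L2_norm (v a)"
        using square_integrable_map[OF v_square_integrable[OF a] m1, of 1] L2_norm_map[OF v_square_integrable[OF a] m1, of 1] by auto
      note q2 = square_integrable_cmult[OF q(1), of "of_real (L * \<bar>r - a\<bar>)"]
      note s = square_integrable_add[OF p(1) q2]
      have "L2_norm (?D r) \<le> ?K * L2_norm (\<lambda>x. ?p x + of_real (L * \<bar>r - a\<bar>) * ?q x)"
      proof (rule L2_norm_dominated[OF s _ _ K])
        show "(\<lambda>x. ?D r x) \<in> borel_measurable borel" using m[OF r r] m[OF a a] by simp
        show "AE x in lborel. norm (?D r x) \<le> ?K * norm (?p x + of_real (L * \<bar>r - a\<bar>) * ?q x)"
          using v_AE_bound[OF a] v_AE_bound[OF r]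
        proof eventually_elim
          case (elim x)
          have "norm (?D r x) \<le> ?K * (norm (v r x - v a x) + norm (modul \<phi> r x - modul \<phi> a x) * norm (v a x))"
            by (rule cubic_diff_lipschitz[OF modul_bound[OF r] modul_bound[OF a] elim(2,1)]) auto
          also have "\<dots> \<le> ?K * (norm (v r x - v a x) + (L * \<bar>r - a\<bar>) * norm (v a x))"
            using L(2)[OF a r, of x] K by (intro mult_left_mono add_mono mult_right_mono) auto
          also have "norm (v r x - v a x) + (L * \<bar>r - a\<bar>) * norm (v a x) = norm (?p x + of_real (L * \<bar>r - a\<bar>) * ?q x)"
            using L(1) by (simp only: of_real_mult[symmetric] of_real_add[symmetric] norm_of_real) simp
          finally show ?case .
        qed
      qed
      also have "\<dots> \<le> ?K * (L2_norm ?p + (L * \<bar>r - a\<bar>) * L2_norm ?q)"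
        using L2_norm_triangle[OF p(1) q2] L2_norm_cmult[OF q(1), of "of_real (L * \<bar>r - a\<bar>)"] L(1) K
        by (intro mult_left_mono) (auto simp: norm_mult)
      finally show ?thesis unfolding p(2) q(2) .
    qed
    then show "\<forall>\<^sub>F r in at a within {0..t}. norm (L2_norm (?D r)) \<le> ?K * (L2_norm (\<lambda>x. v r x - v a x) + (L * \<bar>r - a\<bar>) * L2_norm (v a))"
      by (auto simp: eventually_at_filter)
    have "((\<lambda>r. L2_norm (\<lambda>x. v r x - v a x)) \<longlongrightarrow> 0) (at a within {0..t})"
      using continuous_in_sobolev_L2[OF cont_v] a by (simp add: L2_continuous_on_def)
    then have "((\<lambda>r. ?K * (L2_norm (\<lambda>x. v r x - v a x) + (L * \<bar>r - a\<bar>) * L2_norm (v a))) \<longlongrightarrow> ?K * (0 + 0 * L2_norm (v a))) (at a within {0..t})"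
      by (intro tendsto_intros tendsto_lipschitz_modulus)
    then show "((\<lambda>r. ?K * (L2_norm (\<lambda>x. v r x - v a x) + (L * \<bar>r - a\<bar>) * L2_norm (v a))) \<longlongrightarrow> 0) (at a within {0..t})" by simp
  qed
qed

lemma L2_continuous_forcing: "L2_continuous_on {0..t} forcing"
  unfolding forcing_def by (rule L2_continuous_on_add[OF L2_continuous_cubic L2_continuous_resid])

section \<open>Derivation of the equation for the perturbation\<close>

lemma modul_second_derivative:
  assumes s: "s \<in> {0..t}"
  shows "diffk 2 (modul \<phi> s)"
    and "nderiv 2 (modul \<phi> s) = (\<lambda>x. modul (vderiv (vderiv \<phi>)) s x * (1 - gx s x)\<^sup>2 - modul (vderiv \<phi>) s x * gxx s x)"
proof -
  note phi' = bounded_smooth_vderiv[OF phi]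
  have g1: "diffk 1 (gx s)" using hsob_imp_diffk[OF hsob_gx[OF s]] diffk_mono[of "k+1" "gx s" 1] by simp
  have v1: "vderiv (modul \<phi> s) = (\<lambda>x. modul (vderiv \<phi>) s x * (1 - gx s x))"
    by (rule vderiv_eqI[OF modul_has_vector_derivative_x[OF s phi]])
  have d2: "((\<lambda>x. modul (vderiv \<phi>) s x * (1 - gx s x)) has_vector_derivative
     modul (vderiv (vderiv \<phi>)) s x * (1 - gx s x)\<^sup>2 - modul (vderiv \<phi>) s x * gxx s x) (at x)" for x
  proof -
    have "((\<lambda>x. 1 - gx s x) has_vector_derivative 0 - gxx s x) (at x)"
      unfolding gxx_def using diffk_has_vector_derivative[OF g1, of 0 x]
      by (intro has_vector_derivative_diff) auto
    from has_vector_derivative_mult[OF modul_has_vector_derivative_x[OF s phi'] this]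
    show ?thesis by (simp add: power2_eq_square algebra_simps)
  qed
  have v2: "vderiv (\<lambda>x. modul (vderiv \<phi>) s x * (1 - gx s x)) = (\<lambda>x. modul (vderiv (vderiv \<phi>)) s x * (1 - gx s x)\<^sup>2 - modul (vderiv \<phi>) s x * gxx s x)"
    by (rule vderiv_eqI[OF d2])
  have c: "continuous_on UNIV (modul f s)" if "f \<in> {\<phi>, vderiv \<phi>, vderiv (vderiv \<phi>)}" for f
    using cbd_modul[OF s that] diffk_imp_continuous by (auto simp: cbd_def)
  have c3: "continuous_on UNIV (\<lambda>x. modul (vderiv (vderiv \<phi>)) s x * (1 - gx s x)\<^sup>2 - modul (vderiv \<phi>) s x * gxx s x)"
    using diffk_continuous_nderiv[OF g1, of 0] diffk_continuous_nderiv[OF g1, of 1] c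
    by (auto intro!: continuous_intros simp: gxx_def)
  have "diffk (Suc 0) (vderiv (modul \<phi> s))" unfolding v1
    by (rule diffk_SucI[OF d2]) (simp only: diffk.simps c3)
  then have "diffk (Suc (Suc 0)) (modul \<phi> s)"
    unfolding v1 by (rule diffk_SucI[OF modul_has_vector_derivative_x[OF s phi]])
  then show "diffk 2 (modul \<phi> s)" by (simp only: numeral_2_eq_2)
  show "nderiv 2 (modul \<phi> s) = (\<lambda>x. modul (vderiv (vderiv \<phi>)) s x * (1 - gx s x)\<^sup>2 - modul (vderiv \<phi>) s x * gxx s x)"
    by (simp add: numeral_2_eq_2 v1 v2)
qed

text \<open>The stationary equation, evaluated at x - \<gamma>, trades the reaction term of the
  profile for its second derivative. The last bracket is the second space derivative of the
  modulated wave, which cancels against the dispersion of that wave.\<close>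

lemma reaction_identity:
  "lle_reaction \<alpha> F (\<psi> s x) + modul (vderiv \<phi>) s x * gt s x
     = - (1 + \<i> * of_real \<alpha>) * v s x + forcing s x + \<i> * of_real \<beta> *
       (modul (vderiv (vderiv \<phi>)) s x * (1 - gx s x)\<^sup>2 - modul (vderiv \<phi>) s x * gxx s x)"
proof -
  have st: "lle_reaction \<alpha> F (modul \<phi> s x) = \<i> * of_real \<beta> * modul (vderiv (vderiv \<phi>)) s x"
  proof -
    have "0 = - \<i> * of_real \<beta> * nderiv 2 \<phi> (x - \<gamma> s x) + lle_reaction \<alpha> F (\<phi> (x - \<gamma> s x))"
      using stationary unfolding lle_stationary_def by blast
    then show ?thesis by (simp add: modul_def numeral_2_eq_2)
  qed
  have "\<psi> s x = modul \<phi> s x + v s x" by (simp add: v_eq forward_perturbation_def modul_def)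
  then have "lle_reaction \<alpha> F (\<psi> s x) = lle_reaction \<alpha> F (modul \<phi> s x) - (1 + \<i> * of_real \<alpha>) * v s x + cubic_diff (modul \<phi> s x) (v s x)"
    by (simp add: lle_reaction_def cubic_diff_def algebra_simps)
  then show ?thesis unfolding st forcing_def resid_def by (simp add: algebra_simps power2_eq_square)
qed

text \<open>The modulated wave is not in L2, so the roles are exchanged: the test function is a
  constant L2 curve, the wave is its coefficient, and the product is paired with the indicator of an
  interval containing the support.\<close>

lemma modul_pairing_derivative:
  assumes s: "s \<in> {0..t}" and e: "test_function \<eta>"
  shows "((\<lambda>r. LINT x|lborel. \<eta> x *\<^sub>R modul \<phi> r x) has_vector_derivative
     - (LINT x|lborel. \<eta> x *\<^sub>R (modul (vderiv \<phi>) s x * gt s x))) (at s within {0..t})"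
proof -
  obtain R K where R: "R > 0" "K > 0" "\<And>x. \<bar>\<eta> x\<bar> \<le> K" "\<And>x. \<bar>x\<bar> > R \<Longrightarrow> \<eta> x = 0"
    using test_function_bound[OF e] by metis
  let ?W = "\<lambda>x. complex_of_real (\<eta> x)" and ?Z = "\<lambda>x. indicator {-R..R} x :: complex"
  have "\<bar>\<eta> x\<bar> \<le> K * indicator {-R..R} x" for x
    using R(3)[of x] R(4)[of x] by (cases "\<bar>x\<bar> > R") (auto simp: indicator_def abs_le_iff not_less)
  then have sW: "square_integrable ?W"
    using test_function_measurable[OF e]
    by (intro square_integrable_bounded_support[of _ K "-R" R]) auto
  have sZ: "square_integrable ?Z"
    by (rule square_integrable_bounded_support[of _ 1 "-R" R]) (auto simp: indicator_def)
  have DW: "has_L2_derivative (\<lambda>_. ?W) (\<lambda>_. 0) s {0..t}" and DZ: "has_L2_derivative (\<lambda>_. ?Z) (\<lambda>_. 0) s {0..t}"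
    using s sW sZ by (auto simp: has_L2_derivative_def)
  obtain L where L: "L > 0" "\<And>a b x. a \<in> {0..t} \<Longrightarrow> b \<in> {0..t} \<Longrightarrow> norm (modul \<phi> b x - modul \<phi> a x) \<le> L * \<bar>b - a\<bar>"
    "\<And>s x. norm (modul (vderiv \<phi>) s x) \<le> L"
    using modul_lipschitz[OF phi] by metis
  have gtm: "gt s \<in> borel_measurable borel"
    using L2_continuous_gt s by (auto simp: L2_continuous_on_def intro: square_integrable_measurable)
  have D: "has_L2_derivative (\<lambda>r x. modul \<phi> r x * ?W x) (\<lambda>x. - (modul (vderiv \<phi>) s x * gt s x) * ?W x + modul \<phi> s x * 0) s {0..t}"
  proof (rule has_L2_derivative_mult_coeff[OF DW, where P = B and L = L])
    show "(\<lambda>x. - (modul (vderiv \<phi>) s x * gt s x)) \<in> borel_measurable borel"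
      using modul_measurable[OF s, of "vderiv \<phi>"] gtm by simp
    show "norm (- (modul (vderiv \<phi>) s x * gt s x)) \<le> L" for x
      using mult_mono[OF L(3)[of s x] gamma_t_bound[OF s, of x]] L(1) by (simp add: norm_mult gt_def)
  qed (use modul_measurable modul_bound L(2) s modul_has_vector_derivative_t[OF s phi] in auto)
  have eq1: "modul \<phi> r x * ?W x * ?Z x = \<eta> x *\<^sub>R modul \<phi> r x" for r x
    using R(4)[of x] by (cases "\<bar>x\<bar> > R") (auto simp: indicator_def abs_le_iff not_less scaleR_conv_of_real)
  have eq2: "(- (modul (vderiv \<phi>) s x * gt s x) * ?W x + modul \<phi> s x * 0) * ?Z x = - (\<eta> x *\<^sub>R (modul (vderiv \<phi>) s x * gt s x))" for x
    using R(4)[of x] by (cases "\<bar>x\<bar> > R") (auto simp: indicator_def abs_le_iff not_less scaleR_conv_of_real)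
  show ?thesis using has_vector_derivative_pairing[OF D DZ] unfolding eq1 eq2 by simp
qed

text \<open>Subtracts the time derivative of the modulated wave from the weak equation for \<psi>.
  The wave is C^2 in space, so both derivatives on the test function can be moved back onto
  it.\<close>

lemma v_pairing_derivative:
  assumes s: "s \<in> {0..t}" and e: "test_function \<eta>"
  shows "((\<lambda>r. LINT x|lborel. \<eta> x *\<^sub>R v r x) has_vector_derivative
     (LINT x|lborel. nderiv 2 \<eta> x *\<^sub>R (- \<i> * of_real \<beta> * v s x)
        + \<eta> x *\<^sub>R (- (1 + \<i> * of_real \<alpha>) * v s x + forcing s x))) (at s within {0..t})"
proof -
  have e2: "test_function (nderiv 2 \<eta>)" by (rule test_function_nderiv[OF e])
  let ?Q = "nderiv 2 (modul \<phi> s)"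
  have lc: "locally_integrable (\<lambda>x. c * u x)" if "locally_integrable u" for c :: complex and u
    using that by (simp add: locally_integrable_def set_integrable_def flip: mult_scaleR_right)
  have lpsi: "locally_integrable (\<psi> r)" and lreac: "locally_integrable (\<lambda>x. lle_reaction \<alpha> F (\<psi> r x))" if "r \<in> {0..t}" for r
    using solution that by (auto simp: lle_solution_def)
  have lm: "locally_integrable (modul \<phi> r)" if "r \<in> {0..t}" for r
    using diffk_imp_continuous[OF modul_second_derivative(1)[OF that]] by (rule continuous_imp_locally_integrable)
  have lQ: "locally_integrable ?Q"
    using diffk_continuous_nderiv[OF modul_second_derivative(1)[OF s]] by (intro continuous_imp_locally_integrable) auto
  have lv: "locally_integrable (v s)" by (rule square_integrable_imp_locally_integrable[OF v_square_integrable[OF s]])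
  have lf: "locally_integrable (forcing s)"
    using L2_continuous_forcing s by (intro square_integrable_imp_locally_integrable) (auto simp: L2_continuous_on_def)
  have lgt: "locally_integrable (\<lambda>x. modul (vderiv \<phi>) s x * gt s x)"
    using L2_continuous_modul_mult[OF _ L2_continuous_gt, of "vderiv \<phi>"] s
    by (intro square_integrable_imp_locally_integrable) (auto simp: L2_continuous_on_def)
  let ?A = "LINT x|lborel. nderiv 2 \<eta> x *\<^sub>R (- \<i> * of_real \<beta> * \<psi> s x) + \<eta> x *\<^sub>R lle_reaction \<alpha> F (\<psi> s x)"
  let ?M = "LINT x|lborel. \<eta> x *\<^sub>R (modul (vderiv \<phi>) s x * gt s x)"
  have "((\<lambda>r. LINT x|lborel. \<eta> x *\<^sub>R \<psi> r x) has_vector_derivative ?A) (at s within {0..t})"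
    using solution e s by (auto simp: lle_solution_def)
  from has_vector_derivative_diff[OF this modul_pairing_derivative[OF s e]]
  have D: "((\<lambda>r. (LINT x|lborel. \<eta> x *\<^sub>R \<psi> r x) - (LINT x|lborel. \<eta> x *\<^sub>R modul \<phi> r x)) has_vector_derivative ?A - - ?M) (at s within {0..t})" .
  have lhs: "(LINT x|lborel. \<eta> x *\<^sub>R \<psi> r x) - (LINT x|lborel. \<eta> x *\<^sub>R modul \<phi> r x) = (LINT x|lborel. \<eta> x *\<^sub>R v r x)" if "r \<in> {0..t}" for r
    using test_function_integrable[OF e lpsi[OF that]] test_function_integrable[OF e lm[OF that]]
    by (subst Bochner_Integration.integral_diff[symmetric]) (simp_all add: v_eq forward_perturbation_def modul_def scaleR_diff_right)
  have W: "(LINT x|lborel. nderiv 2 \<eta> x *\<^sub>R modul \<phi> s x) = (LINT x|lborel. \<eta> x *\<^sub>R ?Q x)"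
    using has_weak_deriv_nderiv[OF modul_second_derivative(1)[OF s]] e by (simp add: has_weak_deriv_def)
  note i1 = test_function_integrable[OF e2 lc[OF lpsi[OF s]], of "- \<i> * of_real \<beta>"]
    and i2 = test_function_integrable[OF e lreac[OF s]]
    and i3 = test_function_integrable[OF e lgt]
    and i4 = test_function_integrable[OF e2 lc[OF lv], of "- \<i> * of_real \<beta>"]
    and i5 = test_function_integrable[OF e locally_integrable_add[OF lc[OF lv] lf], of "- (1 + \<i> * of_real \<alpha>)"]
    and i6 = test_function_integrable[OF e2 lc[OF lm[OF s]], of "- \<i> * of_real \<beta>"]
    and i7 = test_function_integrable[OF e lc[OF lQ], of "\<i> * of_real \<beta>"]
  have pt: "nderiv 2 \<eta> x *\<^sub>R (- \<i> * of_real \<beta> * \<psi> s x) + \<eta> x *\<^sub>R lle_reaction \<alpha> F (\<psi> s x) + \<eta> x *\<^sub>R (modul (vderiv \<phi>) s x * gt s x)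
     = nderiv 2 \<eta> x *\<^sub>R (- \<i> * of_real \<beta> * v s x) + \<eta> x *\<^sub>R (- (1 + \<i> * of_real \<alpha>) * v s x + forcing s x)
       + (nderiv 2 \<eta> x *\<^sub>R (- \<i> * of_real \<beta> * modul \<phi> s x) + \<eta> x *\<^sub>R (\<i> * of_real \<beta> * ?Q x))" for x
  proof -
    have p: "\<psi> s x = modul \<phi> s x + v s x" by (simp add: v_eq forward_perturbation_def modul_def)
    have "\<eta> x *\<^sub>R lle_reaction \<alpha> F (\<psi> s x) + \<eta> x *\<^sub>R (modul (vderiv \<phi>) s x * gt s x)
       = \<eta> x *\<^sub>R (- (1 + \<i> * of_real \<alpha>) * v s x + forcing s x) + \<eta> x *\<^sub>R (\<i> * of_real \<beta> * ?Q x)"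
      unfolding scaleR_add_right[symmetric] modul_second_derivative(2)[OF s] by (simp only: reaction_identity)
    moreover have "nderiv 2 \<eta> x *\<^sub>R (- \<i> * of_real \<beta> * \<psi> s x) = nderiv 2 \<eta> x *\<^sub>R (- \<i> * of_real \<beta> * v s x) + nderiv 2 \<eta> x *\<^sub>R (- \<i> * of_real \<beta> * modul \<phi> s x)"
      unfolding p scaleR_add_right[symmetric] by (simp add: distrib_left add.commute)
    ultimately show ?thesis by simp
  qed
  have "?A - - ?M = (LINT x|lborel. nderiv 2 \<eta> x *\<^sub>R (- \<i> * of_real \<beta> * \<psi> s x) + \<eta> x *\<^sub>R lle_reaction \<alpha> F (\<psi> s x) + \<eta> x *\<^sub>R (modul (vderiv \<phi>) s x * gt s x))"
    by (subst Bochner_Integration.integral_add[OF Bochner_Integration.integrable_add[OF i1 i2] i3]) simp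
  also have "\<dots> = (LINT x|lborel. nderiv 2 \<eta> x *\<^sub>R (- \<i> * of_real \<beta> * v s x) + \<eta> x *\<^sub>R (- (1 + \<i> * of_real \<alpha>) * v s x + forcing s x))
     + (LINT x|lborel. nderiv 2 \<eta> x *\<^sub>R (- \<i> * of_real \<beta> * modul \<phi> s x) + \<eta> x *\<^sub>R (\<i> * of_real \<beta> * ?Q x))"
    unfolding pt by (rule Bochner_Integration.integral_add[OF Bochner_Integration.integrable_add[OF i4 i5] Bochner_Integration.integrable_add[OF i6 i7]])
  \<comment> \<open>The dispersion of the modulated wave meets the bracket of
    \<open>reaction_identity\<close>; the two cancel by the weak derivative identity
    \<open>W\<close>.\<close>
  also have "(LINT x|lborel. nderiv 2 \<eta> x *\<^sub>R (- \<i> * of_real \<beta> * modul \<phi> s x) + \<eta> x *\<^sub>R (\<i> * of_real \<beta> * ?Q x)) = 0"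
  proof -
    have z: "(LINT x|lborel. \<zeta> x *\<^sub>R (c * u x)) = c * (LINT x|lborel. \<zeta> x *\<^sub>R u x)" for \<zeta> u and c :: complex
      by (simp only: mult_scaleR_right[symmetric] integral_mult_right_zero)
    show ?thesis
      unfolding Bochner_Integration.integral_add[OF i6 i7] z W by simp
  qed
  finally have "?A - - ?M = (LINT x|lborel. nderiv 2 \<eta> x *\<^sub>R (- \<i> * of_real \<beta> * v s x) + \<eta> x *\<^sub>R (- (1 + \<i> * of_real \<alpha>) * v s x + forcing s x))"
    by simp
  with D have D': "((\<lambda>r. (LINT x|lborel. \<eta> x *\<^sub>R \<psi> r x) - (LINT x|lborel. \<eta> x *\<^sub>R modul \<phi> r x)) has_vector_derivative
      (LINT x|lborel. nderiv 2 \<eta> x *\<^sub>R (- \<i> * of_real \<beta> * v s x) + \<eta> x *\<^sub>R (- (1 + \<i> * of_real \<alpha>) * v s x + forcing s x))) (at s within {0..t})"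
    by (simp only:)
  show ?thesis by (rule has_vector_derivative_transform[OF s _ D']) (simp only: lhs)
qed

text \<open>The time derivative of the mollified perturbation. Both space derivatives sit on the
  kernel, since the perturbation itself may have only one weak derivative.\<close>

definition velocity :: "(real \<Rightarrow> real) \<Rightarrow> real \<Rightarrow> real \<Rightarrow> complex" where
  "velocity \<kappa> s x = - (\<i> * of_real \<beta>) * conv (nderiv 2 \<kappa>) (v s) x + (- (1 + \<i> * of_real \<alpha>) * conv \<kappa> (v s) x + conv \<kappa> (forcing s) x)"

lemma L2_continuous_v: "L2_continuous_on {0..t} v"
  by (rule continuous_in_sobolev_L2[OF cont_v])

lemma forcing_square_integrable: "s \<in> {0..t} \<Longrightarrow> square_integrable (forcing s)"
  using L2_continuous_forcing by (simp add: L2_continuous_on_def)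

text \<open>The weak equation tested with the reflected kernel at the point x.\<close>

lemma conv_v_derivative:
  assumes s: "s \<in> {0..t}" and c: "test_function \<kappa>"
  shows "((\<lambda>r. conv \<kappa> (v r) x) has_vector_derivative velocity \<kappa> s x) (at s within {0..t})"
proof -
  note cr = test_function_reflect[OF c, of x]
  have lv: "locally_integrable (v s)" and lf: "locally_integrable (forcing s)"
    using v_square_integrable[OF s] forcing_square_integrable[OF s] square_integrable_imp_locally_integrable by auto
  note i = conv_integrable[OF test_function_nderiv[OF c, of 2] lv, of x] conv_integrable[OF c lv, of x] conv_integrable[OF c lf, of x]
  have n2: "nderiv 2 (\<lambda>y. \<kappa> (x - y)) = (\<lambda>y. nderiv 2 \<kappa> (x - y))"
    using nderiv_reflect[OF c, of 2 x] by simp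
  have pt: "nderiv 2 \<kappa> (x - y) *\<^sub>R (- \<i> * of_real \<beta> * v s y) + \<kappa> (x - y) *\<^sub>R (- (1 + \<i> * of_real \<alpha>) * v s y + forcing s y)
     = - (\<i> * of_real \<beta>) * (nderiv 2 \<kappa> (x - y) *\<^sub>R v s y) + (- (1 + \<i> * of_real \<alpha>) * (\<kappa> (x - y) *\<^sub>R v s y) + \<kappa> (x - y) *\<^sub>R forcing s y)" for y
    by (simp add: scaleR_conv_of_real algebra_simps)
  have "(LINT y|lborel. nderiv 2 (\<lambda>y. \<kappa> (x - y)) y *\<^sub>R (- \<i> * of_real \<beta> * v s y)
        + \<kappa> (x - y) *\<^sub>R (- (1 + \<i> * of_real \<alpha>) * v s y + forcing s y)) = velocity \<kappa> s x"
    unfolding n2 pt velocity_def conv_def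
    using i by (simp only: Bochner_Integration.integral_add Bochner_Integration.integrable_add integral_mult_right_zero integrable_mult_right)
  then show ?thesis using v_pairing_derivative[OF s cr] by (simp only: conv_def)
qed

lemma conv_v_has_L2_derivative:
  assumes s: "s \<in> {0..t}" and c: "test_function \<kappa>"
  shows "has_L2_derivative (\<lambda>r. conv \<kappa> (v r)) (velocity \<kappa> s) s {0..t}"
proof (rule has_L2_derivative_pointwise[OF conv_v_derivative[OF _ c] _ _ _ s])
  note c2 = test_function_nderiv[OF c, of 2]
  show "continuous_on {0..t} (\<lambda>s. velocity \<kappa> s x)" for x
    unfolding velocity_def
    by (intro continuous_intros L2_continuous_on_conv(2)[OF L2_continuous_v] L2_continuous_on_conv(2)[OF L2_continuous_forcing] c c2)
  show "square_integrable (conv \<kappa> (v s))" if "s \<in> {0..t}" for s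
    by (rule square_integrable_conv[OF c v_square_integrable[OF that]])
  show "L2_continuous_on {0..t} (velocity \<kappa>)"
    unfolding velocity_def
    by (intro L2_continuous_on_add L2_continuous_on_cmult L2_continuous_on_conv(1)[OF L2_continuous_v] L2_continuous_on_conv(1)[OF L2_continuous_forcing] c c2)
qed

end

section \<open>Estimates for the cubic nonlinearity\<close>

text \<open>Membership and bound in one predicate, so that estimates of polynomial expressions can
  be composed by applying rules.\<close>

definition hbd :: "nat \<Rightarrow> (real \<Rightarrow> complex) \<Rightarrow> real \<Rightarrow> bool" where
  "hbd k u M \<longleftrightarrow> hsob k u \<and> hnorm k u \<le> M"

lemma hbd_nonneg: "hbd k u M \<Longrightarrow> 0 \<le> M"
  unfolding hbd_def using hnorm_nonneg order_trans by blast

lemma hbd_add: "hbd k u M \<Longrightarrow> hbd k w N \<Longrightarrow> hbd k (\<lambda>x. u x + w x) (M + N)"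
  unfolding hbd_def using hsob_add hnorm_add by (meson add_mono order_trans)

lemma hbd_cnj: "hbd k u M \<Longrightarrow> hbd k (\<lambda>x. cnj (u x)) M"
  unfolding hbd_def using hsob_cnj hnorm_cnj by auto

lemma hbd_cmult: "hbd k u M \<Longrightarrow> hbd k (\<lambda>x. c * u x) (norm c * M)"
  unfolding hbd_def using hsob_cmult hnorm_cmult by (metis mult_left_mono norm_ge_zero)

lemma hbd_mult:
  assumes "k \<ge> 1" "hbd k u M" "hbd k w N"
  shows "hbd k (\<lambda>x. u x * w x) (2 ^ Suc k * (M * N))"
proof -
  have "hnorm k (\<lambda>x. u x * w x) \<le> 2 ^ Suc k * (hnorm k u * hnorm k w)"
    using assms by (intro hnorm_mult) (auto simp: hbd_def)
  also have "\<dots> \<le> 2 ^ Suc k * (M * N)"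
    using assms hbd_nonneg[OF assms(2)] by (intro mult_left_mono mult_mono) (auto simp: hbd_def)
  finally show ?thesis using assms hsob_mult by (auto simp: hbd_def)
qed

lemma hbd_coeff:
  assumes "cbd k c B" "hbd k u M"
  shows "hbd k (\<lambda>x. c x * u x) (2 ^ Suc k * (B * M))"
proof -
  have "hnorm k (\<lambda>x. c x * u x) \<le> 2 ^ Suc k * (B * hnorm k u)"
    using assms by (intro hnorm_coeff_mult) (auto simp: hbd_def)
  also have "\<dots> \<le> 2 ^ Suc k * (B * M)"
    using assms cbd_nonneg[OF assms(1)] by (intro mult_left_mono) (auto simp: hbd_def)
  finally show ?thesis using assms hsob_coeff_mult by (auto simp: hbd_def)
qed

lemma cbd_coefficients:
  assumes c: "cbd k c B"
  shows "cbd k (\<lambda>x. 2 * \<i> * (c x * cnj (c x))) (2 * (2 ^ k * (B * B)))"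
    and "cbd k (\<lambda>x. \<i> * (c x * c x)) (2 ^ k * (B * B))"
    and "cbd k (\<lambda>x. 2 * \<i> * c x) (2 * B)" and "cbd k (\<lambda>x. \<i> * cnj (c x)) B"
  using cbd_cmult[OF cbd_mult[OF c cbd_cnj[OF c]], of "2 * \<i>"] cbd_cmult[OF cbd_mult[OF c c], of \<i>]
    cbd_cmult[OF c, of "2 * \<i>"] cbd_cmult[OF cbd_cnj[OF c], of \<i>]
  by (auto simp: norm_mult)

definition cubic_rem :: "complex \<Rightarrow> complex \<Rightarrow> complex" where
  "cubic_rem c z = 2 * \<i> * c * (z * cnj z) + (\<i> * cnj c * (z * z) + \<i> * (z * z * cnj z))"

lemma cubic_diff_split:
  "cubic_diff c z = 2 * \<i> * (c * cnj c) * z + \<i> * (c * c) * cnj z + cubic_rem c z"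
  by (simp add: cubic_diff_expand cubic_rem_def)

text \<open>The cubic term is counted as quadratic by means of the bound 1 on the norm; the
  smallness of the solution will absorb the result.\<close>

lemma cubic_rem_bound:
  assumes k: "k \<ge> 1" and c: "cbd k c B" and v: "hsob k v" "hnorm k v \<le> 1"
  shows "hbd k (\<lambda>x. cubic_rem (c x) (v x)) (2 ^ (2 * k + 2) * (3 * B + 1) * (hnorm k v)\<^sup>2)"
proof -
  let ?n = "hnorm k v" and ?P = "(2::real) ^ Suc k"
  have h: "hbd k v ?n" using v by (simp add: hbd_def)
  note hc = hbd_cnj[OF h]
  note vv = hbd_mult[OF k h h] and vc = hbd_mult[OF k h hc]
  have b: "hbd k (\<lambda>x. cubic_rem (c x) (v x))
     (?P * (2 * B * (?P * (?n * ?n))) + (?P * (B * (?P * (?n * ?n))) + norm \<i> * (?P * (?P * (?n * ?n) * ?n))))"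
    unfolding cubic_rem_def
    by (rule hbd_add[OF hbd_coeff[OF cbd_coefficients(3)[OF c] vc]
          hbd_add[OF hbd_coeff[OF cbd_coefficients(4)[OF c] vv] hbd_cmult[OF hbd_mult[OF k vv hc]]]])
  have "?P * (?P * (?n * ?n) * ?n) \<le> ?P * (?P * (?n * ?n) * 1)"
    using v(2) by (intro mult_left_mono) auto
  then have "?P * (2 * B * (?P * (?n * ?n))) + (?P * (B * (?P * (?n * ?n))) + norm \<i> * (?P * (?P * (?n * ?n) * ?n)))
     \<le> ?P * (2 * B * (?P * (?n * ?n))) + (?P * (B * (?P * (?n * ?n))) + ?P * (?P * (?n * ?n) * 1))"
    by (simp del: power_Suc)
  also have "\<dots> = (?P * ?P) * (3 * B + 1) * ?n\<^sup>2" by (simp add: power2_eq_square algebra_simps del: power_Suc)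
  also have "?P * ?P = 2 ^ (2 * k + 2)" unfolding power_add[symmetric] by (rule arg_cong[of _ _ "(^) 2"]) simp
  finally show ?thesis using b by (simp add: hbd_def)
qed

lemma hsob_cubic_diff:
  assumes "k \<ge> 1" "cbd k c B" "hsob k v" "hnorm k v \<le> 1"
  shows "hsob k (\<lambda>x. cubic_diff (c x) (v x))"
  unfolding cubic_diff_split
  using cubic_rem_bound[OF assms] hsob_coeff_mult[OF cbd_coefficients(1)[OF assms(2)] assms(3)]
    hsob_coeff_mult[OF cbd_coefficients(2)[OF assms(2)] hsob_cnj[OF assms(3)]]
  by (auto simp: hbd_def intro!: hsob_add)

lemma hnorm_cubic_diff_le:
  assumes k: "k \<ge> 1" and c: "cbd k c B" and v: "hsob k v" "hnorm k v \<le> 1"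
  shows "hnorm k (\<lambda>x. cubic_diff (c x) (v x)) \<le> 2 ^ Suc k * (2 * (2 ^ k * (B * B))) + 2 ^ Suc k * (2 ^ k * (B * B)) + 2 ^ (2 * k + 2) * (3 * B + 1)"
proof -
  have B: "0 \<le> B" by (rule cbd_nonneg[OF c])
  have h: "hbd k v 1" using v by (simp add: hbd_def)
  have n1: "(hnorm k v)\<^sup>2 \<le> 1" using v(2) by (simp add: power_le_one)
  have "2 ^ (2 * k + 2) * (3 * B + 1) * (hnorm k v)\<^sup>2 \<le> 2 ^ (2 * k + 2) * (3 * B + 1) * 1"
    using B n1 by (intro mult_left_mono) auto
  then show ?thesis
    using hbd_add[OF hbd_add[OF hbd_coeff[OF cbd_coefficients(1)[OF c] h] hbd_coeff[OF cbd_coefficients(2)[OF c] hbd_cnj[OF h]]] cubic_rem_bound[OF k c v]]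
    unfolding hbd_def cubic_diff_split mult_1_right by linarith
qed

lemma hnorm_cubic_diff_lipschitz:
  assumes k: "k \<ge> 1" and B: "B \<ge> 0"
  obtains K where "K > 0" "\<And>c a b. cbd k c B \<Longrightarrow> hsob k a \<Longrightarrow> hnorm k a \<le> 1 \<Longrightarrow> hsob k b \<Longrightarrow> hnorm k b \<le> 1 \<Longrightarrow>
    hnorm k (\<lambda>x. cubic_diff (c x) (a x) - cubic_diff (c x) (b x)) \<le> K * hnorm k (\<lambda>x. a x - b x)"
proof -
  define P where "P = (2::real) ^ Suc k"
  \<comment> \<open>One summand for each term of the expansion below; the final 1 makes the constant
    positive.\<close>
  define K where "K = P * (2 * (2 ^ k * (B * B))) + P * (2 ^ k * (B * B)) + P * (2 * B * (P + P)) + P * (B * (P + P)) + (P * P + P * (P + P)) + 1"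
  have P0: "P > 0" by (simp add: P_def)
  show ?thesis
  proof (rule that[of K])
    show "K > 0" unfolding K_def using P0 B by (intro add_nonneg_pos add_nonneg_nonneg) auto
    fix c a b assume c: "cbd k c B" and a: "hsob k a" "hnorm k a \<le> 1" and b: "hsob k b" "hnorm k b \<le> 1"
    let ?d = "\<lambda>x. a x - b x" and ?n = "hnorm k (\<lambda>x. a x - b x)"
    have ha: "hbd k a 1" and hb: "hbd k b 1" and hd: "hbd k ?d ?n"
      using a b hsob_diff by (auto simp: hbd_def)
    note dc = hbd_cnj[OF hd]
    note m = hbd_mult[OF k, folded P_def] and cf = hbd_coeff[of k, folded P_def]
    \<comment> \<open>Every difference of monomials is telescoped so that each summand contains
      exactly one factor a - b or its conjugate.\<close>
    have eq: "cubic_diff (c x) (a x) - cubic_diff (c x) (b x) =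
        2 * \<i> * (c x * cnj (c x)) * ?d x + \<i> * (c x * c x) * cnj (?d x)
        + (2 * \<i> * c x) * (?d x * cnj (a x) + b x * cnj (?d x)) + (\<i> * cnj (c x)) * (?d x * a x + b x * ?d x)
        + \<i> * (?d x * (a x * cnj (a x)) + b x * (?d x * cnj (a x) + b x * cnj (?d x)))" for x
      unfolding cubic_diff_expand by (simp add: algebra_simps)
    note q = hbd_add[OF m[OF hd hbd_cnj[OF ha]] m[OF hb dc]]
    have "hbd k (\<lambda>x. cubic_diff (c x) (a x) - cubic_diff (c x) (b x))
       (P * (2 * (2 ^ k * (B * B)) * ?n) + P * (2 ^ k * (B * B) * ?n) + P * (2 * B * (P * (?n * 1) + P * (1 * ?n)))
         + P * (B * (P * (?n * 1) + P * (1 * ?n)))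
         + norm \<i> * (P * (?n * (P * (1 * 1))) + P * (1 * (P * (?n * 1) + P * (1 * ?n)))))"
      unfolding eq
      by (rule hbd_add[OF hbd_add[OF hbd_add[OF hbd_add[OF cf[OF cbd_coefficients(1)[OF c] hd] cf[OF cbd_coefficients(2)[OF c] dc]]
            cf[OF cbd_coefficients(3)[OF c] q]] cf[OF cbd_coefficients(4)[OF c] hbd_add[OF m[OF hd ha] m[OF hb hd]]]]
            hbd_cmult[OF hbd_add[OF m[OF hd m[OF ha hbd_cnj[OF ha]]] m[OF hb q]]]])
    then have "hnorm k (\<lambda>x. cubic_diff (c x) (a x) - cubic_diff (c x) (b x)) \<le> (K - 1) * ?n"
      by (simp add: hbd_def K_def algebra_simps)
    also have "\<dots> \<le> K * ?n" by (intro mult_right_mono) auto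
    finally show "hnorm k (\<lambda>x. cubic_diff (c x) (a x) - cubic_diff (c x) (b x)) \<le> K * ?n" .
  qed
qed

lemma L2_norm_cubic_diff_le:
  assumes "\<And>x. norm (c x) \<le> B" "AE x in lborel. norm (v x) \<le> 1" "square_integrable v" "(\<lambda>x. cubic_diff (c x) (v x)) \<in> borel_measurable borel"
  shows "L2_norm (\<lambda>x. cubic_diff (c x) (v x)) \<le> (3 * (B + 1)\<^sup>2 + 6 * B + 3) * L2_norm v"
proof -
  have B: "0 \<le> B" using assms(1)[of 0] norm_ge_zero order_trans by blast
  show ?thesis
  proof (rule L2_norm_dominated[OF assms(3,4)])
    show "AE x in lborel. norm (cubic_diff (c x) (v x)) \<le> (3 * (B + 1)\<^sup>2 + 6 * B + 3) * norm (v x)"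
      using assms(2)
    proof eventually_elim
      case (elim x)
      show ?case using cubic_diff_lipschitz[OF assms(1) assms(1), of "v x" 0 x x] elim by simp
    qed
  qed (use B in simp)
qed

text \<open>At top order the two linear terms are kept explicit, because one of them is purely
  rotational and the other is the one without sign that the energy must cancel. The commutators cost
  one derivative less and the remainder is quadratic; at order \<open>m\<close> and in L2 no such
  separation is required.\<close>

lemma cubic_top_order_estimates:
  fixes B :: real and m :: nat
  assumes B: "B \<ge> 0"
  obtains K where "K > 0"
    "\<And>c v. cbd (Suc m) c B \<Longrightarrow> hsob (Suc m) v \<Longrightarrow> hnorm (Suc m) v \<le> 1 \<Longrightarrow>
      L2_norm (\<lambda>x. nderiv (Suc m) (\<lambda>x. cubic_diff (c x) (v x)) x
         - (2 * \<i> * (c x * cnj (c x)) * nderiv (Suc m) v x + \<i> * (c x * c x) * cnj (nderiv (Suc m) v x)))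
        \<le> K * (hnorm m v + (hnorm (Suc m) v)\<^sup>2)"
    "\<And>c v. cbd (Suc m) c B \<Longrightarrow> hsob (Suc m) v \<Longrightarrow> hnorm (Suc m) v \<le> 1 \<Longrightarrow>
      L2_norm (nderiv m (\<lambda>x. cubic_diff (c x) (v x))) \<le> K * (hnorm m v + (hnorm (Suc m) v)\<^sup>2)"
    "\<And>c v. cbd (Suc m) c B \<Longrightarrow> hsob (Suc m) v \<Longrightarrow> hnorm (Suc m) v \<le> 1 \<Longrightarrow>
      L2_norm (\<lambda>x. cubic_diff (c x) (v x)) \<le> K * L2_norm v"
proof -
  let ?k = "Suc m"
  \<comment> \<open>\<open>K1\<close> collects the two commutators, \<open>K2\<close> the quadratic
    remainder, \<open>K3\<close> the bound in L2, \<open>K4\<close> the linear terms at order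
    \<open>m\<close>.\<close>
  define K1 where "K1 = 2 ^ (2 * m + 2) * (3 * (2 ^ ?k * (B * B)))"
  define K2 where "K2 = 2 ^ (2 * ?k + 2) * (3 * B + 1)"
  define K3 where "K3 = 3 * (B + 1)\<^sup>2 + 6 * B + 3"
  define K4 where "K4 = 2 ^ Suc m * (3 * (2 ^ ?k * (B * B)))"
  define K where "K = K1 + K2 + K3 + K4"
  have pos: "0 \<le> K1" "0 \<le> K2" "0 < K3" "0 \<le> K4" using B by (auto simp: K1_def K2_def K3_def K4_def intro!: add_nonneg_pos)
  have K0: "K > 0" and KK: "K1 \<le> K" "K2 \<le> K" "K3 \<le> K" "K4 \<le> K" using pos by (auto simp: K_def)
  have split: "\<exists>A1 A2 Q. A1 = (\<lambda>x. 2 * \<i> * (c x * cnj (c x)) * v x) \<and> A2 = (\<lambda>x. \<i> * (c x * c x) * cnj (v x)) \<and>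
     Q = (\<lambda>x. cubic_rem (c x) (v x)) \<and> hsob ?k A1 \<and> hsob ?k A2 \<and> hsob ?k Q \<and> hnorm ?k Q \<le> K2 * (hnorm ?k v)\<^sup>2 \<and>
     (\<forall>j\<le>?k. nderiv j (\<lambda>x. cubic_diff (c x) (v x)) = (\<lambda>x. nderiv j A1 x + nderiv j A2 x + nderiv j Q x))"
    if c: "cbd ?k c B" and v: "hsob ?k v" "hnorm ?k v \<le> 1" for c v
  proof -
    let ?A1 = "\<lambda>x. 2 * \<i> * (c x * cnj (c x)) * v x" and ?A2 = "\<lambda>x. \<i> * (c x * c x) * cnj (v x)" and ?Q = "\<lambda>x. cubic_rem (c x) (v x)"
    have h: "hsob ?k ?A1" "hsob ?k ?A2" "hsob ?k ?Q" "hnorm ?k ?Q \<le> K2 * (hnorm ?k v)\<^sup>2"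
      using hsob_coeff_mult[OF cbd_coefficients(1)[OF c] v(1)] hsob_coeff_mult[OF cbd_coefficients(2)[OF c] hsob_cnj[OF v(1)]]
        cubic_rem_bound[OF _ c v] unfolding K2_def hbd_def by auto
    note d = h(1,2,3)[THEN hsob_imp_diffk]
    have "nderiv j (\<lambda>x. cubic_diff (c x) (v x)) = (\<lambda>x. nderiv j ?A1 x + nderiv j ?A2 x + nderiv j ?Q x)" if "j \<le> ?k" for j
      unfolding cubic_diff_split nderiv_add[OF diffk_add[OF d(1,2)] d(3) that] nderiv_add[OF d(1,2) that] ..
    with h show ?thesis by blast
  qed
  show ?thesis
  proof (rule that[OF K0])
    fix c v assume c: "cbd ?k c B" and v: "hsob ?k v" "hnorm ?k v \<le> 1"
    obtain A1 A2 Q where A: "A1 = (\<lambda>x. 2 * \<i> * (c x * cnj (c x)) * v x)" "A2 = (\<lambda>x. \<i> * (c x * c x) * cnj (v x))"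
      "hsob ?k A1" "hsob ?k A2" "hsob ?k Q" "hnorm ?k Q \<le> K2 * (hnorm ?k v)\<^sup>2"
      "\<forall>j\<le>?k. nderiv j (\<lambda>x. cubic_diff (c x) (v x)) = (\<lambda>x. nderiv j A1 x + nderiv j A2 x + nderiv j Q x)"
      using split[OF c v] by blast
    note vc = hsob_cnj[OF v(1)]
    note cf1 = cbd_coefficients(1)[OF c] and cf2 = cbd_coefficients(2)[OF c]
    have ncn: "nderiv ?k (\<lambda>x. cnj (v x)) = (\<lambda>x. cnj (nderiv ?k v x))"
      by (rule nderiv_cnj[OF hsob_imp_diffk[OF v(1)]]) simp
    let ?R1 = "\<lambda>x. nderiv ?k A1 x - 2 * \<i> * (c x * cnj (c x)) * nderiv ?k v x"
    let ?R2 = "\<lambda>x. nderiv ?k A2 x - \<i> * (c x * c x) * cnj (nderiv ?k v x)"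
    have b1: "L2_norm ?R1 \<le> 2 ^ (2 * m + 2) * (2 * (2 ^ ?k * (B * B)) * hnorm m v)"
      unfolding A(1) by (rule L2_commutator_bound[OF cf1 v(1)])
    have b2: "L2_norm ?R2 \<le> 2 ^ (2 * m + 2) * (2 ^ ?k * (B * B) * hnorm m v)"
      using L2_commutator_bound[OF cf2 vc] hnorm_cnj[OF hsob_mono[OF v(1)], of m] unfolding A(2) ncn by simp
    have s1: "square_integrable ?R1"
    proof (rule square_integrable_diff)
      show "square_integrable (nderiv ?k A1)" by (rule hsob_square_integrable[OF A(3)]) simp
      show "square_integrable (\<lambda>x. 2 * \<i> * (c x * cnj (c x)) * nderiv ?k v x)"
        using hsob_coeff_mult[of 0 "\<lambda>x. 2 * \<i> * (c x * cnj (c x))" _ "nderiv ?k v"] cbd_mono[OF cf1, of 0] hsob_nderiv[OF v(1), of 0 ?k]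
        by (auto intro: hsob_square_integrable_0)
    qed
    have s2: "square_integrable ?R2"
    proof (rule square_integrable_diff)
      show "square_integrable (nderiv ?k A2)" by (rule hsob_square_integrable[OF A(4)]) simp
      show "square_integrable (\<lambda>x. \<i> * (c x * c x) * cnj (nderiv ?k v x))"
        using hsob_coeff_mult[of 0 "\<lambda>x. \<i> * (c x * c x)" _ "\<lambda>x. cnj (nderiv ?k v x)"] cbd_mono[OF cf2, of 0] 
          hsob_cnj[OF hsob_nderiv[OF v(1), of 0 ?k]]
        by (auto intro: hsob_square_integrable_0)
    qed
    have s3: "square_integrable (nderiv ?k Q)" by (rule hsob_square_integrable[OF A(5)]) simp
    have q3: "L2_norm (nderiv j Q) \<le> K2 * (hnorm ?k v)\<^sup>2" if "j \<le> ?k" for j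
      using L2_nderiv_le_hnorm[OF that, of Q] A(6) by linarith
    have eq: "(\<lambda>x. nderiv ?k (\<lambda>x. cubic_diff (c x) (v x)) x
         - (2 * \<i> * (c x * cnj (c x)) * nderiv ?k v x + \<i> * (c x * c x) * cnj (nderiv ?k v x)))
       = (\<lambda>x. ?R1 x + ?R2 x + nderiv ?k Q x)"
      using A(7)[rule_format, OF order_refl] by (simp add: algebra_simps del: funpow.simps)
    have n0: "0 \<le> hnorm m v" by simp
    have comb: "K' * hnorm m v + K2 * (hnorm ?k v)\<^sup>2 \<le> K * (hnorm m v + (hnorm ?k v)\<^sup>2)" if "K' \<le> K" for K'
      using mult_right_mono[OF that n0] mult_right_mono[OF KK(2), of "(hnorm ?k v)\<^sup>2"] by (simp add: algebra_simps)
    have "L2_norm (\<lambda>x. ?R1 x + ?R2 x + nderiv ?k Q x) \<le> L2_norm ?R1 + L2_norm ?R2 + L2_norm (nderiv ?k Q)"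
      using L2_norm_triangle[OF square_integrable_add[OF s1 s2] s3] L2_norm_triangle[OF s1 s2] by linarith
    also have "\<dots> \<le> K1 * hnorm m v + K2 * (hnorm ?k v)\<^sup>2"
      using b1 b2 q3[OF order_refl] unfolding K1_def by (simp add: algebra_simps del: power_Suc)
    also have "\<dots> \<le> K * (hnorm m v + (hnorm ?k v)\<^sup>2)" by (rule comb[OF KK(1)])
    finally show "L2_norm (\<lambda>x. nderiv ?k (\<lambda>x. cubic_diff (c x) (v x)) x
         - (2 * \<i> * (c x * cnj (c x)) * nderiv ?k v x + \<i> * (c x * c x) * cnj (nderiv ?k v x)))
        \<le> K * (hnorm m v + (hnorm ?k v)\<^sup>2)" unfolding eq .
    have vm: "hsob m v" by (rule hsob_mono[OF v(1)]) simp
    have m1: "L2_norm (nderiv m A1) \<le> 2 ^ Suc m * (2 * (2 ^ ?k * (B * B)) * hnorm m v)"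
      unfolding A(1) using L2_nderiv_le_hnorm[OF order_refl] hnorm_coeff_mult[OF cbd_mono[OF cf1, of m] vm] by (meson le_SucI order_refl order_trans)
    have m2: "L2_norm (nderiv m A2) \<le> 2 ^ Suc m * (2 ^ ?k * (B * B) * hnorm m v)"
      unfolding A(2) using L2_nderiv_le_hnorm[OF order_refl] hnorm_coeff_mult[OF cbd_mono[OF cf2, of m] hsob_cnj[OF vm]] 
      unfolding hnorm_cnj[OF vm] by (meson le_SucI order_refl order_trans)
    have sm: "square_integrable (nderiv m A1)" "square_integrable (nderiv m A2)" "square_integrable (nderiv m Q)"
      using hsob_square_integrable[OF A(3)] hsob_square_integrable[OF A(4)] hsob_square_integrable[OF A(5)] by auto
    have eqm: "nderiv m (\<lambda>x. cubic_diff (c x) (v x)) = (\<lambda>x. nderiv m A1 x + nderiv m A2 x + nderiv m Q x)" using A(7) by simp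
    have "L2_norm (\<lambda>x. nderiv m A1 x + nderiv m A2 x + nderiv m Q x) \<le> L2_norm (nderiv m A1) + L2_norm (nderiv m A2) + L2_norm (nderiv m Q)"
      using L2_norm_triangle[OF square_integrable_add[OF sm(1,2)] sm(3)] L2_norm_triangle[OF sm(1,2)] by linarith
    also have "\<dots> \<le> K4 * hnorm m v + K2 * (hnorm ?k v)\<^sup>2"
      using m1 m2 q3[of m] unfolding K4_def by (simp add: algebra_simps del: power_Suc)
    also have "\<dots> \<le> K * (hnorm m v + (hnorm ?k v)\<^sup>2)" by (rule comb[OF KK(4)])
    finally show "L2_norm (nderiv m (\<lambda>x. cubic_diff (c x) (v x))) \<le> K * (hnorm m v + (hnorm ?k v)\<^sup>2)" unfolding eqm .
    have nv: "norm (v x) \<le> 1" for x using hsob_sup_bound[OF v(1), of 0 x] v(2) by simp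
    have hN: "hsob ?k (\<lambda>x. cubic_diff (c x) (v x))" by (rule hsob_cubic_diff[OF _ c v]) simp
    have "L2_norm (\<lambda>x. cubic_diff (c x) (v x)) \<le> K3 * L2_norm v"
      unfolding K3_def using cbd_bound[OF c] nv hsob_square_integrable_0[OF v(1)] square_integrable_measurable[OF hsob_square_integrable_0[OF hN]]
      by (intro L2_norm_cubic_diff_le) auto
    also have "\<dots> \<le> K * L2_norm v" using KK(3) by (intro mult_right_mono) auto
    finally show "L2_norm (\<lambda>x. cubic_diff (c x) (v x)) \<le> K * L2_norm v" .
  qed
qed


section \<open>Convergence of mollified nonlinearities\<close>

text \<open>The function \<open>f\<close> is only an L2 limit of the smooth functions
  \<open>G p\<close>. The Cauchy property in H^k forces derivatives of the mollified limit and
  derivatives of the approximations to merge; weak derivatives of \<open>f\<close> never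
  appear.\<close>

lemma
  fixes f :: "real \<Rightarrow> complex" and G :: "nat \<Rightarrow> real \<Rightarrow> complex"
  assumes f: "square_integrable f" and G: "\<And>p. hsob k (G p)"
    and lim: "(\<lambda>p. L2_norm (\<lambda>x. f x - G p x)) \<longlonglongrightarrow> 0" and j: "j \<le> k"
  shows nderiv_mollify_approx: "e > 0 \<Longrightarrow> \<forall>\<^sub>F p in sequentially.
      L2_norm (\<lambda>x. nderiv j (mollify n f) x - mollify n (nderiv j (G p)) x) < e"
    and square_integrable_nderiv_mollify: "square_integrable (nderiv j (mollify n f))"
    and L2_norm_nderiv_mollify_le: "(\<And>p. hnorm k (G p) \<le> M) \<Longrightarrow> L2_norm (nderiv j (mollify n f)) \<le> M"
    and nderiv_mollify_tendsto: "(\<And>e. e > 0 \<Longrightarrow> \<exists>N. \<forall>p\<ge>N. \<forall>q\<ge>N. hnorm k (\<lambda>x. G p x - G q x) < e)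
      \<Longrightarrow> (\<lambda>n. L2_norm (\<lambda>x. nderiv j (mollify n f) x - nderiv j (G n) x)) \<longlonglongrightarrow> 0"
proof -
  note lf = square_integrable_imp_locally_integrable[OF f]
  have sG: "square_integrable (G p)" "square_integrable (nderiv j (G p))" for p
    using hsob_square_integrable_0[OF G] hsob_square_integrable[OF G j] by auto
  have tj: "test_function (nderiv j (mollifier n))" for n by (rule test_function_nderiv) simp
  have nf: "nderiv j (mollify n f) = conv (nderiv j (mollifier n)) f" for n
    by (rule nderiv_conv[OF mollifier_test lf])
  show sn: "square_integrable (nderiv j (mollify n f))" for n unfolding nf by (rule square_integrable_conv[OF tj f])
  have nG: "mollify n (nderiv j (G p)) = conv (nderiv j (mollifier n)) (G p)" for n p
    using conv_nderiv[OF mollifier_test diffk_mono[OF hsob_imp_diffk[OF G] j]] by simp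
  show approx: "\<forall>\<^sub>F p in sequentially. L2_norm (\<lambda>x. nderiv j (mollify n f) x - mollify n (nderiv j (G p)) x) < e" if "e > 0" for e n
  proof -
    have "L2_norm (\<lambda>x. nderiv j (mollify n f) x - mollify n (nderiv j (G p)) x) \<le> (LINT y|lborel. \<bar>nderiv j (mollifier n) y\<bar>) * L2_norm (\<lambda>x. f x - G p x)" for p
      using L2_norm_conv[OF tj square_integrable_diff[OF f sG(1)], of n p]
        conv_diff[OF tj lf square_integrable_imp_locally_integrable[OF sG(1)], of n p] by (simp only: nf nG)
    moreover have "(\<lambda>p. (LINT y|lborel. \<bar>nderiv j (mollifier n) y\<bar>) * L2_norm (\<lambda>x. f x - G p x)) \<longlonglongrightarrow> 0"
      using tendsto_mult[OF tendsto_const lim] by simp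
    then have "\<forall>\<^sub>F p in sequentially. (LINT y|lborel. \<bar>nderiv j (mollifier n) y\<bar>) * L2_norm (\<lambda>x. f x - G p x) < e"
      using that by (rule order_tendstoD(2))
    ultimately show ?thesis by (auto elim!: eventually_mono intro: le_less_trans)
  qed
  show "L2_norm (nderiv j (mollify n f)) \<le> M" if M: "\<And>p. hnorm k (G p) \<le> M" for n
  proof (rule field_le_epsilon)
    fix e :: real assume "e > 0"
    then obtain p where p: "L2_norm (\<lambda>x. nderiv j (mollify n f) x - mollify n (nderiv j (G p)) x) < e"
      using eventually_happens[OF approx] by auto
    have "L2_norm (nderiv j (mollify n f)) \<le> L2_norm (\<lambda>x. nderiv j (mollify n f) x - mollify n (nderiv j (G p)) x) + L2_norm (mollify n (nderiv j (G p)))"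
      by (rule L2_norm_le_diff[OF sn square_integrable_mollify[OF sG(2)]])
    also have "\<dots> \<le> e + M"
      using p L2_norm_mollify[OF sG(2), of n p] L2_nderiv_le_hnorm[OF j, of "G p"] M[of p] by linarith
    finally show "L2_norm (nderiv j (mollify n f)) \<le> M + e" by simp
  qed
  show "(\<lambda>n. L2_norm (\<lambda>x. nderiv j (mollify n f) x - nderiv j (G n) x)) \<longlonglongrightarrow> 0"
    if C: "\<And>e. e > 0 \<Longrightarrow> \<exists>N. \<forall>p\<ge>N. \<forall>q\<ge>N. hnorm k (\<lambda>x. G p x - G q x) < e"
  proof (rule LIMSEQ_I)
    fix e :: real assume e: "e > 0"
    obtain N where N: "\<And>p q. p \<ge> N \<Longrightarrow> q \<ge> N \<Longrightarrow> hnorm k (\<lambda>x. G p x - G q x) < e / 5"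
      using C[of "e / 5"] e by auto
    have NL: "L2_norm (\<lambda>x. nderiv j (G p) x - nderiv j (G q) x) < e / 5" if "p \<ge> N" "q \<ge> N" for p q
      using L2_nderiv_le_hnorm[OF j, of "\<lambda>x. G p x - G q x"] N[OF that]
        nderiv_diff[OF hsob_imp_diffk[OF G] hsob_imp_diffk[OF G] j, of p q] by simp
    have "\<forall>\<^sub>F n in sequentially. L2_norm (\<lambda>x. mollify n (nderiv j (G N)) x - nderiv j (G N) x) < e / 5"
      using e by (intro order_tendstoD(2)[OF mollify_tendsto_L2[OF sG(2)]]) auto
    then obtain N2 where N2: "\<And>n. n \<ge> N2 \<Longrightarrow> L2_norm (\<lambda>x. mollify n (nderiv j (G N)) x - nderiv j (G N) x) < e / 5"
      unfolding eventually_sequentially by blast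
    show "\<exists>no. \<forall>n\<ge>no. norm (L2_norm (\<lambda>x. nderiv j (mollify n f) x - nderiv j (G n) x) - 0) < e"
    proof (intro exI[of _ "max N N2"] allI impI)
      fix n assume n: "max N N2 \<le> n"
      have "\<forall>\<^sub>F p in sequentially. p \<ge> N \<and> L2_norm (\<lambda>x. nderiv j (mollify n f) x - mollify n (nderiv j (G p)) x) < e / 5"
        using e by (intro eventually_conj eventually_ge_at_top approx) auto
      \<comment> \<open>The index \<open>p\<close> may depend on \<open>n\<close>, because the
        Cauchy bound makes the choice irrelevant once it is beyond \<open>N\<close>.\<close>
      then obtain p where p: "p \<ge> N" "L2_norm (\<lambda>x. nderiv j (mollify n f) x - mollify n (nderiv j (G p)) x) < e / 5"
        using eventually_happens trivial_limit_sequentially by blast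
      note mp = square_integrable_mollify[OF sG(2)[of p], of n] and mN = square_integrable_mollify[OF sG(2)[of N], of n]
      have 2: "L2_norm (\<lambda>x. mollify n (nderiv j (G p)) x - mollify n (nderiv j (G N)) x) < e / 5"
        using L2_norm_mollify[OF square_integrable_diff[OF sG(2)[of p] sG(2)[of N]], of n] NL[OF p(1) order_refl]
          conv_diff[OF mollifier_test sG(2)[of p, THEN square_integrable_imp_locally_integrable] sG(2)[of N, THEN square_integrable_imp_locally_integrable], of n]
        by simp
      \<comment> \<open>A path of four steps, through mollifications of \<open>G p\<close> and of
        \<open>G N\<close>; contraction of mollification and the Cauchy bound make each step smaller
        than e/5.\<close>
      have "L2_norm (\<lambda>x. nderiv j (mollify n f) x - nderiv j (G n) x)
        \<le> L2_norm (\<lambda>x. nderiv j (mollify n f) x - mollify n (nderiv j (G p)) x)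
          + (L2_norm (\<lambda>x. mollify n (nderiv j (G p)) x - mollify n (nderiv j (G N)) x)
          + (L2_norm (\<lambda>x. mollify n (nderiv j (G N)) x - nderiv j (G N) x)
          + L2_norm (\<lambda>x. nderiv j (G N) x - nderiv j (G n) x)))"
        using L2_norm_triangle_mid[OF sn[of n] mp sG(2)[of n]] L2_norm_triangle_mid[OF mp mN sG(2)[of n]]
          L2_norm_triangle_mid[OF mN sG(2)[of N] sG(2)[of n]] by linarith
      also have "\<dots> < e" using p(2) 2 N2[of n] NL[of N n] n e by simp
      finally show "norm (L2_norm (\<lambda>x. nderiv j (mollify n f) x - nderiv j (G n) x) - 0) < e" by simp
    qed
  qed
qed

section \<open>The modified energy\<close>

definition energy :: "real \<Rightarrow> real \<Rightarrow> nat \<Rightarrow> (real \<Rightarrow> complex) \<Rightarrow> (real \<Rightarrow> complex) \<Rightarrow> real" where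
  "energy \<beta> K m c v = (L2_norm (nderiv (Suc m) v))\<^sup>2
     + (1 / \<beta>) * Re (LINT x|lborel. (c x * c x) * cnj (nderiv m v x) * cnj (nderiv m v x)) + K * (L2_norm v)\<^sup>2"

text \<open>The formal time derivative of \<open>energy\<close>: \<open>p\<close> stands for the
  time derivative of c^2, and \<open>g0\<close>, \<open>gm\<close>, \<open>gk\<close> stand for
  those of v, D^m v and D^(m+1) v.\<close>

definition energy_rate :: "real \<Rightarrow> real \<Rightarrow> nat \<Rightarrow> (real \<Rightarrow> complex) \<Rightarrow> (real \<Rightarrow> complex) \<Rightarrow> (real \<Rightarrow> complex)
    \<Rightarrow> (real \<Rightarrow> complex) \<Rightarrow> (real \<Rightarrow> complex) \<Rightarrow> (real \<Rightarrow> complex) \<Rightarrow> real" where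
  "energy_rate \<beta> K m c p v g0 gm gk = 2 * Re (LINT x|lborel. cnj (nderiv (Suc m) v x) * gk x)
     + (1 / \<beta>) * (Re (LINT x|lborel. p x * cnj (nderiv m v x) * cnj (nderiv m v x))
        + 2 * Re (LINT x|lborel. (c x * c x) * cnj (nderiv m v x) * cnj (gm x)))
     + 2 * K * Re (LINT x|lborel. cnj (v x) * g0 x)"

lemma Re_integral_self: "Re (LINT x|lborel. cnj (u x) * u x) = (L2_norm u)\<^sup>2"
proof -
  have "complex_of_real ((L2_norm u)\<^sup>2) = (LINT x|lborel. cnj (u x) * u x)"
    unfolding L2_norm_sq_complex by (simp only: mult.commute)
  then show ?thesis by (metis Re_complex_of_real)
qed

lemma Re_pairing_le:
  fixes u w :: "real \<Rightarrow> complex"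
  assumes "square_integrable u" "square_integrable w"
  shows "\<bar>Re (LINT x|lborel. u x * w x)\<bar> \<le> L2_norm u * L2_norm w"
  using L2_pairing_le[OF assms] abs_Re_le_cmod order_trans by blast

text \<open>The correction involves only order \<open>m\<close>. Interpolation bounds it by half of
  the top order square plus a multiple of the L2 square, which leads to the coefficients 1/2 and
  3/2.\<close>

lemma energy_bounds:
  fixes \<beta> B :: real and m :: nat
  assumes "\<beta> \<noteq> 0" and B: "B \<ge> 0" and \<eta>: "\<eta> > 0" "\<eta> * (B\<^sup>2 / \<bar>\<beta>\<bar>) \<le> 1 / 2"
    and C: "C \<ge> 0" "\<And>u. hsob (Suc m) u \<Longrightarrow> (hnorm m u)\<^sup>2 \<le> \<eta> * (L2_norm (nderiv (Suc m) u))\<^sup>2 + C * (L2_norm u)\<^sup>2"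
    and c: "cbd 0 c B" and v: "hsob (Suc m) v"
  shows energy_lower: "(1 / 2) * (L2_norm (nderiv (Suc m) v))\<^sup>2 + (K - C * (B\<^sup>2 / \<bar>\<beta>\<bar>)) * (L2_norm v)\<^sup>2 \<le> energy \<beta> K m c v"
    and energy_upper: "energy \<beta> K m c v \<le> (3 / 2) * (L2_norm (nderiv (Suc m) v))\<^sup>2 + (K + C * (B\<^sup>2 / \<bar>\<beta>\<bar>)) * (L2_norm v)\<^sup>2"
proof -
  let ?q = "B\<^sup>2 / \<bar>\<beta>\<bar>" and ?a = "L2_norm (nderiv (Suc m) v)" and ?w = "\<lambda>x. cnj (nderiv m v x)"
  have q0: "0 \<le> ?q" by simp
  have w: "square_integrable ?w" by (rule square_integrable_cnj[OF hsob_square_integrable[OF v]]) simp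
  have cm: "(\<lambda>x. c x * c x) \<in> borel_measurable borel"
    using c by (auto simp: cbd_def intro!: borel_measurable_continuous_onI continuous_on_mult)
  have cb: "AE x in lborel. norm (c x * c x) \<le> B * B"
    using cbd_bound[OF c] B by (intro AE_I2) (auto simp: norm_mult intro!: mult_mono)
  have BB: "0 \<le> B * B" using B by simp
  note cw = square_integrable_bounded_mult[OF w cm cb BB] L2_norm_bounded_mult[OF w cm cb BB]
  have lw: "L2_norm ?w \<le> hnorm m v" using L2_nderiv_le_hnorm[of m m v] by simp
  have "\<bar>Re (LINT x|lborel. c x * c x * ?w x * ?w x)\<bar> \<le> L2_norm (\<lambda>x. c x * c x * ?w x) * L2_norm ?w"
    by (rule Re_pairing_le[OF cw(1) w])
  also have "\<dots> \<le> (B * B * L2_norm ?w) * L2_norm ?w" by (intro mult_right_mono cw) auto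
  also have "\<dots> = B\<^sup>2 * (L2_norm ?w)\<^sup>2" by (simp add: power2_eq_square)
  also have "\<dots> \<le> B\<^sup>2 * (hnorm m v)\<^sup>2" using lw by (intro mult_left_mono power_mono) auto
  finally have "\<bar>1 / \<beta>\<bar> * \<bar>Re (LINT x|lborel. c x * c x * ?w x * ?w x)\<bar> \<le> \<bar>1 / \<beta>\<bar> * (B\<^sup>2 * (hnorm m v)\<^sup>2)"
    by (rule mult_left_mono) simp
  then have "\<bar>(1 / \<beta>) * Re (LINT x|lborel. c x * c x * ?w x * ?w x)\<bar> \<le> ?q * (hnorm m v)\<^sup>2"
    by (simp only: abs_mult) simp
  also have "\<dots> \<le> ?q * (\<eta> * ?a\<^sup>2 + C * (L2_norm v)\<^sup>2)" by (intro mult_left_mono C(2) v q0)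
  also have "\<dots> = (\<eta> * ?q) * ?a\<^sup>2 + C * ?q * (L2_norm v)\<^sup>2" by (simp add: algebra_simps)
  also have "\<dots> \<le> (1 / 2) * ?a\<^sup>2 + C * ?q * (L2_norm v)\<^sup>2" using \<eta>(2) by (intro add_right_mono mult_right_mono) auto
  finally show "(1 / 2) * ?a\<^sup>2 + (K - C * ?q) * (L2_norm v)\<^sup>2 \<le> energy \<beta> K m c v"
    "energy \<beta> K m c v \<le> (3 / 2) * ?a\<^sup>2 + (K + C * ?q) * (L2_norm v)\<^sup>2"
    unfolding energy_def left_diff_distrib[of K] distrib_right[of K] by linarith+
qed

text \<open>Here \<open>a\<close>, \<open>b\<close>, \<open>y\<close>, \<open>n\<close> stand for the top order, lower order, \<open>L\<^sup>2\<close> and full norms of the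
  perturbation, \<open>r\<close> for the residual and \<open>e\<close> for the mollification error.\<close>

lemma dissipation_arith:
  fixes a b y r e n D H K M C :: real
  assumes nn: "0 \<le> a" "0 \<le> b" "0 \<le> y" "0 \<le> r" "0 \<le> e" "1 \<le> H" "0 \<le> K" "0 \<le> C"
    and n: "n = a + b" "n \<le> 1 / (16 * H)" "y \<le> n"
    and D: "D \<le> - 2 * a\<^sup>2 + H * (a * b + a * n\<^sup>2 + a * r + a * e + b\<^sup>2 + b * n\<^sup>2 + b * r + b * e) + 2 * K * (H * y\<^sup>2 + y * r + y * e)"
    and b: "(2 * H\<^sup>2 + H + 2) * b\<^sup>2 \<le> (1 / 8) * a\<^sup>2 + C * y\<^sup>2"
  shows "D \<le> - (3 / 2) * a\<^sup>2 + (C + 2 * K * H + K + 3 * H\<^sup>2 + 2 * H) * (y\<^sup>2 + r\<^sup>2) + (2 * H + 2 * K) * e"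
proof -
  have n1: "n \<le> 1" using n(2) nn(6) by (smt (verit) divide_le_eq_1)
  have ab1: "a \<le> 1" "b \<le> 1" "y \<le> 1" using n n1 nn by auto
  have sq: "2 * (p * q) \<le> p\<^sup>2 + q\<^sup>2" for p q :: real using sum_squares_bound[of p q] by simp
  have t1: "H * (a * b) \<le> (1/8) * a\<^sup>2 + 2 * H\<^sup>2 * b\<^sup>2"
    using sq[of "a / 2" "2 * H * b"] by (simp add: power2_eq_square algebra_simps)
  have t2: "H * (a * r) \<le> (1/8) * a\<^sup>2 + 2 * H\<^sup>2 * r\<^sup>2"
    using sq[of "a / 2" "2 * H * r"] by (simp add: power2_eq_square algebra_simps)
  have t3: "H * (b * r) \<le> b\<^sup>2 + H\<^sup>2 * r\<^sup>2"
  proof -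
    have "2 * (H * (b * r)) \<le> b\<^sup>2 + H\<^sup>2 * r\<^sup>2" using sq[of b "H * r"] by (simp add: power_mult_distrib mult_ac)
    moreover have "0 \<le> H * (b * r)" using nn by auto
    ultimately show ?thesis by linarith
  qed
  \<comment> \<open>Since n = a + b the two terms collapse to H n^3, and the smallness of
    \<open>n\<close> reduces this to n^2 / 16.\<close>
  have "H * (a * n\<^sup>2 + b * n\<^sup>2) = H * n * n\<^sup>2" using n(1) by (simp add: algebra_simps)
  also have "\<dots> \<le> (1/16) * n\<^sup>2"
  proof (rule mult_right_mono)
    have "H * n \<le> H * (1 / (16 * H))" using n(2) nn(6) by (intro mult_left_mono) auto
    then show "H * n \<le> 1 / 16" using nn(6) by simp
  qed simp
  also have "\<dots> \<le> (1/8) * a\<^sup>2 + (1/8) * b\<^sup>2"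
    unfolding n(1) using sq[of a b] by (simp add: power2_sum)
  finally have t4: "H * (a * n\<^sup>2 + b * n\<^sup>2) \<le> (1/8) * a\<^sup>2 + (1/8) * b\<^sup>2" .
  have t5: "H * (a * e + b * e) \<le> 2 * H * e"
  proof -
    have "H * (a * e + b * e) \<le> H * (1 * e + 1 * e)" using nn ab1 by (intro mult_left_mono add_mono mult_right_mono) auto
    then show ?thesis by simp
  qed
  have t6: "2 * K * (H * y\<^sup>2 + y * r + y * e) \<le> 2 * K * H * y\<^sup>2 + K * (y\<^sup>2 + r\<^sup>2) + 2 * K * e"
  proof -
    have "K * (2 * (y * r)) \<le> K * (y\<^sup>2 + r\<^sup>2)" using nn by (intro mult_left_mono sq) auto
    moreover have "2 * K * (y * e) \<le> 2 * K * (1 * e)" using nn ab1 by (intro mult_left_mono mult_right_mono) auto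
    ultimately show ?thesis by (simp add: algebra_simps)
  qed
  \<comment> \<open>The bounds \<open>t1\<close>, \<open>t2\<close> and \<open>t4\<close> each spend
    an eighth of a^2. The hypothesis on b^2 will spend one more, which leaves -(3/2) a^2.\<close>
  have "D \<le> - 2 * a\<^sup>2 + (3/8) * a\<^sup>2 + (2 * H\<^sup>2 + H + 2) * b\<^sup>2 + 3 * H\<^sup>2 * r\<^sup>2 + 2 * H * e + (2 * K * H * y\<^sup>2 + K * (y\<^sup>2 + r\<^sup>2) + 2 * K * e)"
  proof -
    have "D \<le> - 2 * a\<^sup>2 + (H * (a * b) + H * (a * n\<^sup>2 + b * n\<^sup>2) + H * (a * r) + H * (a * e + b * e) + H * b\<^sup>2 + H * (b * r))
       + 2 * K * (H * y\<^sup>2 + y * r + y * e)"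
      using D by (simp add: algebra_simps)
    moreover have "(2 * H\<^sup>2 + H + 2) * b\<^sup>2 = 2 * H\<^sup>2 * b\<^sup>2 + H * b\<^sup>2 + 2 * b\<^sup>2" by (simp add: algebra_simps)
    ultimately show ?thesis using t1 t2 t3 t4 t5 t6 zero_le_power2[of b] by linarith
  qed
  also have "\<dots> \<le> - (3 / 2) * a\<^sup>2 + (C + 2 * K * H) * y\<^sup>2 + K * (y\<^sup>2 + r\<^sup>2) + 3 * H\<^sup>2 * r\<^sup>2 + (2 * H + 2 * K) * e"
    using b by (simp add: algebra_simps)
  also have "\<dots> \<le> - (3 / 2) * a\<^sup>2 + (C + 2 * K * H + K + 3 * H\<^sup>2 + 2 * H) * (y\<^sup>2 + r\<^sup>2) + (2 * H + 2 * K) * e"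
  proof -
    have "0 \<le> (C + 2 * K * H + 2 * H) * r\<^sup>2" "0 \<le> (3 * H\<^sup>2 + 2 * H) * y\<^sup>2" using nn by auto
    then show ?thesis by (simp add: algebra_simps)
  qed
  finally show ?thesis .
qed

text \<open>The top order term \<open>Re \<integral> i c\<^sup>2 (cnj D\<^sup>kv)\<^sup>2\<close> has no sign.  The correction in the energy
  produces its negative, because the conjugate perturbation disperses in the opposite direction.\<close>

lemma energy_rate_le:
  fixes \<alpha> \<beta> B K H K1 :: real and m :: nat
  assumes beta: "\<beta> \<noteq> 0" and B: "B \<ge> 0" and K: "K \<ge> 0" and K1: "K1 > 0"
    and H: "H = 2 * K1 + 2 + 2 * (2 ^ Suc m * (B * B)) + (2 * B\<^sup>2 / \<bar>\<beta>\<bar>) * (3 + \<bar>\<alpha>\<bar> + K1)"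
    and c: "cbd (Suc m) c B" and v: "hsob (Suc m + 2) v" and R: "hsob (Suc m) R" and N: "hsob (Suc m) N"
    and N1: "L2_norm (\<lambda>x. nderiv (Suc m) N x - (2 * \<i> * (c x * cnj (c x)) * nderiv (Suc m) v x + \<i> * (c x * c x) * cnj (nderiv (Suc m) v x)))
        \<le> K1 * (hnorm m v + (hnorm (Suc m) v)\<^sup>2)"
    and N2: "L2_norm (nderiv m N) \<le> K1 * (hnorm m v + (hnorm (Suc m) v)\<^sup>2)"
    and N3: "L2_norm N \<le> K1 * L2_norm v"
    and p: "p \<in> borel_measurable borel" "\<And>x. norm (p x) \<le> 2 * B\<^sup>2"
    and e: "square_integrable e0" "square_integrable em" "square_integrable ek"
    and es: "L2_norm e0 \<le> er" "L2_norm em \<le> er" "L2_norm ek \<le> er"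
    and g: "g = (\<lambda>j e x. - (\<i> * of_real \<beta>) * nderiv (j + 2) v x + (- (1 + \<i> * of_real \<alpha>) * nderiv j v x + (nderiv j N x + nderiv j R x + e x)))"
    and a: "a = L2_norm (nderiv (Suc m) v)" and b: "b = hnorm m v" and y: "y = L2_norm v" and r: "r = hnorm (Suc m) R" and n: "n = hnorm (Suc m) v"
  shows "energy_rate \<beta> K m c p v (g 0 e0) (g m em) (g (Suc m) ek)
     \<le> - 2 * a\<^sup>2 + H * (a * b + a * n\<^sup>2 + a * r + a * er + b\<^sup>2 + b * n\<^sup>2 + b * r + b * er) + 2 * K * (H * y\<^sup>2 + y * r + y * er)"
proof -
  let ?k = "Suc m"
  define u where "u = nderiv ?k v"
  define w where "w = nderiv m v"
  define c2 where "c2 = (\<lambda>x. \<i> * (c x * c x))"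
  define q where "q = 2 * B\<^sup>2 / \<bar>\<beta>\<bar>"
  define G where "G = 2 ^ Suc m * (B * B)"
  have q0: "0 \<le> q" and G0: "0 \<le> G" using B by (auto simp: q_def G_def)
  have nn: "0 \<le> a" "0 \<le> b" "0 \<le> y" "0 \<le> r" "0 \<le> er" using a b y r order_trans[OF L2_norm_nonneg es(1)] by auto
  have hu: "hsob 2 u" unfolding u_def by (rule hsob_nderiv[OF v]) simp
  have hw: "hsob 3 w" unfolding w_def by (rule hsob_nderiv[OF v]) simp
  have su: "square_integrable u" and sw: "square_integrable w" and sv: "square_integrable v"
    using hsob_square_integrable_0[OF hu] hsob_square_integrable_0[OF hw] hsob_square_integrable_0[OF v] .
  have sN: "square_integrable (nderiv j N)" and sR: "square_integrable (nderiv j R)" if "j \<le> ?k" for j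
    using hsob_square_integrable[OF N that] hsob_square_integrable[OF R that] .
  have wb: "L2_norm w \<le> b" unfolding w_def b by (rule L2_nderiv_le_hnorm) simp
  have Rj: "L2_norm (nderiv j R) \<le> r" if "j \<le> ?k" for j unfolding r by (rule L2_nderiv_le_hnorm[OF that])
  have bdm: "square_integrable (\<lambda>x. d x * z x) \<and> L2_norm (\<lambda>x. d x * z x) \<le> M * L2_norm z"
    if "d \<in> borel_measurable borel" "\<And>x. norm (d x) \<le> M" "square_integrable z" for d z :: "real \<Rightarrow> complex" and M
  proof -
    have "0 \<le> M" using that(2)[of 0] norm_ge_zero order_trans by blast
    then show ?thesis using square_integrable_bounded_mult[OF that(3,1)] L2_norm_bounded_mult[OF that(3,1)] that(2) by auto
  qed
  have cm: "c \<in> borel_measurable borel" using c unfolding cbd_def by (blast intro: borel_measurable_continuous_onI diffk_imp_continuous)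
  have c2b: "cbd ?k c2 G" unfolding c2_def G_def by (rule cbd_coefficients(2)[OF c])
  have ccb: "norm (c x * c x) \<le> B\<^sup>2" "norm (\<i> * (c x * c x)) \<le> B\<^sup>2" "norm (2 * \<i> * (c x * cnj (c x))) \<le> 2 * B\<^sup>2" for x
    using cbd_bound[OF c, of x] B by (auto simp: norm_mult power2_eq_square intro!: mult_mono)
  have ccm: "(\<lambda>x. c x * c x) \<in> borel_measurable borel" "(\<lambda>x. \<i> * (c x * c x)) \<in> borel_measurable borel" 
    "(\<lambda>x. 2 * \<i> * (c x * cnj (c x))) \<in> borel_measurable borel"
  proof -
    have [measurable]: "cnj \<in> borel_measurable borel"
      by (intro borel_measurable_continuous_onI continuous_intros)
    note [measurable] = cm
    show "(\<lambda>x. c x * c x) \<in> borel_measurable borel" "(\<lambda>x. \<i> * (c x * c x)) \<in> borel_measurable borel" by measurable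
    show "(\<lambda>x. 2 * \<i> * (c x * cnj (c x))) \<in> borel_measurable borel"
      using measurable_compose[OF cm, of cnj borel] by measurable
  qed
  note scu = square_integrable_cnj[OF su] and scw = square_integrable_cnj[OF sw] and scv = square_integrable_cnj[OF sv]
  have disp: "Re (\<i> * of_real \<beta> * (LINT x|lborel. cnj (z x) * nderiv 2 z x)) = 0" if z: "hsob 2 z" for z
  proof -
    have z1: "hsob 1 z" "hsob 1 (vderiv z)" using hsob_mono[OF z, of 1] hsob_nderiv[OF z, of 1 1] by auto
    have vz: "vderiv (\<lambda>x. cnj (z x)) = (\<lambda>x. cnj (vderiv z x))"
      using nderiv_cnj[OF hsob_imp_diffk[OF z1(1)], of 1] by simp
    have "(LINT x|lborel. cnj (z x) * nderiv 2 z x) = - (LINT x|lborel. cnj (vderiv z x) * vderiv z x)"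
      using integral_by_parts_line[OF hsob_cnj[OF z1(1)] z1(2)] by (simp add: vz numeral_2_eq_2)
    also have "\<dots> = - complex_of_real ((L2_norm (vderiv z))\<^sup>2)"
      unfolding L2_norm_sq_complex by (simp only: mult.commute)
    finally show ?thesis by (simp flip: of_real_power)
  qed
  have damp: "Re ((1 + \<i> * of_real \<alpha>) * (LINT x|lborel. cnj (z x) * z x)) = (L2_norm z)\<^sup>2" for z
  proof -
    have "(LINT x|lborel. cnj (z x) * z x) = complex_of_real ((L2_norm z)\<^sup>2)"
      unfolding L2_norm_sq_complex by (simp only: mult.commute)
    then show ?thesis by (simp flip: of_real_power)
  qed
  \<comment> \<open>The integrand is i times a real function, so this linear term only
    rotates.\<close>
  have rot: "Re (LINT x|lborel. cnj (u x) * (2 * \<i> * (c x * cnj (c x)) * u x)) = 0"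
  proof -
    have i: "integrable lborel (\<lambda>x. cnj (u x) * (2 * \<i> * (c x * cnj (c x)) * u x))"
      using bdm[OF ccm(3) ccb(3) su] by (intro square_integrable_imp_integrable_mult[OF scu]) auto
    have "Re (cnj (u x) * (2 * \<i> * (c x * cnj (c x)) * u x)) = 0" for x
    proof -
      have "cnj (u x) * (2 * \<i> * (c x * cnj (c x)) * u x) = \<i> * of_real (2 * (cmod (c x))\<^sup>2 * (cmod (u x))\<^sup>2)"
        unfolding of_real_mult complex_norm_square by simp
      then show ?thesis by simp
    qed
    then show ?thesis using integral_Re[OF i] by simp
  qed
  define S where "S = Re (LINT x|lborel. cnj (u x) * (c2 x * cnj (u x)))"
  \<comment> \<open>The part of the nonlinearity at top order that is of lower order or quadratic;
    \<open>S\<close> above it is the pairing without sign.\<close>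
  define Lo where "Lo = (\<lambda>x. nderiv ?k N x - (2 * \<i> * (c x * cnj (c x)) * u x + c2 x * cnj (u x)))"
  have s2u: "square_integrable (\<lambda>x. 2 * \<i> * (c x * cnj (c x)) * u x)" "square_integrable (\<lambda>x. c2 x * cnj (u x))"
    using bdm[OF ccm(3) ccb(3) su] bdm[OF ccm(2) ccb(2) scu] unfolding c2_def by auto
  have sLo: "square_integrable Lo" unfolding Lo_def by (intro square_integrable_diff square_integrable_add s2u sN order_refl)
  have lLo: "L2_norm Lo \<le> K1 * (b + n\<^sup>2)" using N1 unfolding Lo_def u_def c2_def b n .
  let ?Z = "\<lambda>x. Lo x + (nderiv ?k R x + ek x)"
  have sZ: "square_integrable ?Z" by (intro square_integrable_add sLo sR e order_refl)
  have lZ: "L2_norm ?Z \<le> K1 * (b + n\<^sup>2) + r + er"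
    using L2_norm_triangle[OF sLo square_integrable_add[OF sR[OF order_refl] e(3)]] L2_norm_triangle[OF sR[OF order_refl] e(3)] lLo Rj[OF order_refl] es(3) by linarith
  \<comment> \<open>The balance at top order: damping, the term \<open>S\<close> without sign, and
    controllable errors.\<close>
  have T1: "Re (LINT x|lborel. cnj (u x) * g ?k ek x) \<le> - a\<^sup>2 + S + a * (K1 * (b + n\<^sup>2) + r + er)"
  proof -
    have sk2: "square_integrable (nderiv 2 u)" by (rule hsob_square_integrable[OF hu]) simp
    note i1 = square_integrable_imp_integrable_mult[OF scu sk2] and i2 = square_integrable_imp_integrable_mult[OF scu su]
      and i3 = square_integrable_imp_integrable_mult[OF scu s2u(1)] and i4 = square_integrable_imp_integrable_mult[OF scu s2u(2)]
      and i5 = square_integrable_imp_integrable_mult[OF scu sZ]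
    have u2: "nderiv (?k + 2) v = nderiv 2 u" unfolding u_def by (simp add: numeral_2_eq_2)
    have "cnj (u x) * g ?k ek x = - (\<i> * of_real \<beta>) * (cnj (u x) * nderiv 2 u x) + (- (1 + \<i> * of_real \<alpha>) * (cnj (u x) * u x)
      + (cnj (u x) * (2 * \<i> * (c x * cnj (c x)) * u x) + (cnj (u x) * (c2 x * cnj (u x)) + cnj (u x) * ?Z x)))" for x
      unfolding g u2 Lo_def by (simp add: u_def[symmetric] algebra_simps del: funpow.simps)
    then have "(LINT x|lborel. cnj (u x) * g ?k ek x) = - (\<i> * of_real \<beta>) * (LINT x|lborel. cnj (u x) * nderiv 2 u x)
       + (- (1 + \<i> * of_real \<alpha>) * (LINT x|lborel. cnj (u x) * u x) + ((LINT x|lborel. cnj (u x) * (2 * \<i> * (c x * cnj (c x)) * u x))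
       + ((LINT x|lborel. cnj (u x) * (c2 x * cnj (u x))) + (LINT x|lborel. cnj (u x) * ?Z x))))"
      using i1 i2 i3 i4 i5 by (simp only: Bochner_Integration.integral_add Bochner_Integration.integrable_add integral_mult_right_zero integrable_mult_right)
    then have "Re (LINT x|lborel. cnj (u x) * g ?k ek x) = - Re (\<i> * of_real \<beta> * (LINT x|lborel. cnj (u x) * nderiv 2 u x))
       + (- Re ((1 + \<i> * of_real \<alpha>) * (LINT x|lborel. cnj (u x) * u x)) + (Re (LINT x|lborel. cnj (u x) * (2 * \<i> * (c x * cnj (c x)) * u x))
       + (S + Re (LINT x|lborel. cnj (u x) * ?Z x))))"
      unfolding S_def by (simp only: plus_complex.simps minus_mult_left[symmetric] uminus_complex.simps)
    also have "\<dots> = - a\<^sup>2 + S + Re (LINT x|lborel. cnj (u x) * ?Z x)"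
      unfolding disp[OF hu] damp rot by (simp add: a u_def)
    also have "Re (LINT x|lborel. cnj (u x) * ?Z x) \<le> L2_norm u * L2_norm ?Z"
      using Re_pairing_le[OF scu sZ] by simp
    also have "\<dots> \<le> a * (K1 * (b + n\<^sup>2) + r + er)" unfolding a u_def[symmetric] by (intro mult_left_mono lZ) simp
    finally show ?thesis by simp
  qed
  have T2: "\<bar>(1 / \<beta>) * Re (LINT x|lborel. p x * cnj (w x) * cnj (w x))\<bar> \<le> q * b\<^sup>2"
  proof -
    note pw = bdm[OF p scw]
    have "\<bar>Re (LINT x|lborel. p x * cnj (w x) * cnj (w x))\<bar> \<le> L2_norm (\<lambda>x. p x * cnj (w x)) * L2_norm (\<lambda>x. cnj (w x))"
      using pw by (intro Re_pairing_le scw) auto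
    also have "\<dots> \<le> (2 * B\<^sup>2 * b) * b"
      using pw wb nn by (intro mult_mono order_trans[OF conjunct2[OF pw]] mult_left_mono) auto
    finally have "\<bar>1 / \<beta>\<bar> * \<bar>Re (LINT x|lborel. p x * cnj (w x) * cnj (w x))\<bar> \<le> \<bar>1 / \<beta>\<bar> * ((2 * B\<^sup>2 * b) * b)"
      by (rule mult_left_mono) simp
    then show ?thesis by (simp only: abs_mult) (simp add: q_def power2_eq_square)
  qed
  let ?Y = "\<lambda>x. - (1 + \<i> * of_real \<alpha>) * w x + (nderiv m N x + nderiv m R x + em x)"
  have mk: "m \<le> ?k" by simp
  have sY: "square_integrable ?Y" by (intro square_integrable_add square_integrable_cmult sw sN sR e mk)
  have lY: "L2_norm ?Y \<le> (1 + \<bar>\<alpha>\<bar>) * b + K1 * (b + n\<^sup>2) + r + er"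
  proof -
    have "L2_norm ?Y \<le> L2_norm (\<lambda>x. - (1 + \<i> * of_real \<alpha>) * w x) + (L2_norm (nderiv m N) + L2_norm (nderiv m R) + L2_norm em)"
      using L2_norm_triangle[OF square_integrable_cmult[OF sw] square_integrable_add[OF square_integrable_add[OF sN[OF mk] sR[OF mk]] e(2)], of "- (1 + \<i> * of_real \<alpha>)"]
        L2_norm_triangle[OF square_integrable_add[OF sN[OF mk] sR[OF mk]] e(2)] L2_norm_triangle[OF sN[OF mk] sR[OF mk]] by linarith
    moreover have "L2_norm (\<lambda>x. - (1 + \<i> * of_real \<alpha>) * w x) \<le> (1 + \<bar>\<alpha>\<bar>) * b"
      unfolding L2_norm_cmult[OF sw] norm_minus_cancel
      using norm_triangle_ineq[of 1 "\<i> * complex_of_real \<alpha>"] wb by (intro mult_mono) (auto simp: norm_mult)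
    ultimately show ?thesis using N2 Rj[OF mk] es(2) unfolding b n by linarith
  qed
  \<comment> \<open>Conjugation reverses the sign of the dispersion, so its contribution carries a
    factor \<beta> that cancels 1 / \<beta>. What remains is i c^2 times the product of the
    conjugates of w and w'', with w = D^m v; integrating by parts once turns it into
    \<open>- S\<close> plus a term with the derivative on c^2.\<close>
  have T3: "(1 / \<beta>) * (2 * Re (LINT x|lborel. c x * c x * cnj (w x) * cnj (g m em x)))
     \<le> - 2 * S + 2 * (G * b * a) + q * (b * ((1 + \<bar>\<alpha>\<bar>) * b + K1 * (b + n\<^sup>2) + r + er))"
  proof -
    have sw2: "square_integrable (\<lambda>x. cnj (nderiv 2 w x))" by (rule square_integrable_cnj[OF hsob_square_integrable[OF hw]]) simp
    note ccw = bdm[OF ccm(1) ccb(1) scw]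
    have s1: "square_integrable (\<lambda>x. c2 x * cnj (w x))" using bdm[OF ccm(2) ccb(2) scw] by (simp add: c2_def)
    note i1 = square_integrable_imp_integrable_mult[OF s1 sw2]
      and i2 = square_integrable_imp_integrable_mult[OF conjunct1[OF ccw] square_integrable_cnj[OF sY]]
    have w2: "nderiv (m + 2) v = nderiv 2 w" unfolding w_def by (simp add: numeral_2_eq_2)
    have "c x * c x * cnj (w x) * cnj (g m em x) = of_real \<beta> * (c2 x * cnj (w x) * cnj (nderiv 2 w x)) + c x * c x * cnj (w x) * cnj (?Y x)" for x
      unfolding g w2 c2_def by (simp add: w_def[symmetric] algebra_simps del: funpow.simps)
    then have "(LINT x|lborel. c x * c x * cnj (w x) * cnj (g m em x)) = of_real \<beta> * (LINT x|lborel. c2 x * cnj (w x) * cnj (nderiv 2 w x))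
       + (LINT x|lborel. c x * c x * cnj (w x) * cnj (?Y x))"
      using i1 i2 by (simp only: Bochner_Integration.integral_add integral_mult_right_zero integrable_mult_right)
    \<comment> \<open>The derivative is moved off w''. It falls either on \<open>c2\<close>, giving
      a product of orders \<open>m\<close> and m + 1, or on the other factor \<open>w\<close>,
      giving \<open>S\<close>.\<close>
    moreover have "(LINT x|lborel. c2 x * cnj (w x) * cnj (nderiv 2 w x)) = - (LINT x|lborel. vderiv c2 x * cnj (w x) * cnj (u x)) - (LINT x|lborel. cnj (u x) * (c2 x * cnj (u x)))"
    proof -
      have h1: "hsob 1 (\<lambda>x. c2 x * cnj (w x))"
        by (rule hsob_coeff_mult[OF cbd_mono[OF c2b, of 1 G]]) (use hsob_cnj[OF hsob_mono[OF hw, of 1]] in auto)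
      have h2: "hsob 1 (\<lambda>x. cnj (u x))" by (rule hsob_cnj[OF hsob_mono[OF hu]]) simp
      have wu: "vderiv w = u" by (simp add: w_def u_def)
      have vu: "vderiv (\<lambda>x. cnj (u x)) = (\<lambda>x. cnj (nderiv 2 w x))"
        using nderiv_cnj[OF hsob_imp_diffk[OF hu], of 1] wu by (simp add: numeral_2_eq_2)
      have vcw: "vderiv (\<lambda>x. cnj (w x)) = (\<lambda>x. cnj (u x))"
        using nderiv_cnj[OF hsob_imp_diffk[OF hw], of 1] wu by simp
      have d: "diffk (Suc 0) c2" "diffk (Suc 0) (\<lambda>x. cnj (w x))"
        using c2b diffk_mono[of ?k c2 "Suc 0"] hsob_imp_diffk[OF hsob_cnj[OF hsob_mono[OF hw, of "Suc 0"]]] by (auto simp: cbd_def simp del: diffk.simps)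
      have vq: "vderiv (\<lambda>x. c2 x * cnj (w x)) = (\<lambda>x. vderiv c2 x * cnj (w x) + c2 x * cnj (u x))"
        using vderiv_mult(1)[OF d] vcw by simp
      have vc2: "cbd 0 (vderiv c2) G" by (rule cbd_vderiv, rule cbd_mono[OF c2b]) auto
      have "vderiv c2 \<in> borel_measurable borel" using vc2 by (simp add: cbd_def borel_measurable_continuous_onI)
      then have sv2: "square_integrable (\<lambda>x. vderiv c2 x * cnj (w x))"
        using bdm[of "vderiv c2", OF _ cbd_bound[OF vc2] scw] by blast
      note j1 = square_integrable_imp_integrable_mult[OF sv2 scu] and j2 = square_integrable_imp_integrable_mult[OF s2u(2) scu]
      have "(LINT x|lborel. c2 x * cnj (w x) * cnj (nderiv 2 w x)) = - (LINT x|lborel. (vderiv c2 x * cnj (w x) + c2 x * cnj (u x)) * cnj (u x))"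
        using integral_by_parts_line[OF h1 h2] unfolding vq vu by simp
      also have "(LINT x|lborel. (vderiv c2 x * cnj (w x) + c2 x * cnj (u x)) * cnj (u x)) 
          = (LINT x|lborel. vderiv c2 x * cnj (w x) * cnj (u x)) + (LINT x|lborel. c2 x * cnj (u x) * cnj (u x))"
        unfolding distrib_right using j1 j2 by (rule Bochner_Integration.integral_add)
      also have "(LINT x|lborel. c2 x * cnj (u x) * cnj (u x)) = (LINT x|lborel. cnj (u x) * (c2 x * cnj (u x)))"
        by (simp only: mult.commute)
      finally show ?thesis by simp
    qed
    moreover have "\<bar>Re (LINT x|lborel. vderiv c2 x * cnj (w x) * cnj (u x))\<bar> \<le> G * b * a"
    proof -
      have vc2: "cbd 0 (vderiv c2) G" by (rule cbd_vderiv, rule cbd_mono[OF c2b]) auto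
      have "vderiv c2 \<in> borel_measurable borel" using vc2 by (simp add: cbd_def borel_measurable_continuous_onI)
      from bdm[of "vderiv c2", OF this cbd_bound[OF vc2] scw]
      have v: "square_integrable (\<lambda>x. vderiv c2 x * cnj (w x))" "L2_norm (\<lambda>x. vderiv c2 x * cnj (w x)) \<le> G * L2_norm w"
        by simp_all
      have "\<bar>Re (LINT x|lborel. vderiv c2 x * cnj (w x) * cnj (u x))\<bar> \<le> L2_norm (\<lambda>x. vderiv c2 x * cnj (w x)) * L2_norm (\<lambda>x. cnj (u x))"
        by (rule Re_pairing_le[OF v(1) scu])
      also have "\<dots> \<le> (G * b) * a" 
        using v(2) wb G0 nn mult_left_mono[OF wb G0] by (intro mult_mono) (auto simp: a u_def)
      finally show ?thesis .
    qed
    moreover have "\<bar>(1 / \<beta>) * (2 * Re (LINT x|lborel. c x * c x * cnj (w x) * cnj (?Y x)))\<bar> \<le> q * (b * ((1 + \<bar>\<alpha>\<bar>) * b + K1 * (b + n\<^sup>2) + r + er))"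
    proof -
      have "\<bar>Re (LINT x|lborel. c x * c x * cnj (w x) * cnj (?Y x))\<bar> \<le> L2_norm (\<lambda>x. c x * c x * cnj (w x)) * L2_norm (\<lambda>x. cnj (?Y x))"
        using ccw by (intro Re_pairing_le square_integrable_cnj[OF sY]) auto
      also have "\<dots> \<le> (B\<^sup>2 * b) * ((1 + \<bar>\<alpha>\<bar>) * b + K1 * (b + n\<^sup>2) + r + er)"
        unfolding L2_norm_cnj using ccw wb nn lY mult_left_mono[OF wb, of "B\<^sup>2"] by (intro mult_mono) auto
      finally have "\<bar>2 / \<beta>\<bar> * \<bar>Re (LINT x|lborel. c x * c x * cnj (w x) * cnj (?Y x))\<bar> \<le> \<bar>2 / \<beta>\<bar> * ((B\<^sup>2 * b) * ((1 + \<bar>\<alpha>\<bar>) * b + K1 * (b + n\<^sup>2) + r + er))"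
        by (rule mult_left_mono) simp
      also have "\<dots> = q * (b * ((1 + \<bar>\<alpha>\<bar>) * b + K1 * (b + n\<^sup>2) + r + er))" by (simp add: q_def)
      also have "\<bar>2 / \<beta>\<bar> * \<bar>Re (LINT x|lborel. c x * c x * cnj (w x) * cnj (?Y x))\<bar> = \<bar>(1 / \<beta>) * (2 * Re (LINT x|lborel. c x * c x * cnj (w x) * cnj (?Y x)))\<bar>"
        by (simp add: abs_mult)
      finally show ?thesis .
    qed
    \<comment> \<open>Pure arithmetic in which 1 / \<beta> cancels \<beta>, stated for arbitrary
      complex numbers to keep the integrals opaque.\<close>
    moreover have "(1 / \<beta>) * (2 * Re I) \<le> - 2 * Re S' + 2 * X1 + X2"
      if "I = of_real \<beta> * J + Y" "J = - V - S'" "\<bar>Re V\<bar> \<le> X1" "\<bar>(1 / \<beta>) * (2 * Re Y)\<bar> \<le> X2" for I J Y V S' :: complex and X1 X2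
    proof -
      have "(1 / \<beta>) * (2 * Re I) = 2 * Re J + (1 / \<beta>) * (2 * Re Y)" using that(1) beta by (simp add: field_simps)
      moreover have "Re J = - Re V - Re S'" using that(2) by simp
      ultimately show ?thesis using that(3,4) by linarith
    qed
    ultimately show ?thesis unfolding S_def by blast
  qed
  let ?X = "\<lambda>x. N x + R x + e0 x"
  have sN0: "square_integrable N" and sR0: "square_integrable R" using sN[of 0] sR[of 0] by auto
  have sX: "square_integrable ?X" by (intro square_integrable_add sN0 sR0 e)
  have lX: "L2_norm ?X \<le> K1 * y + r + er"
    using L2_norm_triangle[OF square_integrable_add[OF sN0 sR0] e(1)] L2_norm_triangle[OF sN0 sR0] N3 Rj[of 0] es(1) by (simp add: y)
  have T4: "Re (LINT x|lborel. cnj (v x) * g 0 e0 x) \<le> y * (K1 * y + r + er)"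
  proof -
    have v2: "square_integrable (nderiv 2 v)" and hv2: "hsob 2 v" using hsob_square_integrable[OF v, of 2] hsob_mono[OF v, of 2] by auto
    note i1 = square_integrable_imp_integrable_mult[OF scv v2] and i2 = square_integrable_imp_integrable_mult[OF scv sv]
      and i5 = square_integrable_imp_integrable_mult[OF scv sX]
    have "cnj (v x) * g 0 e0 x = - (\<i> * of_real \<beta>) * (cnj (v x) * nderiv 2 v x) + (- (1 + \<i> * of_real \<alpha>) * (cnj (v x) * v x) + cnj (v x) * ?X x)" for x
      unfolding g by (simp add: algebra_simps numeral_2_eq_2)
    then have "(LINT x|lborel. cnj (v x) * g 0 e0 x) = - (\<i> * of_real \<beta>) * (LINT x|lborel. cnj (v x) * nderiv 2 v x)
       + (- (1 + \<i> * of_real \<alpha>) * (LINT x|lborel. cnj (v x) * v x) + (LINT x|lborel. cnj (v x) * ?X x))"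
      using i1 i2 i5 by (simp only: Bochner_Integration.integral_add Bochner_Integration.integrable_add integral_mult_right_zero integrable_mult_right)
    then have "Re (LINT x|lborel. cnj (v x) * g 0 e0 x) = - Re (\<i> * of_real \<beta> * (LINT x|lborel. cnj (v x) * nderiv 2 v x))
       + (- Re ((1 + \<i> * of_real \<alpha>) * (LINT x|lborel. cnj (v x) * v x)) + Re (LINT x|lborel. cnj (v x) * ?X x))"
      by (simp only: plus_complex.simps minus_mult_left[symmetric] uminus_complex.simps)
    also have "\<dots> \<le> Re (LINT x|lborel. cnj (v x) * ?X x)" unfolding disp[OF hv2] damp by simp
    also have "\<dots> \<le> L2_norm (\<lambda>x. cnj (v x)) * L2_norm ?X" using Re_pairing_le[OF scv sX] by simp
    also have "\<dots> \<le> y * (K1 * y + r + er)" unfolding L2_norm_cnj y[symmetric] by (intro mult_left_mono lX nn)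
    finally show ?thesis .
  qed
  \<comment> \<open>The top order balance enters twice and contributes 2 \<open>S\<close>, the
    correction contributes -2 \<open>S\<close>; from here on no term without sign is left.\<close>
  have "energy_rate \<beta> K m c p v (g 0 e0) (g m em) (g ?k ek)
     \<le> 2 * (- a\<^sup>2 + S + a * (K1 * (b + n\<^sup>2) + r + er)) + (q * b\<^sup>2 + (- 2 * S + 2 * (G * b * a) + q * (b * ((1 + \<bar>\<alpha>\<bar>) * b + K1 * (b + n\<^sup>2) + r + er))))
       + 2 * K * (y * (K1 * y + r + er))"
    unfolding energy_rate_def u_def[symmetric] w_def[symmetric] distrib_left[of "1 / \<beta>"]
    using T1 K by (intro add_mono abs_le_D1[OF T2] T3 mult_left_mono[OF T4] mult_left_mono[of _ _ 2]) auto
  also have "\<dots> = - 2 * a\<^sup>2 + ((2 * K1 + 2 * G) * (a * b) + 2 * K1 * (a * n\<^sup>2) + 2 * (a * r) + 2 * (a * er)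
       + q * (2 + \<bar>\<alpha>\<bar> + K1) * b\<^sup>2 + q * K1 * (b * n\<^sup>2) + q * (b * r) + q * (b * er)) + 2 * K * (K1 * y\<^sup>2 + y * r + y * er)"
    by (simp add: algebra_simps power2_eq_square)
  also have "\<dots> \<le> - 2 * a\<^sup>2 + (H * (a * b) + H * (a * n\<^sup>2) + H * (a * r) + H * (a * er) + H * b\<^sup>2 + H * (b * n\<^sup>2) + H * (b * r) + H * (b * er))
       + 2 * K * (H * y\<^sup>2 + y * r + y * er)"
  proof -
    have H': "H = 2 * K1 + 2 + 2 * G + q * (3 + \<bar>\<alpha>\<bar> + K1)" unfolding H G_def q_def ..
    have qq: "0 \<le> q * K1" "0 \<le> q * \<bar>\<alpha>\<bar>" using q0 K1 by auto
    \<comment> \<open>\<open>H\<close> was chosen as a common upper bound for all coefficients of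
      the error terms.\<close>
    have k: "2 * K1 + 2 * G \<le> H" "2 * K1 \<le> H" "2 \<le> H" "q * (2 + \<bar>\<alpha>\<bar> + K1) \<le> H" "q * K1 \<le> H" "q \<le> H" "K1 \<le> H"
      unfolding H' distrib_left using qq q0 K1 G0 by auto
    show ?thesis using nn K by (intro add_mono mult_right_mono mult_left_mono k) auto
  qed
  finally show ?thesis by (simp only: distrib_left)
qed

section \<open>The energy along the mollified flow\<close>

lemma hnorm_vderiv_le: "hnorm k (vderiv u) \<le> hnorm (Suc k) u"
proof -
  have "hnorm k (vderiv u) = (\<Sum>j\<le>k. L2_norm (nderiv (Suc j) u))"
    unfolding hnorm_def by (simp only: nderiv_Suc)
  moreover have "hnorm (Suc k) u = L2_norm (nderiv 0 u) + (\<Sum>j\<le>k. L2_norm (nderiv (Suc j) u))"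
    unfolding hnorm_def by (rule sum.atMost_Suc_shift)
  ultimately show ?thesis using L2_norm_nonneg[of "nderiv 0 u"] by linarith
qed

context modulated_lle
begin

section \<open>The energy of the mollified perturbation\<close>

abbreviation vmol :: "nat \<Rightarrow> real \<Rightarrow> real \<Rightarrow> complex" where "vmol n s \<equiv> mollify n (v s)"

text \<open>The time derivative of the square of the modulated profile, which takes the place of
  \<open>p\<close> in \<open>energy_rate\<close>.\<close>

definition modul_sq_t :: "real \<Rightarrow> real \<Rightarrow> complex" where
  "modul_sq_t s x = - (2 * (modul \<phi> s x * (modul (vderiv \<phi>) s x * gt s x)))"

lemma gt_measurable: "s \<in> {0..t} \<Longrightarrow> gt s \<in> borel_measurable borel"
  using L2_continuous_gt by (auto simp: L2_continuous_on_def intro: square_integrable_measurable)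

lemma modul_sq_t_measurable: "s \<in> {0..t} \<Longrightarrow> modul_sq_t s \<in> borel_measurable borel"
  unfolding modul_sq_t_def using modul_measurable[of s] gt_measurable[of s] by simp

lemma modul_sq_t_bound: "s \<in> {0..t} \<Longrightarrow> norm (modul_sq_t s x) \<le> 2 * B\<^sup>2"
proof -
  assume s: "s \<in> {0..t}"
  have "norm (modul \<phi> s x) * (norm (modul (vderiv \<phi>) s x) * norm (gt s x)) \<le> B * (B * 1)"
    using modul_bound[OF s] gamma_t_bound[OF s, of x] B_nonneg by (intro mult_mono) (auto simp: gt_def)
  then show ?thesis by (simp add: modul_sq_t_def norm_mult power2_eq_square)
qed

lemma vmol_facts:
  assumes s: "s \<in> {0..t}"
  shows hsob_vmol: "hsob j (vmol n s)"
    and nderiv_vmol: "nderiv j (vmol n s) = conv (nderiv j (mollifier n)) (v s)"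
    and hnorm_vmol: "hnorm k (vmol n s) \<le> real (k + 1) * sobolev_norm k (v s)"
  using hsob_mollify_sobolev[OF sobolev_v[OF s]]
    nderiv_conv[OF mollifier_test square_integrable_imp_locally_integrable[OF v_square_integrable[OF s]]]
    order_trans[OF hnorm_mollify_le[OF sobolev_v[OF s]] sum_L2_le_sobolev_norm] by auto

text \<open>All derivatives of the mollified perturbation are differentiable curves in L2. In the
  correction, the squared profile multiplies one conjugate factor as a coefficient and the product
  is paired with the other conjugate factor.\<close>

lemma energy_has_derivative:
  assumes s: "s \<in> {0..t}"
  shows "((\<lambda>r. energy \<beta> K m (modul \<phi> r) (vmol n r)) has_real_derivative
     energy_rate \<beta> K m (modul \<phi> s) (modul_sq_t s) (vmol n s) (velocity (nderiv 0 (mollifier n)) s)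
       (velocity (nderiv m (mollifier n)) s) (velocity (nderiv (Suc m) (mollifier n)) s)) (at s within {0..t})"
proof -
  define u where "u = (\<lambda>j r. conv (nderiv j (mollifier n)) (v r))"
  define g where "g = (\<lambda>j. velocity (nderiv j (mollifier n)) s)"
  have D: "has_L2_derivative (u j) (g j) s {0..t}" for j
    unfolding u_def g_def by (rule conv_v_has_L2_derivative[OF s test_function_nderiv]) simp
  note Dc = has_L2_derivative_cnj[OF D]
  have sq: "square_integrable (u j s)" "square_integrable (g j)" for j
    using has_L2_derivativeD(2,3)[OF D] s by auto
  have Re_d: "((\<lambda>r. Re (h r)) has_real_derivative Re d) (at s within {0..t})"
    if "(h has_vector_derivative d) (at s within {0..t})" for h d
    unfolding has_real_derivative_iff_has_vector_derivative
    by (rule bounded_linear.has_vector_derivative[OF bounded_linear_Re that])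
  have L2d: "((\<lambda>r. (L2_norm (u j r))\<^sup>2) has_real_derivative 2 * Re (LINT x|lborel. cnj (u j s x) * g j x)) (at s within {0..t})" for j
  proof -
    have "(LINT x|lborel. cnj (g j x) * u j s x) = cnj (LINT x|lborel. cnj (u j s x) * g j x)"
      by (subst Bochner_Integration.integral_cnj[symmetric]) (simp only: complex_cnj_mult complex_cnj_cnj mult.commute)
    then have "Re (LINT x|lborel. cnj (g j x) * u j s x) = Re (LINT x|lborel. cnj (u j s x) * g j x)" by simp
    then show ?thesis
      using Re_d[OF has_vector_derivative_pairing[OF Dc[of j] D[of j]]] unfolding Re_integral_self plus_complex.sel by (simp only: mult_2)
  qed
  obtain L where L: "L > 0" "\<And>a b x. a \<in> {0..t} \<Longrightarrow> b \<in> {0..t} \<Longrightarrow> norm (modul \<phi> b x - modul \<phi> a x) \<le> L * \<bar>b - a\<bar>"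
    "\<And>s x. norm (modul (vderiv \<phi>) s x) \<le> L"
    by (rule modul_lipschitz[OF phi], rule that)
  let ?c = "modul \<phi> s" and ?p = "modul_sq_t s" and ?w = "\<lambda>x. cnj (u m s x)"
  have mb: "norm (modul \<phi> r x) \<le> B" and mm: "modul \<phi> r \<in> borel_measurable borel" if "r \<in> {0..t}" for r x
    using modul_bound[OF that, of \<phi> x] modul_measurable[OF that, of \<phi>] by auto
  have W: "has_L2_derivative (\<lambda>r x. (modul \<phi> r x * modul \<phi> r x) * cnj (u m r x)) (\<lambda>x. ?p x * ?w x + (?c x * ?c x) * cnj (g m x)) s {0..t}"
  proof (rule has_L2_derivative_mult_coeff[OF Dc, where P = "B * B" and L = "2 * (B * L)"])
    fix r assume r: "r \<in> {0..t}"
    show "(\<lambda>x. modul \<phi> r x * modul \<phi> r x) \<in> borel_measurable borel" using mm r by simp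
    fix x
    show "norm (modul \<phi> r x * modul \<phi> r x) \<le> B * B" unfolding norm_mult using mb r B_nonneg by (intro mult_mono) auto
    have "modul \<phi> r x * modul \<phi> r x - modul \<phi> s x * modul \<phi> s x = (modul \<phi> r x - modul \<phi> s x) * (modul \<phi> r x + modul \<phi> s x)"
      by (simp add: algebra_simps)
    then have "norm (modul \<phi> r x * modul \<phi> r x - modul \<phi> s x * modul \<phi> s x) \<le> (L * \<bar>r - s\<bar>) * (B + B)"
      unfolding norm_mult[symmetric] using L(2)[OF s r, of x] norm_triangle_mono[of "modul \<phi> r x" B "modul \<phi> s x" B] mb r s L(1)
      by (simp only: norm_mult) (intro mult_mono, auto)
    then show "norm (modul \<phi> r x * modul \<phi> r x - modul \<phi> s x * modul \<phi> s x) \<le> 2 * (B * L) * \<bar>r - s\<bar>" by (simp add: algebra_simps)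
  next
    show "?p \<in> borel_measurable borel" by (rule modul_sq_t_measurable[OF s])
    fix x
    have "norm (modul \<phi> s x) * (norm (modul (vderiv \<phi>) s x) * norm (gt s x)) \<le> B * (L * 1)"
      using mb[OF s] L gamma_t_bound[OF s, of x] B_nonneg by (intro mult_mono) (auto simp: gt_def)
    then show "norm (?p x) \<le> 2 * (B * L)" by (simp add: modul_sq_t_def norm_mult)
    show "((\<lambda>r. modul \<phi> r x * modul \<phi> r x) has_vector_derivative ?p x) (at s within {0..t})"
      by (rule has_vector_derivative_eq_rhs[OF has_vector_derivative_mult[OF modul_has_vector_derivative_t[OF s phi] modul_has_vector_derivative_t[OF s phi]]])
         (simp add: modul_sq_t_def algebra_simps)
  qed
  have cw: "square_integrable (\<lambda>x. ?p x * ?w x)" "square_integrable (\<lambda>x. ?c x * ?c x * cnj (g m x))" "square_integrable (\<lambda>x. ?c x * ?c x * ?w x)"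
  proof -
    have "AE x in lborel. norm (?c x * ?c x) \<le> B * B" unfolding norm_mult using mb s B_nonneg by (intro AE_I2 mult_mono) auto
    then show "square_integrable (\<lambda>x. ?c x * ?c x * cnj (g m x))" "square_integrable (\<lambda>x. ?c x * ?c x * ?w x)"
      using mm s B_nonneg sq by (auto intro!: square_integrable_bounded_mult square_integrable_cnj)
    show "square_integrable (\<lambda>x. ?p x * ?w x)"
      using modul_sq_t_bound[OF s] modul_sq_t_measurable[OF s] sq
      by (intro square_integrable_bounded_mult[where B = "2 * B\<^sup>2"] square_integrable_cnj) auto
  qed
  note sw = square_integrable_cnj[OF sq(1)[of m]] and sg = square_integrable_cnj[OF sq(2)[of m]]
  note i1 = square_integrable_imp_integrable_mult[OF cw(1) sw] and i2 = square_integrable_imp_integrable_mult[OF cw(2) sw]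
  have "(LINT x|lborel. (?p x * ?w x + (?c x * ?c x) * cnj (g m x)) * ?w x) = (LINT x|lborel. ?p x * ?w x * ?w x) + (LINT x|lborel. (?c x * ?c x) * cnj (g m x) * ?w x)"
    unfolding distrib_right by (rule Bochner_Integration.integral_add[OF i1 i2])
  \<comment> \<open>The pairing is symmetric, so differentiating either conjugate factor gives the
    same integral; hence the factor 2.\<close>
  moreover have "(LINT x|lborel. (?c x * ?c x) * cnj (g m x) * ?w x) = (LINT x|lborel. (?c x * ?c x) * ?w x * cnj (g m x))"
    by (simp only: mult_ac)
  ultimately have "((\<lambda>r. Re (LINT x|lborel. (modul \<phi> r x * modul \<phi> r x) * cnj (u m r x) * cnj (u m r x))) has_real_derivative
      Re (LINT x|lborel. ?p x * ?w x * ?w x) + 2 * Re (LINT x|lborel. (?c x * ?c x) * ?w x * cnj (g m x))) (at s within {0..t})"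
    using Re_d[OF has_vector_derivative_pairing[OF W Dc[of m]]] unfolding mult_2 plus_complex.sel by (simp only: plus_complex.sel add.assoc)
  note mid = this
  have "((\<lambda>r. (L2_norm (u (Suc m) r))\<^sup>2 + (1 / \<beta>) * Re (LINT x|lborel. (modul \<phi> r x * modul \<phi> r x) * cnj (u m r x) * cnj (u m r x)) + K * (L2_norm (u 0 r))\<^sup>2)
     has_real_derivative (2 * Re (LINT x|lborel. cnj (u (Suc m) s x) * g (Suc m) x)
       + (1 / \<beta>) * (Re (LINT x|lborel. ?p x * ?w x * ?w x) + 2 * Re (LINT x|lborel. (?c x * ?c x) * ?w x * cnj (g m x)))
       + K * (2 * Re (LINT x|lborel. cnj (u 0 s x) * g 0 x)))) (at s within {0..t})"
    by (rule DERIV_add[OF DERIV_add[OF L2d DERIV_cmult[OF mid]] DERIV_cmult[OF L2d]])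
  then have fin: "((\<lambda>r. (L2_norm (u (Suc m) r))\<^sup>2 + (1 / \<beta>) * Re (LINT x|lborel. (modul \<phi> r x * modul \<phi> r x) * cnj (u m r x) * cnj (u m r x)) + K * (L2_norm (u 0 r))\<^sup>2)
     has_real_derivative energy_rate \<beta> K m (modul \<phi> s) (modul_sq_t s) (vmol n s) (g 0) (g m) (g (Suc m))) (at s within {0..t})"
    unfolding energy_rate_def nderiv_vmol[OF s] u_def by (simp add: mult_ac)
  have eq: "energy \<beta> K m (modul \<phi> r) (vmol n r) = (L2_norm (u (Suc m) r))\<^sup>2 + (1 / \<beta>) * Re (LINT x|lborel. (modul \<phi> r x * modul \<phi> r x) * cnj (u m r x) * cnj (u m r x)) + K * (L2_norm (u 0 r))\<^sup>2"
    if "r \<in> {0..t}" for r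
    unfolding energy_def nderiv_vmol[OF that] u_def by simp
  have "((\<lambda>r. energy \<beta> K m (modul \<phi> r) (vmol n r)) has_real_derivative energy_rate \<beta> K m (modul \<phi> s) (modul_sq_t s) (vmol n s) (g 0) (g m) (g (Suc m))) (at s within {0..t})"
    by (rule has_field_derivative_transform_within[OF fin, of 1]) (use s eq in auto)
  then show ?thesis by (simp add: g_def)
qed

text \<open>\<gamma>t is known only through its Sobolev class, so its continuous representative is
  inserted and the result agrees with the residual almost everywhere. Every term keeps a factor
  \<gamma>_t, \<gamma>_x or \<gamma>_xx, hence the bound is linear in the gradient norm.\<close>

lemma resid_representative:
  assumes s: "s \<in> {0..t}"
  obtains R where "hsob k R" "AE x in lborel. R x = resid s x"
    "hnorm k R \<le> (2 ^ Suc k * B + \<bar>\<beta>\<bar> * (2 ^ Suc k * (B * (2 ^ Suc k * 3))) + \<bar>\<beta>\<bar> * (2 ^ Suc k * B)) * real (k + 2)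
       * sqrt (grad_norm_sq (k + 2) (\<gamma>x s) (\<gamma>t s))"
proof -
  let ?P = "(2::real) ^ Suc k" and ?S = "sqrt (grad_norm_sq (k + 2) (\<gamma>x s) (\<gamma>t s))"
  let ?M = "real (k + 2) * ?S"
  have St: "sobolev (Suc (k + 1)) (\<lambda>x. complex_of_real (\<gamma>t s x))"
    using sobolev_of_real[OF sobolev_t[OF s]] by simp
  obtain w where w: "hsob (k + 1) w" "AE x in lborel. w x = complex_of_real (\<gamma>t s x)"
    "\<And>j. j \<le> k + 1 \<Longrightarrow> L2_norm (nderiv j w) = L2_norm (weak_deriv j (\<lambda>x. complex_of_real (\<gamma>t s x)))"
    by (rule sobolev_representative[OF St], rule that)
  have le: "hnorm (k + 1) z \<le> ?M" if "\<And>j. j \<le> k + 1 \<Longrightarrow> L2_norm (nderiv j z) \<le> ?S" for z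
    using sum_mono[of "{..k + 1}" "\<lambda>j. L2_norm (nderiv j z)" "\<lambda>_. ?S"] that unfolding hnorm_def by simp
  have wM: "hbd k w ?M"
  proof -
    have "hnorm (k + 1) w \<le> ?M"
    proof (rule le)
      fix j assume j: "j \<le> k + 1"
      have "L2_norm (nderiv j w) = L2_norm (weak_deriv j (\<gamma>t s))"
        using w(3)[OF j] L2_weak_deriv_of_real[OF sobolev_t[OF s], of j] j by simp
      also have "\<dots> \<le> sobolev_norm (k + 2) (\<gamma>t s)" using j by (intro L2_le_sobolev_norm) auto
      finally show "L2_norm (nderiv j w) \<le> ?S" using sobolev_norm_t_le[of s] by linarith
    qed
    then show ?thesis using hnorm_mono[of k "k + 1" w] hsob_mono[OF w(1), of k] by (auto simp: hbd_def)
  qed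
  have gM: "hnorm (k + 1) (gx s) \<le> ?M"
  proof (rule le)
    fix j assume j: "j \<le> k + 1"
    have "L2_norm (nderiv j (gx s)) \<le> sobolev_norm (k + 2) (\<gamma>x s)" 
      using L2_nderiv_gx[OF s j] L2_le_sobolev_norm[of j "k + 2" "\<gamma>x s"] j by simp
    then show "L2_norm (nderiv j (gx s)) \<le> ?S" using sobolev_norm_x_le[of s] by linarith
  qed
  have gb: "hbd k (gx s) ?M" using gM hnorm_mono[of k "k + 1" "gx s"] hsob_mono[OF hsob_gx[OF s], of k] by (auto simp: hbd_def)
  have gxxb: "hbd k (gxx s) ?M"
    using gM hnorm_vderiv_le[of k "gx s"] hsob_nderiv[OF hsob_gx[OF s], of k 1] by (auto simp: hbd_def gxx_def)
  have c3: "cbd k (\<lambda>x. gx s x - 2) 3"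
  proof -
    have 2: "cbd k (\<lambda>x. - 2) 2"
      unfolding cbd_def using diffk_const[of k "-2::complex"] by (auto simp: nderiv_const simp del: funpow.simps)
    show ?thesis using cbd_add[OF cbd_mono[OF cbd_gx[OF s], of k 1] 2] by simp
  qed
  define R where "R = (\<lambda>x. modul (vderiv \<phi>) s x * w x
     + ((- (\<i> * of_real \<beta>)) * (modul (vderiv (vderiv \<phi>)) s x * ((gx s x - 2) * gx s x)) + (\<i> * of_real \<beta>) * (modul (vderiv \<phi>) s x * gxx s x)))"
  note cm = cbd_modul[OF s, of "vderiv \<phi>", simplified] cbd_modul[OF s, of "vderiv (vderiv \<phi>)", simplified]
  have "hbd k R (?P * (B * ?M) + (norm (- (\<i> * complex_of_real \<beta>)) * (?P * (B * (?P * (3 * ?M)))) + norm (\<i> * complex_of_real \<beta>) * (?P * (B * ?M))))"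
    unfolding R_def by (intro hbd_add hbd_cmult hbd_coeff cm c3 wM gb gxxb)
  moreover have "?P * (B * ?M) + (norm (- (\<i> * complex_of_real \<beta>)) * (?P * (B * (?P * (3 * ?M)))) + norm (\<i> * complex_of_real \<beta>) * (?P * (B * ?M)))
     = (?P * B + \<bar>\<beta>\<bar> * (?P * (B * (?P * 3))) + \<bar>\<beta>\<bar> * (?P * B)) * real (k + 2) * ?S"
    by (simp add: norm_mult algebra_simps del: power_Suc)
  ultimately have R: "hsob k R" "hnorm k R \<le> (?P * B + \<bar>\<beta>\<bar> * (?P * (B * (?P * 3))) + \<bar>\<beta>\<bar> * (?P * B)) * real (k + 2) * ?S"
    by (auto simp: hbd_def)
  have "AE x in lborel. R x = resid s x"
    using w(2) by eventually_elim (simp add: R_def resid_def gt_def algebra_simps)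
  with R that show ?thesis by blast
qed

text \<open>\<open>moll_error\<close> measures how far mollification is from commuting with the nonlinearity.\<close>

definition moll_error :: "nat \<Rightarrow> (real \<Rightarrow> complex) \<Rightarrow> real \<Rightarrow> nat \<Rightarrow> real" where
  "moll_error j R s n = L2_norm (\<lambda>x. nderiv j (mollify n (forcing s)) x
     - nderiv j (\<lambda>x. cubic_diff (modul \<phi> s x) (vmol n s x) + R x) x)"

text \<open>The error tends to 0 at each time separately; the bound uniform in \<open>n\<close>
  supplies the majorant for the passage to the limit under the time integral.\<close>

lemma
  assumes s: "s \<in> {0..t}" and R: "hsob k R" "AE x in lborel. R x = resid s x" and j: "j \<le> k"
  shows moll_error_tendsto: "moll_error j R s \<longlonglongrightarrow> 0"
    and moll_error_le: "moll_error j R s n \<le> 2 * (2 ^ Suc k * (2 * (2 ^ k * (B * B))) + 2 ^ Suc k * (2 ^ k * (B * B)) + 2 ^ (2 * k + 2) * (3 * B + 1) + hnorm k R)"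
    and moll_error_square_integrable: "square_integrable (\<lambda>x. nderiv j (mollify n (forcing s)) x
     - nderiv j (\<lambda>x. cubic_diff (modul \<phi> s x) (vmol n s x) + R x) x)"
proof -
  let ?M = "2 ^ Suc k * (2 * (2 ^ k * (B * B))) + 2 ^ Suc k * (2 ^ k * (B * B)) + 2 ^ (2 * k + 2) * (3 * B + 1) + hnorm k R"
  let ?K = "3 * (B + 1)\<^sup>2 + 6 * B + 3"
  let ?N = "\<lambda>p x. cubic_diff (modul \<phi> s x) (vmol p s x)"
  \<comment> \<open>The nonlinearity at the mollified perturbation, plus the residual: these are
    smooth approximations of the forcing, convergent in L2 by the pointwise Lipschitz bound.\<close>
  define G where "G = (\<lambda>p x. ?N p x + R x)"
  have c: "cbd k (modul \<phi> s) B" by (rule cbd_modul[OF s]) simp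
  have vm: "hsob k (vmol p s)" "hnorm k (vmol p s) \<le> 1" for p
    using hsob_vmol[OF s] hnorm_vmol[OF s, of p] small_v[OF s] by auto
  have hN: "hsob k (?N p)" for p by (rule hsob_cubic_diff[OF k_pos c vm])
  have hG: "hsob k (G p)" for p unfolding G_def by (rule hsob_add[OF hN R(1)])
  have GM: "hnorm k (G p) \<le> ?M" for p
    unfolding G_def using hnorm_add[OF hN R(1), of p] hnorm_cubic_diff_le[OF k_pos c vm, of p] by linarith
  note f = forcing_square_integrable[OF s] and sv = v_square_integrable[OF s]
  have K: "0 \<le> ?K" using B_nonneg by simp
  have lim: "(\<lambda>p. L2_norm (\<lambda>x. forcing s x - G p x)) \<longlonglongrightarrow> 0"
  proof (rule Lim_null_comparison)
    have "L2_norm (\<lambda>x. forcing s x - G p x) \<le> ?K * L2_norm (\<lambda>x. vmol p s x - v s x)" for p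
    proof (rule L2_norm_dominated[OF square_integrable_diff[OF square_integrable_mollify[OF sv] sv] _ _ K])
      show "(\<lambda>x. forcing s x - G p x) \<in> borel_measurable borel"
        by (rule square_integrable_measurable[OF square_integrable_diff[OF f hsob_square_integrable_0[OF hG]]])
      show "AE x in lborel. norm (forcing s x - G p x) \<le> ?K * norm (vmol p s x - v s x)"
        using R(2) v_AE_bound[OF s]
      proof eventually_elim
        case (elim x)
        have b: "norm (vmol p s x) \<le> 1" using hsob_sup_bound[OF vm(1)[of p], of 0] k_pos vm(2)[of p] by (auto dest: order_trans)
        have "norm (forcing s x - G p x) = norm (?N p x - cubic_diff (modul \<phi> s x) (v s x))"
          using elim(1) by (simp add: forcing_def G_def norm_minus_commute)
        also have "\<dots> \<le> ?K * (norm (vmol p s x - v s x) + norm (modul \<phi> s x - modul \<phi> s x) * norm (v s x))"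
          by (rule cubic_diff_lipschitz[OF cbd_bound[OF c] cbd_bound[OF c] b elim(2)])
        finally show ?case by simp
      qed
    qed
    then show "\<forall>\<^sub>F p in sequentially. norm (L2_norm (\<lambda>x. forcing s x - G p x)) \<le> ?K * L2_norm (\<lambda>x. vmol p s x - v s x)" by simp
    show "(\<lambda>p. ?K * L2_norm (\<lambda>x. vmol p s x - v s x)) \<longlonglongrightarrow> 0"
      using tendsto_mult[OF tendsto_const mollify_tendsto_L2[OF sv]] by simp
  qed
  \<comment> \<open>Here the Lipschitz bound in H^k is used; mollifications of a Sobolev function
    are Cauchy in that norm.\<close>
  have Cauchy: "\<exists>N. \<forall>p\<ge>N. \<forall>q\<ge>N. hnorm k (\<lambda>x. G p x - G q x) < e" if e: "e > 0" for e
  proof -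
    obtain K' where K': "K' > 0" "\<And>c a b. cbd k c B \<Longrightarrow> hsob k a \<Longrightarrow> hnorm k a \<le> 1 \<Longrightarrow> hsob k b \<Longrightarrow> hnorm k b \<le> 1 \<Longrightarrow>
      hnorm k (\<lambda>x. cubic_diff (c x) (a x) - cubic_diff (c x) (b x)) \<le> K' * hnorm k (\<lambda>x. a x - b x)"
      using hnorm_cubic_diff_lipschitz[OF k_pos B_nonneg] by blast
    obtain N where N: "\<And>p q. p \<ge> N \<Longrightarrow> q \<ge> N \<Longrightarrow> hnorm k (\<lambda>x. vmol p s x - vmol q s x) < e / K'"
      using mollify_hnorm_Cauchy[OF sobolev_v[OF s], of "e / K'"] e K'(1) by auto
    have "hnorm k (\<lambda>x. G p x - G q x) < e" if pq: "p \<ge> N" "q \<ge> N" for p q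
    proof -
      have "hnorm k (\<lambda>x. G p x - G q x) = hnorm k (\<lambda>x. ?N p x - ?N q x)" by (simp add: G_def)
      also have "\<dots> \<le> K' * hnorm k (\<lambda>x. vmol p s x - vmol q s x)" by (rule K'(2)[OF c vm vm])
      also have "\<dots> < K' * (e / K')" using N[OF pq] K'(1) by (intro mult_strict_left_mono) auto
      finally show ?thesis using K'(1) by simp
    qed
    then show ?thesis by blast
  qed
  have me: "moll_error j R s = (\<lambda>n. L2_norm (\<lambda>x. nderiv j (mollify n (forcing s)) x - nderiv j (G n) x))"
    by (simp add: moll_error_def G_def fun_eq_iff)
  note sm = square_integrable_nderiv_mollify[OF f hG lim j] and sG = hsob_square_integrable[OF hG j]
  show "moll_error j R s \<longlonglongrightarrow> 0" unfolding me by (rule nderiv_mollify_tendsto[OF f hG lim j Cauchy])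
  show "moll_error j R s n \<le> 2 * ?M"
    unfolding me using L2_norm_diff_le[OF sm[of n] sG[of n]] L2_norm_nderiv_mollify_le[OF f hG lim j GM, of n]
      L2_nderiv_le_hnorm[OF j, of "G n"] GM[of n] unfolding mult_2 by (meson add_mono order_trans)
  show "square_integrable (\<lambda>x. nderiv j (mollify n (forcing s)) x
     - nderiv j (\<lambda>x. cubic_diff (modul \<phi> s x) (vmol n s x) + R x) x)"
    using square_integrable_diff[OF sm[of n] sG[of n]] by (simp add: G_def)
qed

text \<open>Brings the velocity into the shape required by \<open>energy_rate_le\<close>, with the
  mollification error as the perturbing term.\<close>

lemma velocity_split:
  assumes s: "s \<in> {0..t}" and N: "hsob k N" and R: "hsob k R" and j: "j \<le> k"
  shows "velocity (nderiv j (mollifier n)) s = (\<lambda>x. - (\<i> * of_real \<beta>) * nderiv (j + 2) (vmol n s) x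
     + (- (1 + \<i> * of_real \<alpha>) * nderiv j (vmol n s) x + (nderiv j N x + nderiv j R x
       + (nderiv j (mollify n (forcing s)) x - nderiv j (\<lambda>x. N x + R x) x))))"
proof -
  have 1: "nderiv 2 (nderiv j (mollifier n)) = nderiv (j + 2) (mollifier n)"
    by (simp add: numeral_2_eq_2)
  have 2: "nderiv j (mollify n (forcing s)) = conv (nderiv j (mollifier n)) (forcing s)"
    by (rule nderiv_conv[OF mollifier_test square_integrable_imp_locally_integrable[OF forcing_square_integrable[OF s]]])
  have 3: "nderiv j (\<lambda>x. N x + R x) = (\<lambda>x. nderiv j N x + nderiv j R x)"
    by (rule nderiv_add[OF hsob_imp_diffk[OF N] hsob_imp_diffk[OF R] j])
  show ?thesis unfolding velocity_def 1 2 3 nderiv_vmol[OF s] by (rule ext) simp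
qed

end

text \<open>Gronwall's argument with a vanishing error. Neither the rates \<open>D n\<close> nor the
  errors \<open>er n\<close> are assumed measurable in time: the gauge integral makes the weighted
  rate integrable because it is a derivative, and the error is replaced by the positive part of the
  excess, which it dominates.\<close>

lemma energy_limit_inequality:
  fixes E D er :: "nat \<Rightarrow> real \<Rightarrow> real" and U :: "real \<Rightarrow> real"
  assumes t: "t \<ge> 0"
    and d: "\<And>n s. s \<in> {0..t} \<Longrightarrow> (E n has_real_derivative D n s) (at s within {0..t})"
    and U: "continuous_on {0..t} U"
    and le: "\<And>n s. s \<in> {0..t} \<Longrightarrow> D n s + E n s \<le> U s + er n s"
    and er: "\<And>n s. s \<in> {0..t} \<Longrightarrow> 0 \<le> er n s" "\<And>n s. s \<in> {0..t} \<Longrightarrow> er n s \<le> M"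
    and lim: "\<And>s. s \<in> {0..t} \<Longrightarrow> (\<lambda>n. er n s) \<longlonglongrightarrow> 0"
    and X: "\<And>n. X n \<le> E n t" "X \<longlonglongrightarrow> x" and e0: "\<And>n. E n 0 \<le> e0"
  shows "x \<le> exp (- t) * e0 + integral {0..t} (\<lambda>s. exp (- (t - s)) * U s)"
proof -
  define q where "q = (\<lambda>n s. exp (- (t - s)) * (D n s + E n s))"
  define V where "V = (\<lambda>s. exp (- (t - s)) * U s)"
  \<comment> \<open>The amount by which the inequality without error fails. It lies between 0 and
    the error, hence tends to 0 and is at most \<open>M\<close>.\<close>
  define h where "h = (\<lambda>n s. max 0 (q n s - V s))"
  \<comment> \<open>The weight is an integrating factor: the derivative of exp(-(t - s)) times the
    energy is the weighted sum of rate and energy.\<close>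
  have q: "(q n has_integral E n t - exp (- t) * E n 0) {0..t}" for n
  proof -
    have "((\<lambda>s. exp (- (t - s)) * E n s) has_vector_derivative q n s) (at s within {0..t})" if "s \<in> {0..t}" for s
      unfolding has_real_derivative_iff_has_vector_derivative[symmetric] q_def
      by (auto intro!: derivative_eq_intros d that simp: algebra_simps)
    from fundamental_theorem_of_calculus[OF t this] show ?thesis by simp
  qed
  have V: "V integrable_on {0..t}"
    unfolding V_def by (intro integrable_continuous_real continuous_intros U)
  have qV: "q n s - V s \<le> exp (- (t - s)) * er n s" if "s \<in> {0..t}" for n s
    using mult_left_mono[OF le[OF that, of n], of "exp (- (t - s))"] by (simp add: q_def V_def algebra_simps)
  have ex: "exp (- (t - s)) * er n s \<le> er n s" if "s \<in> {0..t}" for n s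
    using that er(1)[OF that, of n] mult_right_mono[of "exp (- (t - s))" 1 "er n s"] by simp
  have qVM: "q n s - V s \<le> M" if "s \<in> {0..t}" for n s
    using qV[OF that, of n] ex[OF that, of n] er(2)[OF that, of n] by linarith
  have M0: "0 \<le> M" using er(1)[of 0 0] er(2)[of 0 0] t by auto
  have qVi: "(\<lambda>s. q n s - V s) integrable_on {0..t}" for n
    using q[of n] V by (intro integrable_diff) auto
  \<comment> \<open>Bounded above by \<open>M\<close>, the excess q n - V becomes nonnegative when
    subtracted from \<open>M\<close>, and a nonnegative gauge integrable function is absolutely
    integrable. Maxima preserve absolute integrability.\<close>
  have hi: "h n integrable_on {0..t}" for n
  proof -
    have a: "(\<lambda>s. M - (q n s - V s)) absolutely_integrable_on {0..t}"
      using qVM[of _ n] by (intro nonnegative_absolutely_integrable_1 integrable_diff qVi) auto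
    have c: "(\<lambda>s. M) absolutely_integrable_on {0..t}" "(\<lambda>s. 0::real) absolutely_integrable_on {0..t}" by simp_all
    have "(\<lambda>s. M - (M - (q n s - V s))) absolutely_integrable_on {0..t}" by (rule set_integral_diff(1)[OF c(1) a])
    then have "(\<lambda>s. max 0 (M - (M - (q n s - V s)))) absolutely_integrable_on {0..t}"
      by (intro absolutely_integrable_max_1 c(2))
    then show ?thesis unfolding h_def using set_lebesgue_integral_eq_integral(1) by fastforce
  qed
  have hb: "norm (h n s) \<le> M" if "s \<in> {0..t}" for n s
    using qVM[OF that, of n] M0 by (auto simp: h_def)
  have h0: "(\<lambda>n. h n s) \<longlonglongrightarrow> 0" if "s \<in> {0..t}" for s
  proof (rule Lim_null_comparison[OF always_eventually lim[OF that]], rule allI)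
    show "norm (h n s) \<le> er n s" for n
      using qV[OF that, of n] ex[OF that, of n] er(1)[OF that, of n] by (auto simp: h_def)
  qed
  have hl: "(\<lambda>n. integral {0..t} (h n)) \<longlonglongrightarrow> integral {0..t} (\<lambda>s. 0)"
    by (rule dominated_convergence(2)[OF hi _ hb h0]) auto
  have "X n \<le> exp (- t) * e0 + integral {0..t} V + integral {0..t} (h n)" for n
  proof -
    have "integral {0..t} (q n) \<le> integral {0..t} (\<lambda>s. V s + h n s)"
      using q[of n] V hi[of n] by (intro integral_le integrable_add) (auto simp: h_def)
    also have "\<dots> = integral {0..t} V + integral {0..t} (h n)" by (rule integral_add[OF V hi])
    finally have "E n t - exp (- t) * E n 0 \<le> integral {0..t} V + integral {0..t} (h n)"
      using integral_unique[OF q[of n]] by simp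
    moreover have "exp (- t) * E n 0 \<le> exp (- t) * e0" using e0 by simp
    ultimately show ?thesis using X(1)[of n] by linarith
  qed
  moreover have "(\<lambda>n. exp (- t) * e0 + integral {0..t} V + integral {0..t} (h n)) \<longlonglongrightarrow> exp (- t) * e0 + integral {0..t} V + integral {0..t} (\<lambda>s. 0)"
    by (intro tendsto_intros hl)
  ultimately have "x \<le> exp (- t) * e0 + integral {0..t} V + integral {0..t} (\<lambda>s. 0)"
    using X(2) by (intro LIMSEQ_le[of X x]) auto
  then show ?thesis by (simp add: V_def)
qed

text \<open>The locale fixes a solution, whereas the constants have to be chosen before it;
  therefore they enter as parameters with their defining equations.\<close>

lemma (in modulated_lle) damping_estimate:
  fixes m :: nat and K K1 H \<eta> C\<^sub>\<eta> Q CR C1 :: real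
  assumes k_eq: "k = Suc m" and beta: "\<beta> \<noteq> 0" and K1: "K1 > 0"
    and N1: "\<And>c v. cbd (Suc m) c B \<Longrightarrow> hsob (Suc m) v \<Longrightarrow> hnorm (Suc m) v \<le> 1 \<Longrightarrow>
      L2_norm (\<lambda>x. nderiv (Suc m) (\<lambda>x. cubic_diff (c x) (v x)) x
         - (2 * \<i> * (c x * cnj (c x)) * nderiv (Suc m) v x + \<i> * (c x * c x) * cnj (nderiv (Suc m) v x)))
        \<le> K1 * (hnorm m v + (hnorm (Suc m) v)\<^sup>2)"
    and N2: "\<And>c v. cbd (Suc m) c B \<Longrightarrow> hsob (Suc m) v \<Longrightarrow> hnorm (Suc m) v \<le> 1 \<Longrightarrow>
      L2_norm (nderiv m (\<lambda>x. cubic_diff (c x) (v x))) \<le> K1 * (hnorm m v + (hnorm (Suc m) v)\<^sup>2)"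
    and N3: "\<And>c v. cbd (Suc m) c B \<Longrightarrow> hsob (Suc m) v \<Longrightarrow> hnorm (Suc m) v \<le> 1 \<Longrightarrow>
      L2_norm (\<lambda>x. cubic_diff (c x) (v x)) \<le> K1 * L2_norm v"
    and H: "H = 2 * K1 + 2 + 2 * (2 ^ Suc m * (B * B)) + (2 * B\<^sup>2 / \<bar>\<beta>\<bar>) * (3 + \<bar>\<alpha>\<bar> + K1)"
    and Q: "Q = B\<^sup>2 / \<bar>\<beta>\<bar>"
    and eta: "0 < \<eta>" "\<eta> * Q \<le> 1 / 2" "\<eta> \<le> 1" "(2 * H\<^sup>2 + H + 2) * \<eta> \<le> 1 / 8"
    and Ceta: "0 \<le> C\<^sub>\<eta>" "\<And>u. hsob (Suc m) u \<Longrightarrow> (hnorm m u)\<^sup>2 \<le> \<eta> * (L2_norm (nderiv (Suc m) u))\<^sup>2 + C\<^sub>\<eta> * (L2_norm u)\<^sup>2"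
    and small: "\<And>s. s \<in> {0..t} \<Longrightarrow> real (k + 1) * sobolev_norm k (v s) \<le> 1 / (16 * H)"
    and K: "K = C\<^sub>\<eta> * Q + 1"
    and CR: "CR = ((2 ^ Suc k * B + \<bar>\<beta>\<bar> * (2 ^ Suc k * (B * (2 ^ Suc k * 3))) + \<bar>\<beta>\<bar> * (2 ^ Suc k * B)) * real (k + 2))\<^sup>2"
    and C1: "C1 = (2 * H\<^sup>2 + H + 2) * C\<^sub>\<eta> + 2 * K * H + K + 3 * H\<^sup>2 + 2 * H + (K + C\<^sub>\<eta> * Q)"
  shows "(sobolev_norm k (v t))\<^sup>2 \<le> (8 + 2 * C\<^sub>\<eta>) * (exp (- t) * ((3 / 2 + K + C\<^sub>\<eta> * Q) * (sobolev_norm k (v 0))\<^sup>2)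
     + integral {0..t} (\<lambda>s. exp (- (t - s)) * (C1 * (1 + CR) * ((L2_norm (v s))\<^sup>2 + grad_norm_sq (k + 2) (\<gamma>x s) (\<gamma>t s)))))"
proof -
  have Q0: "0 \<le> Q" by (simp add: Q)
  have H1: "1 \<le> H"
  proof -
    have "0 \<le> (2 * B\<^sup>2 / \<bar>\<beta>\<bar>) * (3 + \<bar>\<alpha>\<bar> + K1)" "0 \<le> 2 * (2 ^ Suc m * (B * B))" using K1 B_nonneg by auto
    then show ?thesis unfolding H using K1 by linarith
  qed
  have K0: "1 \<le> K" unfolding K using Ceta(1) Q0 by simp
  have C10: "0 \<le> C1" unfolding C1 using H1 K0 Ceta(1) Q0 by (intro add_nonneg_nonneg mult_nonneg_nonneg) auto
  have CR0: "0 \<le> CR" by (simp add: CR)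
  let ?G = "\<lambda>s. grad_norm_sq (k + 2) (\<gamma>x s) (\<gamma>t s)"
  have G0: "0 \<le> ?G s" for s by (simp add: grad_norm_sq_def)
  \<comment> \<open>The residual's representative is chosen separately at each time, so nothing is
    known about its dependence on time; \<open>energy_limit_inequality\<close> tolerates
    this.\<close>
  have "\<forall>s\<in>{0..t}. \<exists>R. hsob k R \<and> (AE x in lborel. R x = resid s x) \<and> (hnorm k R)\<^sup>2 \<le> CR * ?G s"
  proof
    fix s assume s: "s \<in> {0..t}"
    obtain R where R: "hsob k R" "AE x in lborel. R x = resid s x"
      "hnorm k R \<le> (2 ^ Suc k * B + \<bar>\<beta>\<bar> * (2 ^ Suc k * (B * (2 ^ Suc k * 3))) + \<bar>\<beta>\<bar> * (2 ^ Suc k * B)) * real (k + 2) * sqrt (?G s)"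
      using resid_representative[OF s] by blast
    have "(hnorm k R)\<^sup>2 \<le> CR * ?G s"
      using power_mono[OF R(3) hnorm_nonneg, of 2] G0[of s] unfolding CR power_mult_distrib[of _ "sqrt (?G s)"] by simp
    with R show "\<exists>R. hsob k R \<and> (AE x in lborel. R x = resid s x) \<and> (hnorm k R)\<^sup>2 \<le> CR * ?G s" by blast
  qed
  then obtain R where R: "\<And>s. s \<in> {0..t} \<Longrightarrow> hsob k (R s)" "\<And>s. s \<in> {0..t} \<Longrightarrow> AE x in lborel. R s x = resid s x"
    "\<And>s. s \<in> {0..t} \<Longrightarrow> (hnorm k (R s))\<^sup>2 \<le> CR * ?G s" by metis
  define E where "E = (\<lambda>n r. energy \<beta> K m (modul \<phi> r) (vmol n r))"
  define D where "D = (\<lambda>n s. energy_rate \<beta> K m (modul \<phi> s) (modul_sq_t s) (vmol n s) (velocity (nderiv 0 (mollifier n)) s)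
       (velocity (nderiv m (mollifier n)) s) (velocity (nderiv (Suc m) (mollifier n)) s))"
  define er where "er = (\<lambda>n s. moll_error 0 (R s) s n + moll_error m (R s) s n + moll_error (Suc m) (R s) s n)"
  define U where "U = (\<lambda>s. C1 * (1 + CR) * ((L2_norm (v s))\<^sup>2 + ?G s))"
  have me0: "0 \<le> moll_error j S s n" for j S s n by (simp add: moll_error_def)
  have c: "cbd (Suc m) (modul \<phi> s) B" if "s \<in> {0..t}" for s using cbd_modul[OF that, of \<phi>] k_eq by simp
  have c0: "cbd 0 (modul \<phi> s) B" if "s \<in> {0..t}" for s by (rule cbd_mono[OF c[OF that]]) auto
  have nv: "hnorm (Suc m) (vmol n s) \<le> 1 / (16 * H)" "hnorm (Suc m) (vmol n s) \<le> 1" if "s \<in> {0..t}" for n s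
    using hnorm_vmol[OF that, of n] small[OF that] small_v[OF that] k_eq by auto
  note eb = energy_bounds[OF beta B_nonneg eta(1) eta(2)[unfolded Q] Ceta]
  have rate: "D n s + E n s \<le> U s + (2 * H + 2 * K) * er n s" if s: "s \<in> {0..t}" for n s
  proof -
    let ?N = "\<lambda>x. cubic_diff (modul \<phi> s x) (vmol n s x)"
    let ?e = "\<lambda>j x. nderiv j (mollify n (forcing s)) x - nderiv j (\<lambda>x. ?N x + R s x) x"
    define a where "a = L2_norm (nderiv (Suc m) (vmol n s))"
    define b where "b = hnorm m (vmol n s)"
    define y where "y = L2_norm (vmol n s)"
    define r where "r = hnorm (Suc m) (R s)"
    define nn where "nn = hnorm (Suc m) (vmol n s)"
    have hv: "hsob j (vmol n s)" for j by (rule hsob_vmol[OF s])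
    have hN: "hsob k ?N" using hsob_cubic_diff[OF _ c[OF s] hv nv(2)[OF s]] k_eq by simp
    have j: "0 \<le> k" "m \<le> k" "Suc m \<le> k" using k_eq by auto
    note se = moll_error_square_integrable[OF s R(1,2)[OF s]]
    have es: "L2_norm (?e 0) \<le> er n s" "L2_norm (?e m) \<le> er n s" "L2_norm (?e (Suc m)) \<le> er n s"
      using me0 unfolding er_def moll_error_def[symmetric] by (auto intro: add_nonneg_nonneg)
    have er0: "0 \<le> er n s" unfolding er_def using me0 by (intro add_nonneg_nonneg) auto
    have "D n s \<le> - 2 * a\<^sup>2 + H * (a * b + a * nn\<^sup>2 + a * r + a * er n s + b\<^sup>2 + b * nn\<^sup>2 + b * r + b * er n s) + 2 * K * (H * y\<^sup>2 + y * r + y * er n s)"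
      unfolding D_def velocity_split[OF s hN R(1)[OF s] j(1)] velocity_split[OF s hN R(1)[OF s] j(2)] velocity_split[OF s hN R(1)[OF s] j(3)]
      by (rule energy_rate_le[OF beta B_nonneg _ K1 H c[OF s] hv R(1)[OF s, unfolded k_eq] hN[unfolded k_eq]
            N1[OF c[OF s] hv nv(2)[OF s]] N2[OF c[OF s] hv nv(2)[OF s]] N3[OF c[OF s] hv nv(2)[OF s]]
            modul_sq_t_measurable[OF s] modul_sq_t_bound[OF s] se[OF j(1)] se[OF j(2)] se[OF j(3)] es refl a_def b_def y_def r_def nn_def])
         (use K0 in simp)
    moreover have "nn = a + b" unfolding nn_def a_def b_def by (simp add: hnorm_Suc)
    moreover have "nn \<le> 1 / (16 * H)" unfolding nn_def by (rule nv(1)[OF s])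
    moreover have "y \<le> nn" unfolding y_def nn_def using L2_nderiv_le_hnorm[of 0 "Suc m" "vmol n s"] by simp
    \<comment> \<open>Interpolation, with \<eta> so small that the factor in front of b^2 leaves an
      eighth of a^2.\<close>
    moreover have "(2 * H\<^sup>2 + H + 2) * b\<^sup>2 \<le> (1 / 8) * a\<^sup>2 + ((2 * H\<^sup>2 + H + 2) * C\<^sub>\<eta>) * y\<^sup>2"
    proof -
      have "0 \<le> 2 * H\<^sup>2 + H + 2" using H1 by (simp add: add_nonneg_nonneg)
      then have "(2 * H\<^sup>2 + H + 2) * b\<^sup>2 \<le> (2 * H\<^sup>2 + H + 2) * (\<eta> * a\<^sup>2 + C\<^sub>\<eta> * y\<^sup>2)"
        unfolding a_def b_def y_def by (intro mult_left_mono Ceta(2) hv)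
      also have "\<dots> = ((2 * H\<^sup>2 + H + 2) * \<eta>) * a\<^sup>2 + ((2 * H\<^sup>2 + H + 2) * C\<^sub>\<eta>) * y\<^sup>2" by (simp add: algebra_simps)
      also have "\<dots> \<le> (1 / 8) * a\<^sup>2 + ((2 * H\<^sup>2 + H + 2) * C\<^sub>\<eta>) * y\<^sup>2" by (intro add_right_mono mult_right_mono eta(4)) simp
      finally show ?thesis .
    qed
    ultimately have "D n s \<le> - (3 / 2) * a\<^sup>2 + ((2 * H\<^sup>2 + H + 2) * C\<^sub>\<eta> + 2 * K * H + K + 3 * H\<^sup>2 + 2 * H) * (y\<^sup>2 + r\<^sup>2) + (2 * H + 2 * K) * er n s"
      using H1 K0 Ceta(1) er0
      by (intro dissipation_arith[where b = b and n = nn]) (auto simp: a_def b_def y_def r_def)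
    \<comment> \<open>The coefficient 3/2 of a^2 matches what the dissipation left over, so adding
      the energy to its rate removes a^2 altogether. This fixes the decay rate 1.\<close>
    moreover have "E n s \<le> (3 / 2) * a\<^sup>2 + (K + C\<^sub>\<eta> * Q) * y\<^sup>2"
      unfolding E_def a_def y_def Q by (rule eb(2)[OF _ c0[OF s] hv])
    moreover have "(K + C\<^sub>\<eta> * Q) * y\<^sup>2 \<le> (K + C\<^sub>\<eta> * Q) * (y\<^sup>2 + r\<^sup>2)"
      using K0 Ceta(1) Q0 by (intro mult_left_mono) auto
    ultimately have "D n s + E n s \<le> C1 * (y\<^sup>2 + r\<^sup>2) + (2 * H + 2 * K) * er n s"
      unfolding C1 distrib_right[of _ "K + C\<^sub>\<eta> * Q"] by linarith
    moreover have "y\<^sup>2 + r\<^sup>2 \<le> (1 + CR) * ((L2_norm (v s))\<^sup>2 + ?G s)"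
    proof -
      have "y\<^sup>2 \<le> (L2_norm (v s))\<^sup>2" unfolding y_def using L2_norm_mollify[OF v_square_integrable[OF s]] by (intro power_mono) auto
      moreover have "r\<^sup>2 \<le> CR * ?G s" unfolding r_def using R(3)[OF s] k_eq by simp
      moreover have "0 \<le> CR * (L2_norm (v s))\<^sup>2" using CR0 by simp
      ultimately show ?thesis using G0[of s] by (simp add: algebra_simps)
    qed
    then have "C1 * (y\<^sup>2 + r\<^sup>2) \<le> U s" unfolding U_def mult.assoc by (rule mult_left_mono[OF _ C10])
    ultimately show ?thesis by linarith
  qed
  obtain Mg where Mg: "\<And>s. s \<in> {0..t} \<Longrightarrow> ?G s \<le> Mg"
  proof -
    have "?G s \<le> 1" if "s \<in> {0..t}" for s
    proof -
      have "1 * sqrt (?G s) \<le> real (k + 3) * sqrt (?G s)" using G0[of s] by (intro mult_right_mono) auto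
      then have "sqrt (?G s) \<le> 1" using small_grad[OF that] by linarith
      then show ?thesis by simp
    qed
    then show ?thesis using that by blast
  qed
  define Me where "Me = 2 * (2 ^ Suc k * (2 * (2 ^ k * (B * B))) + 2 ^ Suc k * (2 ^ k * (B * B)) + 2 ^ (2 * k + 2) * (3 * B + 1) + sqrt (CR * Mg))"
  have meM: "moll_error j (R s) s n \<le> Me" if "s \<in> {0..t}" "j \<le> k" for j s n
  proof -
    have "hnorm k (R s) \<le> sqrt (CR * Mg)"
      using R(3)[OF that(1)] mult_left_mono[OF Mg[OF that(1)] CR0] by (intro real_le_rsqrt) linarith
    then show ?thesis unfolding Me_def
      by (intro order_trans[OF moll_error_le[OF that(1) R(1,2)[OF that(1)] that(2)]] mult_left_mono add_left_mono) auto
  qed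
  have jk: "0 \<le> k" "m \<le> k" "Suc m \<le> k" using k_eq by auto
  have P: "0 < 8 + 2 * C\<^sub>\<eta>" using Ceta(1) by simp
  \<comment> \<open>A lower bound of the energy by the squared H^k norm; the denominator comes from
    \<open>split\<close> below.\<close>
  define X where "X = (\<lambda>n. (\<Sum>j\<le>k. (L2_norm (nderiv j (vmol n t)))\<^sup>2) / (8 + 2 * C\<^sub>\<eta>))"
  have t0: "t \<in> {0..t}" "0 \<in> {0..t}" using t_pos by auto
  have "(sobolev_norm k (v t))\<^sup>2 / (8 + 2 * C\<^sub>\<eta>) \<le> exp (- t) * ((3 / 2 + K + C\<^sub>\<eta> * Q) * (sobolev_norm k (v 0))\<^sup>2) + integral {0..t} (\<lambda>s. exp (- (t - s)) * U s)"
  proof (rule energy_limit_inequality[of t E D U "\<lambda>n s. (2 * H + 2 * K) * er n s" "(2 * H + 2 * K) * (3 * Me)" X])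
    have HK: "0 \<le> 2 * H + 2 * K" using H1 K0 by simp
    show "0 \<le> t" using t_pos by simp
    show "(E n has_real_derivative D n s) (at s within {0..t})" if "s \<in> {0..t}" for n s
      unfolding E_def D_def by (rule energy_has_derivative[OF that])
    show "continuous_on {0..t} U"
      unfolding U_def grad_norm_sq_def
      by (intro continuous_intros L2_continuous_on_imp_continuous_norm L2_continuous_v continuous_on_sobolev_norm_sq cont_x cont_t)
    show "D n s + E n s \<le> U s + (2 * H + 2 * K) * er n s" if "s \<in> {0..t}" for n s by (rule rate[OF that])
    show "0 \<le> (2 * H + 2 * K) * er n s" if "s \<in> {0..t}" for n s
      unfolding er_def using me0 by (intro mult_nonneg_nonneg[OF HK] add_nonneg_nonneg)
    show "(2 * H + 2 * K) * er n s \<le> (2 * H + 2 * K) * (3 * Me)" if "s \<in> {0..t}" for n s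
      using meM[OF that jk(1), of n] meM[OF that jk(2), of n] meM[OF that jk(3), of n] unfolding er_def
      by (intro mult_left_mono HK) linarith
    show "(\<lambda>n. (2 * H + 2 * K) * er n s) \<longlonglongrightarrow> 0" if s: "s \<in> {0..t}" for s
    proof -
      note l = moll_error_tendsto[OF s R(1,2)[OF s]]
      have "(\<lambda>n. (2 * H + 2 * K) * (moll_error 0 (R s) s n + moll_error m (R s) s n + moll_error (Suc m) (R s) s n)) \<longlonglongrightarrow> (2 * H + 2 * K) * (0 + 0 + 0)"
        by (intro tendsto_intros l[OF jk(1)] l[OF jk(2)] l[OF jk(3)])
      then show ?thesis by (simp add: er_def)
    qed
    show "X n \<le> E n t" for n
    proof -
      let ?a = "L2_norm (nderiv (Suc m) (vmol n t))" and ?b = "hnorm m (vmol n t)" and ?y = "L2_norm (vmol n t)"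
      note hv = hsob_vmol[OF t0(1), of "Suc m" n]
      have split: "2 * p + c * q \<le> (8 + 2 * c) * ((1 / 2) * p + q)" if "0 \<le> p" "0 \<le> q" "0 \<le> c" for p q c :: real
      proof -
        have "(8 + 2 * c) * ((1 / 2) * p + q) = 4 * p + 8 * q + c * p + 2 * (c * q)" by (simp add: field_simps)
        then show ?thesis using that mult_nonneg_nonneg[OF that(3,1)] mult_nonneg_nonneg[OF that(3,2)] by linarith
      qed
      have "(\<Sum>j\<le>m. (L2_norm (nderiv j (vmol n t)))\<^sup>2) \<le> ?b\<^sup>2"
      proof -
        have "(\<Sum>j\<le>m. (L2_norm (nderiv j (vmol n t)))\<^sup>2) \<le> (\<Sum>j\<le>m. L2_norm (nderiv j (vmol n t)) * ?b)"
          unfolding power2_eq_square by (intro sum_mono mult_left_mono L2_nderiv_le_hnorm) auto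
        also have "\<dots> = ?b * ?b" unfolding hnorm_def sum_distrib_right ..
        finally show ?thesis by (simp add: power2_eq_square)
      qed
      then have "(\<Sum>j\<le>k. (L2_norm (nderiv j (vmol n t)))\<^sup>2) \<le> ?a\<^sup>2 + ?b\<^sup>2" unfolding k_eq sum.atMost_Suc by linarith
      also have "\<dots> \<le> ?a\<^sup>2 + (\<eta> * ?a\<^sup>2 + C\<^sub>\<eta> * ?y\<^sup>2)" using Ceta(2)[OF hv] by simp
      also have "\<dots> \<le> 2 * ?a\<^sup>2 + C\<^sub>\<eta> * ?y\<^sup>2" using mult_right_mono[OF eta(3), of "?a\<^sup>2"] by simp
      also have "\<dots> \<le> (8 + 2 * C\<^sub>\<eta>) * ((1 / 2) * ?a\<^sup>2 + ?y\<^sup>2)"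
        by (rule split) (simp_all add: Ceta(1))
      also have "\<dots> \<le> (8 + 2 * C\<^sub>\<eta>) * E n t"
      proof (rule mult_left_mono)
        \<comment> \<open>\<open>K\<close> exceeds the interpolation constant times \<open>Q\<close>
          by exactly 1, which is the coefficient of the L2 square here.\<close>
        show "(1 / 2) * ?a\<^sup>2 + ?y\<^sup>2 \<le> E n t"
          using eb(1)[OF _ c0[OF t0(1)] hv, of K] unfolding E_def K Q by simp
      qed (use Ceta(1) in simp)
      finally show ?thesis unfolding X_def pos_divide_le_eq[OF P] by (simp only: mult.commute)
    qed
    show "X \<longlonglongrightarrow> (sobolev_norm k (v t))\<^sup>2 / (8 + 2 * C\<^sub>\<eta>)"
      unfolding X_def sobolev_norm_sq
    proof (intro tendsto_intros)
      show "8 + 2 * C\<^sub>\<eta> \<noteq> 0" using Ceta(1) by simp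
      fix j assume "j \<in> {..k}"
      then have j: "j \<le> k" by simp
      note w = sobolev_square_integrable[OF sobolev_v[OF t0(1)] j]
      have "(\<lambda>n. L2_norm (mollify n (weak_deriv j (v t))) - L2_norm (weak_deriv j (v t))) \<longlonglongrightarrow> 0"
        by (rule Lim_null_comparison[OF always_eventually mollify_tendsto_L2[OF w]])
           (use L2_norm_abs_diff_le[OF square_integrable_mollify[OF w] w] in simp)
      then show "(\<lambda>n. L2_norm (nderiv j (vmol n t))) \<longlonglongrightarrow> L2_norm (weak_deriv j (v t))"
        unfolding nderiv_mollify_sobolev[OF sobolev_v[OF t0(1)] j] by (simp only: LIM_zero_iff)
    qed
    show "E n 0 \<le> (3 / 2 + K + C\<^sub>\<eta> * Q) * (sobolev_norm k (v 0))\<^sup>2" for n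
    proof -
      note sv = sobolev_v[OF t0(2)] and hv = hsob_vmol[OF t0(2), of "Suc m" n]
      have b: "L2_norm (nderiv j (vmol n 0)) \<le> sobolev_norm k (v 0)" if "j \<le> k" for j
        unfolding nderiv_mollify_sobolev[OF sv that]
        using L2_norm_mollify[OF sobolev_square_integrable[OF sv that], of n] L2_le_sobolev_norm[OF that, of "v 0"] by linarith
      have "E n 0 \<le> (3 / 2) * (L2_norm (nderiv (Suc m) (vmol n 0)))\<^sup>2 + (K + C\<^sub>\<eta> * Q) * (L2_norm (vmol n 0))\<^sup>2"
        unfolding E_def Q by (rule eb(2)[OF _ c0[OF t0(2)] hv])
      also have "\<dots> \<le> (3 / 2) * (sobolev_norm k (v 0))\<^sup>2 + (K + C\<^sub>\<eta> * Q) * (sobolev_norm k (v 0))\<^sup>2"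
        using b[OF jk(3)] b[OF jk(1)] K0 Ceta(1) Q0 by (intro add_mono mult_left_mono power_mono) auto
      finally show ?thesis by (simp only: distrib_right add.assoc)
    qed
  qed
  then show ?thesis unfolding U_def pos_divide_le_eq[OF P] by (simp only: mult.commute)
qed

theorem lemma5p4:
  fixes \<alpha> \<beta> F T :: real and \<phi> :: "real \<Rightarrow> complex" and k :: nat
  assumes "\<beta> \<noteq> 0" and "F > 0"
    and "smooth \<phi>" and "T > 0" and "\<forall>x. \<phi> (x + T) = \<phi> x"
    and "lle_stationary \<alpha> \<beta> F \<phi>"
    and "k \<ge> 1"
  shows "\<exists>\<theta>>0. \<exists>C>0. \<exists>\<epsilon>>0.
    \<forall>(t::real) (\<psi> :: real \<Rightarrow> real \<Rightarrow> complex) (\<gamma> :: real \<Rightarrow> real \<Rightarrow> real)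
      (\<gamma>x :: real \<Rightarrow> real \<Rightarrow> real) (\<gamma>t :: real \<Rightarrow> real \<Rightarrow> real) (v :: real \<Rightarrow> real \<Rightarrow> complex).
      0 \<le> t \<longrightarrow>
      lle_solution \<alpha> \<beta> F {0..t} \<psi> \<longrightarrow>
      has_partial_derivs {0..t} \<gamma> \<gamma>x \<gamma>t \<longrightarrow>
      v = forward_perturbation \<phi> \<psi> \<gamma> \<longrightarrow>
      continuous_in_sobolev k {0..t} v \<longrightarrow>
      continuous_in_sobolev (k + 2) {0..t} \<gamma>x \<longrightarrow>
      continuous_in_sobolev (k + 2) {0..t} \<gamma>t \<longrightarrow>
      (\<forall>s\<in>{0..t}. sobolev_norm k (v s) \<le> \<epsilon> \<and> grad_norm_sq (k + 2) (\<gamma>x s) (\<gamma>t s) \<le> \<epsilon>) \<longrightarrow>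
      (sobolev_norm k (v t))\<^sup>2
        \<le> C * exp (- \<theta> * t) * (sobolev_norm k (v 0))\<^sup>2
          + C * integral {0..t} (\<lambda>s. exp (- \<theta> * (t - s)) *
                  ((L2_norm (v s))\<^sup>2 + grad_norm_sq (k + 2) (\<gamma>x s) (\<gamma>t s)))"
proof -
  obtain m where m: "k = Suc m" using assms(7) by (cases k) auto
  have phi: "bounded_smooth \<phi>" using periodic_smooth_imp_bounded_smooth assms(3-5) by blast
  \<comment> \<open>A single bound for the profile and its first two derivatives under every
    admissible phase.\<close>
  have "\<exists>B\<ge>0. \<forall>f\<in>{\<phi>, vderiv \<phi>, vderiv (vderiv \<phi>)}. \<forall>\<gamma> g. (\<forall>x. (\<gamma> has_real_derivative g x) (at x)) \<longrightarrow>
     cbd k (\<lambda>x. 1 - complex_of_real (g x)) 2 \<longrightarrow> cbd k (\<lambda>x. f (x - \<gamma> x)) B"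
  proof -
    obtain B where B: "\<And>f \<gamma> g. bounded_smooth f \<Longrightarrow> \<forall>x. (\<gamma> has_real_derivative g x) (at x) \<Longrightarrow>
       cbd k (\<lambda>x. 1 - complex_of_real (g x)) 2 \<Longrightarrow> cbd k (\<lambda>x. f (x - \<gamma> x)) (B f)"
      using cbd_modulated[of _ k] by metis
    \<comment> \<open>Absolute values are summed so that each of the three individual bounds lies
      below the common one.\<close>
    let ?B = "\<bar>B \<phi>\<bar> + \<bar>B (vderiv \<phi>)\<bar> + \<bar>B (vderiv (vderiv \<phi>))\<bar>"
    have "cbd k (\<lambda>x. f (x - \<gamma> x)) ?B" if "f \<in> {\<phi>, vderiv \<phi>, vderiv (vderiv \<phi>)}" "\<forall>x. (\<gamma> has_real_derivative g x) (at x)"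
       "cbd k (\<lambda>x. 1 - complex_of_real (g x)) 2" for f \<gamma> g
    proof (rule cbd_mono[OF B[OF _ that(2,3)] order_refl])
      show "bounded_smooth f" using that(1) phi bounded_smooth_vderiv by auto
      show "B f \<le> ?B" using that(1) by auto
    qed
    then show ?thesis by (intro exI[of _ ?B]) auto
  qed
  then obtain B where B: "B \<ge> 0" "\<And>f \<gamma> g. f \<in> {\<phi>, vderiv \<phi>, vderiv (vderiv \<phi>)} \<Longrightarrow> \<forall>x. (\<gamma> has_real_derivative g x) (at x) \<Longrightarrow>
     cbd k (\<lambda>x. 1 - complex_of_real (g x)) 2 \<Longrightarrow> cbd k (\<lambda>x. f (x - \<gamma> x)) B" by blast
  obtain K1 where K1: "K1 > 0"
    "\<And>c v. cbd (Suc m) c B \<Longrightarrow> hsob (Suc m) v \<Longrightarrow> hnorm (Suc m) v \<le> 1 \<Longrightarrow>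
      L2_norm (\<lambda>x. nderiv (Suc m) (\<lambda>x. cubic_diff (c x) (v x)) x
         - (2 * \<i> * (c x * cnj (c x)) * nderiv (Suc m) v x + \<i> * (c x * c x) * cnj (nderiv (Suc m) v x)))
        \<le> K1 * (hnorm m v + (hnorm (Suc m) v)\<^sup>2)"
    "\<And>c v. cbd (Suc m) c B \<Longrightarrow> hsob (Suc m) v \<Longrightarrow> hnorm (Suc m) v \<le> 1 \<Longrightarrow>
      L2_norm (nderiv m (\<lambda>x. cubic_diff (c x) (v x))) \<le> K1 * (hnorm m v + (hnorm (Suc m) v)\<^sup>2)"
    "\<And>c v. cbd (Suc m) c B \<Longrightarrow> hsob (Suc m) v \<Longrightarrow> hnorm (Suc m) v \<le> 1 \<Longrightarrow>
      L2_norm (\<lambda>x. cubic_diff (c x) (v x)) \<le> K1 * L2_norm v"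
    by (rule cubic_top_order_estimates[OF B(1), of m]) blast
  define Q where "Q = B\<^sup>2 / \<bar>\<beta>\<bar>"
  define H where "H = 2 * K1 + 2 + 2 * (2 ^ Suc m * (B * B)) + (2 * B\<^sup>2 / \<bar>\<beta>\<bar>) * (3 + \<bar>\<alpha>\<bar> + K1)"
  have Q0: "0 \<le> Q" by (simp add: Q_def)
  have H1: "1 \<le> H"
  proof -
    have "0 \<le> (2 * B\<^sup>2 / \<bar>\<beta>\<bar>) * (3 + \<bar>\<alpha>\<bar> + K1)" "0 \<le> 2 * (2 ^ Suc m * (B * B))" using K1(1) B(1) by auto
    then show ?thesis unfolding H_def using K1(1) by linarith
  qed
  define P where "P = 2 * H\<^sup>2 + H + 2"
  have P0: "0 < P" unfolding P_def using H1 by (intro add_nonneg_pos) auto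
  \<comment> \<open>Three demands: the H^k norm is controlled by the top order and L2 norms (1), the
    energy is equivalent to them (Q + 1 also avoids division by 0), and the lower order terms are
    absorbed by the damping (8 P).\<close>
  define \<eta> where "\<eta> = min 1 (min (1 / (2 * (Q + 1))) (1 / (8 * P)))"
  have eta: "0 < \<eta>" "\<eta> * Q \<le> 1 / 2" "\<eta> \<le> 1" "P * \<eta> \<le> 1 / 8"
  proof -
    show "0 < \<eta>" using Q0 P0 by (simp add: \<eta>_def)
    show "\<eta> \<le> 1" by (simp add: \<eta>_def)
    have "\<eta> * Q \<le> 1 / (2 * (Q + 1)) * Q" using Q0 by (intro mult_right_mono) (auto simp: \<eta>_def)
    also have "\<dots> \<le> 1 / 2" using Q0 by (simp add: field_simps)
    finally show "\<eta> * Q \<le> 1 / 2" .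
    have "P * \<eta> \<le> P * (1 / (8 * P))" using P0 by (intro mult_left_mono) (auto simp: \<eta>_def)
    then show "P * \<eta> \<le> 1 / 8" using P0 by simp
  qed
  obtain C\<^sub>\<eta> where Ceta: "0 \<le> C\<^sub>\<eta>" "\<And>u. hsob (Suc m) u \<Longrightarrow> (hnorm m u)\<^sup>2 \<le> \<eta> * (L2_norm (nderiv (Suc m) u))\<^sup>2 + C\<^sub>\<eta> * (L2_norm u)\<^sup>2"
    using hnorm_interpolation[OF eta(1), of m] by blast
  define K where "K = C\<^sub>\<eta> * Q + 1"
  define CR where "CR = ((2 ^ Suc k * B + \<bar>\<beta>\<bar> * (2 ^ Suc k * (B * (2 ^ Suc k * 3))) + \<bar>\<beta>\<bar> * (2 ^ Suc k * B)) * real (k + 2))\<^sup>2"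
  define C1 where "C1 = (2 * H\<^sup>2 + H + 2) * C\<^sub>\<eta> + 2 * K * H + K + 3 * H\<^sup>2 + 2 * H + (K + C\<^sub>\<eta> * Q)"
  have K0: "1 \<le> K" unfolding K_def using Ceta(1) Q0 by simp
  have C10: "0 \<le> C1" unfolding C1_def using H1 K0 Ceta(1) Q0 by (intro add_nonneg_nonneg mult_nonneg_nonneg) auto
  have CR0: "0 \<le> CR" by (simp add: CR_def)
  define A1 where "A1 = (8 + 2 * C\<^sub>\<eta>) * (3 / 2 + K + C\<^sub>\<eta> * Q)"
  define A2 where "A2 = (8 + 2 * C\<^sub>\<eta>) * (C1 * (1 + CR))"
  have A: "1 \<le> A1" "0 \<le> A2"
  proof -
    have "1 * 1 \<le> (8 + 2 * C\<^sub>\<eta>) * (3 / 2 + K + C\<^sub>\<eta> * Q)" using Ceta(1) K0 Q0 by (intro mult_mono) (auto intro: add_nonneg_nonneg add_increasing2)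
    then show "1 \<le> A1" by (simp add: A1_def)
    show "0 \<le> A2" using Ceta(1) C10 CR0 by (simp add: A2_def)
  qed
  \<comment> \<open>The first entry is squared because the hypothesis bounds the squared gradient
    norm; it keeps \<gamma>_x and \<gamma>_t below 1. The second makes the cubic terms absorbable
    and, as \<open>H\<close> is at least 1, also keeps the perturbation below 1.\<close>
  define \<epsilon> where "\<epsilon> = min ((1 / real (k + 3))\<^sup>2) (1 / (16 * H) / real (k + 1))"
  have eps: "\<epsilon> > 0" using H1 by (simp add: \<epsilon>_def)
  have estimate: "(sobolev_norm k (v t))\<^sup>2
        \<le> (A1 + A2) * exp (- 1 * t) * (sobolev_norm k (v 0))\<^sup>2
          + (A1 + A2) * integral {0..t} (\<lambda>s. exp (- 1 * (t - s)) *
                  ((L2_norm (v s))\<^sup>2 + grad_norm_sq (k + 2) (\<gamma>x s) (\<gamma>t s)))"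
    if t: "0 \<le> t" and sol: "lle_solution \<alpha> \<beta> F {0..t} \<psi>" and pd: "has_partial_derivs {0..t} \<gamma> \<gamma>x \<gamma>t"
      and v: "v = forward_perturbation \<phi> \<psi> \<gamma>" and cv: "continuous_in_sobolev k {0..t} v"
      and cx: "continuous_in_sobolev (k + 2) {0..t} \<gamma>x" and ct: "continuous_in_sobolev (k + 2) {0..t} \<gamma>t"
      and small: "\<forall>s\<in>{0..t}. sobolev_norm k (v s) \<le> \<epsilon> \<and> grad_norm_sq (k + 2) (\<gamma>x s) (\<gamma>t s) \<le> \<epsilon>"
    for t \<psi> \<gamma> \<gamma>x \<gamma>t v
  \<comment> \<open>At t = 0 the derivative within a one-point interval carries no information; the
    integral vanishes and the claim is that the constant is at least 1.\<close>
  proof (cases "t = 0")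
    case True
    have "1 * (sobolev_norm k (v 0))\<^sup>2 \<le> (A1 + A2) * (sobolev_norm k (v 0))\<^sup>2" using A by (intro mult_right_mono) auto
    then show ?thesis using True by simp
  next
    case False
    let ?I = "integral {0..t} (\<lambda>s. exp (- 1 * (t - s)) * ((L2_norm (v s))\<^sup>2 + grad_norm_sq (k + 2) (\<gamma>x s) (\<gamma>t s)))"
    have sv: "real (k + 1) * sobolev_norm k (v s) \<le> 1 / (16 * H)" if "s \<in> {0..t}" for s
    proof -
      have "sobolev_norm k (v s) \<le> 1 / (16 * H) / real (k + 1)" using small that by (auto simp: \<epsilon>_def)
      then have "real (k + 1) * sobolev_norm k (v s) \<le> real (k + 1) * (1 / (16 * H) / real (k + 1))" by (intro mult_left_mono) auto
      then show ?thesis by simp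
    qed
    have H16: "1 / (16 * H) \<le> 1" using H1 by (simp add: divide_le_eq)
    interpret modulated_lle \<alpha> \<beta> F t B k \<phi> \<psi> \<gamma> \<gamma>x \<gamma>t v
    proof
      show "real (k + 3) * sqrt (grad_norm_sq (k + 2) (\<gamma>x s) (\<gamma>t s)) \<le> 1" if "s \<in> {0..t}" for s
      proof -
        have "grad_norm_sq (k + 2) (\<gamma>x s) (\<gamma>t s) \<le> (1 / real (k + 3))\<^sup>2" using small that by (auto simp: \<epsilon>_def)
        then have "sqrt (grad_norm_sq (k + 2) (\<gamma>x s) (\<gamma>t s)) \<le> 1 / real (k + 3)" by (intro real_le_lsqrt) auto
        then have "real (k + 3) * sqrt (grad_norm_sq (k + 2) (\<gamma>x s) (\<gamma>t s)) \<le> real (k + 3) * (1 / real (k + 3))" by (intro mult_left_mono) auto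
        then show ?thesis by simp
      qed
      show "real (k + 1) * sobolev_norm k (v s) \<le> 1" if "s \<in> {0..t}" for s using sv[OF that] H16 by linarith
    qed (use t False assms phi sol pd v cv cx ct B(2) in auto)
    have ring: "a * (e * (x * y) + c * i) = (a * x) * e * y + (a * c) * i" for a e x y c i :: real
      by (simp add: algebra_simps)
    have "(sobolev_norm k (v t))\<^sup>2 \<le> (8 + 2 * C\<^sub>\<eta>) * (exp (- t) * ((3 / 2 + K + C\<^sub>\<eta> * Q) * (sobolev_norm k (v 0))\<^sup>2)
     + integral {0..t} (\<lambda>s. exp (- (t - s)) * (C1 * (1 + CR) * ((L2_norm (v s))\<^sup>2 + grad_norm_sq (k + 2) (\<gamma>x s) (\<gamma>t s)))))"
      by (rule damping_estimate[OF m assms(1) K1 H_def Q_def eta(1-3) eta(4)[unfolded P_def] Ceta sv K_def CR_def C1_def])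
    also have "integral {0..t} (\<lambda>s. exp (- (t - s)) * (C1 * (1 + CR) * ((L2_norm (v s))\<^sup>2 + grad_norm_sq (k + 2) (\<gamma>x s) (\<gamma>t s)))) = C1 * (1 + CR) * ?I"
      by (subst integral_mult_right[symmetric]) (simp add: mult_ac)
    finally have "(sobolev_norm k (v t))\<^sup>2 \<le> A1 * exp (- 1 * t) * (sobolev_norm k (v 0))\<^sup>2 + A2 * ?I"
      unfolding A1_def A2_def ring by simp
    also have "\<dots> \<le> (A1 + A2) * exp (- 1 * t) * (sobolev_norm k (v 0))\<^sup>2 + (A1 + A2) * ?I"
    proof -
      have "0 \<le> ?I"
      \<comment> \<open>For a function that is not integrable, \<open>integral\<close> is 0 by
        convention, which settles the second case.\<close>
      proof (cases "(\<lambda>s. exp (- 1 * (t - s)) * ((L2_norm (v s))\<^sup>2 + grad_norm_sq (k + 2) (\<gamma>x s) (\<gamma>t s))) integrable_on {0..t}")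
        case True
        then show ?thesis by (rule integral_nonneg) (simp add: grad_norm_sq_def)
      qed (simp add: not_integrable_integral)
      then show ?thesis using A by (intro add_mono mult_right_mono) auto
    qed
    finally show ?thesis .
  qed
  have C: "A1 + A2 > 0" using A by simp
  show ?thesis
    by (rule exI[of _ 1], rule conjI[OF zero_less_one], rule exI[of _ "A1 + A2"], rule conjI[OF C],
        rule exI[of _ \<epsilon>], rule conjI[OF eps], intro allI impI, rule estimate)
qed

end
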